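(* Let $\lambda=(\lambda_1,\dots,\lambda_\ell)$ be any partition, $\ell=\ell(\lambda)$. Under the re-scaling $\alpha=(c_\alpha-1)N$, $\beta=(c_\beta-1)N$, the positive and negative JUE correlators have the following Laurent expansions as $N\to\infty$: $$(-1)^{|\lambda|}N^{\ell(\lambda)}\frac{|\lambda|!}{z_\lambda}\left\langle\prod_{j=1}^{\ell}\mathrm{tr}\,X^{\lambda_j}\right\rangle=\sum_{g\ge0}\frac{1}{N^{2g-2}}\sum_{\mu,\nu\vdash|\lambda|}\frac{c_\alpha^{\ell(\nu)}}{(-c_\alpha-c_\beta)^{\ell(\mu)+\ell(\nu)+\ell(\lambda)+2g-2}}\,h_g(\lambda,\mu,\nu),$$ $$(-1)^{|\lambda|}N^{\ell(\lambda)}\frac{|\lambda|!}{z_\lambda}\left\langle\prod_{j=1}^{\ell}\mathrm{tr}\,X^{-\lambda_j}\right\rangle=\sum_{g\ge0}\frac{1}{N^{2g-2}}\sum_{\mu,\nu\vdash|\lambda|}\frac{(1-c_\alpha-c_\beta)^{\ell(\nu)}}{(c_\alpha-1)^{\ell(\mu)+\ell(\nu)+\ell(\lambda)+2g-2}}\,h_g(\lambda,\mu,\nu),$$ where $h_g(\lambda,\mu,\nu)$ are the triple monotone Hurwitz numbers.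
   Context: Jacobi Unitary Ensemble (JUE): for $N\ge1$ and $\mathrm{Re}\,\alpha,\mathrm{Re}\,\beta>-1$, let $\mathcal H_N(0,1)$ be the set of $N\times N$ hermitian matrices with eigenvalues in $(0,1)$, with Lebesgue measure $\mathrm dX=\prod_i\mathrm dX_{ii}\prod_{i<j}\mathrm d\,\mathrm{Re}X_{ij}\,\mathrm d\,\mathrm{Im}X_{ij}$, and let $\mathrm dm_N^{\sf J}(X)=\frac1{C_N^{\sf J}}\det^\alpha(X)\det^\beta(\mathbf 1-X)\,\mathrm dX$, normalized to total mass $1$. The (positive and negative) JUE correlators are $\langle\prod_j\mathrm{tr}X^{\pm k_j}\rangle=\int_{\mathcal H_N(0,1)}\prod_j\mathrm{tr}X^{\pm k_j}\,\mathrm dm_N^{\sf J}(X)$. The integral is defined for $\mathrm{Re}\,\alpha\pm\sum_jk_j>-1$ and $\mathrm{Re}\,\beta>-1$, and the correlators extend to rational functions of $N,\alpha,\beta$. Partitions: $\lambda\vdash n$ means $\lambda$ is a partition of $n=|\lambda|$; $\ell(\lambda)$ is the number of parts; $\mathrm{cyc}(\lambda)\subset\mathfrak S_n$ is the conjugacy class of permutations of $\{1,\dots,n\}$ of cycle type $\lambda$; $z_\lambda=\prod_{i\ge1}i^{m_i}m_i!$ with $m_i=|\{j:\lambda_j=i\}|$. Triple monotone Hurwitz numbers: for $n\ge0$, $\lambda,\mu,\nu\vdash n$ and an integer $g\ge0$, $h_g(\lambda,\mu,\nu)$ is the number of tuples $(\pi_1,\pi_2,\tau_1,\dots,\tau_r)$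 of permutations in $\mathfrak S_n$ such that (1) $r=2g-2-n+\ell(\mu)+\ell(\nu)+\ell(\lambda)$; (2) $\pi_1\in\mathrm{cyc}(\mu)$, $\pi_2\in\mathrm{cyc}(\nu)$; (3) $\tau_i=(a_i,b_i)$ are transpositions with $a_i<b_i$ and $b_1\le\cdots\le b_r$; (4) $\pi_1\pi_2\tau_1\cdots\tau_r\in\mathrm{cyc}(\lambda)$.
   Formalization: The sums run over integers g ≥ 1−ℓ(λ), with h_g defined by the same conditions for negative g, since g ≥ 0 fails for λ=(1,1) (the N⁴ term, g=−1, is missing); c_α+c_β≠0 (first formula) and c_α≠1 (second) are made explicit. *)

theory Defs
  imports
    "HOL-Analysis.Analysis"
    "HOL-Library.Multiset"
    "HOL-Combinatorics.Combinatorics"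
    "HOL-Computational_Algebra.Polynomial"
    "Jordan_Normal_Form.Determinant"
    "Jordan_Normal_Form.Char_Poly"
    "Jordan_Normal_Form.Gauss_Jordan_Elimination"
begin

text \<open>A partition is the multiset of its (positive) parts: its weight is \<^const>\<open>sum_mset\<close> and
  its length is \<^const>\<open>size\<close>.\<close>

definition partitions_of :: "nat \<Rightarrow> nat multiset set" where
  "partitions_of n = {lam. 0 \<notin># lam \<and> sum_mset lam = n}"

definition z_part :: "nat multiset \<Rightarrow> nat" where
  "z_part lam = (\<Prod>i\<in>set_mset lam. i ^ count lam i * fact (count lam i))"

definition cycle_type :: "nat \<Rightarrow> (nat \<Rightarrow> nat) \<Rightarrow> nat multiset" where
  "cycle_type n \<pi> = image_mset card (mset_set (orbit \<pi> ` {1..n}))"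

definition cyc :: "nat \<Rightarrow> nat multiset \<Rightarrow> (nat \<Rightarrow> nat) set" where
  "cyc n lam = {\<pi>. \<pi> permutes {1..n} \<and> cycle_type n \<pi> = lam}"

text \<open>A transposition is recorded by the pair of its entries \<open>a < b\<close>, which it determines.
  Permutations are multiplied as functions; the opposite convention gives the same numbers
  below, because conjugacy classes are closed under inversion.\<close>

definition transp_prod :: "(nat \<times> nat) list \<Rightarrow> nat \<Rightarrow> nat" where
  "transp_prod ts = foldr (\<lambda>(a, b) \<sigma>. Transposition.transpose a b \<circ> \<sigma>) ts id"

definition hurwitz_tuples ::
  "int \<Rightarrow> nat multiset \<Rightarrow> nat multiset \<Rightarrow> nat multiset \<Rightarrow>
     ((nat \<Rightarrow> nat) \<times> (nat \<Rightarrow> nat) \<times> (nat \<times> nat) list) set" where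
  "hurwitz_tuples g lam \<mu> \<nu> =
     (let n = sum_mset lam in
      {(\<pi>1, \<pi>2, ts).
         int (length ts) = 2 * g - 2 - int n + int (size \<mu>) + int (size \<nu>) + int (size lam) \<and>
         \<pi>1 \<in> cyc n \<mu> \<and> \<pi>2 \<in> cyc n \<nu> \<and>
         (\<forall>(a, b) \<in> set ts. 1 \<le> a \<and> a < b \<and> b \<le> n) \<and>
         sorted (map snd ts) \<and>
         \<pi>1 \<circ> \<pi>2 \<circ> transp_prod ts \<in> cyc n lam})"

text \<open>No transitivity is imposed on the factorizations, so the genus may be negative: a
  factorization acting with \<open>c\<close> orbits on \<open>{1..n}\<close> has \<open>g \<ge> 1 - c \<ge> 1 - size lam\<close>.\<close>

definition hurwitz :: "int \<Rightarrow> nat multiset \<Rightarrow> nat multiset \<Rightarrow> nat multiset \<Rightarrow> nat" where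
  "hurwitz g lam \<mu> \<nu> = card (hurwitz_tuples g lam \<mu> \<nu>)"

text \<open>A hermitian matrix is parametrized by \<open>N\<^sup>2\<close> real coordinates: \<open>x (i, i)\<close> is the diagonal
  entry, and for \<open>i < j\<close> the real and imaginary parts of the entry at \<open>(i, j)\<close> are \<open>x (i, j)\<close>
  and \<open>x (j, i)\<close>. In these coordinates \<open>dX\<close> is the product Lebesgue measure.\<close>

definition herm_of :: "nat \<Rightarrow> (nat \<times> nat \<Rightarrow> real) \<Rightarrow> complex mat" where
  "herm_of N x = mat N N (\<lambda>(i, j).
     if i = j then complex_of_real (x (i, i))
     else if i < j then Complex (x (i, j)) (x (j, i))
     else Complex (x (j, i)) (- x (i, j)))"

definition herm_lebesgue :: "nat \<Rightarrow> (nat \<times> nat \<Rightarrow> real) measure" where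
  "herm_lebesgue N = (\<Pi>\<^sub>M p\<in>{..<N} \<times> {..<N}. lborel)"

definition herm01 :: "nat \<Rightarrow> (nat \<times> nat \<Rightarrow> real) set" where
  "herm01 N = {x \<in> space (herm_lebesgue N).
     \<forall>k. eigenvalue (herm_of N x) k \<longrightarrow> k \<in> complex_of_real ` {0<..<1}}"

text \<open>On the domain of integration both determinants are positive reals, so the principal
  branch used by \<^const>\<open>powr\<close> is the ordinary complex power of a positive number.\<close>

definition jue_weight :: "nat \<Rightarrow> complex \<Rightarrow> complex \<Rightarrow> complex mat \<Rightarrow> complex" where
  "jue_weight N \<alpha> \<beta> X = Determinant.det X powr \<alpha> * Determinant.det (1\<^sub>m N - X) powr \<beta>"

definition jue_mean :: "(complex mat \<Rightarrow> complex) \<Rightarrow> nat \<Rightarrow> complex \<Rightarrow> complex \<Rightarrow> complex" where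
  "jue_mean f N \<alpha> \<beta> =
     (LINT x:herm01 N|herm_lebesgue N. f (herm_of N x) * jue_weight N \<alpha> \<beta> (herm_of N x)) /
     (LINT x:herm01 N|herm_lebesgue N. jue_weight N \<alpha> \<beta> (herm_of N x))"

definition mtrace :: "complex mat \<Rightarrow> complex" where
  "mtrace X = (\<Sum>i<dim_row X. X $$ (i, i))"

definition tr_pos :: "nat multiset \<Rightarrow> complex mat \<Rightarrow> complex" where
  "tr_pos lam X = (\<Prod>k\<in>#lam. mtrace (X ^\<^sub>m k))"

definition tr_neg :: "nat multiset \<Rightarrow> complex mat \<Rightarrow> complex" where
  "tr_neg lam X = (\<Prod>k\<in>#lam. mtrace (the (mat_inverse X) ^\<^sub>m k))"

text \<open>Polynomials in three variables are nested univariate polynomials.\<close>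

definition poly3 :: "complex poly poly poly \<Rightarrow> complex \<Rightarrow> complex \<Rightarrow> complex \<Rightarrow> complex" where
  "poly3 p N \<alpha> \<beta> = poly (poly (poly p [:[:N:]:]) [:\<alpha>:]) \<beta>"

text \<open>The value at \<open>(N, \<alpha>, \<beta>)\<close> of the rational function that agrees with \<open>F\<close> on the set \<open>D\<close>:
  some fraction \<open>p / q\<close> representing it must be regular at that point. When \<open>D\<close> is Zariski
  dense, as below, the rational function is unique, and the value does not depend on the
  representing fraction.\<close>

definition rational_ext ::
  "(nat \<Rightarrow> complex \<Rightarrow> complex \<Rightarrow> bool) \<Rightarrow> (nat \<Rightarrow> complex \<Rightarrow> complex \<Rightarrow> complex) \<Rightarrow>
     complex \<Rightarrow> complex \<Rightarrow> complex \<Rightarrow> complex" where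
  "rational_ext D F N \<alpha> \<beta> =
     (THE v. \<exists>p q. poly3 q N \<alpha> \<beta> \<noteq> 0 \<and> v = poly3 p N \<alpha> \<beta> / poly3 q N \<alpha> \<beta> \<and>
        (\<forall>n a b. D n a b \<longrightarrow> poly3 q (of_nat n) a b \<noteq> 0 \<longrightarrow>
           F n a b = poly3 p (of_nat n) a b / poly3 q (of_nat n) a b))"

definition jue_pos :: "nat multiset \<Rightarrow> complex \<Rightarrow> complex \<Rightarrow> complex \<Rightarrow> complex" where
  "jue_pos lam = rational_ext
     (\<lambda>n a b. n \<ge> 1 \<and> Re a > -1 \<and> Re b > -1)
     (jue_mean (tr_pos lam))"

definition jue_neg :: "nat multiset \<Rightarrow> complex \<Rightarrow> complex \<Rightarrow> complex \<Rightarrow> complex" where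
  "jue_neg lam = rational_ext
     (\<lambda>n a b. n \<ge> 1 \<and> Re a - real (sum_mset lam) > -1 \<and> Re b > -1)
     (jue_mean (tr_neg lam))"

end

theory Submission
  imports Defs
begin

text \<open>Let \<open>f\<^sub>n \<in> \<complex>[S\<^sub>n]\<close> collect the expectations of \<open>tr (\<sigma> X\<^sup>\<otimes>\<^sup>n)\<close>, which are products of traces over the
  cycles of \<open>\<sigma>\<close>. Integration by parts over the hermitian matrices, in the last tensor factor, gives
  \<open>f\<^sub>n\<^sub>+\<^sub>1 (c + J) = f\<^sub>n (N + J) (e + J)\<close> with \<open>J\<close> the Jucys--Murphy element of \<open>n + 1\<close>, where \<open>c = 2 N + \<alpha> + \<beta>\<close> and
  \<open>e = N + \<alpha>\<close>; for \<open>X\<^sup>-\<^sup>1\<close> in place of \<open>X\<close> the same holds with \<open>c = - \<alpha>\<close> and \<open>e = - (N + \<alpha> + \<beta>)\<close>. Hence \<open>f\<^sub>n\<close> is the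
  product of the factors \<open>(N + J\<^sub>k) (e + J\<^sub>k) / (c + J\<^sub>k)\<close>. The numerators expand, by Jucys, into sums over all permutations
  weighted by their numbers of cycles, and the denominators into complete symmetric polynomials of the \<open>J\<^sub>k\<close>,
  that is, sums over monotone sequences of transpositions: the coefficients are monotone Hurwitz
  numbers. Since the recursion is a linear system solved by Cramer's rule, the correlators are rational functions, and
  these agree with the series as soon as \<open>|c| > n\<^sup>2\<close>.

  Boundary terms are removed by a cutoff in \<open>det X det (1 - X)\<close> and dominated convergence. The
  integrability of the weight follows by induction on \<open>N\<close>: by Schur complements the last diagonal
  entry contributes a Beta integral.\<close>

section \<open>Cycles of permutations\<close>

text \<open>The identity is exact for each large N, and no asymptotic estimate occurs. The integrals
  exist only for integer N and parameters in half-planes, while the series is evaluated where they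
  may fail to exist. The bridge is algebraic: integrals and series solve the same triangular linear
  system, so both satisfy \<open>f * Q = P\<close> with the same polynomials P and Q, and a rational
  function is determined by its values where the integrals exist. Two obstacles shape the analysis.
  For complex \<alpha> and \<beta> the weight oscillates, so the normalization by which the
  correlators are divided could vanish; such a zero is propagated to shifted parameters by the loop
  equations themselves and then contradicted. Moreover the weight may blow up at the boundary, where
  its logarithmic derivative has poles; the field in the integration by parts contains the factor 1
  - X to cancel poles, and the cutoff is scaled so that the terms it creates are bounded uniformly.
  The domain is described by polynomial inequalities in the coordinates, which makes it measurable
  and open along coordinate lines.\<close>

abbreviation pinv :: "('a \<Rightarrow> 'a) \<Rightarrow> 'a \<Rightarrow> 'a" where "pinv \<equiv> inv_into UNIV"

text \<open>The weights allow an induction on \<open>S\<close>: when a point is removed from a cycle, its weight is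
  added to that of its predecessor.\<close>

definition wtype :: "'a set \<Rightarrow> ('a \<Rightarrow> nat) \<Rightarrow> ('a \<Rightarrow> 'a) \<Rightarrow> nat multiset" where
  "wtype S w p = image_mset (sum w) (mset_set (orbit p ` S))"

definition ncyc :: "'a set \<Rightarrow> ('a \<Rightarrow> 'a) \<Rightarrow> nat" where
  "ncyc S p = card (orbit p ` S)"

lemma size_wtype: "finite S \<Longrightarrow> size (wtype S w p) = ncyc S p"
  by (simp add: wtype_def ncyc_def)

lemma cycle_type_wtype: "cycle_type n p = wtype {1..n} (\<lambda>_. 1) p"
proof -
  have "card = sum (\<lambda>_ :: nat. 1 :: nat)" by (intro ext card_eq_sum)
  then show ?thesis unfolding cycle_type_def wtype_def by (simp only:)
qed

lemma size_cycle_type: "size (cycle_type n p) = ncyc {1..n} p"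
  by (simp add: cycle_type_wtype size_wtype)

lemma self_in_orbit_permutes:
  assumes "p permutes S" "finite S" shows "x \<in> orbit p x"
proof -
  have "permutation p" unfolding permutation_permutes using assms by blast
  then show ?thesis by (rule permutation_self_in_orbit)
qed

lemma orbit_eq_permutes:
  assumes "p permutes S" "finite S" "x \<in> orbit p y" shows "orbit p x = orbit p y"
proof -
  have "permutation p" unfolding permutation_permutes using assms by blast
  then show ?thesis using cyclic_on_orbit' orbit_cyclic_eq3 assms(3) by metis
qed

text \<open>Composing with the transposition of \<open>n\<close> and its predecessor
  \<open>m\<close> cuts \<open>n\<close> out of its cycle: \<open>m\<close> goes to
  \<open>p n\<close> and \<open>n\<close> becomes fixed. Inductions on the ground set strip one
  point in this way.\<close>

lemma permutes_remove_transpose: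
  assumes p: "p permutes insert n S" and m: "p m = n"
  shows "(p \<circ> Transposition.transpose m n) permutes S"
proof -
  have mem: "m \<in> insert n S" using p m by (metis insertI1 permutes_in_image)
  have "(p \<circ> Transposition.transpose m n) permutes insert n S"
    using p mem by (intro permutes_compose permutes_swap_id) auto
  then show ?thesis
    by (rule permutes_superset) (auto simp: m)
qed

lemma orbit_remove:
  assumes p: "p permutes insert n S" and "finite S" and m: "p m = n" and mS: "m \<in> S" and n: "n \<notin> S" and x: "x \<in> S"
  shows "orbit (p \<circ> Transposition.transpose m n) x = orbit p x - {n}" (is "orbit ?q x = _")
proof -
  have inj: "p a = p b \<Longrightarrow> a = b" for a b using p by (metis permutes_inj injD)
  have q: "?q permutes S" by (rule permutes_remove_transpose[OF p m])
  have qS: "y \<in> S \<Longrightarrow> ?q y \<in> S" for y using q by (simp only: permutes_in_image)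
  have qm: "?q m = p n" by simp
  have qy: "?q y = p y" if "y \<noteq> m" "y \<noteq> n" for y using that by simp
  have xn: "x \<noteq> n" using x n by auto
  show ?thesis
  proof (intro subset_antisym subsetI)
    fix y assume "y \<in> orbit ?q x"
    then have "y \<in> orbit p x \<and> y \<in> S"
    proof induction
      case base
      show ?case
      proof (cases "x = m")
        case True
        have "p (p x) \<in> orbit p x" by (intro orbit.step orbit.base)
        then have "p (p m) \<in> orbit p x" using True by simp
        then show ?thesis using True qS[OF x] m by simp
      next
        case False
        then show ?thesis using qS[OF x] qy[OF _ xn] by (simp add: orbit.base)
      qed
    next
      case (step y)
      then have yn: "y \<noteq> n" using n by auto
      show ?case
      proof (cases "y = m")
        case True
        have "p (p m) \<in> orbit p x" using True step by (intro orbit.step) auto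
        then show ?thesis using True qS[of y] step m by simp
      next
        case False
        then show ?thesis using qS[of y] step qy[OF _ yn] by (simp add: orbit.step)
      qed
    qed
    then show "y \<in> orbit p x - {n}" using n by auto
  next
    fix y assume "y \<in> orbit p x - {n}"
    then have "y \<in> orbit p x" "y \<noteq> n" by auto
    \<comment> \<open>The \<open>p\<close>-orbit may pass through \<open>n\<close>, which
      \<open>?q\<close> skips. At that moment the invariant records that the next point
      \<open>p n\<close> has already been reached, and the induction can go on.\<close>
    have "(y \<noteq> n \<longrightarrow> y \<in> orbit ?q x) \<and> (y = n \<longrightarrow> p n \<in> orbit ?q x)"
      using \<open>y \<in> orbit p x\<close>
    proof induction
      case base
      show ?case
      proof (cases "p x = n")
        case True
        then have "x = m" using inj m by auto
        then have "p n \<in> orbit ?q x" using orbit.base[of ?q x] qm by metis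
        then show ?thesis using True by blast
      next
        case False
        then have "x \<noteq> m" using m by auto
        then have "p x \<in> orbit ?q x" using orbit.base[of ?q x] qy[OF _ xn] by metis
        then show ?thesis using False by blast
      qed
    next
      case (step y)
      show ?case
      proof (cases "y = n")
        case True
        have "p n \<noteq> n" using inj[of n m] m mS n by auto
        then show ?thesis using step True by simp
      next
        case False
        show ?thesis
        proof (cases "p y = n")
          case True
          then have "y = m" using inj m by auto
          then have "p n \<in> orbit ?q x" using step False orbit.step[of y ?q x] qm by metis
          then show ?thesis using True by blast
        next
          case F2: False
          then have "y \<noteq> m" using m by auto
          then have "p y \<in> orbit ?q x" using step False orbit.step[of y ?q x] qy[OF _ False] by metis
          then show ?thesis using F2 by blast
        qed
      qed
    qed
    with \<open>y \<noteq> n\<close> show "y \<in> orbit ?q x" by simp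
  qed
qed

text \<open>The cycles of the shortened permutation are the old ones with \<open>n\<close> deleted,
  and deletion identifies no two of them because each contains a point of \<open>S\<close>. As
  \<open>m\<close> and \<open>n\<close> share a cycle, moving the weight of \<open>n\<close> to
  \<open>m\<close> preserves all cycle weights.\<close>

lemma wtype_remove:
  assumes p: "p permutes insert n S" and fin: "finite S" and m: "p m = n" and mn: "m \<in> S" and n: "n \<notin> S"
  shows "wtype (insert n S) w p = wtype S (w(m := w m + w n)) (p \<circ> Transposition.transpose m n)"
proof -
  let ?q = "p \<circ> Transposition.transpose m n" and ?w = "w(m := w m + w n)"
  have finI: "finite (insert n S)" using fin by simp
  have inj: "p a = p b \<Longrightarrow> a = b" for a b using p by (metis permutes_inj injD)
  have self: "x \<in> orbit p x" for x by (rule self_in_orbit_permutes[OF p finI])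
  have nm: "n \<in> orbit p x \<longleftrightarrow> m \<in> orbit p x" for x
  proof
    assume "n \<in> orbit p x" then show "m \<in> orbit p x"
      by (cases rule: orbit.cases) (use inj m self in blast)+
  next
    assume "m \<in> orbit p x" then show "n \<in> orbit p x" using m orbit.step by metis
  qed
  have on: "orbit p n = orbit p m"
    using nm self orbit_eq_permutes[OF p finI] by metis
  have im: "orbit p ` insert n S = orbit p ` S" using on mn by auto
  have im2: "orbit ?q ` S = (\<lambda>C. C - {n}) ` (orbit p ` S)"
    by (auto simp: orbit_remove[OF p fin m mn n] image_image simp del: o_apply)
  have injO: "inj_on (\<lambda>C. C - {n}) (orbit p ` S)"
  proof (rule inj_onI)
    fix A B assume A: "A \<in> orbit p ` S" and B: "B \<in> orbit p ` S" and e: "A - {n} = B - {n}"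
    then obtain x y where x: "x \<in> S" "A = orbit p x" and y: "y \<in> S" "B = orbit p y" by auto
    have "x \<in> B" using e self[of x] x n by blast
    then show "A = B" using x y orbit_eq_permutes[OF p finI] by metis
  qed
  have sm: "sum ?w (A - {n}) = sum w A" if AS: "A \<in> orbit p ` S" for A
  proof -
    obtain x where x: "x \<in> S" "A = orbit p x" using AS by auto
    have "A \<subseteq> insert n S" using x permutes_orbit_subset[OF p] by auto
    then have fA: "finite A" using finI finite_subset by auto
    have mn': "m \<noteq> n" using mn n by auto
    show ?thesis
    proof (cases "n \<in> A")
      case True
      then have mA: "m \<in> A" using nm x by auto
      have "sum ?w (A - {n}) = ?w m + sum ?w (A - {n} - {m})"
        using mA mn' fA by (intro sum.remove) auto
      also have "sum ?w (A - {n} - {m}) = sum w (A - {n} - {m})" by (intro sum.cong) auto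
      also have "?w m + sum w (A - {n} - {m}) = w n + (w m + sum w (A - {n} - {m}))" by simp
      also have "w m + sum w (A - {n} - {m}) = sum w (A - {n})"
        using mA mn' fA by (intro sum.remove[symmetric]) auto
      also have "w n + sum w (A - {n}) = sum w A" using True fA by (intro sum.remove[symmetric]) auto
      finally show ?thesis .
    next
      case False
      then have "m \<notin> A" using nm x by auto
      then have "sum ?w A = sum w A" by (intro sum.cong) auto
      then show ?thesis using False by simp
    qed
  qed
  have "wtype S ?w ?q = image_mset (sum ?w) (image_mset (\<lambda>C. C - {n}) (mset_set (orbit p ` S)))"
    unfolding wtype_def im2 using image_mset_mset_set[OF injO] by simp
  also have "\<dots> = image_mset (sum w) (mset_set (orbit p ` S))"
    using fin sm by (auto simp: image_mset.compositionality intro!: image_mset_cong)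
  finally show ?thesis unfolding wtype_def im by simp
qed

lemma wtype_fixed:
  assumes p: "p permutes insert n S" and fin: "finite S" and pn: "p n = n" and n: "n \<notin> S"
  shows "p permutes S" "wtype (insert n S) w p = add_mset (w n) (wtype S w p)"
proof -
  show pS: "p permutes S" using p pn n by (metis insertI1 permutes_superset DiffE insertE)
  have on: "orbit p n = {n}" using pn by (simp add: orbit_eq_singleton_iff)
  have "{n} \<notin> orbit p ` S"
  proof
    assume "{n} \<in> orbit p ` S"
    then obtain x where "x \<in> S" "orbit p x = {n}" by auto
    then show False using self_in_orbit_permutes[OF pS fin, of x] n by auto
  qed
  then show "wtype (insert n S) w p = add_mset (w n) (wtype S w p)"
    unfolding wtype_def using fin on by simp
qed

lemma wtype_empty [simp]: "wtype {} w p = {#}"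
  by (simp add: wtype_def)

lemma wtype_cong: 
  assumes "p permutes S" "\<And>x. x \<in> S \<Longrightarrow> w x = w' x" "finite S" shows "wtype S w p = wtype S w' p"
proof -
  have "sum w A = sum w' A" if "A \<in> orbit p ` S" for A
    using that permutes_orbit_subset[OF assms(1)] assms(2) by (intro sum.cong) blast+
  then show ?thesis unfolding wtype_def
    using assms(3) by (intro image_mset_cong) auto
qed

lemma ncyc_fixed:
  assumes "p permutes insert n S" "finite S" "p n = n" "n \<notin> S"
  shows "ncyc (insert n S) p = Suc (ncyc S p)"
  using wtype_fixed(2)[OF assms, of "\<lambda>_. 0"] assms(2) size_wtype[of S "\<lambda>_. 0" p] size_wtype[of "insert n S" "\<lambda>_. 0" p] by simp

lemma ncyc_remove:
  assumes "p permutes insert n S" "finite S" "p m = n" "m \<in> S" "n \<notin> S"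
  shows "ncyc (insert n S) p = ncyc S (p \<circ> Transposition.transpose m n)"
  using arg_cong[OF wtype_remove[OF assms, of "\<lambda>_. 0"], of size] assms(2) by (simp add: size_wtype)

lemma ncyc_empty [simp]: "ncyc {} p = 0" by (simp add: ncyc_def)

text \<open>A permutation of \<open>insert n S\<close> either fixes \<open>n\<close> or is uniquely
  a permutation of \<open>S\<close> composed on the right with the transposition of \<open>n\<close>
  and its preimage \<open>m\<close>. In \<open>sum_over_permutations_insert\<close> the
  transposition stands on the left, so the sum is first taken over inverses.\<close>

lemma sum_permutes_insert:
  fixes h :: "('a \<Rightarrow> 'a) \<Rightarrow> 'b::comm_monoid_add"
  assumes fin: "finite S" and n: "n \<notin> S"
  shows "(\<Sum>p\<in>{p. p permutes insert n S}. h p) =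
     (\<Sum>p\<in>{p. p permutes S}. h p) + (\<Sum>p\<in>{p. p permutes S}. \<Sum>m\<in>S. h (p \<circ> Transposition.transpose m n))"
proof -
  have "(\<Sum>p\<in>{p. p permutes insert n S}. h p) = (\<Sum>p\<in>{p. p permutes insert n S}. h (pinv p))"
    by (rule sum_permutations_inverse)
  also have "\<dots> = (\<Sum>b\<in>insert n S. \<Sum>q\<in>{q. q permutes S}. h (pinv (Transposition.transpose n b \<circ> q)))"
    by (rule sum_over_permutations_insert[OF fin n])
  also have "\<dots> = (\<Sum>b\<in>insert n S. \<Sum>q\<in>{q. q permutes S}. h (pinv q \<circ> Transposition.transpose b n))"
  proof (intro sum.cong refl)
    fix b q assume "q \<in> {q. q permutes S}"
    then have "bij q" by (auto intro: permutes_bij)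
    then show "h (pinv (Transposition.transpose n b \<circ> q)) = h (pinv q \<circ> Transposition.transpose b n)"
      by (subst o_inv_distrib) (auto simp: transpose_commute)
  qed
  also have "\<dots> = (\<Sum>b\<in>insert n S. \<Sum>q\<in>{q. q permutes S}. h (q \<circ> Transposition.transpose b n))"
    by (rule sum.cong[OF refl], rule sum_permutations_inverse[symmetric, of "\<lambda>q. h (q \<circ> Transposition.transpose _ n)"])
  also have "\<dots> = (\<Sum>p\<in>{p. p permutes S}. h p) + (\<Sum>p\<in>{p. p permutes S}. \<Sum>m\<in>S. h (p \<circ> Transposition.transpose m n))"
    using fin n by (simp add: sum.swap[of _ S])
  finally show ?thesis .
qed

section \<open>Traces of permuted tensor products\<close>

text \<open>The trace of the permutation \<open>p\<close> of the factors of \<open>(\<complex>\<^sup>N)\<^sup>\<otimes>\<^sup>S\<close> composed with the tensor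
  product of the \<open>N \<times> N\<close> matrices \<open>A k\<close>. It factorizes into traces over the cycles of \<open>p\<close>.\<close>

definition tperm :: "nat \<Rightarrow> 'a set \<Rightarrow> ('a \<Rightarrow> 'a) \<Rightarrow> ('a \<Rightarrow> nat \<Rightarrow> nat \<Rightarrow> complex) \<Rightarrow> complex" where
  "tperm N S p A = (\<Sum>i\<in>S \<rightarrow>\<^sub>E {..<N}. \<Prod>k\<in>S. A k (i k) (i (p k)))"

lemma sum_PiE_insert:
  fixes h :: "('a \<Rightarrow> 'b) \<Rightarrow> 'c::comm_monoid_add"
  assumes "n \<notin> S"
  shows "(\<Sum>i\<in>insert n S \<rightarrow>\<^sub>E B. h i) = (\<Sum>i\<in>S \<rightarrow>\<^sub>E B. \<Sum>c\<in>B. h (i(n := c)))"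
proof -
  have "(\<Sum>i\<in>insert n S \<rightarrow>\<^sub>E B. h i) = (\<Sum>x\<in>B \<times> (S \<rightarrow>\<^sub>E B). h ((\<lambda>(y, g). g(n := y)) x))"
    unfolding PiE_insert_eq by (rule sum.reindex[OF inj_combinator[OF assms], unfolded o_def])
  also have "\<dots> = (\<Sum>c\<in>B. \<Sum>i\<in>S \<rightarrow>\<^sub>E B. h (i(n := c)))"
    by (simp add: sum.cartesian_product split_def)
  finally show ?thesis by (simp add: sum.swap[of _ B])
qed

lemma tperm_cong:
  assumes "p permutes S" "\<And>k a b. k \<in> S \<Longrightarrow> a < N \<Longrightarrow> b < N \<Longrightarrow> A k a b = B k a b"
  shows "tperm N S p A = tperm N S p B"
  unfolding tperm_def
proof (intro sum.cong prod.cong refl)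
  fix i k assume i: "i \<in> S \<rightarrow>\<^sub>E {..<N}" and k: "k \<in> S"
  then have "i k < N" "i (p k) < N" using permutes_in_image[OF assms(1), of k] by (auto simp: PiE_iff)
  then show "A k (i k) (i (p k)) = B k (i k) (i (p k))" using assms(2) k by blast
qed

lemma tperm_fixed:
  assumes p: "p permutes S" and "finite S" and n: "n \<notin> S"
  shows "tperm N (insert n S) p A = (\<Sum>c<N. A n c c) * tperm N S p A"
proof -
  have pn: "p n = n" using p n by (rule permutes_not_in)
  have "(\<Sum>i\<in>S \<rightarrow>\<^sub>E {..<N}. \<Sum>c<N. \<Prod>k\<in>insert n S. A k ((i(n := c)) k) ((i(n := c)) (p k)))
    = (\<Sum>i\<in>S \<rightarrow>\<^sub>E {..<N}. \<Sum>c<N. A n c c * (\<Prod>k\<in>S. A k (i k) (i (p k))))"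
  proof (intro sum.cong refl)
    fix i :: "'a \<Rightarrow> nat" and c :: nat
    have "(\<Prod>k\<in>S. A k ((i(n := c)) k) ((i(n := c)) (p k))) = (\<Prod>k\<in>S. A k (i k) (i (p k)))"
    proof (rule prod.cong[OF refl])
      fix k assume k: "k \<in> S"
      then have "p k \<in> S" using p by (simp add: permutes_in_image)
      then have "k \<noteq> n" "p k \<noteq> n" using k n by auto
      then show "A k ((i(n := c)) k) ((i(n := c)) (p k)) = A k (i k) (i (p k))" by simp
    qed
    then show "(\<Prod>k\<in>insert n S. A k ((i(n := c)) k) ((i(n := c)) (p k))) = A n c c * (\<Prod>k\<in>S. A k (i k) (i (p k)))"
      using assms pn by simp
  qed
  then show ?thesis unfolding tperm_def sum_PiE_insert[OF n]
    by (simp add: sum_distrib_left sum_distrib_right mult.commute)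
qed

text \<open>If \<open>p\<close> sends \<open>m\<close> to \<open>n\<close>, the index
  \<open>i n\<close> occurs only as column index at \<open>m\<close> and as row index at
  \<open>n\<close>; summing over it multiplies the two matrices.\<close>

lemma tperm_remove:
  assumes p: "p permutes insert n S" and fin: "finite S" and m: "p m = n" and mS: "m \<in> S" and n: "n \<notin> S"
  shows "tperm N (insert n S) p A =
    tperm N S (p \<circ> Transposition.transpose m n) (A(m := \<lambda>a b. \<Sum>c<N. A m a c * A n c b))"
proof -
  let ?q = "p \<circ> Transposition.transpose m n"
  have inj: "p a = p b \<Longrightarrow> a = b" for a b using p by (metis permutes_inj injD)
  have mn: "m \<noteq> n" using mS n by auto
  have pn: "p n \<noteq> n" using inj m mn by metis
  have pnS: "p n \<in> S" using p pn by (metis insertE insertI1 permutes_in_image)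
  have "(\<Sum>c<N. \<Prod>k\<in>insert n S. A k ((i(n := c)) k) ((i(n := c)) (p k)))
     = (\<Prod>k\<in>S. (A(m := \<lambda>a b. \<Sum>c<N. A m a c * A n c b)) k (i k) (i (?q k)))" for i
  proof -
    let ?R = "\<Prod>k\<in>S-{m}. A k (i k) (i (p k))"
    have e: "(\<Prod>k\<in>insert n S. A k ((i(n := c)) k) ((i(n := c)) (p k))) = A m (i m) c * A n c (i (p n)) * ?R" for c
    proof -
      have "(\<Prod>k\<in>S. A k ((i(n := c)) k) ((i(n := c)) (p k))) =
        A m (i m) c * (\<Prod>k\<in>S-{m}. A k ((i(n := c)) k) ((i(n := c)) (p k)))"
        using fin mS m mn by (subst prod.remove[of S m]) auto
      also have "(\<Prod>k\<in>S-{m}. A k ((i(n := c)) k) ((i(n := c)) (p k))) = ?R"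
      proof (rule prod.cong[OF refl])
        fix k assume k: "k \<in> S - {m}"
        then have "p k \<noteq> n" "k \<noteq> n" using inj m n by auto
        then show "A k ((i(n := c)) k) ((i(n := c)) (p k)) = A k (i k) (i (p k))" by simp
      qed
      finally show ?thesis using fin n pn by (simp add: mult_ac)
    qed
    have "(\<Prod>k\<in>S. (A(m := \<lambda>a b. \<Sum>c<N. A m a c * A n c b)) k (i k) (i (?q k)))
       = (\<Sum>c<N. A m (i m) c * A n c (i (p n))) * (\<Prod>k\<in>S-{m}. (A(m := \<lambda>a b. \<Sum>c<N. A m a c * A n c b)) k (i k) (i (?q k)))"
      using fin mS by (subst prod.remove[of S m]) auto
    also have "(\<Prod>k\<in>S-{m}. (A(m := \<lambda>a b. \<Sum>c<N. A m a c * A n c b)) k (i k) (i (?q k))) = ?R"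
    proof (rule prod.cong[OF refl])
      fix k assume k: "k \<in> S - {m}"
      then have "k \<noteq> m" "k \<noteq> n" using n by auto
      then show "(A(m := \<lambda>a b. \<Sum>c<N. A m a c * A n c b)) k (i k) (i (?q k)) = A k (i k) (i (p k))" by simp
    qed
    finally show ?thesis unfolding e by (simp add: sum_distrib_right)
  qed
  then show ?thesis unfolding tperm_def sum_PiE_insert[OF n] by (simp only:)
qed

lemma tperm_empty [simp]: "tperm N {} p A = 1"
  by (simp add: tperm_def)

lemma index_mult_mat_sum:
  assumes "A \<in> carrier_mat N N" "B \<in> carrier_mat N N" "a < N" "b < N"
  shows "(A * B) $$ (a, b) = (\<Sum>c<N. A $$ (a, c) * B $$ (c, b))"
proof -
  have "(A * B) $$ (a, b) = (\<Sum>c\<in>{0..<N}. Matrix.row A a $ c * col B b $ c)"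
    using assms by (simp add: scalar_prod_def)
  also have "\<dots> = (\<Sum>c<N. A $$ (a, c) * B $$ (c, b))"
    unfolding atLeast0LessThan using assms by (intro sum.cong) auto
  finally show ?thesis .
qed

lemma pow_mat_add_mult:
  assumes "X \<in> carrier_mat N N"
  shows "X ^\<^sub>m (i + j) = X ^\<^sub>m i * X ^\<^sub>m (j :: nat)"
proof (induction j)
  case (Suc j)
  have "X ^\<^sub>m (i + Suc j) = X ^\<^sub>m i * X ^\<^sub>m j * X" by (simp only: add_Suc_right pow_mat.simps Suc)
  also have "\<dots> = X ^\<^sub>m i * (X ^\<^sub>m j * X)" using assms by (intro assoc_mult_mat) auto
  finally show ?case by simp
qed (use assms in auto)

text \<open>Merging neighbours along a cycle multiplies powers of \<open>X\<close> and so adds the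
  exponents \<open>w\<close>, exactly as weights are merged in \<open>wtype_remove\<close>. With all
  weights 1, a cycle of length \<open>k\<close> yields the trace of the \<open>k\<close>-th
  power.\<close>

lemma tperm_power:
  assumes X: "X \<in> carrier_mat N N" and "finite S" "p permutes S"
  shows "tperm N S p (\<lambda>k a b. (X ^\<^sub>m w k) $$ (a, b)) = (\<Prod>k\<in>#wtype S w p. mtrace (X ^\<^sub>m k))"
  using assms(2,3)
proof (induction S arbitrary: p w rule: finite_induct)
  case empty
  then show ?case by simp
next
  case (insert n S)
  have XN: "X ^\<^sub>m k \<in> carrier_mat N N" for k using X by simp
  show ?case
  proof (cases "p n = n")
    case True
    have tr: "(\<Sum>c<N. (X ^\<^sub>m w n) $$ (c, c)) = mtrace (X ^\<^sub>m w n)"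
      by (simp only: mtrace_def carrier_matD(1)[OF XN])
    note f = wtype_fixed[OF insert.prems insert.hyps(1) True insert.hyps(2)]
    show ?thesis unfolding f(2) tperm_fixed[OF f(1) insert.hyps] insert.IH[OF f(1)] tr by simp
  next
    case False
    define m where "m = pinv p n"
    have m: "p m = n" unfolding m_def using insert.prems by (rule permutes_inverses)
    have mS: "m \<in> S" using m False insert.prems by (metis insertE insertI1 permutes_in_image)
    let ?q = "p \<circ> Transposition.transpose m n"
    have q: "?q permutes S" using permutes_remove_transpose[OF insert.prems m] .
    have "tperm N (insert n S) p (\<lambda>k a b. (X ^\<^sub>m w k) $$ (a, b)) =
      tperm N S ?q (\<lambda>k a b. (X ^\<^sub>m (w(m := w m + w n)) k) $$ (a, b))"
      unfolding tperm_remove[OF insert.prems insert.hyps(1) m mS insert.hyps(2)]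
    proof (rule tperm_cong[OF q])
      fix k a b assume "k \<in> S" "a < N" "b < N"
      have "X ^\<^sub>m (w m + w n) = X ^\<^sub>m w m * X ^\<^sub>m w n"
        by (rule pow_mat_add_mult[OF X])
      then show "((\<lambda>k a b. (X ^\<^sub>m w k) $$ (a, b))(m := \<lambda>a b. \<Sum>c<N. (X ^\<^sub>m w m) $$ (a, c) * (X ^\<^sub>m w n) $$ (c, b))) k a b
         = (X ^\<^sub>m (w(m := w m + w n)) k) $$ (a, b)"
        using index_mult_mat_sum[OF XN XN \<open>a < N\<close> \<open>b < N\<close>] by simp
    qed
    also have "\<dots> = (\<Prod>k\<in>#wtype (insert n S) w p. mtrace (X ^\<^sub>m k))"
      unfolding wtype_remove[OF insert.prems insert.hyps(1) m mS insert.hyps(2)] by (rule insert.IH[OF q])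
    finally show ?thesis .
  qed
qed

section \<open>Counting permutations of a given cycle type\<close>

lemma z_part_superset:
  assumes "finite A" "set_mset lam \<subseteq> A"
  shows "z_part lam = (\<Prod>i\<in>A. i ^ count lam i * fact (count lam i))"
  unfolding z_part_def using assms
  by (intro prod.mono_neutral_left) (auto simp: not_in_iff)

lemma z_part_remove:
  assumes "k \<in># lam"
  shows "z_part lam = k * count lam k * z_part (lam - {#k#})"
proof -
  let ?A = "set_mset lam" and ?f = "\<lambda>lam i. i ^ count lam i * fact (count lam i)"
  obtain c where c: "count lam k = Suc c" using assms by (metis count_greater_zero_iff gr0_implies_Suc)
  let ?R = "\<Prod>i\<in>?A - {k}. ?f (lam - {#k#}) i"
  have "z_part lam = ?f lam k * (\<Prod>i\<in>?A - {k}. ?f lam i)"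
    unfolding z_part_def using assms by (intro prod.remove) auto
  also have "(\<Prod>i\<in>?A - {k}. ?f lam i) = ?R"
    by (intro prod.cong) auto
  also have "?f lam k = k * count lam k * ?f (lam - {#k#}) k"
    unfolding c by (simp add: c algebra_simps)
  also have "k * count lam k * ?f (lam - {#k#}) k * ?R
     = k * count lam k * (?f (lam - {#k#}) k * ?R)"
    by (simp only: mult.assoc)
  also have "?f (lam - {#k#}) k * (\<Prod>i\<in>?A - {k}. ?f (lam - {#k#}) i) = (\<Prod>i\<in>?A. ?f (lam - {#k#}) i)"
    using assms by (intro prod.remove[symmetric]) auto
  also have "\<dots> = z_part (lam - {#k#})"
    using in_diffD by (intro z_part_superset[symmetric]) force+
  finally show ?thesis .
qed

lemma card_filter_sum: "finite A \<Longrightarrow> card {x \<in> A. P x} = (\<Sum>x\<in>A. if P x then 1 else 0)"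
  by (simp add: sum.If_cases Int_def)

text \<open>The marked point \<open>s\<close> carries weight \<open>k\<close>, all others weight 1.
  A fixed \<open>s\<close> is a whole part \<open>k\<close> and contributes
  \<open>k * count lam k\<close>; otherwise \<open>s\<close> is absorbed by its predecessor, whose
  weight becomes \<open>Suc k\<close>, and this contributes the parts \<open>j \<ge> Suc k\<close>.
  The sum over \<open>j\<close> thus lists the parts that can contain \<open>s\<close>.\<close>

lemma card_wtype_special:
  fixes S :: "'a set"
  assumes fin: "finite S" and s: "s \<notin> S" and k: "1 \<le> k"
    and lam: "0 \<notin># lam" "sum_mset lam = card S + k"
    and P: "\<And>mu. 0 \<notin># mu \<Longrightarrow> sum_mset mu = card S \<Longrightarrow>
       card {p. p permutes S \<and> wtype S (\<lambda>_. 1) p = mu} * z_part mu = fact (card S)"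
    and Q: "\<And>m. m \<in> S \<Longrightarrow>
       card {p. p permutes S \<and> wtype S ((\<lambda>_. 1)(m := Suc k)) p = lam} * z_part lam
         = fact (card S - 1) * (\<Sum>j\<in>{j\<in>set_mset lam. Suc k \<le> j}. j * count lam j)"
  shows "card {p. p permutes insert s S \<and> wtype (insert s S) ((\<lambda>_. 1)(s := k)) p = lam} * z_part lam
    = fact (card S) * (\<Sum>j\<in>{j\<in>set_mset lam. k \<le> j}. j * count lam j)"
proof -
  let ?w = "(\<lambda>_. 1)(s := k)"
  define c1 where "c1 = (if k \<in># lam then card {p. p permutes S \<and> wtype S (\<lambda>_. 1) p = lam - {#k#}} else 0)"
  define cm where "cm = (\<lambda>m. card {p. p permutes S \<and> wtype S ((\<lambda>_. 1)(m := Suc k)) p = lam})"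
  let ?h = "\<lambda>p. if wtype (insert s S) ?w p = lam then 1 else 0 :: nat"
  have finP: "finite {p. p permutes A}" if "finite A" for A :: "'a set" using finite_permutations[OF that] .
  have filt: "card {p. p permutes A \<and> R p} = (\<Sum>p\<in>{p. p permutes A}. if R p then 1 else 0)"
    if "finite A" for A :: "'a set" and R
    using card_filter_sum[OF finP[OF that], of R] by (simp only: mem_Collect_eq)
  have "card {p. p permutes insert s S \<and> wtype (insert s S) ?w p = lam} = (\<Sum>p\<in>{p. p permutes insert s S}. ?h p)"
    using fin by (intro filt) auto
  also have "\<dots> = (\<Sum>p\<in>{p. p permutes S}. ?h p) + (\<Sum>p\<in>{p. p permutes S}. \<Sum>m\<in>S. ?h (p \<circ> Transposition.transpose m s))"
    by (rule sum_permutes_insert[OF fin s])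
  also have "(\<Sum>p\<in>{p. p permutes S}. \<Sum>m\<in>S. ?h (p \<circ> Transposition.transpose m s))
     = (\<Sum>m\<in>S. card {p. p permutes S \<and> wtype S ((\<lambda>_. 1)(m := Suc k)) p = lam})"
  proof -
    have "?h (p \<circ> Transposition.transpose m s) = (if wtype S ((\<lambda>_. 1)(m := Suc k)) p = lam then 1 else 0)"
      if p: "p permutes S" and m: "m \<in> S" for p m
    proof -
      let ?p = "p \<circ> Transposition.transpose m s"
      have p1: "?p permutes insert s S"
        using m by (intro permutes_compose[OF permutes_swap_id permutes_subset[OF p]]) auto
      have p2: "?p m = s" using permutes_not_in[OF p s] by simp
      have "wtype (insert s S) ?w ?p = wtype S (?w(m := ?w m + ?w s)) (?p \<circ> Transposition.transpose m s)"
        by (rule wtype_remove[OF p1 fin p2 m s])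
      also have "?p \<circ> Transposition.transpose m s = p" by (simp add: comp_assoc)
      also have "wtype S (?w(m := ?w m + ?w s)) p = wtype S ((\<lambda>_. 1)(m := Suc k)) p"
        using s m by (intro wtype_cong[OF p _ fin]) auto
      finally show ?thesis by (simp only:)
    qed
    then have "(\<Sum>p\<in>{p. p permutes S}. \<Sum>m\<in>S. ?h (p \<circ> Transposition.transpose m s))
       = (\<Sum>p\<in>{p. p permutes S}. \<Sum>m\<in>S. if wtype S ((\<lambda>_. 1)(m := Suc k)) p = lam then 1 else 0)"
      by (intro sum.cong refl) auto
    also have "\<dots> = (\<Sum>m\<in>S. \<Sum>p\<in>{p. p permutes S}. if wtype S ((\<lambda>_. 1)(m := Suc k)) p = lam then 1 else 0)"
      by (rule sum.swap)
    finally show ?thesis by (simp only: filt[OF fin])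
  qed
  also have "(\<Sum>p\<in>{p. p permutes S}. ?h p) =
     (if k \<in># lam then card {p. p permutes S \<and> wtype S (\<lambda>_. 1) p = lam - {#k#}} else 0)"
  proof -
    have "wtype (insert s S) ?w p = add_mset k (wtype S (\<lambda>_. 1) p)" if p: "p permutes S" for p
    proof -
      have "wtype (insert s S) ?w p = add_mset (?w s) (wtype S ?w p)"
        by (rule wtype_fixed[OF permutes_subset[OF p] fin permutes_not_in[OF p s] s]) auto
      also have "wtype S ?w p = wtype S (\<lambda>_. 1) p" using s by (intro wtype_cong[OF p _ fin]) auto
      finally show ?thesis by (simp only: fun_upd_same)
    qed
    then have "(\<Sum>p\<in>{p. p permutes S}. ?h p) = (\<Sum>p\<in>{p. p permutes S}. 
       if k \<in># lam \<and> wtype S (\<lambda>_. 1) p = lam - {#k#} then 1 else 0)"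
      by (intro sum.cong refl if_cong) (auto)
    then show ?thesis by (cases "k \<in># lam") (simp_all only: filt[OF fin] simp_thms if_True if_False sum.neutral_const)
  qed
  finally have E: "card {p. p permutes insert s S \<and> wtype (insert s S) ?w p = lam} = c1 + (\<Sum>m\<in>S. cm m)"
    unfolding c1_def cm_def .
  have "card {p. p permutes insert s S \<and> wtype (insert s S) ?w p = lam} * z_part lam =
     c1 * z_part lam + (\<Sum>m\<in>S. cm m * z_part lam)"
    unfolding E by (simp add: add_mult_distrib sum_distrib_right)
  also have "c1 * z_part lam =
     fact (card S) * (k * count lam k)"
  proof (cases "k \<in># lam")
    case True
    have "0 \<notin># lam - {#k#}" using lam(1) in_diffD by fastforce
    moreover have "sum_mset (lam - {#k#}) = card S" using lam(2) True
      using sum_mset.remove[OF True] by simp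
    ultimately have "card {p. p permutes S \<and> wtype S (\<lambda>_. 1) p = lam - {#k#}} * z_part (lam - {#k#}) = fact (card S)" by (rule P)
    then have "c1 * z_part (lam - {#k#}) = fact (card S)" using True by (simp only: c1_def if_True)
    then show ?thesis unfolding z_part_remove[OF True] by (simp add: mult_ac)
  next
    case False
    have "count lam k = 0" using False by (simp add: not_in_iff)
    moreover have "c1 = 0" unfolding c1_def using False by simp
    ultimately show ?thesis by simp
  qed
  also have "(\<Sum>m\<in>S. cm m * z_part lam)
     = fact (card S) * (\<Sum>j\<in>{j\<in>set_mset lam. Suc k \<le> j}. j * count lam j)"
  proof (cases "S = {}")
    case False
    then obtain c where "card S = Suc c" using fin by (metis card_0_eq not0_implies_Suc)
    moreover have "cm m * z_part lam = fact (card S - 1) * (\<Sum>j\<in>{j\<in>set_mset lam. Suc k \<le> j}. j * count lam j)"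
      if "m \<in> S" for m unfolding cm_def by (rule Q[OF that])
    ultimately show ?thesis by (simp add: algebra_simps)
  next
    case True
    then have "sum_mset lam = k" using lam by simp
    have "{j\<in>set_mset lam. Suc k \<le> j} = {}"
    proof safe
      fix j assume "j \<in># lam" "Suc k \<le> j"
      then have "j \<le> sum_mset lam" by (metis sum_mset.remove le_add1)
      then show "j \<in> {}" using \<open>sum_mset lam = k\<close> \<open>Suc k \<le> j\<close> by simp
    qed
    then show ?thesis using True by (simp only: sum.empty mult_0_right)
  qed
  also have "fact (card S) * (k * count lam k) + fact (card S) * (\<Sum>j\<in>{j\<in>set_mset lam. Suc k \<le> j}. j * count lam j)
     = fact (card S) * (\<Sum>j\<in>{j\<in>set_mset lam. k \<le> j}. j * count lam j)"
  proof (cases "k \<in># lam")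
    case True
    then have "{j\<in>set_mset lam. k \<le> j} = insert k {j\<in>set_mset lam. Suc k \<le> j}" by auto
    then show ?thesis by (simp add: algebra_simps)
  next
    case False
    then have "{j\<in>set_mset lam. k \<le> j} = {j\<in>set_mset lam. Suc k \<le> j}"
      by (auto simp: Suc_le_eq le_less)
    then show ?thesis using False by (simp add: not_in_iff)
  qed
  finally show ?thesis .
qed

lemma sum_mset_eq_sum_count: "sum_mset (lam :: nat multiset) = (\<Sum>j\<in>set_mset lam. j * count lam j)"
proof (induction lam)
  case (add x lam)
  show ?case
  proof (cases "x \<in># lam")
    case True
    have "(\<Sum>j\<in>set_mset lam. j * count (add_mset x lam) j) = (\<Sum>j\<in>set_mset lam. j * count lam j + (if j = x then j else 0))"
      by (intro sum.cong) auto
    also have "\<dots> = sum_mset lam + x" using True add.IH by (simp add: sum.distrib)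
    finally show ?thesis using True by (simp add: insert_absorb)
  next
    case False
    have "(\<Sum>j\<in>set_mset lam. j * count (add_mset x lam) j) = (\<Sum>j\<in>set_mset lam. j * count lam j)"
      using False by (intro sum.cong) auto
    then show ?thesis using False add.IH by (simp add: not_in_iff)
  qed
qed simp

text \<open>The two counts feed each other. \<open>?P (Suc m)\<close> is \<open>?Q m\<close> with
  \<open>k = 1\<close>, where the sum over the parts is the whole size \<open>Suc m\<close>;
  \<open>?Q (Suc m)\<close> uses \<open>?P (Suc m)\<close> for a fixed marked point and
  \<open>?Q m\<close> with weight \<open>Suc k\<close> for an absorbed one.\<close>

lemma card_wtype_aux:
  fixes m :: nat
  shows "(\<forall>S :: 'a set. \<forall>mu. finite S \<longrightarrow> card S = m \<longrightarrow> 0 \<notin># mu \<longrightarrow> sum_mset mu = m \<longrightarrow>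
       card {p. p permutes S \<and> wtype S (\<lambda>_. 1) p = mu} * z_part mu = fact m) \<and>
    (\<forall>S :: 'a set. \<forall>s k lam. finite S \<longrightarrow> card S = m \<longrightarrow> s \<notin> S \<longrightarrow> 1 \<le> k \<longrightarrow> 0 \<notin># lam \<longrightarrow> sum_mset lam = m + k \<longrightarrow>
       card {p. p permutes insert s S \<and> wtype (insert s S) ((\<lambda>_. 1)(s := k)) p = lam} * z_part lam
    = fact m * (\<Sum>j\<in>{j\<in>set_mset lam. k \<le> j}. j * count lam j))"
    (is "?P m \<and> ?Q m")
proof (induction m)
  case 0
  have P0: "?P 0"
  proof (intro allI impI)
    fix S :: "'a set" and mu :: "nat multiset"
    assume "finite S" "card S = 0" "0 \<notin># mu" "sum_mset mu = 0"
    then have "S = {}" "mu = {#}" by (auto simp: multiset_eq_iff) (metis count_eq_zero_iff sum_mset_0_iff)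
    then show "card {p. p permutes S \<and> wtype S (\<lambda>_. 1) p = mu} * z_part mu = fact 0"
      by (simp add: z_part_def)
  qed
  have "?Q 0"
    using P0 by (intro allI impI, subst card_wtype_special) auto
  with P0 show ?case by blast
next
  case (Suc m)
  have PS: "?P (Suc m)"
  proof (intro allI impI)
    fix S :: "'a set" and mu :: "nat multiset"
    assume a: "finite S" "card S = Suc m" "0 \<notin># mu" "sum_mset mu = Suc m"
    then obtain s S' where S: "S = insert s S'" "s \<notin> S'" "card S' = m" "finite S'"
      by (metis card_Suc_eq finite_insert)
    have "card {p. p permutes insert s S' \<and> wtype (insert s S') ((\<lambda>_. 1)(s := 1)) p = mu} * z_part mu
       = fact m * (\<Sum>j\<in>{j\<in>set_mset mu. 1 \<le> j}. j * count mu j)"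
      by (rule conjunct2[OF Suc, rule_format]) (use S a in auto)
    also have "{j\<in>set_mset mu. 1 \<le> j} = set_mset mu" using a(3) by (auto simp: Suc_le_eq intro: gr0I)
    also have "(\<lambda>_. 1 :: nat)(s := 1) = (\<lambda>_. 1)" by auto
    also have "(\<Sum>j\<in>set_mset mu. j * count mu j) = Suc m" using sum_mset_eq_sum_count a by metis
    finally show "card {p. p permutes S \<and> wtype S (\<lambda>_. 1) p = mu} * z_part mu = fact (Suc m)"
      using S by (simp add: algebra_simps)
  qed
  have "?Q (Suc m)"
  proof (intro allI impI)
    fix S :: "'a set" and s k and lam :: "nat multiset"
    assume a: "finite S" "card S = Suc m" "s \<notin> S" "1 \<le> k" "0 \<notin># lam" "sum_mset lam = Suc m + k"
    show "card {p. p permutes insert s S \<and> wtype (insert s S) ((\<lambda>_. 1)(s := k)) p = lam} * z_part lam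
       = fact (Suc m) * (\<Sum>j\<in>{j\<in>set_mset lam. k \<le> j}. j * count lam j)"
    proof (subst a(2)[symmetric], rule card_wtype_special)
      fix x assume x: "x \<in> S"
      have e: "insert x (S - {x}) = S" "card S - 1 = m" using x a by auto
      have "card {p. p permutes insert x (S - {x}) \<and> wtype (insert x (S - {x})) ((\<lambda>_. 1)(x := Suc k)) p = lam} * z_part lam =
        fact m * (\<Sum>j\<in>{j\<in>set_mset lam. Suc k \<le> j}. j * count lam j)"
        by (rule conjunct2[OF Suc, rule_format]) (use x a in auto)
      then show "card {p. p permutes S \<and> wtype S ((\<lambda>_. 1)(x := Suc k)) p = lam} * z_part lam =
        fact (card S - 1) * (\<Sum>j\<in>{j\<in>set_mset lam. Suc k \<le> j}. j * count lam j)"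
        unfolding e .
    qed (use a PS in auto)
  qed
  with PS show ?case by blast
qed

lemma card_cyc:
  assumes "0 \<notin># lam"
  shows "card (cyc (sum_mset lam) lam) * z_part lam = fact (sum_mset lam)"
  unfolding cyc_def cycle_type_wtype
  using conjunct1[OF card_wtype_aux, rule_format, of "{1..sum_mset lam}" "sum_mset lam" lam] assms by simp

section \<open>Cycle numbers under multiplication\<close>

text \<open>A cycle of \<open>p\<close> that avoids \<open>a\<close> and \<open>b\<close> is also a
  cycle of the product, and differs from the cycle of the product through \<open>a\<close>. At most
  two cycles of \<open>p\<close> are left over.\<close>

lemma ncyc_transpose_ge:
  assumes p: "p permutes U" and fin: "finite U" and ab: "a \<in> U" "b \<in> U"
  shows "ncyc U p \<le> Suc (ncyc U (p \<circ> Transposition.transpose a b))"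
proof -
  let ?q = "p \<circ> Transposition.transpose a b"
  have q: "?q permutes U" using p ab by (intro permutes_compose permutes_swap_id)
  have self: "a \<in> orbit ?q a" by (rule self_in_orbit_permutes[OF q fin])
  have "orbit p ` U \<subseteq> {orbit p a, orbit p b} \<union> (orbit ?q ` U - {orbit ?q a})"
  proof
    fix C assume "C \<in> orbit p ` U"
    then obtain x where x: "x \<in> U" "C = orbit p x" by auto
    show "C \<in> {orbit p a, orbit p b} \<union> (orbit ?q ` U - {orbit ?q a})"
    proof (cases "a \<in> C \<or> b \<in> C")
      case True
      then show ?thesis using x orbit_eq_permutes[OF p fin] by auto
    next
      case False
      have "orbit p x = orbit ?q x"
      proof (rule orbit_cong0)
        show "x \<in> C" using x self_in_orbit_permutes[OF p fin] by auto
        show "p \<in> C \<rightarrow> C" using x by (auto intro: orbit.step)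
        fix y assume "y \<in> C"
        then have "y \<noteq> a" "y \<noteq> b" using False by auto
        then show "p y = ?q y" by simp
      qed
      then show ?thesis using x self False by auto
    qed
  qed
  then have "ncyc U p \<le> card ({orbit p a, orbit p b} \<union> (orbit ?q ` U - {orbit ?q a}))"
    unfolding ncyc_def using fin by (intro card_mono) auto
  also have "\<dots> \<le> card {orbit p a, orbit p b} + card (orbit ?q ` U - {orbit ?q a})" by (rule card_Un_le)
  also have "\<dots> \<le> 2 + (ncyc U ?q - 1)"
    unfolding ncyc_def using fin ab by (intro add_mono) (auto simp: card_insert_if)
  also have "\<dots> = Suc (ncyc U ?q)"
  proof -
    have "ncyc U ?q \<noteq> 0" unfolding ncyc_def using fin ab by auto
    then show ?thesis by simp
  qed
  finally show ?thesis .
qed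

text \<open>For the length, meaning the size of the ground set minus the number of cycles, this is
  the triangle inequality. Stripping a transposition from \<open>p\<close> lowers its length by one,
  and \<open>ncyc_transpose_ge\<close> controls the effect on the product.\<close>

lemma ncyc_compose_ge:
  assumes s: "s permutes U" and fU: "finite U" and "finite S" "S \<subseteq> U" "p permutes S"
  shows "ncyc U s + ncyc S p \<le> ncyc U (s \<circ> p) + card S"
  using assms(3,4,5)
proof (induction S arbitrary: p rule: finite_induct)
  case empty
  then show ?case by simp
next
  case (insert n S)
  show ?case
  proof (cases "p n = n")
    case True
    have p: "p permutes S" using wtype_fixed(1)[OF insert.prems(2) insert.hyps(1) True insert.hyps(2)] .
    show ?thesis using insert.IH[OF _ p] insert.prems(1) insert.hyps ncyc_fixed[OF insert.prems(2) insert.hyps(1) True insert.hyps(2)]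
      by (simp del: o_apply)
  next
    case False
    define m where "m = pinv p n"
    have m: "p m = n" unfolding m_def using insert.prems(2) by (rule permutes_inverses)
    have mS: "m \<in> S" using m False insert.prems(2) by (metis insertE insertI1 permutes_in_image)
    let ?q = "p \<circ> Transposition.transpose m n"
    have q: "?q permutes S" using permutes_remove_transpose[OF insert.prems(2) m] .
    have "s \<circ> ?q permutes U" using q insert.prems by (intro permutes_compose[OF permutes_subset s]) auto
    then have a: "ncyc U (s \<circ> ?q) \<le> Suc (ncyc U ((s \<circ> ?q) \<circ> Transposition.transpose m n))"
      using insert.prems mS fU by (intro ncyc_transpose_ge) auto
    have e: "(s \<circ> ?q) \<circ> Transposition.transpose m n = s \<circ> p" by (simp add: comp_assoc)
    have "ncyc U (s \<circ> ?q) \<le> Suc (ncyc U (s \<circ> p))" using a unfolding e .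
    moreover have "ncyc U s + ncyc S ?q \<le> ncyc U (s \<circ> ?q) + card S" using insert.IH[OF _ q] insert.prems(1) by blast
    moreover have "card (insert n S) = Suc (card S)" using insert.hyps by simp
    ultimately show ?thesis unfolding ncyc_remove[OF insert.prems(2) insert.hyps(1) m mS insert.hyps(2)] by linarith
  qed
qed

lemma sign_ncyc:
  assumes "finite S" "p permutes S"
  shows "sign p = (-1) ^ (card S + ncyc S p)"
  using assms
proof (induction S arbitrary: p rule: finite_induct)
  case empty
  then show ?case by simp
next
  case (insert n S)
  show ?case
  proof (cases "p n = n")
    case True
    have p: "p permutes S" using wtype_fixed(1)[OF insert.prems insert.hyps(1) True insert.hyps(2)] .
    show ?thesis using insert.IH[OF p] insert.hyps ncyc_fixed[OF insert.prems insert.hyps(1) True insert.hyps(2)] by simp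
  next
    case False
    define m where "m = pinv p n"
    have m: "p m = n" unfolding m_def using insert.prems by (rule permutes_inverses)
    have mS: "m \<in> S" using m False insert.prems by (metis insertE insertI1 permutes_in_image)
    let ?q = "p \<circ> Transposition.transpose m n"
    have q: "?q permutes S" using permutes_remove_transpose[OF insert.prems m] .
    have "p = ?q \<circ> Transposition.transpose m n" by (simp add: comp_assoc)
    then have "sign p = sign ?q * sign (Transposition.transpose m n)"
      by (metis sign_compose q insert.hyps(1) permutation_permutes permutation_swap_id)
    also have "sign (Transposition.transpose m n) = -1" using mS insert.hyps by (auto simp: sign_swap_id)
    finally show ?thesis unfolding insert.IH[OF q] ncyc_remove[OF insert.prems insert.hyps(1) m mS insert.hyps(2)]
      using insert.hyps by simp
  qed
qed

lemma sum_mset_wtype: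
  assumes "finite S" "p permutes S" shows "sum_mset (wtype S w p) = sum w S"
  using assms
proof (induction S arbitrary: p w rule: finite_induct)
  case empty
  then show ?case by simp
next
  case (insert n S)
  show ?case
  proof (cases "p n = n")
    case True
    note f = wtype_fixed[OF insert.prems insert.hyps(1) True insert.hyps(2)]
    show ?thesis unfolding f(2) using insert.IH[OF f(1)] insert.hyps by simp
  next
    case False
    define m where "m = pinv p n"
    have m: "p m = n" unfolding m_def using insert.prems by (rule permutes_inverses)
    have mS: "m \<in> S" using m False insert.prems by (metis insertE insertI1 permutes_in_image)
    define w' where "w' = w(m := w m + w n)"
    have "sum w' S = w' m + sum w' (S - {m})" using mS insert.hyps by (intro sum.remove)
    also have "sum w' (S - {m}) = sum w (S - {m})" by (intro sum.cong) (auto simp: w'_def)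
    also have "w' m + sum w (S - {m}) = w n + (w m + sum w (S - {m}))" by (simp add: w'_def)
    also have "w m + sum w (S - {m}) = sum w S" using mS insert.hyps by (intro sum.remove[symmetric])
    also have "w n + sum w S = sum w (insert n S)" using insert.hyps by simp
    finally show ?thesis unfolding wtype_remove[OF insert.prems insert.hyps(1) m mS insert.hyps(2)]
      insert.IH[OF permutes_remove_transpose[OF insert.prems m]] w'_def .
  qed
qed

lemma cycle_type_partition:
  assumes p: "p permutes {1..n}" shows "cycle_type n p \<in> partitions_of n"
proof -
  have "sum_mset (cycle_type n p) = n"
    unfolding cycle_type_wtype using sum_mset_wtype[OF _ p, of "\<lambda>_. 1"] by simp
  moreover have "0 \<notin># cycle_type n p"
  proof
    assume "0 \<in># cycle_type n p"
    then obtain x where "x \<in> {1..n}" "card (orbit p x) = 0" by (auto simp: cycle_type_def)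
    moreover have "finite (orbit p x)"
      using permutes_orbit_subset[OF p \<open>x \<in> {1..n}\<close>] finite_subset by blast
    ultimately show False using orbit_nonempty[of p x] by auto
  qed
  ultimately show ?thesis by (simp add: partitions_of_def)
qed

lemma cyc_nonempty:
  assumes "0 \<notin># lam" shows "cyc (sum_mset lam) lam \<noteq> {}"
proof
  assume "cyc (sum_mset lam) lam = {}"
  then show False using card_cyc[OF assms] by simp
qed

lemma finite_partitions_of: "finite (partitions_of n)"
proof -
  have "partitions_of n \<subseteq> cycle_type n ` {p. p permutes {1..n}}"
  proof
    fix lam assume "lam \<in> partitions_of n"
    then have "0 \<notin># lam" "sum_mset lam = n" by (auto simp: partitions_of_def)
    then obtain p where "p \<in> cyc n lam" using cyc_nonempty by blast
    then show "lam \<in> cycle_type n ` {p. p permutes {1..n}}" by (auto simp: cyc_def)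
  qed
  then show ?thesis using finite_permutations[of "{1..n}"] by (simp add: finite_subset)
qed

section \<open>Jucys--Murphy elements\<close>

text \<open>A function \<open>f\<close> stands for the element \<open>\<Sum>\<^sub>s f s \<cdot> s\<close> of the group algebra of the symmetric group.
  The operators below are right multiplications: by the Jucys--Murphy element \<open>J\<^sub>k\<close> of \<open>k\<close>, by
  \<open>\<Sum>\<^sub>p x^cyc(p) \<cdot> p\<close> (which is \<open>(x + J\<^sub>1) \<dots> (x + J\<^sub>n)\<close> by Jucys), and by the complete homogeneous
  symmetric polynomial \<open>h\<^sub>r(J\<^sub>1, \<dots>, J\<^sub>n)\<close>, whose expansion runs over monotone sequences.\<close>

definition jm :: "nat \<Rightarrow> ((nat \<Rightarrow> nat) \<Rightarrow> complex) \<Rightarrow> (nat \<Rightarrow> nat) \<Rightarrow> complex" where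
  "jm k f s = (\<Sum>m\<in>{1..<k}. f (s \<circ> Transposition.transpose m k))"

definition cycop :: "nat \<Rightarrow> complex \<Rightarrow> ((nat \<Rightarrow> nat) \<Rightarrow> complex) \<Rightarrow> (nat \<Rightarrow> nat) \<Rightarrow> complex" where
  "cycop n x f s = (\<Sum>p\<in>{p. p permutes {1..n}}. x ^ ncyc {1..n} p * f (s \<circ> pinv p))"

definition monseqs :: "nat \<Rightarrow> nat \<Rightarrow> (nat \<times> nat) list set" where
  "monseqs n r = {ts. length ts = r \<and> (\<forall>(a, b)\<in>set ts. 1 \<le> a \<and> a < b \<and> b \<le> n) \<and> sorted (map snd ts)}"

definition monop :: "nat \<Rightarrow> nat \<Rightarrow> ((nat \<Rightarrow> nat) \<Rightarrow> complex) \<Rightarrow> (nat \<Rightarrow> nat) \<Rightarrow> complex" where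
  "monop n r f s = (\<Sum>ts\<in>monseqs n r. f (s \<circ> pinv (transp_prod ts)))"

text \<open>The permutation \<open>q\<close> fixes \<open>k\<close>, so conjugation by it permutes
  the transpositions of \<open>k\<close> with the smaller points and leaves their sum unchanged: the
  Jucys--Murphy element commutes with the smaller symmetric group.\<close>

lemma jm_commute:
  assumes q: "q permutes {1..<k}"
  shows "jm k (\<lambda>s. f (s \<circ> q)) s = jm k f (s \<circ> q)"
proof -
  have e: "Transposition.transpose (q m) k \<circ> q = q \<circ> Transposition.transpose m k" for m
  proof -
    have qk: "q k = k" using q by (rule permutes_not_in) simp
    have "Transposition.transpose (q m) (q k) \<circ> q = q \<circ> Transposition.transpose m k"
      using permutes_inj[OF q] by (auto simp: fun_eq_iff Transposition.transpose_def inj_eq)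
    then show ?thesis by (simp only: qk)
  qed
  have "jm k (\<lambda>s. f (s \<circ> q)) s = (\<Sum>m\<in>{1..<k}. f (s \<circ> (Transposition.transpose (q m) k \<circ> q)))"
    unfolding jm_def
    using sum.permute[OF q, of "\<lambda>m. f (s \<circ> (Transposition.transpose m k \<circ> q))"]
    by (simp only: o_def[of _ q] comp_assoc) (simp only: o_def)
  also have "\<dots> = jm k f (s \<circ> q)" unfolding e jm_def by (simp only: comp_assoc)
  finally show ?thesis .
qed

lemma atLeastAtMost_Suc_insert: "{1..Suc n} = insert (Suc n) {1..n}" by auto

lemma pinv_compose_transpose:
  assumes "p permutes S"
  shows "pinv (p \<circ> Transposition.transpose m k) = Transposition.transpose m k \<circ> pinv p"
  using permutes_bij[OF assms] by (subst o_inv_distrib) auto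

text \<open>One factor \<open>x + J\<close> of the product of Jucys, with \<open>J\<close> the
  element of \<open>Suc n\<close>. A fixed \<open>Suc n\<close> is one more cycle and gives
  \<open>x\<close>; inserting \<open>Suc n\<close> after \<open>m\<close> in the cycle of
  \<open>m\<close> keeps the number of cycles and gives a transposition.\<close>

lemma cycop_Suc:
  "cycop (Suc n) x f s = x * cycop n x f s + jm (Suc n) (cycop n x f) s"
proof -
  let ?S = "{1..n}"
  let ?h = "\<lambda>p. x ^ ncyc {1..Suc n} p * f (s \<circ> pinv p)"
  have "cycop (Suc n) x f s = (\<Sum>p\<in>{p. p permutes insert (Suc n) ?S}. ?h p)"
    unfolding cycop_def atLeastAtMost_Suc_insert ..
  also have "\<dots> = (\<Sum>p\<in>{p. p permutes ?S}. ?h p) + (\<Sum>p\<in>{p. p permutes ?S}. \<Sum>m\<in>?S. ?h (p \<circ> Transposition.transpose m (Suc n)))"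
    by (rule sum_permutes_insert) auto
  also have "(\<Sum>p\<in>{p. p permutes ?S}. ?h p) = x * cycop n x f s"
    unfolding cycop_def sum_distrib_left
  proof (intro sum.cong refl)
    fix p assume "p \<in> {p. p permutes ?S}"
    then have p: "p permutes ?S" by simp
    have "ncyc {1..Suc n} p = Suc (ncyc ?S p)" unfolding atLeastAtMost_Suc_insert
      by (rule ncyc_fixed[OF permutes_subset[OF p] _ permutes_not_in[OF p]]) auto
    then show "?h p = x * (x ^ ncyc ?S p * f (s \<circ> pinv p))" by simp
  qed
  also have "(\<Sum>p\<in>{p. p permutes ?S}. \<Sum>m\<in>?S. ?h (p \<circ> Transposition.transpose m (Suc n)))
    = (\<Sum>p\<in>{p. p permutes ?S}. \<Sum>m\<in>?S. x ^ ncyc ?S p * f (s \<circ> Transposition.transpose m (Suc n) \<circ> pinv p))"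
  proof (intro sum.cong refl)
    fix p m assume "p \<in> {p. p permutes ?S}" and m: "m \<in> ?S"
    then have p: "p permutes ?S" by simp
    let ?p = "p \<circ> Transposition.transpose m (Suc n)"
    have p1: "?p permutes insert (Suc n) ?S"
      using m by (intro permutes_compose[OF permutes_swap_id permutes_subset[OF p]]) auto
    have p2: "?p m = Suc n" using permutes_not_in[OF p] by simp
    have "ncyc (insert (Suc n) ?S) ?p = ncyc ?S (?p \<circ> Transposition.transpose m (Suc n))"
      by (rule ncyc_remove[OF p1 _ p2 m]) auto
    also have "?p \<circ> Transposition.transpose m (Suc n) = p" by (simp add: comp_assoc)
    finally show "?h ?p = x ^ ncyc ?S p * f (s \<circ> Transposition.transpose m (Suc n) \<circ> pinv p)"
      unfolding atLeastAtMost_Suc_insert pinv_compose_transpose[OF p] by (simp only: comp_assoc)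
  qed
  also have "\<dots> = (\<Sum>m\<in>?S. \<Sum>p\<in>{p. p permutes ?S}. x ^ ncyc ?S p * f (s \<circ> Transposition.transpose m (Suc n) \<circ> pinv p))"
    by (rule sum.swap)
  also have "\<dots> = jm (Suc n) (cycop n x f) s"
    unfolding jm_def cycop_def by (simp only: atLeastLessThanSuc_atLeastAtMost)
  finally show ?thesis .
qed

lemma jm_sum: "jm k (\<lambda>s. \<Sum>i\<in>I. f i s) s = (\<Sum>i\<in>I. jm k (f i) s)"
  unfolding jm_def by (rule sum.swap)

lemma jm_scale: "jm k (\<lambda>s. a * f s) s = a * jm k f s"
  by (simp add: jm_def sum_distrib_left)

lemma cycop_jm: "cycop n x (jm (Suc n) f) s = jm (Suc n) (cycop n x f) s"
proof -
  have e: "jm (Suc n) f (s \<circ> pinv p) = jm (Suc n) (\<lambda>s. f (s \<circ> pinv p)) s" if "p permutes {1..n}" for p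
  proof -
    have "pinv p permutes {1..<Suc n}" using permutes_inv[OF that] by (simp only: atLeastLessThanSuc_atLeastAtMost)
    from jm_commute[OF this] show ?thesis by metis
  qed
  have "cycop n x (jm (Suc n) f) s = (\<Sum>p\<in>{p. p permutes {1..n}}. x ^ ncyc {1..n} p * jm (Suc n) (\<lambda>s. f (s \<circ> pinv p)) s)"
    unfolding cycop_def by (intro sum.cong refl) (simp only: e mem_Collect_eq)
  also have "\<dots> = jm (Suc n) (cycop n x f) s"
    unfolding cycop_def[abs_def] jm_sum jm_scale ..
  finally show ?thesis .
qed

lemma cycop_linear:
  "cycop n x (\<lambda>s. a * f s + b * g s) s = a * cycop n x f s + b * cycop n x g s"
  by (simp add: cycop_def sum.distrib sum_distrib_left algebra_simps)

section \<open>Monotone sequences of transpositions and complete symmetric polynomials\<close>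

lemma transp_prod_snoc: "transp_prod (ts @ [(a, b)]) = transp_prod ts \<circ> Transposition.transpose a b"
proof (induction ts)
  case Nil then show ?case by (simp add: transp_prod_def)
next
  case (Cons x ts)
  obtain u v where x: "x = (u, v)" by (cases x)
  have c: "transp_prod ((u, v) # l) = Transposition.transpose u v \<circ> transp_prod l" for l
    by (simp add: transp_prod_def)
  show ?case unfolding x append_Cons c Cons.IH by (simp only: comp_assoc)
qed

lemma transp_prod_Nil [simp]: "transp_prod [] = id" by (simp add: transp_prod_def)

lemma transp_prod_permutes:
  assumes "\<forall>(a, b)\<in>set ts. 1 \<le> a \<and> a < b \<and> b \<le> n" shows "transp_prod ts permutes {1..n}"
  using assms
proof (induction ts rule: rev_induct)
  case Nil then show ?case by (simp only: transp_prod_Nil permutes_id)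
next
  case (snoc x ts)
  obtain u v where x: "x = (u, v)" by (cases x)
  have "transp_prod ts permutes {1..n}" using snoc by simp
  moreover have "u \<in> {1..n}" "v \<in> {1..n}" using snoc.prems x by auto
  ultimately show ?case unfolding x transp_prod_snoc
    by (intro permutes_compose[OF permutes_swap_id])
qed

lemma monseqs_permutes: "ts \<in> monseqs n r \<Longrightarrow> transp_prod ts permutes {1..n}"
  by (rule transp_prod_permutes) (simp add: monseqs_def)

lemma monseqs_subset: "monseqs n r \<subseteq> {ts. set ts \<subseteq> {1..n} \<times> {1..n} \<and> length ts = r}"
  by (fastforce simp: monseqs_def)

lemma finite_monseqs: "finite (monseqs n r)"
  by (rule finite_subset[OF monseqs_subset finite_lists_length_eq]) simp

text \<open>Without the order condition each entry is one of \<open>n * n\<close> pairs. This crude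
  count is the origin of the bound \<open>n * n < norm c\<close> under which the series
  converges.\<close>

lemma card_monseqs: "card (monseqs n r) \<le> (n * n) ^ r"
proof -
  have "card (monseqs n r) \<le> card {ts. set ts \<subseteq> {1..n} \<times> {1..n} \<and> length ts = r}"
    by (rule card_mono[OF finite_lists_length_eq monseqs_subset]) simp
  also have "\<dots> = (n * n) ^ r" by (subst card_lists_length_eq) (simp_all add: card_cartesian_product)
  finally show ?thesis .
qed

lemma monseqs_0 [simp]: "monseqs n 0 = {[]}" by (auto simp: monseqs_def)

text \<open>As the larger entries increase along the sequence, \<open>Suc n\<close> occurs if and
  only if it occurs in the last transposition. This mirrors the recursion of the complete symmetric
  polynomials when a variable is adjoined: either the variable is absent, or one copy of it is split
  off.\<close>

lemma monseqs_Suc: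
  "monseqs (Suc n) (Suc r) = monseqs n (Suc r) \<union> (\<lambda>(m, ts). ts @ [(m, Suc n)]) ` ({1..<Suc n} \<times> monseqs (Suc n) r)"
proof (intro subset_antisym subsetI)
  fix ts assume ts: "ts \<in> monseqs (Suc n) (Suc r)"
  then have "ts \<noteq> []" by (auto simp: monseqs_def)
  then obtain us a b where u: "ts = us @ [(a, b)]" by (metis rev_exhaust surj_pair)
  show "ts \<in> monseqs n (Suc r) \<union> (\<lambda>(m, ts). ts @ [(m, Suc n)]) ` ({1..<Suc n} \<times> monseqs (Suc n) r)"
  proof (cases "b = Suc n")
    case True
    have "us \<in> monseqs (Suc n) r" "a \<in> {1..<Suc n}" using ts True unfolding u by (auto simp: monseqs_def sorted_append)
    then show ?thesis unfolding u True by force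
  next
    case False
    then have b: "b \<le> n" using ts unfolding u by (auto simp: monseqs_def)
    have "\<forall>x\<in>set us. snd x \<le> b" using ts unfolding u by (auto simp: monseqs_def sorted_append)
    then have "ts \<in> monseqs n (Suc r)" using ts b unfolding u by (fastforce simp: monseqs_def)
    then show ?thesis by simp
  qed
next
  fix ts assume "ts \<in> monseqs n (Suc r) \<union> (\<lambda>(m, ts). ts @ [(m, Suc n)]) ` ({1..<Suc n} \<times> monseqs (Suc n) r)"
  then show "ts \<in> monseqs (Suc n) (Suc r)"
    by (auto simp: monseqs_def sorted_append) fastforce+
qed

lemma monop_Suc:
  "monop (Suc n) (Suc r) f s = monop n (Suc r) f s + jm (Suc n) (monop (Suc n) r f) s"
proof -
  let ?F = "\<lambda>ts. f (s \<circ> pinv (transp_prod ts))"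
  let ?g = "\<lambda>(m, ts). ts @ [(m, Suc n)]"
  let ?B = "{1..<Suc n} \<times> monseqs (Suc n) r"
  have "monseqs n (Suc r) \<inter> ?g ` ?B = {}" by (auto simp: monseqs_def)
  then have "monop (Suc n) (Suc r) f s = monop n (Suc r) f s + sum ?F (?g ` ?B)"
    unfolding monop_def monseqs_Suc by (intro sum.union_disjoint) (auto simp: finite_monseqs)
  also have "sum ?F (?g ` ?B) = (\<Sum>x\<in>?B. ?F (?g x))"
    by (subst sum.reindex) (auto simp: inj_on_def)
  also have "\<dots> = (\<Sum>x\<in>?B. f (s \<circ> Transposition.transpose (fst x) (Suc n) \<circ> pinv (transp_prod (snd x))))"
  proof (intro sum.cong refl)
    fix x assume "x \<in> ?B"
    then obtain m ts where x: "x = (m, ts)" "ts \<in> monseqs (Suc n) r" by auto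
    show "?F (?g x) = f (s \<circ> Transposition.transpose (fst x) (Suc n) \<circ> pinv (transp_prod (snd x)))"
      unfolding x(1) by (simp only: prod.case fst_conv snd_conv transp_prod_snoc pinv_compose_transpose[OF monseqs_permutes[OF x(2)]] comp_assoc)
  qed
  also have "\<dots> = jm (Suc n) (monop (Suc n) r f) s"
    unfolding jm_def monop_def sum.cartesian_product by (simp add: split_def)
  finally show ?thesis .
qed

lemma monop_0 [simp]: "monop n 0 f s = f s" by (simp add: monop_def)

lemma monop_jm: "monop n r (jm (Suc n) f) s = jm (Suc n) (monop n r f) s"
proof -
  have e: "jm (Suc n) f (s \<circ> pinv (transp_prod ts)) = jm (Suc n) (\<lambda>s. f (s \<circ> pinv (transp_prod ts))) s" if "ts \<in> monseqs n r" for ts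
  proof -
    have "pinv (transp_prod ts) permutes {1..<Suc n}"
      using permutes_inv[OF monseqs_permutes[OF that]] by (simp only: atLeastLessThanSuc_atLeastAtMost)
    from jm_commute[OF this] show ?thesis by metis
  qed
  have "monop n r (jm (Suc n) f) s = (\<Sum>ts\<in>monseqs n r. jm (Suc n) (\<lambda>s. f (s \<circ> pinv (transp_prod ts))) s)"
    unfolding monop_def by (intro sum.cong refl) (simp only: e)
  also have "\<dots> = jm (Suc n) (monop n r f) s"
    unfolding monop_def[abs_def] jm_sum ..
  finally show ?thesis .
qed

lemma monop_linear:
  "monop n r (\<lambda>s. a * f s + b * g s) s = a * monop n r f s + b * monop n r g s"
  by (simp add: monop_def sum.distrib sum_distrib_left)

lemma monop_bound:
  assumes "\<And>s. norm (f s) \<le> B" shows "norm (monop n r f s) \<le> B * real (n * n) ^ r"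
proof -
  have B: "0 \<le> B" using assms[of undefined] norm_ge_zero order_trans by blast
  have "norm (monop n r f s) \<le> (\<Sum>ts\<in>monseqs n r. B)"
    unfolding monop_def by (rule sum_norm_le) (rule assms)
  also have "\<dots> = B * real (card (monseqs n r))" by simp
  also have "\<dots> \<le> B * real (n * n) ^ r"
    using card_monseqs[of n r] B by (intro mult_left_mono) (metis of_nat_le_iff of_nat_power, simp)
  finally show ?thesis .
qed

text \<open>Right multiplication by the inverse of \<open>(c + J\<^sub>1) \<dots> (c + J\<^sub>n)\<close>, for large \<open>c\<close>.\<close>

definition invop :: "nat \<Rightarrow> complex \<Rightarrow> ((nat \<Rightarrow> nat) \<Rightarrow> complex) \<Rightarrow> (nat \<Rightarrow> nat) \<Rightarrow> complex" where
  "invop n c f s = (\<Sum>r. (-1) ^ r / c ^ (n + r) * monop n r f s)"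

lemma invop_summable:
  assumes "real (n * n) < norm c" "\<And>s. norm (f s) \<le> B"
  shows "summable (\<lambda>r. norm ((-1) ^ r / c ^ (k + r) * monop n r f s))"
proof (rule summable_comparison_test')
  have c: "c \<noteq> 0" using assms(1) by auto
  show "summable (\<lambda>r. B / norm c ^ k * (real (n * n) / norm c) ^ r)"
    using assms(1) by (intro summable_mult summable_geometric) (auto simp: divide_simps)
  fix r :: nat
  have "norm (norm ((-1) ^ r / c ^ (k + r) * monop n r f s)) = norm (monop n r f s) / norm c ^ (k + r)"
    by (simp add: norm_mult norm_divide norm_power)
  also have "\<dots> \<le> B * real (n * n) ^ r / norm c ^ (k + r)"
    by (intro divide_right_mono monop_bound assms) simp
  also have "\<dots> = B / norm c ^ k * (real (n * n) / norm c) ^ r"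
    by (simp add: power_add power_divide)
  finally show "norm (norm ((-1) ^ r / c ^ (k + r) * monop n r f s)) \<le> B / norm c ^ k * (real (n * n) / norm c) ^ r" .
qed

text \<open>By \<open>monop_Suc\<close>, the term of index \<open>Suc r\<close> of
  \<open>c * invop (Suc n) c f\<close> is the corresponding term of \<open>invop n c f\<close> minus
  \<open>J\<close> applied to the term of index \<open>r\<close> of
  \<open>invop (Suc n) c f\<close>. Adding \<open>J\<close> applied to the whole series cancels the
  second part.\<close>

lemma invop_Suc:
  assumes c: "real (Suc n * Suc n) < norm c" and f: "\<And>s. norm (f s) \<le> B"
  shows "c * invop (Suc n) c f s + jm (Suc n) (invop (Suc n) c f) s = invop n c f s"
proof -
  have c0: "c \<noteq> 0"
  proof
    assume "c = 0" then have "real (Suc n * Suc n) < 0" using c by simp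
    then show False by (metis of_nat_less_0_iff)
  qed
  have cn: "real (n * n) < norm c"
    by (rule le_less_trans[OF _ c]) (simp add: algebra_simps)
  let ?a = "\<lambda>r s. (-1) ^ r / c ^ (Suc n + r) * monop (Suc n) r f s"
  let ?b = "\<lambda>r s. (-1) ^ r / c ^ (n + r) * monop n r f s"
  have sa: "summable (\<lambda>r. ?a r s)" for s
    by (rule summable_norm_cancel[OF invop_summable[OF c f]])
  have sb: "summable (\<lambda>r. ?b r s)" for s
    by (rule summable_norm_cancel[OF invop_summable[OF cn f]])
  have sj: "summable (\<lambda>r. jm (Suc n) (?a r) s)"
    unfolding jm_def by (intro summable_sum sa)
  have J: "jm (Suc n) (invop (Suc n) c f) s = (\<Sum>r. jm (Suc n) (?a r) s)"
    unfolding jm_def invop_def by (rule suminf_sum[symmetric, OF sa])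
  have "c * invop (Suc n) c f s = (\<Sum>r. c * ?a r s)" unfolding invop_def by (rule suminf_mult[symmetric, OF sa])
  also have "\<dots> = (\<Sum>r. c * ?a (Suc r) s) + c * ?a 0 s"
    using suminf_split_head[OF summable_mult[OF sa], of c s] by simp
  also have "(\<Sum>r. c * ?a (Suc r) s) = (\<Sum>r. ?b (Suc r) s - jm (Suc n) (?a r) s)"
  proof (rule suminf_cong)
    fix r
    have "jm (Suc n) (?a r) s = (-1) ^ r / c ^ (Suc n + r) * jm (Suc n) (monop (Suc n) r f) s"
      by (rule jm_scale)
    then show "c * ?a (Suc r) s = ?b (Suc r) s - jm (Suc n) (?a r) s"
      unfolding monop_Suc using c0 by (simp add: field_simps)
  qed
  also have "\<dots> = (\<Sum>r. ?b (Suc r) s) - (\<Sum>r. jm (Suc n) (?a r) s)"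
    using sb sj by (intro suminf_diff[symmetric]) (simp_all only: summable_Suc_iff[of "\<lambda>r. ?b r s"])
  also have "(\<Sum>r. ?b (Suc r) s) = invop n c f s - ?b 0 s"
    unfolding invop_def using suminf_split_head[OF sb] by simp
  also have "c * ?a 0 s = ?b 0 s" using c0 by (simp add: field_simps)
  finally show ?thesis unfolding J by simp
qed

lemma jm_bound:
  assumes "\<And>s. norm (f s) \<le> B" shows "norm (jm k f s) \<le> real k * B"
proof -
  have B: "0 \<le> B" using assms[of undefined] norm_ge_zero order_trans by blast
  have "norm (jm k f s) \<le> (\<Sum>m\<in>{1..<k}. B)" unfolding jm_def by (rule sum_norm_le) (rule assms)
  also have "\<dots> \<le> real k * B" using B by (simp add: mult_right_mono)
  finally show ?thesis .
qed

lemma invop_linear: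
  assumes c: "real (n * n) < norm c" and f: "\<And>s. norm (f s) \<le> B" and g: "\<And>s. norm (g s) \<le> B'"
  shows "invop n c (\<lambda>s. a * f s + b * g s) s = a * invop n c f s + b * invop n c g s"
proof -
  have sf: "summable (\<lambda>r. (-1) ^ r / c ^ (n + r) * monop n r f s)"
    by (rule summable_norm_cancel[OF invop_summable[OF c f]])
  have sg: "summable (\<lambda>r. (-1) ^ r / c ^ (n + r) * monop n r g s)"
    by (rule summable_norm_cancel[OF invop_summable[OF c g]])
  show ?thesis unfolding invop_def monop_linear
    by (subst suminf_mult[symmetric, OF sf], subst suminf_mult[symmetric, OF sg],
       subst suminf_add[OF summable_mult[OF sf] summable_mult[OF sg]]) (simp add: algebra_simps)
qed

lemma invop_jm:
  assumes c: "real (n * n) < norm c" and f: "\<And>s. norm (f s) \<le> B"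
  shows "invop n c (jm (Suc n) f) s = jm (Suc n) (invop n c f) s"
proof -
  have sf: "summable (\<lambda>r. (-1) ^ r / c ^ (n + r) * monop n r f s)" for s
    by (rule summable_norm_cancel[OF invop_summable[OF c f]])
  have "jm (Suc n) (invop n c f) s = (\<Sum>r. jm (Suc n) (\<lambda>s. (-1) ^ r / c ^ (n + r) * monop n r f s) s)"
    unfolding jm_def invop_def by (rule suminf_sum[symmetric, OF sf])
  then show ?thesis unfolding jm_scale invop_def monop_jm by simp
qed

text \<open>In the group algebra of the symmetric groups, with \<open>J\<close> the Jucys--Murphy element of \<open>n + 1\<close>,
  the recursion reads \<open>f (n + 1) * (c + J) = f n * (N + J) * (e + J)\<close>.\<close>

definition loop_rhs :: "nat \<Rightarrow> complex \<Rightarrow> complex \<Rightarrow> ((nat \<Rightarrow> nat) \<Rightarrow> complex) \<Rightarrow> (nat \<Rightarrow> nat) \<Rightarrow> complex" where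
  "loop_rhs n N e f s = e * (N * f s + jm (Suc n) f s) + jm (Suc n) (\<lambda>s. N * f s + jm (Suc n) f s) s"

text \<open>The level is capped by \<open>M\<close> because for given parameters the moments of the
  inverse matrix exist only up to a bounded degree. Extension by zero lets \<open>loop_rhs\<close>
  read \<open>f n\<close> at permutations of one more point.\<close>

definition loop_sol :: "nat \<Rightarrow> complex \<Rightarrow> complex \<Rightarrow> complex \<Rightarrow> (nat \<Rightarrow> (nat \<Rightarrow> nat) \<Rightarrow> complex) \<Rightarrow> bool" where
  "loop_sol M N e c f \<longleftrightarrow> f 0 id = 1 \<and> (\<forall>n\<le>M. \<forall>s. \<not> s permutes {1..n} \<longrightarrow> f n s = 0) \<and>
     (\<forall>n<M. \<forall>s. s permutes {1..Suc n} \<longrightarrow> c * f (Suc n) s + jm (Suc n) (f (Suc n)) s = loop_rhs n N e (f n) s)"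

definition delta_id :: "(nat \<Rightarrow> nat) \<Rightarrow> complex" where "delta_id s = (if s = id then 1 else 0)"

definition loop_series :: "complex \<Rightarrow> complex \<Rightarrow> complex \<Rightarrow> nat \<Rightarrow> (nat \<Rightarrow> nat) \<Rightarrow> complex" where
  "loop_series N e c n = invop n c (cycop n e (cycop n N delta_id))"

lemma cycop_bound:
  assumes "\<And>s. norm (f s) \<le> B" 
  shows "norm (cycop n x f s) \<le> (\<Sum>p\<in>{p. p permutes {1..n}}. norm x ^ ncyc {1..n} p * B)"
  unfolding cycop_def by (rule sum_norm_le) (simp add: norm_mult norm_power assms mult_left_mono)

lemma delta_id_bound: "norm (delta_id s) \<le> 1" by (simp add: delta_id_def)

lemma permutes_compose_right_iff:
  assumes "q permutes S" shows "(s \<circ> q) permutes S \<longleftrightarrow> s permutes S"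
proof
  assume "(s \<circ> q) permutes S"
  then have "(s \<circ> q) \<circ> pinv q permutes S" using permutes_inv[OF assms] permutes_compose by blast
  then show "s permutes S" by (simp add: comp_assoc permutes_inv_o[OF assms])
qed (use assms permutes_compose in blast)

lemma loop_series_support:
  assumes "\<not> s permutes {1..n}" shows "loop_series N e c n s = 0"
proof -
  have a: "cycop n x f s = 0" if "\<And>s. \<not> s permutes {1..n} \<Longrightarrow> f s = 0" "\<not> s permutes {1..n}" for x f s
    unfolding cycop_def
  proof (rule sum.neutral, rule ballI)
    fix p assume "p \<in> {p. p permutes {1..n}}"
    then have "pinv p permutes {1..n}" using permutes_inv by blast
    then have "f (s \<circ> pinv p) = 0" using that permutes_compose_right_iff by blast
    then show "x ^ ncyc {1..n} p * f (s \<circ> pinv p) = 0" by simp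
  qed
  have d: "\<not> s permutes {1..n} \<Longrightarrow> delta_id s = 0" for s by (auto simp: delta_id_def permutes_id)
  let ?u = "cycop n e (cycop n N delta_id)"
  have u: "\<not> s permutes {1..n} \<Longrightarrow> ?u s = 0" for s by (intro a d)
  have "monop n r ?u s = 0" for r
    unfolding monop_def
  proof (rule sum.neutral, rule ballI)
    fix ts assume "ts \<in> monseqs n r"
    then have "pinv (transp_prod ts) permutes {1..n}" using permutes_inv monseqs_permutes by blast
    then show "?u (s \<circ> pinv (transp_prod ts)) = 0" using u assms permutes_compose_right_iff by blast
  qed
  then show ?thesis unfolding loop_series_def invop_def by simp
qed

text \<open>Each of the three operators gains one factor at level \<open>Suc n\<close>. The
  Jucys--Murphy element of \<open>Suc n\<close> commutes with the smaller symmetric group, so the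
  new numerators can be pulled through \<open>cycop n\<close> and \<open>invop n\<close> (facts
  \<open>2\<close>, \<open>4\<close> and \<open>5\<close>), and the new denominator is removed by
  \<open>invop_Suc\<close>.\<close>

lemma loop_series_sol:
  assumes c: "real (M * M) < norm c"
  shows "loop_sol M N e c (loop_series N e c)"
  unfolding loop_sol_def
proof (intro conjI allI impI)
  have "cycop 0 x f s = f s" for x f s
    by (simp add: cycop_def)
  moreover have "invop 0 c f s = f s" for f s
  proof -
    have "monop 0 r f s = 0" if "r \<noteq> 0" for r
    proof -
      have "monseqs 0 r = {}" using that by (cases r) (auto simp: monseqs_def length_Suc_conv)
      then show ?thesis by (simp add: monop_def)
    qed
    then have "(\<lambda>r. (-1) ^ r / c ^ (0 + r) * monop 0 r f s) = (\<lambda>r. if r = 0 then f s else 0)"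
      by (auto simp: fun_eq_iff)
    then show ?thesis unfolding invop_def using suminf_finite[of "{0}" "\<lambda>r. if r = (0::nat) then f s else 0"] by simp
  qed
  ultimately show "loop_series N e c 0 id = 1" by (simp add: loop_series_def delta_id_def)
next
  fix n :: nat and s assume "\<not> s permutes {1..n}" then show "loop_series N e c n s = 0" by (rule loop_series_support)
next
  fix n :: nat and s assume n: "n < M"
  have "real (Suc n * Suc n) \<le> real (M * M)" using n by (intro of_nat_mono mult_mono) auto
  then have c1: "real (Suc n * Suc n) < norm c" using c by linarith
  have c0: "real (n * n) < norm c" by (rule le_less_trans[OF _ c1]) (simp add: algebra_simps)
  define u where "u = cycop n N delta_id"
  define w where "w = cycop n e u"
  let ?N = "\<lambda>f s. N * f s + 1 * jm (Suc n) f s" and ?e = "\<lambda>f s. e * f s + 1 * jm (Suc n) f s"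
  obtain B1 where B1: "\<And>s. norm (u s) \<le> B1" unfolding u_def using cycop_bound[of delta_id 1 n N, OF delta_id_bound] by blast
  obtain B2 where B2: "\<And>s. norm (w s) \<le> B2" unfolding w_def using cycop_bound[of u B1 n e, OF B1] by blast
  have bJ: "\<And>s. norm (jm (Suc n) w s) \<le> real (Suc n) * B2" by (rule jm_bound[OF B2])
  have bN: "norm (?N w s) \<le> norm N * B2 + real (Suc n) * B2" for s
    by (rule order_trans[OF norm_triangle_ineq]) (use B2 bJ in \<open>simp add: norm_mult add_mono mult_left_mono del: of_nat_Suc\<close>)
  have bJN: "\<And>s. norm (jm (Suc n) (?N w) s) \<le> real (Suc n) * (norm N * B2 + real (Suc n) * B2)" by (rule jm_bound[OF bN])
  have bE: "norm (?e (?N w) s) \<le> norm e * (norm N * B2 + real (Suc n) * B2) + real (Suc n) * (norm N * B2 + real (Suc n) * B2)" for s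
    by (rule order_trans[OF norm_triangle_ineq], rule add_mono)
       (use bN bJN in \<open>simp_all only: norm_mult mult_left_mono norm_ge_zero mult_1\<close>)
  have 1: "cycop (Suc n) N delta_id = ?N u" unfolding u_def by (intro ext) (simp only: cycop_Suc mult_1)
  have 2: "cycop n e (?N u) = ?N w" unfolding w_def cycop_linear[abs_def] by (intro ext) (simp only: cycop_linear cycop_jm)
  have 3: "cycop (Suc n) e (?N u) = ?e (?N w)" by (intro ext, simp only: cycop_Suc 2) (simp only: mult_1)
  have 4: "invop n c (?N w) = ?N (invop n c w)"
    by (intro ext) (simp only: invop_linear[OF c0 B2 bJ] invop_jm[OF c0 B2])
  have 5: "invop n c (?e (?N w)) s = ?e (?N (invop n c w)) s"
    by (simp only: invop_linear[OF c0 bN bJN] invop_jm[OF c0 bN] 4)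
  have "c * loop_series N e c (Suc n) s + jm (Suc n) (loop_series N e c (Suc n)) s = invop n c (?e (?N w)) s"
    unfolding loop_series_def 1 3 by (rule invop_Suc[OF c1 bE])
  also have "\<dots> = loop_rhs n N e (loop_series N e c n) s"
    unfolding 5 loop_rhs_def loop_series_def u_def[symmetric] w_def[symmetric] by (simp only: mult_1)
  finally show "c * loop_series N e c (Suc n) s + jm (Suc n) (loop_series N e c (Suc n)) s = loop_rhs n N e (loop_series N e c n) s" .
qed

section \<open>Monotone Hurwitz numbers\<close>

definition tuples :: "nat \<Rightarrow> nat \<Rightarrow> nat multiset \<Rightarrow> ((nat \<Rightarrow> nat) \<times> (nat \<Rightarrow> nat) \<times> (nat \<times> nat) list) set" where
  "tuples n r lam = {(p1, p2, ts). p1 permutes {1..n} \<and> p2 permutes {1..n} \<and> ts \<in> monseqs n r \<and>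
     p1 \<circ> p2 \<circ> transp_prod ts \<in> cyc n lam}"

definition tuples_of :: "nat \<Rightarrow> nat \<Rightarrow> nat multiset \<Rightarrow> nat multiset \<Rightarrow> nat multiset \<Rightarrow>
    ((nat \<Rightarrow> nat) \<times> (nat \<Rightarrow> nat) \<times> (nat \<times> nat) list) set" where
  "tuples_of n r lam mu nu = {x \<in> tuples n r lam. (cycle_type n (fst x), cycle_type n (fst (snd x))) = (mu, nu)}"

lemma tuples_subset: "tuples n r lam \<subseteq> {p. p permutes {1..n}} \<times> {p. p permutes {1..n}} \<times> monseqs n r"
  by (auto simp: tuples_def)

lemma finite_tuples: "finite (tuples n r lam)"
  by (rule finite_subset[OF tuples_subset]) (intro finite_cartesian_product finite_permutations finite_monseqs; simp)

lemma card_tuples_of: "card (tuples_of n r lam mu nu) \<le> fact n * fact n * (n * n) ^ r"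
proof -
  have "card (tuples_of n r lam mu nu) \<le> card ({p. p permutes {1..n}} \<times> {p. p permutes {1..n}} \<times> monseqs n r)"
    by (rule card_mono) (use tuples_subset in \<open>auto simp: tuples_of_def finite_monseqs finite_permutations\<close>)
  also have "\<dots> = fact n * fact n * card (monseqs n r)"
    using card_permutations[of "{1..n}" n] by (simp add: card_cartesian_product)
  also have "\<dots> \<le> fact n * fact n * (n * n) ^ r" using card_monseqs by (intro mult_left_mono) auto
  finally show ?thesis .
qed

lemma hurwitz_tuples_of:
  assumes "n = sum_mset lam" "int r = 2 * g - 2 - int n + int (size mu) + int (size nu) + int (size lam)"
  shows "hurwitz g lam mu nu = card (tuples_of n r lam mu nu)"
proof -
  have "hurwitz_tuples g lam mu nu = tuples_of n r lam mu nu"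
    unfolding hurwitz_tuples_def tuples_of_def tuples_def monseqs_def cyc_def Let_def assms(1)[symmetric] assms(2)[symmetric]
    by auto
  then show ?thesis by (simp add: hurwitz_def)
qed

lemma hurwitz_negative:
  assumes "2 * g - 2 - int (sum_mset lam) + int (size mu) + int (size nu) + int (size lam) < 0"
  shows "hurwitz g lam mu nu = 0"
proof -
  have "hurwitz_tuples g lam mu nu = {}"
    unfolding hurwitz_tuples_def Let_def using assms by auto
  then show ?thesis by (simp add: hurwitz_def)
qed

lemma ncyc_transp_prod:
  assumes "s permutes {1..n}" "\<forall>(a, b)\<in>set ts. 1 \<le> a \<and> a < b \<and> b \<le> n"
  shows "ncyc {1..n} s \<le> ncyc {1..n} (s \<circ> transp_prod ts) + length ts"
  using assms(2)
proof (induction ts rule: rev_induct)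
  case Nil then show ?case by simp
next
  case (snoc x ts)
  obtain u v where x: "x = (u, v)" by (cases x)
  have ts: "\<forall>(a, b)\<in>set ts. 1 \<le> a \<and> a < b \<and> b \<le> n" using snoc.prems by simp
  have uv: "u \<in> {1..n}" "v \<in> {1..n}" using snoc.prems x by auto
  have "s \<circ> transp_prod ts permutes {1..n}" by (rule permutes_compose[OF transp_prod_permutes[OF ts] assms(1)])
  from ncyc_transpose_ge[OF this finite_atLeastAtMost uv]
  have "ncyc {1..n} (s \<circ> transp_prod ts) \<le> Suc (ncyc {1..n} (s \<circ> transp_prod (ts @ [x])))"
    by (simp only: x transp_prod_snoc comp_assoc)
  moreover note snoc.IH[OF ts]
  moreover have "length (ts @ [x]) = Suc (length ts)" by simp
  ultimately show ?case by linarith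
qed

text \<open>The inequality is the triangle inequality for cycle numbers, the parity comes from the
  sign. In terms of the genus they say that \<open>r\<close> belongs to an integer \<open>g\<close>
  with \<open>g \<ge> 1 - size lam\<close> whenever some tuple exists; this is the lower end of the
  summation.\<close>

lemma tuples_of_ncyc:
  assumes x: "(p1, p2, ts) \<in> tuples_of n r lam mu nu"
  shows "size mu + size nu \<le> size lam + n + r" "even (n + r + size mu + size nu + size lam)"
proof -
  have p: "p1 permutes {1..n}" "p2 permutes {1..n}" and ts: "\<forall>(a, b)\<in>set ts. 1 \<le> a \<and> a < b \<and> b \<le> n" "length ts = r"
    and lam: "p1 \<circ> p2 \<circ> transp_prod ts \<in> cyc n lam"
    and mu: "mu = cycle_type n p1" "nu = cycle_type n p2"
    using x by (auto simp: tuples_of_def tuples_def monseqs_def)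
  have sl: "size lam = ncyc {1..n} (p1 \<circ> p2 \<circ> transp_prod ts)" using lam by (auto simp: cyc_def size_cycle_type)
  have p12: "p1 \<circ> p2 permutes {1..n}" using p permutes_compose by blast
  have "ncyc {1..n} p1 + ncyc {1..n} p2 \<le> ncyc {1..n} (p1 \<circ> p2) + n"
    using ncyc_compose_ge[OF p(1) _ _ _ p(2)] by simp
  moreover have "ncyc {1..n} (p1 \<circ> p2) \<le> ncyc {1..n} (p1 \<circ> p2 \<circ> transp_prod ts) + r"
    using ncyc_transp_prod[OF p12 ts(1)] ts(2) by simp
  ultimately show "size mu + size nu \<le> size lam + n + r"
    unfolding mu size_cycle_type sl by linarith
  have st: "sign (transp_prod ts) = (-1) ^ length ts"
    using ts(1)
  proof (induction ts rule: rev_induct)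
    case Nil then show ?case by (simp only: transp_prod_Nil sign_id list.size power_0)
  next
    case (snoc x ts)
    obtain u v where x: "x = (u, v)" by (cases x)
    have ts: "\<forall>(a, b)\<in>set ts. 1 \<le> a \<and> a < b \<and> b \<le> n" using snoc.prems by simp
    have "permutation (transp_prod ts)" using transp_prod_permutes[OF ts] permutation_permutes by blast
    then have "sign (transp_prod (ts @ [x])) = sign (transp_prod ts) * sign (Transposition.transpose u v)"
      unfolding x transp_prod_snoc using permutation_swap_id by (rule sign_compose)
    then show ?case using snoc x by (simp add: sign_swap_id)
  qed
  have perm: "permutation p1" "permutation p2" "permutation (transp_prod ts)" "permutation (p1 \<circ> p2)"
    using p p12 transp_prod_permutes[OF ts(1)] permutation_permutes by blast+
  have "sign (p1 \<circ> p2 \<circ> transp_prod ts) = sign p1 * sign p2 * sign (transp_prod ts)"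
    using sign_compose[OF perm(4,3)] sign_compose[OF perm(1,2)] by simp
  moreover have "p1 \<circ> p2 \<circ> transp_prod ts permutes {1..n}" using lam by (simp add: cyc_def)
  ultimately have "(-1 :: int) ^ (n + size lam) = (-1) ^ (n + size mu) * (-1) ^ (n + size nu) * (-1) ^ r"
    using sign_ncyc[of "{1..n}"] p st ts(2) unfolding mu size_cycle_type sl by simp
  then have "(-1 :: int) ^ (n + size lam) * (-1) ^ (n + size lam) =
     (-1) ^ (n + size mu) * (-1) ^ (n + size nu) * (-1) ^ r * (-1) ^ (n + size lam)" by simp
  then have "(-1 :: int) ^ (n + size lam + (n + size lam)) =
     (-1) ^ (n + size mu + (n + size nu) + r + (n + size lam))" by (simp only: power_add)
  then have "even (n + size mu + (n + size nu) + r + (n + size lam))"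
    by (metis even_add minus_one_power_iff one_neq_neg_one)
  then show "even (n + r + size mu + size nu + size lam)" by presburger
qed

lemma cycop_delta:
  "cycop n x delta_id s = (if s permutes {1..n} then x ^ ncyc {1..n} s else 0)"
proof -
  have e: "s \<circ> pinv p = id \<longleftrightarrow> s = p" if "p permutes {1..n}" for p
  proof
    assume "s \<circ> pinv p = id"
    then have "s \<circ> pinv p \<circ> p = p" by simp
    then show "s = p" by (simp add: comp_assoc permutes_inv_o[OF that])
  qed (simp add: permutes_inv_o[OF that])
  have "cycop n x delta_id s = (\<Sum>p\<in>{p. p permutes {1..n}}. if p = s then x ^ ncyc {1..n} p else 0)"
    unfolding cycop_def delta_id_def by (intro sum.cong refl) (use e in auto)
  then show ?thesis by (simp add: finite_permutations)
qed

lemma sum_permutes_right: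
  fixes f :: "('a \<Rightarrow> 'a) \<Rightarrow> 'b::comm_monoid_add"
  assumes q: "q permutes S"
  shows "(\<Sum>p\<in>{p. p permutes S}. f p) = (\<Sum>p\<in>{p. p permutes S}. f (p \<circ> q))"
  using sum_permutations_compose_right[OF q, of f] .

text \<open>For fixed \<open>p2\<close> and \<open>ts\<close> the substitution
  \<open>s = p1 \<circ> p2 \<circ> transp_prod ts\<close> turns the sum over the class into a sum
  over \<open>p1\<close>, and the innermost operator, applied to the unit, weighs \<open>p1\<close>
  by its number of cycles.\<close>

lemma sum_cyc_monop:
  "(\<Sum>s\<in>cyc n lam. monop n r (cycop n e (cycop n N delta_id)) s) =
   (\<Sum>x\<in>tuples n r lam. N ^ ncyc {1..n} (fst x) * e ^ ncyc {1..n} (fst (snd x)))"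
proof -
  let ?P = "{p. p permutes {1..n}}"
  let ?u = "cycop n N delta_id"
  have fP: "finite ?P" by (rule finite_permutations) simp
  have A: "(\<Sum>s\<in>cyc n lam. ?u (s \<circ> pinv (transp_prod ts) \<circ> pinv p2)) =
      (\<Sum>p1\<in>?P. if p1 \<circ> p2 \<circ> transp_prod ts \<in> cyc n lam then N ^ ncyc {1..n} p1 else 0)"
    if ts: "ts \<in> monseqs n r" and p2: "p2 permutes {1..n}" for ts p2
  proof -
    have q: "p2 \<circ> transp_prod ts permutes {1..n}" by (rule permutes_compose[OF monseqs_permutes[OF ts] p2])
    have i1: "transp_prod ts \<circ> pinv (transp_prod ts) = id" "p2 \<circ> pinv p2 = id"
      using permutes_inv_o monseqs_permutes[OF ts] p2 by blast+
    have "(\<Sum>s\<in>cyc n lam. ?u (s \<circ> pinv (transp_prod ts) \<circ> pinv p2)) =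
      (\<Sum>s\<in>?P. if s \<in> cyc n lam then ?u (s \<circ> pinv (transp_prod ts) \<circ> pinv p2) else 0)"
      by (rule sum.mono_neutral_cong_left[OF fP]) (auto simp: cyc_def)
    also have "\<dots> = (\<Sum>p1\<in>?P. if p1 \<circ> (p2 \<circ> transp_prod ts) \<in> cyc n lam then
         ?u (p1 \<circ> (p2 \<circ> transp_prod ts) \<circ> pinv (transp_prod ts) \<circ> pinv p2) else 0)"
      by (rule sum_permutes_right[OF q])
    also have "\<dots> = (\<Sum>p1\<in>?P. if p1 \<circ> p2 \<circ> transp_prod ts \<in> cyc n lam then N ^ ncyc {1..n} p1 else 0)"
    proof (intro sum.cong refl)
      fix p1 assume p1: "p1 \<in> ?P"
      have "p1 \<circ> (p2 \<circ> transp_prod ts) \<circ> pinv (transp_prod ts) \<circ> pinv p2 =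
        p1 \<circ> (p2 \<circ> (transp_prod ts \<circ> pinv (transp_prod ts)) \<circ> pinv p2)" by (simp only: comp_assoc)
      also have "\<dots> = p1" unfolding i1 comp_id by (simp only: i1 comp_id)
      finally have e: "p1 \<circ> (p2 \<circ> transp_prod ts) \<circ> pinv (transp_prod ts) \<circ> pinv p2 = p1" .
      show "(if p1 \<circ> (p2 \<circ> transp_prod ts) \<in> cyc n lam then
         ?u (p1 \<circ> (p2 \<circ> transp_prod ts) \<circ> pinv (transp_prod ts) \<circ> pinv p2) else 0) =
        (if p1 \<circ> p2 \<circ> transp_prod ts \<in> cyc n lam then N ^ ncyc {1..n} p1 else 0)"
        unfolding e cycop_delta using p1 by (simp only: comp_assoc mem_Collect_eq if_True)
    qed
    finally show ?thesis .
  qed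
  have "(\<Sum>s\<in>cyc n lam. monop n r (cycop n e ?u) s) =
     (\<Sum>ts\<in>monseqs n r. \<Sum>s\<in>cyc n lam. \<Sum>p2\<in>?P. e ^ ncyc {1..n} p2 * ?u (s \<circ> pinv (transp_prod ts) \<circ> pinv p2))"
    unfolding monop_def cycop_def[of n e] by (rule sum.swap)
  also have "\<dots> = (\<Sum>ts\<in>monseqs n r. \<Sum>p2\<in>?P. e ^ ncyc {1..n} p2 * (\<Sum>s\<in>cyc n lam. ?u (s \<circ> pinv (transp_prod ts) \<circ> pinv p2)))"
    unfolding sum_distrib_left by (intro sum.cong refl sum.swap)
  also have "\<dots> = (\<Sum>ts\<in>monseqs n r. \<Sum>p2\<in>?P. \<Sum>p1\<in>?P.
      if p1 \<circ> p2 \<circ> transp_prod ts \<in> cyc n lam then N ^ ncyc {1..n} p1 * e ^ ncyc {1..n} p2 else 0)"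
  proof (intro sum.cong refl)
    fix ts p2 assume a: "ts \<in> monseqs n r" "p2 \<in> ?P"
    show "e ^ ncyc {1..n} p2 * (\<Sum>s\<in>cyc n lam. ?u (s \<circ> pinv (transp_prod ts) \<circ> pinv p2)) = (\<Sum>p1\<in>?P.
      if p1 \<circ> p2 \<circ> transp_prod ts \<in> cyc n lam then N ^ ncyc {1..n} p1 * e ^ ncyc {1..n} p2 else 0)"
      unfolding A[OF a(1) CollectD[OF a(2)]] sum_distrib_left by (intro sum.cong refl) auto
  qed
  also have "\<dots> = (\<Sum>p2\<in>?P. \<Sum>ts\<in>monseqs n r. \<Sum>p1\<in>?P.
      if p1 \<circ> p2 \<circ> transp_prod ts \<in> cyc n lam then N ^ ncyc {1..n} p1 * e ^ ncyc {1..n} p2 else 0)"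
    by (rule sum.swap)
  also have "\<dots> = (\<Sum>p2\<in>?P. \<Sum>p1\<in>?P. \<Sum>ts\<in>monseqs n r.
      if p1 \<circ> p2 \<circ> transp_prod ts \<in> cyc n lam then N ^ ncyc {1..n} p1 * e ^ ncyc {1..n} p2 else 0)"
    by (intro sum.cong refl sum.swap)
  also have "\<dots> = (\<Sum>p1\<in>?P. \<Sum>p2\<in>?P. \<Sum>ts\<in>monseqs n r.
      if p1 \<circ> p2 \<circ> transp_prod ts \<in> cyc n lam then N ^ ncyc {1..n} p1 * e ^ ncyc {1..n} p2 else 0)"
    by (rule sum.swap)
  also have "\<dots> = (\<Sum>x\<in>?P \<times> ?P \<times> monseqs n r.
      if fst x \<circ> fst (snd x) \<circ> transp_prod (snd (snd x)) \<in> cyc n lam then N ^ ncyc {1..n} (fst x) * e ^ ncyc {1..n} (fst (snd x)) else 0)"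
    by (simp only: sum.cartesian_product split_def fst_conv snd_conv)
  also have "\<dots> = (\<Sum>x\<in>tuples n r lam. N ^ ncyc {1..n} (fst x) * e ^ ncyc {1..n} (fst (snd x)))"
    by (rule sum.mono_neutral_cong_right[OF finite_cartesian_product[OF fP finite_cartesian_product[OF fP finite_monseqs]]])
      (auto simp: tuples_def)
  finally show ?thesis .
qed

lemma sum_tuples_group:
  "(\<Sum>x\<in>tuples n r lam. N ^ ncyc {1..n} (fst x) * e ^ ncyc {1..n} (fst (snd x))) =
   (\<Sum>mu\<in>partitions_of n. \<Sum>nu\<in>partitions_of n. N ^ size mu * e ^ size nu * of_nat (card (tuples_of n r lam mu nu)))"
  for N e :: complex
proof -
  let ?g = "\<lambda>x. (cycle_type n (fst x), cycle_type n (fst (snd x)))"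
  let ?F = "\<lambda>x. N ^ ncyc {1..n} (fst x) * e ^ ncyc {1..n} (fst (snd x))"
  have "sum ?F (tuples n r lam) = (\<Sum>y\<in>partitions_of n \<times> partitions_of n. sum ?F {x \<in> tuples n r lam. ?g x = y})"
    by (rule sum.group[symmetric, OF finite_tuples]) (auto simp: finite_partitions_of tuples_def intro: cycle_type_partition)
  also have "\<dots> = (\<Sum>y\<in>partitions_of n \<times> partitions_of n. N ^ size (fst y) * e ^ size (snd y) * of_nat (card (tuples_of n r lam (fst y) (snd y))))"
  proof (intro sum.cong refl)
    fix y :: "nat multiset \<times> nat multiset"
    have t: "{x \<in> tuples n r lam. ?g x = y} = tuples_of n r lam (fst y) (snd y)" by (simp add: tuples_of_def)
    have "sum ?F {x \<in> tuples n r lam. ?g x = y} = (\<Sum>x\<in>{x \<in> tuples n r lam. ?g x = y}. N ^ size (fst y) * e ^ size (snd y))"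
      by (intro sum.cong refl) (auto simp: size_cycle_type)
    then show "sum ?F {x \<in> tuples n r lam. ?g x = y} = N ^ size (fst y) * e ^ size (snd y) * of_nat (card (tuples_of n r lam (fst y) (snd y)))"
      unfolding t by simp
  qed
  also have "\<dots> = (\<Sum>mu\<in>partitions_of n. \<Sum>nu\<in>partitions_of n. N ^ size mu * e ^ size nu * of_nat (card (tuples_of n r lam mu nu)))"
    by (simp add: sum.cartesian_product split_def)
  finally show ?thesis .
qed

lemma sum_has_sum:
  fixes f :: "'i \<Rightarrow> 'a \<Rightarrow> complex"
  assumes "\<And>i. i \<in> I \<Longrightarrow> (f i has_sum s i) A"
  shows "((\<lambda>x. \<Sum>i\<in>I. f i x) has_sum (\<Sum>i\<in>I. s i)) A"
  using assms by (induction I rule: infinite_finite_induct) (auto intro: has_sum_add)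

text \<open>At \<open>c = - (kap * N)\<close> the sign \<open>(-1) ^ n\<close> and the alternating
  signs of the geometric expansions cancel. The exponent \<open>n + r\<close> equals
  \<open>size mu + size nu + size lam + 2 * g - 2\<close>, so the powers of \<open>N\<close> combine
  to the exponent \<open>2 - 2 * g\<close> and those of \<open>kap\<close> to the stated
  denominator.\<close>

lemma loop_series_has_sum:
  fixes N e kap :: complex
  assumes n: "n = sum_mset lam" and N0: "N \<noteq> 0" and c: "real (n * n) < norm (kap * N)"
  shows "((\<lambda>g. (1 / N powi (2 * g - 2)) *
            (\<Sum>\<mu>\<in>partitions_of n. \<Sum>\<nu>\<in>partitions_of n.
              e ^ size \<nu> / kap powi (int (size \<mu>) + int (size \<nu>) + int (size lam) + 2 * g - 2) *
              of_nat (hurwitz g lam \<mu> \<nu>)))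
         has_sum ((-1) ^ n * N ^ size lam * (\<Sum>s\<in>cyc n lam. loop_series N (e * N) (- (kap * N)) n s)))
        {1 - int (size lam)..}"
proof -
  let ?c = "- (kap * N)"
  have c': "real (n * n) < norm ?c" using c by simp
  have kN: "kap \<noteq> 0" using c by auto
  define a where "a mu nu r = (-1) ^ n * N ^ size lam * ((-1) ^ r / ?c ^ (n + r) *
     (N ^ size mu * (e * N) ^ size nu * of_nat (card (tuples_of n r lam mu nu))))" for mu nu :: "nat multiset" and r
  define b where "b mu nu g = (1 / N powi (2 * g - 2)) * (e ^ size nu / kap powi (int (size mu) + int (size nu) + int (size lam) + 2 * g - 2) *
              of_nat (hurwitz g lam mu nu))" for mu nu :: "nat multiset" and g
  have abs: "summable (\<lambda>r. norm (a mu nu r))" for mu nu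
  proof (rule summable_comparison_test')
    let ?K = "norm N ^ size lam * (norm N ^ size mu * norm (e * N) ^ size nu) * (fact n * fact n) / norm ?c ^ n"
    show "summable (\<lambda>r. ?K * (real (n * n) / norm ?c) ^ r)"
      using c' by (intro summable_mult summable_geometric) (auto simp: divide_simps)
    fix r :: nat
    have "norm (norm (a mu nu r)) = norm N ^ size lam * (norm N ^ size mu * norm (e * N) ^ size nu) *
      real (card (tuples_of n r lam mu nu)) / norm ?c ^ (n + r)"
      by (simp add: a_def norm_mult norm_divide norm_power)
    also have "\<dots> \<le> norm N ^ size lam * (norm N ^ size mu * norm (e * N) ^ size nu) *
      real (fact n * fact n * (n * n) ^ r) / norm ?c ^ (n + r)"
      using card_tuples_of[of n r lam mu nu] by (intro divide_right_mono mult_left_mono) (simp_all only: of_nat_le_iff, simp_all)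
    also have "\<dots> = ?K * (real (n * n) / norm ?c) ^ r"
      by (simp add: power_add power_divide)
    finally show "norm (norm (a mu nu r)) \<le> ?K * (real (n * n) / norm ?c) ^ r" .
  qed
  have hs: "(a mu nu has_sum (\<Sum>r. a mu nu r)) UNIV" for mu nu
    using norm_summable_imp_has_sum[OF abs summable_sums[OF summable_norm_cancel[OF abs]]] .
  have hb: "(b mu nu has_sum (\<Sum>r. a mu nu r)) {1 - int (size lam)..}" for mu nu
  proof -
    define t where "t = int (size mu) + int (size nu) + int (size lam)"
    define R where "R = {g \<in> {1 - int (size lam)..}. 0 \<le> 2 * g - 2 - int n + t}"
    define h where "h g = nat (2 * g - 2 - int n + t)" for g
    have inj: "inj_on h R" by (auto simp: inj_on_def h_def R_def)
    have ab: "a mu nu (h g) = b mu nu g" if "g \<in> R" for g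
    proof -
      have hg: "int (h g) = 2 * g - 2 - int n + t" using that by (simp add: h_def R_def)
      have hz: "hurwitz g lam mu nu = card (tuples_of n (h g) lam mu nu)"
        by (rule hurwitz_tuples_of[OF n]) (simp add: hg t_def)
      have "(-1) ^ n * ((-1) ^ h g / ?c ^ (n + h g)) = (-1) ^ (n + h g) / ((-1) ^ (n + h g) * (kap * N) ^ (n + h g))"
        unfolding power_minus[of "kap * N"] power_add by simp
      also have "\<dots> = 1 / (kap * N) ^ (n + h g)" by simp
      also have "(kap * N) ^ (n + h g) = (kap * N) powi (t + 2 * g - 2)"
      proof -
        have "int (n + h g) = t + 2 * g - 2" using hg by simp
        then show ?thesis by (metis power_int_of_nat)
      qed
      also have "\<dots> = kap powi (t + 2 * g - 2) * (N powi t * N powi (2 * g - 2))"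
      proof -
        have "N powi (t + (2 * g - 2)) = N powi t * N powi (2 * g - 2)" using N0 by (intro power_int_add) simp
        moreover have "t + (2 * g - 2) = t + 2 * g - 2" by simp
        ultimately show ?thesis by (simp only: power_int_mult_distrib)
      qed
      also have "N powi t = N ^ size mu * N ^ size nu * N ^ size lam"
        using N0 unfolding t_def by (simp add: power_int_add)
      finally have e1: "(-1) ^ n * ((-1) ^ h g / ?c ^ (n + h g)) =
        1 / (kap powi (t + 2 * g - 2) * (N ^ size mu * N ^ size nu * N ^ size lam * N powi (2 * g - 2)))" .
      have "a mu nu (h g) = ((-1) ^ n * ((-1) ^ h g / ?c ^ (n + h g))) * (N ^ size mu * N ^ size nu * N ^ size lam) *
          (e ^ size nu * of_nat (hurwitz g lam mu nu))"
        unfolding a_def hz by (simp add: power_mult_distrib)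
      also have "\<dots> = b mu nu g" unfolding e1 b_def t_def[symmetric]
        using N0 kN by (simp add: divide_simps)
      finally show ?thesis .
    qed
    \<comment> \<open>Values of \<open>r\<close> outside the image of \<open>h\<close> have the
      wrong parity or a genus below the range, and no tuples belong to them. This passes from the
      sum over \<open>r\<close> to the sum over genera.\<close>
    have "(a mu nu has_sum (\<Sum>r. a mu nu r)) (h ` R)"
    proof (rule has_sum_cong_neutral[THEN iffD1, OF _ _ _ hs])
      fix r assume r: "r \<in> UNIV - h ` R"
      show "a mu nu r = 0"
      proof (rule ccontr)
        assume "a mu nu r \<noteq> 0"
        then have "tuples_of n r lam mu nu \<noteq> {}" by (auto simp: a_def)
        then obtain p1 p2 ts where x: "(p1, p2, ts) \<in> tuples_of n r lam mu nu" by (metis ex_in_conv prod_cases3)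
        note tn = tuples_of_ncyc[OF x]
        have "even (int (n + r + size mu + size nu + size lam))" using tn(2) by (simp only: even_of_nat)
        then have "even (int r + int n + 2 - t)" unfolding t_def of_nat_add by presburger
        then obtain g where g: "int r + int n + 2 - t = 2 * g" unfolding dvd_def by blast
        have "1 - int (size lam) \<le> g" using tn(1) g unfolding t_def by linarith
        then have "g \<in> R" "h g = r" using g by (auto simp: R_def h_def)
        then show False using r by blast
      qed
    qed auto
    then have "((a mu nu \<circ> h) has_sum (\<Sum>r. a mu nu r)) R" using has_sum_reindex[OF inj] by blast
    then show ?thesis
    proof (rule has_sum_cong_neutral[THEN iffD1, rotated -1])
      fix g assume "g \<in> {1 - int (size lam)..} - R"
      then have "2 * g - 2 - int (sum_mset lam) + int (size mu) + int (size nu) + int (size lam) < 0"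
        using n by (auto simp: R_def t_def)
      then show "b mu nu g = 0" unfolding b_def by (simp add: hurwitz_negative)
    next
      fix g assume "g \<in> R - {1 - int (size lam)..}" then show "(a mu nu \<circ> h) g = 0" unfolding R_def by blast
    next
      fix g assume "g \<in> R \<inter> {1 - int (size lam)..}" then show "(a mu nu \<circ> h) g = b mu nu g" using ab by simp
    qed
  qed
  have "((\<lambda>g. \<Sum>mu\<in>partitions_of n. \<Sum>nu\<in>partitions_of n. b mu nu g) has_sum
      (\<Sum>mu\<in>partitions_of n. \<Sum>nu\<in>partitions_of n. \<Sum>r. a mu nu r)) {1 - int (size lam)..}"
    by (intro sum_has_sum hb)
  moreover have "(\<lambda>g. \<Sum>mu\<in>partitions_of n. \<Sum>nu\<in>partitions_of n. b mu nu g) = (\<lambda>g. (1 / N powi (2 * g - 2)) *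
            (\<Sum>\<mu>\<in>partitions_of n. \<Sum>\<nu>\<in>partitions_of n.
              e ^ size \<nu> / kap powi (int (size \<mu>) + int (size \<nu>) + int (size lam) + 2 * g - 2) *
              of_nat (hurwitz g lam \<mu> \<nu>)))"
    by (simp only: b_def sum_distrib_left)
  moreover have "(\<Sum>mu\<in>partitions_of n. \<Sum>nu\<in>partitions_of n. \<Sum>r. a mu nu r) =
     (-1) ^ n * N ^ size lam * (\<Sum>s\<in>cyc n lam. loop_series N (e * N) ?c n s)"
  proof -
    have sa: "summable (a mu nu)" for mu nu by (rule summable_norm_cancel[OF abs])
    obtain B1 where B1: "\<And>s. norm (cycop n N delta_id s) \<le> B1" using cycop_bound[of delta_id 1 n N, OF delta_id_bound] by blast
    obtain B2 where B2: "\<And>s. norm (cycop n (e * N) (cycop n N delta_id) s) \<le> B2" using cycop_bound[of "cycop n N delta_id" B1 n "e * N", OF B1] by blast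
    let ?m = "\<lambda>r s. (-1) ^ r / ?c ^ (n + r) * monop n r (cycop n (e * N) (cycop n N delta_id)) s"
    have sm: "summable (\<lambda>r. ?m r s)" for s
      by (rule summable_norm_cancel[OF invop_summable[OF c' B2]])
    have "(\<Sum>s\<in>cyc n lam. loop_series N (e * N) ?c n s) = (\<Sum>r. \<Sum>s\<in>cyc n lam. ?m r s)"
      unfolding loop_series_def invop_def by (rule suminf_sum[symmetric, OF sm])
    then have "(-1) ^ n * N ^ size lam * (\<Sum>s\<in>cyc n lam. loop_series N (e * N) ?c n s) =
      (\<Sum>r. (-1) ^ n * N ^ size lam * (\<Sum>s\<in>cyc n lam. ?m r s))"
      using suminf_mult[OF summable_sum[of "cyc n lam" "\<lambda>s r. ?m r s", OF sm], of "(-1) ^ n * N ^ size lam"] by (simp only:)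
    also have "\<dots> = (\<Sum>r. \<Sum>mu\<in>partitions_of n. \<Sum>nu\<in>partitions_of n. a mu nu r)"
    proof (rule suminf_cong)
      fix r
      have "(\<Sum>s\<in>cyc n lam. ?m r s) = (-1) ^ r / ?c ^ (n + r) *
        (\<Sum>mu\<in>partitions_of n. \<Sum>nu\<in>partitions_of n. N ^ size mu * (e * N) ^ size nu * of_nat (card (tuples_of n r lam mu nu)))"
        unfolding sum_distrib_left[symmetric] sum_cyc_monop sum_tuples_group ..
      then show "(-1) ^ n * N ^ size lam * (\<Sum>s\<in>cyc n lam. ?m r s) = (\<Sum>mu\<in>partitions_of n. \<Sum>nu\<in>partitions_of n. a mu nu r)"
        by (simp only: a_def sum_distrib_left)
    qed
    also have "\<dots> = (\<Sum>mu\<in>partitions_of n. \<Sum>r. \<Sum>nu\<in>partitions_of n. a mu nu r)"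
      by (rule suminf_sum) (intro summable_sum sa)
    also have "\<dots> = (\<Sum>mu\<in>partitions_of n. \<Sum>nu\<in>partitions_of n. \<Sum>r. a mu nu r)"
      by (intro sum.cong refl suminf_sum sa)
    finally show ?thesis ..
  qed
  ultimately show ?thesis by simp
qed

section \<open>Rational dependence on the parameters\<close>

text \<open>Polynomials are handled through their values, so that sums, products and determinants
  with polynomial entries can be treated pointwise.\<close>

definition polyf3 :: "(complex \<Rightarrow> complex \<Rightarrow> complex \<Rightarrow> complex) \<Rightarrow> bool" where
  "polyf3 F \<longleftrightarrow> (\<exists>p. \<forall>N a b. F N a b = poly3 p N a b)"

lemma polyf3_const: "polyf3 (\<lambda>N a b. c)"
  unfolding polyf3_def by (rule exI[of _ "[:[:[:c:]:]:]"]) (simp add: poly3_def)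

lemma polyf3_fst: "polyf3 (\<lambda>N a b. N)"
  unfolding polyf3_def by (rule exI[of _ "[:0, 1:]"]) (simp add: poly3_def)

lemma polyf3_snd: "polyf3 (\<lambda>N a b. a)"
  unfolding polyf3_def by (rule exI[of _ "[:[:0, 1:]:]"]) (simp add: poly3_def)

lemma polyf3_thd: "polyf3 (\<lambda>N a b. b)"
  unfolding polyf3_def by (rule exI[of _ "[:[:[:0, 1:]:]:]"]) (simp add: poly3_def)

lemma polyf3_add: "polyf3 F \<Longrightarrow> polyf3 G \<Longrightarrow> polyf3 (\<lambda>N a b. F N a b + G N a b)"
  unfolding polyf3_def by (elim exE, rule_tac x="p + pa" in exI) (simp add: poly3_def)

lemma polyf3_mult: "polyf3 F \<Longrightarrow> polyf3 G \<Longrightarrow> polyf3 (\<lambda>N a b. F N a b * G N a b)"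
  unfolding polyf3_def by (elim exE, rule_tac x="p * pa" in exI) (simp add: poly3_def)

lemma polyf3_sum: "(\<And>i. i \<in> I \<Longrightarrow> polyf3 (F i)) \<Longrightarrow> polyf3 (\<lambda>N a b. \<Sum>i\<in>I. F i N a b)"
  by (induction I rule: infinite_finite_induct) (auto intro: polyf3_add polyf3_const)

lemma polyf3_prod: "(\<And>i. i \<in> I \<Longrightarrow> polyf3 (F i)) \<Longrightarrow> polyf3 (\<lambda>N a b. \<Prod>i\<in>I. F i N a b)"
  by (induction I rule: infinite_finite_induct) (auto intro: polyf3_mult polyf3_const)

lemma polyf3_uminus: "polyf3 F \<Longrightarrow> polyf3 (\<lambda>N a b. - F N a b)"
  using polyf3_mult[OF polyf3_const[of "-1"]] by simp

lemmas polyf3_intros = polyf3_const polyf3_fst polyf3_snd polyf3_thd polyf3_add polyf3_mult polyf3_sum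
  polyf3_prod polyf3_uminus

lemma polyf3_det:
  assumes A: "\<And>N a b. A N a b \<in> carrier_mat m m"
    and e: "\<And>i j. i < m \<Longrightarrow> j < m \<Longrightarrow> polyf3 (\<lambda>N a b. A N a b $$ (i, j))"
  shows "polyf3 (\<lambda>N a b. Determinant.det (A N a b))"
proof -
  have "polyf3 (\<lambda>N a b. \<Sum>p\<in>{p. p permutes {0..<m}}. of_int (sign p) * (\<Prod>i=0..<m. A N a b $$ (i, p i)))"
    by (intro polyf3_intros e) (auto dest: permutes_in_image)
  then show ?thesis by (simp only: det_def'[OF A])
qed

section \<open>Uniqueness of the rational extension\<close>

lemma poly2_univariate: "\<exists>s. \<forall>a. poly (poly q [:a:]) b = poly s (a :: complex)"
proof (induction q)
  case 0
  then show ?case by (intro exI[of _ 0]) simp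
next
  case (pCons c q)
  then obtain s where "\<forall>a. poly (poly q [:a:]) b = poly s a" by blast
  then show ?case by (intro exI[of _ "pCons (poly c b) s"]) simp
qed

lemma poly3_univariate: "\<exists>s. \<forall>N. poly3 q N a b = poly s N"
proof (induction q)
  case 0
  then show ?case by (intro exI[of _ 0]) (simp add: poly3_def)
next
  case (pCons c q)
  then obtain s where "\<forall>N. poly3 q N a b = poly s N" by blast
  then show ?case by (intro exI[of _ "pCons (poly (poly c [:a:]) b) s"]) (simp add: poly3_def)
qed

lemma poly_zero_on_infinite:
  fixes s :: "complex poly"
  assumes "infinite X" "\<And>x. x \<in> X \<Longrightarrow> poly s x = 0" shows "poly s y = 0"
proof -
  have "s = 0"
  proof (rule ccontr)
    assume "s \<noteq> 0"
    then have "finite {x. poly s x = 0}" by (rule poly_roots_finite)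
    moreover have "X \<subseteq> {x. poly s x = 0}" using assms(2) by blast
    ultimately show False using assms(1) finite_subset by metis
  qed
  then show ?thesis by simp
qed

lemma infinite_halfplane: "infinite {z :: complex. Re z > A}"
proof
  assume f: "finite {z :: complex. Re z > A}"
  have "(of_real ` {A<..<A+1}) \<subseteq> {z :: complex. Re z > A}" by auto
  then have "finite (complex_of_real ` {A<..<A+1})" by (rule finite_subset[OF _ f])
  then have "finite {A<..<A+1}" by (rule finite_imageD) (rule inj_onI, rule of_real_eq_iff[THEN iffD1])
  then show False using infinite_Ioo[of A "A+1"] by simp
qed

text \<open>The variables are freed one at a time, first \<open>b\<close>, then \<open>a\<close>,
  then \<open>N\<close>: a nonzero univariate polynomial has finitely many roots, while half-planes
  and the positive integers are infinite.\<close>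

lemma poly3_zero_dense:
  assumes "\<And>n a b. n \<ge> 1 \<Longrightarrow> Re a > A \<Longrightarrow> Re b > B \<Longrightarrow> poly3 r (of_nat n) a b = 0"
  shows "poly3 r N a b = 0"
proof -
  have 1: "poly3 r (of_nat n) a b = 0" if "n \<ge> 1" "Re a > A" for n a b
    unfolding poly3_def
    by (rule poly_zero_on_infinite[OF infinite_halfplane[of B]]) (use assms that in \<open>simp add: poly3_def\<close>)
  have 2: "poly3 r (of_nat n) a b = 0" if "n \<ge> 1" for n a b
  proof -
    obtain s where s: "\<forall>a. poly (poly (poly r [:[:of_nat n:]:]) [:a:]) b = poly s a" using poly2_univariate by blast
    have "poly s a = 0"
      by (rule poly_zero_on_infinite[OF infinite_halfplane[of A]]) (use 1[OF that] in \<open>simp add: s[rule_format, symmetric] poly3_def[symmetric]\<close>)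
    then show ?thesis using s by (simp add: poly3_def)
  qed
  obtain s where s: "\<forall>N. poly3 r N a b = poly s N" using poly3_univariate by blast
  have "infinite (of_nat ` {1::nat..} :: complex set)"
    by (subst finite_image_iff) (auto simp: inj_on_def infinite_Ici)
  then have "poly s N = 0"
    by (rule poly_zero_on_infinite) (use 2 in \<open>auto simp: s[rule_format, symmetric]\<close>)
  then show ?thesis using s by simp
qed

lemma rational_ext_eq:
  assumes q: "poly3 q N a b \<noteq> 0"
    and F: "\<And>n x y. D n x y \<Longrightarrow> poly3 q (of_nat n) x y \<noteq> 0 \<Longrightarrow> F n x y = poly3 p (of_nat n) x y / poly3 q (of_nat n) x y"
    and D: "\<And>n x y. n \<ge> 1 \<Longrightarrow> Re x > A \<Longrightarrow> Re y > B \<Longrightarrow> D n x y"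
  shows "rational_ext D F N a b = poly3 p N a b / poly3 q N a b"
  unfolding rational_ext_def
proof (rule the_equality)
  show "\<exists>p' q'. poly3 q' N a b \<noteq> 0 \<and> poly3 p N a b / poly3 q N a b = poly3 p' N a b / poly3 q' N a b \<and>
        (\<forall>n a b. D n a b \<longrightarrow> poly3 q' (of_nat n) a b \<noteq> 0 \<longrightarrow> F n a b = poly3 p' (of_nat n) a b / poly3 q' (of_nat n) a b)"
    using q F by blast
next
  fix v assume "\<exists>p' q'. poly3 q' N a b \<noteq> 0 \<and> v = poly3 p' N a b / poly3 q' N a b \<and>
        (\<forall>n a b. D n a b \<longrightarrow> poly3 q' (of_nat n) a b \<noteq> 0 \<longrightarrow> F n a b = poly3 p' (of_nat n) a b / poly3 q' (of_nat n) a b)"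
  then obtain p' q' where q': "poly3 q' N a b \<noteq> 0" and v: "v = poly3 p' N a b / poly3 q' N a b"
    and F': "\<And>n x y. D n x y \<Longrightarrow> poly3 q' (of_nat n) x y \<noteq> 0 \<Longrightarrow> F n x y = poly3 p' (of_nat n) x y / poly3 q' (of_nat n) x y"
    by blast
  \<comment> \<open>The extra factor \<open>q * q'\<close> makes \<open>?r\<close> vanish also where
    a denominator does and nothing is known about the fractions. At the given point it is nonzero
    and can be cancelled.\<close>
  let ?r = "(p * q' - p' * q) * (q * q')"
  have h: "poly3 (s * t) N a b = poly3 s N a b * poly3 t N a b" "poly3 (s - t) N a b = poly3 s N a b - poly3 t N a b" for s t N a b
    by (simp_all add: poly3_def)
  have "poly3 ?r N a b = 0"
  proof (rule poly3_zero_dense)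
    fix n :: nat and x y assume "n \<ge> 1" "Re x > A" "Re y > B"
    then have d: "D n x y" by (rule D)
    show "poly3 ?r (of_nat n) x y = 0"
    proof (cases "poly3 q (of_nat n) x y = 0 \<or> poly3 q' (of_nat n) x y = 0")
      case True then show ?thesis by (auto simp: h)
    next
      case False
      then have "poly3 p (of_nat n) x y / poly3 q (of_nat n) x y = poly3 p' (of_nat n) x y / poly3 q' (of_nat n) x y"
        using F[OF d] F'[OF d] by simp
      then show ?thesis using False by (simp add: h frac_eq_eq)
    qed
  qed
  then have "poly3 p N a b * poly3 q' N a b = poly3 p' N a b * poly3 q N a b" using q q' by (simp add: h)
  then show "v = poly3 p N a b / poly3 q N a b" unfolding v using q q' by (simp add: frac_eq_eq mult.commute)
qed

section \<open>Rationality of the solutions of the recursion\<close>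

text \<open>\<open>Q\<close> is the determinant and \<open>R\<close> the adjugate of the system, so
  both are polynomial. The adjugate identity holds for every \<open>x\<close>, also where the
  determinant vanishes; a trivial kernel enters only in the last conclusion.\<close>

lemma cramer_polyf3:
  fixes M :: "'i \<Rightarrow> 'i \<Rightarrow> complex \<Rightarrow> complex \<Rightarrow> complex \<Rightarrow> complex"
  assumes fin: "finite I" and M: "\<And>i j. polyf3 (M i j)"
  obtains Q R where "polyf3 Q" "\<And>i j. polyf3 (R i j)"
    "\<And>N a b x i. i \<in> I \<Longrightarrow> Q N a b * x i = (\<Sum>j\<in>I. R i j N a b * (\<Sum>k\<in>I. M j k N a b * x k))"
    "\<And>N a b. (\<forall>x. (\<forall>j\<in>I. (\<Sum>k\<in>I. M j k N a b * x k) = 0) \<longrightarrow> (\<forall>k\<in>I. x k = 0)) \<Longrightarrow> Q N a b \<noteq> 0"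
proof -
  define m where "m = card I"
  obtain h where h: "bij_betw h {0..<m} I" using ex_bij_betw_nat_finite[OF fin] m_def by blast
  define h' where "h' = the_inv_into {0..<m} h"
  have h'h: "h' (h i) = i" if "i < m" for i using h that by (simp add: h'_def bij_betw_def the_inv_into_f_f)
  have hh': "h (h' i) = i" "h' i < m" if "i \<in> I" for i
    using h that f_the_inv_into_f[of h "{0..<m}" i] the_inv_into_into[of h "{0..<m}" i "{0..<m}"]
    by (auto simp: h'_def bij_betw_def)
  define A where "A N a b = mat m m (\<lambda>(i, j). M (h i) (h j) N a b)" for N a b
  have A: "A N a b \<in> carrier_mat m m" for N a b by (simp add: A_def)
  have Aij: "A N a b $$ (i, j) = M (h i) (h j) N a b" if "i < m" "j < m" for i j N a b
    using that by (simp add: A_def)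
  have pA: "polyf3 (\<lambda>N a b. A N a b $$ (i, j))" if "i < m" "j < m" for i j
    using M by (simp add: Aij[OF that])
  define Q where "Q N a b = Determinant.det (A N a b)" for N a b
  define R where "R i j N a b = (if i \<in> I \<and> j \<in> I then adj_mat (A N a b) $$ (h' i, h' j) else 0)" for i j N a b
  have reidx: "(\<Sum>j\<in>I. f j) = (\<Sum>j=0..<m. f (h j))" for f :: "'i \<Rightarrow> complex"
    using sum.reindex_bij_betw[OF h, of f] by simp
  have 1: "polyf3 Q" unfolding Q_def[abs_def] by (rule polyf3_det[OF A pA])
  have 2: "polyf3 (R i j)" for i j
  proof (cases "i \<in> I \<and> j \<in> I")
    case True
    then have ij: "h' i < m" "h' j < m" using hh' by auto
    have "R i j = (\<lambda>N a b. (-1) ^ (h' j + h' i) * Determinant.det (mat_delete (A N a b) (h' j) (h' i)))"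
      using True ij carrier_matD[OF A] by (auto simp: R_def[abs_def] adj_mat_def cofactor_def fun_eq_iff)
    moreover have "polyf3 (\<lambda>N a b. Determinant.det (mat_delete (A N a b) (h' j) (h' i)))"
    proof (rule polyf3_det)
      show "mat_delete (A N a b) (h' j) (h' i) \<in> carrier_mat (m - 1) (m - 1)" for N a b
        by (rule mat_delete_carrier[OF A])
      fix k l assume kl: "k < m - 1" "l < m - 1"
      have "mat_delete (A N a b) (h' j) (h' i) $$ (k, l) =
         A N a b $$ (if k < h' j then k else Suc k, if l < h' i then l else Suc l)" for N a b
        unfolding mat_delete_def using A[of N a b] kl by simp
      then show "polyf3 (\<lambda>N a b. mat_delete (A N a b) (h' j) (h' i) $$ (k, l))"
        using kl by (simp only:) (rule pA; simp add: less_diff_conv)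
    qed
    ultimately show ?thesis by (auto intro: polyf3_intros)
  next
    case False
    then have "R i j = (\<lambda>N a b. 0)" by (auto simp: R_def[abs_def] fun_eq_iff)
    then show ?thesis by (simp add: polyf3_const)
  qed
  have 3: "Q N a b * x i = (\<Sum>j\<in>I. R i j N a b * (\<Sum>k\<in>I. M j k N a b * x k))" if i: "i \<in> I" for N a b x i
  proof -
    define v where "v = vec m (\<lambda>k. x (h k))"
    have v: "v \<in> carrier_vec m" by (simp add: v_def)
    have adjA: "adj_mat (A N a b) \<in> carrier_mat m m" using adj_mat(1)[OF A] .
    have "(adj_mat (A N a b) *\<^sub>v (A N a b *\<^sub>v v)) = (adj_mat (A N a b) * A N a b) *\<^sub>v v"
      using assoc_mult_mat_vec[OF adjA A v] by simp
    also have "\<dots> = (Q N a b \<cdot>\<^sub>m 1\<^sub>m m) *\<^sub>v v" using adj_mat(3)[OF A] by (simp add: Q_def)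
    also have "\<dots> = Q N a b \<cdot>\<^sub>v v" using v by (intro eq_vecI) (auto simp: scalar_prod_def if_distrib[of "\<lambda>x. _ * x"] if_distrib[of "\<lambda>x. x * _"] cong: if_cong)
    finally have e: "(adj_mat (A N a b) *\<^sub>v (A N a b *\<^sub>v v)) $ h' i = Q N a b * x i"
      using hh'[OF i] by (simp add: v_def)
    have Av: "(A N a b *\<^sub>v v) $ j = (\<Sum>k\<in>I. M (h j) k N a b * x k)" if "j < m" for j
      using that A[of N a b] v unfolding reidx by (simp add: scalar_prod_def Aij v_def)
    have "(adj_mat (A N a b) *\<^sub>v (A N a b *\<^sub>v v)) $ h' i = (\<Sum>j=0..<m. adj_mat (A N a b) $$ (h' i, j) * (A N a b *\<^sub>v v) $ j)"
      using hh'[OF i] adjA A[of N a b] by (simp add: scalar_prod_def)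
    also have "\<dots> = (\<Sum>j\<in>I. R i j N a b * (\<Sum>k\<in>I. M j k N a b * x k))"
      unfolding reidx[of "\<lambda>j. R i j N a b * (\<Sum>k\<in>I. M j k N a b * x k)"]
    proof (rule sum.cong[OF refl])
      fix j assume "j \<in> {0..<m}"
      then have j: "j < m" "h j \<in> I" using h by (auto simp: bij_betw_def)
      show "adj_mat (A N a b) $$ (h' i, j) * (A N a b *\<^sub>v v) $ j = R i (h j) N a b * (\<Sum>k\<in>I. M (h j) k N a b * x k)"
        unfolding Av[OF j(1)] R_def using i j h'h by simp
    qed
    finally show ?thesis using e by simp
  qed
  have 4: "Q N a b \<noteq> 0" if inj: "\<forall>x. (\<forall>j\<in>I. (\<Sum>k\<in>I. M j k N a b * x k) = 0) \<longrightarrow> (\<forall>k\<in>I. x k = 0)" for N a b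
  proof
    assume "Q N a b = 0"
    then obtain v where v: "v \<in> carrier_vec m" "v \<noteq> 0\<^sub>v m" "A N a b *\<^sub>v v = 0\<^sub>v m"
      using det_0_iff_vec_prod_zero[OF A] unfolding Q_def by blast
    define x where "x i = v $ h' i" for i
    have "x k = 0" if "k \<in> I" for k
    proof (rule inj[rule_format, OF _ that])
      fix j assume j: "j \<in> I"
      have "(\<Sum>k\<in>I. M j k N a b * x k) = (A N a b *\<^sub>v v) $ h' j"
        unfolding reidx using hh'[OF j] A[of N a b] v(1) h'h by (simp add: scalar_prod_def Aij x_def)
      then show "(\<Sum>k\<in>I. M j k N a b * x k) = 0" using v(3) hh'[OF j] by simp
    qed
    then have "v $ j = 0" if "j < m" for j
      using that h h'h[OF that] unfolding x_def bij_betw_def by (metis atLeastLessThan_iff imageI zero_le)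
    then have "v = 0\<^sub>v m" using v(1) by (intro eq_vecI) auto
    then show False using v(2) by simp
  qed
  show thesis by (rule that[of Q R, OF 1 2 3 4])
qed

lemma loop_solD:
  assumes "loop_sol M N e c f"
  shows "f 0 id = 1" "n \<le> M \<Longrightarrow> \<not> s permutes {1..n} \<Longrightarrow> f n s = 0"
    "k < M \<Longrightarrow> s permutes {1..Suc k} \<Longrightarrow> c * f (Suc k) s + jm (Suc k) (f (Suc k)) s = loop_rhs k N e (f k) s"
  using assms unfolding loop_sol_def by simp_all

lemma loop_rhs_scale: "loop_rhs n N e (\<lambda>s. f s * q) s = loop_rhs n N e f s * q"
proof -
  have j: "jm k (\<lambda>s. g s * q) t = jm k g t * q" for k g t by (simp add: jm_def sum_distrib_right)
  have h: "(\<lambda>s. N * (f s * q) + jm (Suc n) (\<lambda>s. f s * q) s) = (\<lambda>s. (N * f s + jm (Suc n) f s) * q)"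
    unfolding j by (intro ext) (simp add: algebra_simps)
  show ?thesis unfolding loop_rhs_def unfolding h unfolding j by (simp add: algebra_simps)
qed

text \<open>Level \<open>Suc n\<close> is a linear system with matrix \<open>c + J\<close>, and
  Cramer's rule multiplies the previous denominator by its determinant. The form
  \<open>f * Q = P\<close>, for every solution, makes the result applicable to the integrals and to
  the series alike. The determinant cannot vanish for large \<open>c\<close>, since \<open>J\<close>
  at level \<open>Suc n\<close> is a sum of only \<open>n\<close> translates.\<close>

lemma loop_rational:
  assumes c: "polyf3 c" and e: "polyf3 e"
  shows "\<exists>Q P. polyf3 Q \<and> (\<forall>s. polyf3 (P s)) \<and>
    (\<forall>N a b f s. loop_sol n N (e N a b) (c N a b) f \<longrightarrow> f n s * Q N a b = P s N a b) \<and>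
    (\<forall>N a b. real n < norm (c N a b) \<longrightarrow> Q N a b \<noteq> 0)"
proof (induction n)
  case 0
  let ?P = "\<lambda>s N a b. if s = id then 1 else 0 :: complex"
  have "polyf3 (?P s)" for s :: "nat \<Rightarrow> nat" by (cases "s = id") (auto intro: polyf3_const)
  moreover have "f 0 s = (if s = id then 1 else 0)" if "loop_sol 0 N e c f" for N e c f s
  proof (cases "s = id")
    case False
    then have "\<not> s permutes {1..0}" by simp
    from loop_solD(2)[OF that _ this] show ?thesis using False by simp
  qed (use loop_solD(1)[OF that] in simp)
  ultimately show ?case
    by (intro exI[of _ "\<lambda>N a b. 1"] exI[of _ ?P] conjI allI impI polyf3_const) (simp_all only: mult_1_right one_neq_zero not_False_eq_True)
next
  case (Suc n)
  then obtain Q P where Q: "polyf3 Q" and P: "\<And>s. polyf3 (P s)"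
    and QP: "\<And>N a b f s. loop_sol n N (e N a b) (c N a b) f \<Longrightarrow> f n s * Q N a b = P s N a b"
    and Q0: "\<And>N a b. real n < norm (c N a b) \<Longrightarrow> Q N a b \<noteq> 0" by blast
  let ?I = "{s. s permutes {1..Suc n}}"
  have finI: "finite ?I" by (rule finite_permutations) simp
  define M where "M s t N a b = (if s = t then c N a b else 0) + (\<Sum>m\<in>{1..<Suc n}. if s \<circ> Transposition.transpose m (Suc n) = t then 1 else 0)"
    for s t :: "nat \<Rightarrow> nat" and N a b
  have pM: "polyf3 (M s t)" for s t
  proof -
    have "polyf3 (\<lambda>N a b. if X then 1 else 0)" for X by (cases X) (auto intro: polyf3_const)
    moreover have "polyf3 (\<lambda>N a b. if X then c N a b else 0)" for X using c by (cases X) (auto intro: polyf3_const)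
    ultimately show ?thesis unfolding M_def[abs_def] by (intro polyf3_add polyf3_sum)
  qed
  have step: "s \<circ> Transposition.transpose m (Suc n) \<in> ?I" if "s \<in> ?I" "m \<in> {1..<Suc n}" for s m
    using that by (auto intro!: permutes_compose[OF permutes_swap_id])
  have Mx: "(\<Sum>t\<in>?I. M s t N a b * x t) = c N a b * x s + jm (Suc n) x s" if s: "s \<in> ?I" for s N a b x
  proof -
    have "(\<Sum>t\<in>?I. M s t N a b * x t) = (\<Sum>t\<in>?I. if s = t then c N a b * x t else 0) +
       (\<Sum>t\<in>?I. \<Sum>m\<in>{1..<Suc n}. if s \<circ> Transposition.transpose m (Suc n) = t then x t else 0)"
      unfolding M_def sum.distrib[symmetric] distrib_right sum_distrib_right
      by (intro sum.cong refl arg_cong2[of _ _ _ _ "(+)"]) auto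
    also have "(\<Sum>t\<in>?I. if s = t then c N a b * x t else 0) = c N a b * x s"
      using s finI by (simp add: sum.delta')
    also have "(\<Sum>t\<in>?I. \<Sum>m\<in>{1..<Suc n}. if s \<circ> Transposition.transpose m (Suc n) = t then x t else 0)
      = (\<Sum>m\<in>{1..<Suc n}. \<Sum>t\<in>?I. if s \<circ> Transposition.transpose m (Suc n) = t then x t else 0)" by (rule sum.swap)
    also have "\<dots> = (\<Sum>m\<in>{1..<Suc n}. x (s \<circ> Transposition.transpose m (Suc n)))"
      by (intro sum.cong refl) (use step[OF s] finI in \<open>simp only: sum.delta' if_True\<close>)
    finally show ?thesis by (simp only: jm_def)
  qed
  obtain Q' R where Q': "polyf3 Q'" and R: "\<And>i j. polyf3 (R i j)"
    and QR: "\<And>N a b x i. i \<in> ?I \<Longrightarrow> Q' N a b * x i = (\<Sum>j\<in>?I. R i j N a b * (\<Sum>k\<in>?I. M j k N a b * x k))"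
    and Q'0: "\<And>N a b. (\<forall>x. (\<forall>j\<in>?I. (\<Sum>k\<in>?I. M j k N a b * x k) = 0) \<longrightarrow> (\<forall>k\<in>?I. x k = 0)) \<Longrightarrow> Q' N a b \<noteq> 0"
    by (rule cramer_polyf3[where M=M, OF finI pM]) (rule that)
  define P' where "P' s N a b = (if s \<in> ?I then \<Sum>t\<in>?I. R s t N a b * loop_rhs n N (e N a b) (\<lambda>s. P s N a b) t else 0)" for s N a b
  have pP': "polyf3 (P' s)" for s
  proof (cases "s \<in> ?I")
    case True
    have "P' s = (\<lambda>N a b. \<Sum>t\<in>?I. R s t N a b * loop_rhs n N (e N a b) (\<lambda>s. P s N a b) t)"
      using True by (intro ext) (simp only: P'_def if_True)
    then show ?thesis unfolding loop_rhs_def jm_def using e P R by (simp only:) (intro polyf3_intros; simp)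
  next
    case False
    then have "P' s = (\<lambda>N a b. 0)" by (intro ext) (simp only: P'_def if_False)
    then show ?thesis by (simp add: polyf3_const)
  qed
  show ?case
  proof (intro exI[of _ "\<lambda>N a b. Q' N a b * Q N a b"] exI[of _ P'] conjI allI impI)
    show "polyf3 (\<lambda>N a b. Q' N a b * Q N a b)" by (intro polyf3_intros Q Q')
    show "polyf3 (P' s)" for s by (rule pP')
  next
    fix N a b f s assume f: "loop_sol (Suc n) N (e N a b) (c N a b) f"
    then have f': "loop_sol n N (e N a b) (c N a b) f" unfolding loop_sol_def by auto
    show "f (Suc n) s * (Q' N a b * Q N a b) = P' s N a b"
    proof (cases "s \<in> ?I")
      case True
      have "Q' N a b * f (Suc n) s = (\<Sum>t\<in>?I. R s t N a b * loop_rhs n N (e N a b) (f n) t)"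
        unfolding QR[OF True]
      proof (intro sum.cong refl arg_cong2[of _ _ _ _ "(*)"])
        fix t assume t: "t \<in> ?I"
        have "t permutes {1..Suc n}" using t by simp
        then show "(\<Sum>k\<in>?I. M t k N a b * f (Suc n) k) = loop_rhs n N (e N a b) (f n) t"
          unfolding Mx[OF t] using f unfolding loop_sol_def by blast
      qed
      then have "Q' N a b * f (Suc n) s * Q N a b = (\<Sum>t\<in>?I. R s t N a b * loop_rhs n N (e N a b) (\<lambda>s. f n s * Q N a b) t)"
        by (simp only: loop_rhs_scale sum_distrib_right mult.assoc)
      then show ?thesis using True unfolding QP[OF f'] by (simp only: P'_def if_True mult_ac)
    next
      case False
      then have "f (Suc n) s = 0" using f unfolding loop_sol_def by blast
      then show ?thesis using False by (simp only: P'_def if_False mult_zero_left)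
    qed
  next
    fix N a b assume cn: "real (Suc n) < norm (c N a b)"
    have "Q' N a b \<noteq> 0"
    proof (rule Q'0, intro allI impI ballI)
      fix x k assume x': "\<forall>j\<in>?I. (\<Sum>k\<in>?I. M j k N a b * x k) = 0" and k: "k \<in> ?I"
      note x = bspec[OF x']
      \<comment> \<open>At an entry of maximal modulus \<open>m\<close> the kernel equation gives
        \<open>norm c * m \<le> n * m\<close>, which forces the maximum to be zero.\<close>
      define m where "m = Max ((\<lambda>s. norm (x s)) ` ?I)"
      have m: "norm (x s) \<le> m" if "s \<in> ?I" for s unfolding m_def using finI that by (intro Max_ge) auto
      have "m \<in> (\<lambda>s. norm (x s)) ` ?I" unfolding m_def using finI k by (intro Max_in) auto
      then obtain s where s: "s \<in> ?I" "m = norm (x s)" by blast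
      have "c N a b * x s = - jm (Suc n) x s" using x[OF s(1)] unfolding Mx[OF s(1)] by (simp add: eq_neg_iff_add_eq_0)
      then have "norm (c N a b) * m = norm (jm (Suc n) x s)" using s(2) by (metis norm_minus_cancel norm_mult)
      also have "\<dots> \<le> (\<Sum>j\<in>{1..<Suc n}. m)" unfolding jm_def by (rule sum_norm_le) (rule m[OF step[OF s(1)]])
      also have "\<dots> = real n * m" by simp
      finally have le: "norm (c N a b) * m \<le> real n * m" .
      have "m \<le> 0"
      proof (rule ccontr)
        assume "\<not> m \<le> 0"
        then have "norm (c N a b) \<le> real n" using le by simp
        then show False using cn by simp
      qed
      then show "x k = 0" using m[OF k] by (meson norm_le_zero_iff order_trans)
    qed
    then show "Q' N a b * Q N a b \<noteq> 0" using Q0[of N a b] cn by simp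
  qed
qed

section \<open>Polynomial functions of the coordinates\<close>

text \<open>An inductive predicate, because measurability, boundedness on boxes, and continuity and
  differentiability along coordinate lines each follow by one induction.\<close>

inductive pf :: "'i set \<Rightarrow> (('i \<Rightarrow> real) \<Rightarrow> complex) \<Rightarrow> bool" for P where
  pf_const: "pf P (\<lambda>x. c)"
| pf_coord: "p \<in> P \<Longrightarrow> pf P (\<lambda>x. complex_of_real (x p))"
| pf_add: "pf P f \<Longrightarrow> pf P g \<Longrightarrow> pf P (\<lambda>x. f x + g x)"
| pf_mult: "pf P f \<Longrightarrow> pf P g \<Longrightarrow> pf P (\<lambda>x. f x * g x)"

lemma pf_sum: "(\<And>i. i \<in> I \<Longrightarrow> pf P (f i)) \<Longrightarrow> pf P (\<lambda>x. \<Sum>i\<in>I. f i x)"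
  by (induction I rule: infinite_finite_induct) (auto intro: pf_add pf_const)

lemma pf_prod: "(\<And>i. i \<in> I \<Longrightarrow> pf P (f i)) \<Longrightarrow> pf P (\<lambda>x. \<Prod>i\<in>I. f i x)"
  by (induction I rule: infinite_finite_induct) (auto intro: pf_mult pf_const)

lemma pf_uminus: "pf P f \<Longrightarrow> pf P (\<lambda>x. - f x)"
  using pf_mult[OF pf_const[of P "-1"]] by simp

lemma pf_diff: "pf P f \<Longrightarrow> pf P g \<Longrightarrow> pf P (\<lambda>x. f x - g x)"
  using pf_add[OF _ pf_uminus] by simp

lemma pf_power: "pf P f \<Longrightarrow> pf P (\<lambda>x. f x ^ n)"
  by (induction n) (auto intro: pf_mult pf_const)

lemmas pf_intros = pf_const pf_coord pf_add pf_mult pf_sum pf_prod pf_uminus pf_diff pf_power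

lemma pf_measurable:
  assumes "pf P f" shows "f \<in> borel_measurable (\<Pi>\<^sub>M p\<in>P. lborel)"
  using assms by induction auto

lemma pf_bounded:
  assumes "pf P f" shows "\<exists>C. \<forall>x. (\<forall>p\<in>P. \<bar>x p\<bar> \<le> R) \<longrightarrow> norm (f x) \<le> C"
  using assms
proof induction
  case (pf_const c) then show ?case by auto
next
  case (pf_coord p)
  then show ?case by (intro exI[of _ R]) auto
next
  case (pf_add f g)
  then obtain C C' where "\<And>x. (\<forall>p\<in>P. \<bar>x p\<bar> \<le> R) \<Longrightarrow> norm (f x) \<le> C" "\<And>x. (\<forall>p\<in>P. \<bar>x p\<bar> \<le> R) \<Longrightarrow> norm (g x) \<le> C'" by blast
  then show ?case by (intro exI[of _ "C + C'"] allI impI norm_triangle_le add_mono) auto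
next
  case (pf_mult f g)
  then obtain C C' where "\<And>x. (\<forall>p\<in>P. \<bar>x p\<bar> \<le> R) \<Longrightarrow> norm (f x) \<le> C" "\<And>x. (\<forall>p\<in>P. \<bar>x p\<bar> \<le> R) \<Longrightarrow> norm (g x) \<le> C'" by blast
  then show ?case
    by (intro exI[of _ "C * C'"] allI impI) (auto simp: norm_mult intro!: mult_mono order_trans[OF norm_ge_zero])
qed

lemma pf_cont:
  assumes "pf P f" shows "continuous_on UNIV (\<lambda>t. f (x(p := t)))"
  using assms
proof induction
  case (pf_coord q)
  then show ?case by (cases "q = p") (auto intro!: continuous_intros)
qed (auto intro!: continuous_intros)

lemma pf_det:
  assumes A: "\<And>x. A x \<in> carrier_mat m m"
    and e: "\<And>i j. i < m \<Longrightarrow> j < m \<Longrightarrow> pf P (\<lambda>x. A x $$ (i, j))"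
  shows "pf P (\<lambda>x. Determinant.det (A x))"
proof -
  have "pf P (\<lambda>x. \<Sum>p\<in>{p. p permutes {0..<m}}. of_int (sign p) * (\<Prod>i=0..<m. A x $$ (i, p i)))"
    by (intro pf_intros e) (auto dest: permutes_in_image)
  then show ?thesis by (simp only: det_def'[OF A])
qed

lemma pf_coeff_det:
  assumes A: "\<And>x. A x \<in> carrier_mat m m"
    and e: "\<And>i j k. i < m \<Longrightarrow> j < m \<Longrightarrow> pf P (\<lambda>x. coeff (A x $$ (i, j)) k)"
  shows "pf P (\<lambda>x. coeff (Determinant.det (A x)) k)"
proof -
  have mult: "\<forall>k. pf P (\<lambda>x. coeff (f x * g x) k)" if "\<forall>k. pf P (\<lambda>x. coeff (f x) k)" "\<forall>k. pf P (\<lambda>x. coeff (g x) k)" for f g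
    using that unfolding coeff_mult by (intro allI pf_sum pf_mult) auto
  have prod: "\<forall>k. pf P (\<lambda>x. coeff (\<Prod>i\<in>I. f i x) k)" if "\<And>i k. i \<in> I \<Longrightarrow> pf P (\<lambda>x. coeff (f i x) k)" for f and I :: "nat set"
    using that
  proof (induction I rule: infinite_finite_induct)
    case (insert i I)
    then show ?case using mult[of "f i" "\<lambda>x. \<Prod>i\<in>I. f i x"] by simp
  qed (auto intro: pf_const)
  have "pf P (\<lambda>x. \<Sum>p\<in>{p. p permutes {0..<m}}. of_int (sign p) * coeff (\<Prod>i=0..<m. A x $$ (i, p i)) k)"
  proof (intro pf_sum pf_mult pf_const)
    fix p assume p: "p \<in> {p. p permutes {0..<m}}"
    have "\<forall>k. pf P (\<lambda>x. coeff (\<Prod>i=0..<m. A x $$ (i, p i)) k)"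
      using p by (intro prod e) (auto dest: permutes_in_image)
    then show "pf P (\<lambda>x. coeff (\<Prod>i=0..<m. A x $$ (i, p i)) k)" by blast
  qed
  moreover have "coeff (of_int z * q) k = of_int z * coeff q k" for z and q :: "complex poly"
    by (simp add: of_int_poly)
  ultimately show ?thesis by (simp only: det_def'[OF A] coeff_sum)
qed

section \<open>Hermitian matrices and their eigenvalues\<close>

definition herm :: "nat \<Rightarrow> complex mat \<Rightarrow> bool" where
  "herm N A \<longleftrightarrow> A \<in> carrier_mat N N \<and> (\<forall>i<N. \<forall>j<N. A $$ (j, i) = cnj (A $$ (i, j)))"

definition bform :: "nat \<Rightarrow> complex mat \<Rightarrow> (nat \<Rightarrow> complex) \<Rightarrow> (nat \<Rightarrow> complex) \<Rightarrow> complex" where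
  "bform N A u v = (\<Sum>i<N. \<Sum>j<N. cnj (u i) * A $$ (i, j) * v j)"

definition nsq :: "nat \<Rightarrow> (nat \<Rightarrow> complex) \<Rightarrow> real" where
  "nsq N v = (\<Sum>i<N. (norm (v i))\<^sup>2)"

definition posdef :: "nat \<Rightarrow> complex mat \<Rightarrow> bool" where
  "posdef N A \<longleftrightarrow> (\<forall>v. (\<exists>i<N. v i \<noteq> 0) \<longrightarrow> 0 < Re (bform N A v v))"

lemma nsq_nonneg: "0 \<le> nsq N v" by (simp add: nsq_def sum_nonneg)

lemma nsq_pos: "(\<exists>i<N. v i \<noteq> 0) \<Longrightarrow> 0 < nsq N v"
  unfolding nsq_def by (elim exE conjE, rule sum_pos2) auto

lemma norm_le_nsq: "i < N \<Longrightarrow> (norm (v i))\<^sup>2 \<le> nsq N v"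
  unfolding nsq_def by (rule member_le_sum) auto

lemma herm_of_carrier [simp]: "herm_of N x \<in> carrier_mat N N" by (simp add: herm_of_def)

lemma herm_herm_of: "herm N (herm_of N x)"
  unfolding herm_def
proof (intro conjI allI impI herm_of_carrier)
  fix i j assume ij: "i < N" "j < N"
  show "herm_of N x $$ (j, i) = cnj (herm_of N x $$ (i, j))"
  proof (cases i j rule: linorder_cases)
    case less then show ?thesis using ij by (simp add: herm_of_def complex_eq_iff)
  next
    case equal then show ?thesis using ij by (simp add: herm_of_def)
  next
    case greater then show ?thesis using ij by (simp add: herm_of_def complex_eq_iff)
  qed
qed

lemma hermD: "herm N A \<Longrightarrow> i < N \<Longrightarrow> j < N \<Longrightarrow> A $$ (j, i) = cnj (A $$ (i, j))"
  unfolding herm_def by blast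

lemma herm_carrier: "herm N A \<Longrightarrow> A \<in> carrier_mat N N"
  unfolding herm_def by blast

lemma herm_one_minus:
  assumes h: "herm N A" shows "herm N (1\<^sub>m N - A)"
  unfolding herm_def
proof (intro conjI allI impI)
  show "1\<^sub>m N - A \<in> carrier_mat N N" by (rule minus_carrier_mat[OF herm_carrier[OF h]])
  fix i j assume "i < N" "j < N"
  then show "(1\<^sub>m N - A) $$ (j, i) = cnj ((1\<^sub>m N - A) $$ (i, j))"
    using herm_carrier[OF h] hermD[OF h, of i j] by simp
qed

lemma bform_sym:
  assumes "herm N A" shows "bform N A v u = cnj (bform N A u v)"
proof -
  have "cnj (bform N A u v) = (\<Sum>i<N. \<Sum>j<N. u i * cnj (A $$ (i, j)) * cnj (v j))"
    by (simp add: bform_def)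
  also have "\<dots> = (\<Sum>i<N. \<Sum>j<N. cnj (v j) * A $$ (j, i) * u i)"
    by (intro sum.cong refl) (simp only: hermD[OF assms, symmetric] lessThan_iff mult_ac)
  also have "\<dots> = bform N A v u" unfolding bform_def by (rule sum.swap)
  finally show ?thesis ..
qed

lemma bform_real: "herm N A \<Longrightarrow> bform N A v v = complex_of_real (Re (bform N A v v))"
  using bform_sym[of N A v v] by (simp add: complex_eq_iff)

lemma bform_diff:
  "bform N A (\<lambda>i. v i - of_real s * u i) (\<lambda>i. v i - of_real s * u i) =
   bform N A v v - of_real s * bform N A u v - of_real s * bform N A v u + (of_real s)\<^sup>2 * bform N A u u"
  unfolding bform_def sum_distrib_left sum.distrib[symmetric] sum_subtractf[symmetric]
  by (intro sum.cong refl) (simp add: algebra_simps power2_eq_square)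

lemma bform_bound:
  "norm (bform N A v v) \<le> (\<Sum>i<N. \<Sum>j<N. norm (A $$ (i, j))) * nsq N v"
proof -
  have "norm (cnj (v i) * A $$ (i, j) * v j) \<le> norm (A $$ (i, j)) * nsq N v" if "i < N" "j < N" for i j
  proof -
    have "2 * (norm (v i) * norm (v j)) \<le> (norm (v i))\<^sup>2 + (norm (v j))\<^sup>2"
      using sum_squares_bound[of "norm (v i)" "norm (v j)"] by simp
    then have "norm (v i) * norm (v j) \<le> nsq N v"
      using norm_le_nsq[OF that(1), of v] norm_le_nsq[OF that(2), of v] by linarith
    then have "norm (A $$ (i, j)) * (norm (v i) * norm (v j)) \<le> norm (A $$ (i, j)) * nsq N v"
      by (rule mult_left_mono) simp
    then show ?thesis by (simp add: norm_mult mult_ac)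
  qed
  then have "norm (bform N A v v) \<le> (\<Sum>i<N. \<Sum>j<N. norm (A $$ (i, j)) * nsq N v)"
    unfolding bform_def by (intro sum_norm_le) auto
  then show ?thesis by (simp add: sum_distrib_right)
qed

lemma eigenvalueE_fun:
  assumes A: "A \<in> carrier_mat N N" and "eigenvalue A k"
  obtains v where "\<exists>i<N. v i \<noteq> 0" "\<And>i. i < N \<Longrightarrow> (\<Sum>j<N. A $$ (i, j) * v j) = k * v i"
proof -
  from assms obtain v where v: "v \<in> carrier_vec N" "v \<noteq> 0\<^sub>v N" "A *\<^sub>v v = k \<cdot>\<^sub>v v"
    by (auto simp: eigenvalue_def eigenvector_def)
  show thesis
  proof (rule that[of "\<lambda>i. v $ i"])
    show "\<exists>i<N. v $ i \<noteq> 0" using v(1,2) by (metis carrier_vecD eq_vecI index_zero_vec)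
    fix i assume i: "i < N"
    have "(A *\<^sub>v v) $ i = (\<Sum>j\<in>{0..<N}. A $$ (i, j) * v $ j)" using A i v(1) by (simp add: scalar_prod_def)
    then show "(\<Sum>j<N. A $$ (i, j) * v $ j) = k * v $ i"
      using v(1) i unfolding v(3) atLeast0LessThan by simp
  qed
qed

lemma bform_eigen:
  assumes "\<And>i. i < N \<Longrightarrow> (\<Sum>j<N. A $$ (i, j) * v j) = k * v i"
  shows "bform N A v v = k * of_real (nsq N v)"
proof -
  have "bform N A v v = (\<Sum>i<N. cnj (v i) * (\<Sum>j<N. A $$ (i, j) * v j))"
    by (simp add: bform_def sum_distrib_left mult.assoc)
  also have "\<dots> = (\<Sum>i<N. k * of_real ((norm (v i))\<^sup>2))"
    using assms by (intro sum.cong refl) (simp add: complex_norm_square mult_ac del: of_real_power)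
  finally show ?thesis by (simp add: nsq_def sum_distrib_left)
qed

lemma herm_eigenvalue_real:
  assumes h: "herm N A" and "eigenvalue A k" shows "k = of_real (Re k)"
proof -
  have A: "A \<in> carrier_mat N N" using h by (simp add: herm_def)
  obtain v where v: "\<exists>i<N. v i \<noteq> 0" "\<And>i. i < N \<Longrightarrow> (\<Sum>j<N. A $$ (i, j) * v j) = k * v i"
    using eigenvalueE_fun[OF A assms(2)] by blast
  have "Im (k * of_real (nsq N v)) = 0"
    using bform_eigen[OF v(2)] bform_real[OF h, of v] by (metis Im_complex_of_real)
  then have "Im k = 0" using nsq_pos[OF v(1)] by simp
  then show ?thesis by (simp add: complex_eq_iff)
qed

lemma posdef_eigenvalue:
  assumes "A \<in> carrier_mat N N" "posdef N A" "eigenvalue A k" shows "0 < Re k"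
proof -
  obtain v where v: "\<exists>i<N. v i \<noteq> 0" "\<And>i. i < N \<Longrightarrow> (\<Sum>j<N. A $$ (i, j) * v j) = k * v i"
    using eigenvalueE_fun[OF assms(1,3)] by blast
  have "0 < Re (bform N A v v)" using assms(2) v(1) by (auto simp: posdef_def)
  then show ?thesis using bform_eigen[OF v(2)] nsq_pos[OF v(1)] by (simp add: zero_less_mult_iff)
qed

lemma det_cnj:
  assumes "herm N A" shows "Determinant.det A = of_real (Re (Determinant.det A))"
proof -
  have A: "A \<in> carrier_mat N N" using assms by (simp add: herm_def)
  have "cnj (Determinant.det A) = (\<Sum>p\<in>{p. p permutes {0..<N}}. of_int (sign p) * (\<Prod>i=0..<N. cnj (A $$ (i, p i))))"
    by (simp add: det_def'[OF A])
  also have "\<dots> = (\<Sum>p\<in>{p. p permutes {0..<N}}. of_int (sign p) * (\<Prod>i=0..<N. A\<^sup>T $$ (i, p i)))"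
  proof (intro sum.cong refl arg_cong2[of _ _ _ _ "(*)"] prod.cong)
    fix p i assume "p \<in> {p. p permutes {0..<N}}" "i \<in> {0..<N}"
    then have "i < N" "p i < N" using permutes_in_image[of p "{0..<N}" i] by auto
    then show "cnj (A $$ (i, p i)) = A\<^sup>T $$ (i, p i)" using A hermD[OF assms, of i "p i"] by simp
  qed
  also have "\<dots> = Determinant.det (A\<^sup>T)" using A by (intro det_def'[symmetric]) simp
  also have "\<dots> = Determinant.det A" by (rule det_transpose[OF A])
  finally show ?thesis by (simp add: complex_eq_iff)
qed

section \<open>Positivity through the characteristic polynomial\<close>

text \<open>For hermitian \<open>A\<close>, positive definiteness means that all coefficients of \<open>det (t + A)\<close> are positive.
  This turns the condition on the eigenvalues into finitely many polynomial inequalities in the coordinates.\<close>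

definition cpoly :: "complex mat \<Rightarrow> complex poly" where "cpoly A = char_poly (- A)"

lemma poly_det_eval:
  assumes "M \<in> carrier_mat N N"
  shows "poly (Determinant.det M) a = Determinant.det (map_mat (\<lambda>p. poly p a) M)"
proof -
  have M': "map_mat (\<lambda>p. poly p a) M \<in> carrier_mat N N" using assms by simp
  have e: "poly (of_int z :: 'a poly) a = of_int z" for z by (simp add: of_int_poly)
  show ?thesis unfolding det_def'[OF assms] det_def'[OF M'] poly_sum poly_mult poly_prod e
    using assms by (intro sum.cong refl arg_cong2[of _ _ _ _ "(*)"] prod.cong) (auto dest: permutes_in_image)
qed

lemma poly_cpoly:
  assumes A: "A \<in> carrier_mat N N"
  shows "poly (cpoly A) a = Determinant.det (a \<cdot>\<^sub>m 1\<^sub>m N + A)"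
proof -
  have c: "char_poly_matrix (- A) \<in> carrier_mat N N" using A by simp
  have "map_mat (\<lambda>p. poly p a) (char_poly_matrix (- A)) = a \<cdot>\<^sub>m 1\<^sub>m N + A"
    using A by (intro eq_matI) (auto simp: char_poly_matrix_def)
  then show ?thesis unfolding cpoly_def char_poly_def poly_det_eval[OF c] by simp
qed

lemma cpoly_0: "A \<in> carrier_mat N N \<Longrightarrow> coeff (cpoly A) 0 = Determinant.det A"
proof -
  assume A: "A \<in> carrier_mat N N"
  have "0 \<cdot>\<^sub>m 1\<^sub>m N + A = A" using A by (intro eq_matI) auto
  then show ?thesis using poly_cpoly[OF A, of 0] by (simp add: poly_0_coeff_0)
qed

lemma cpoly_root:
  assumes A: "A \<in> carrier_mat N N"
  shows "poly (cpoly A) k = 0 \<longleftrightarrow> eigenvalue A (- k)"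
proof -
  have e: "char_matrix A (- k) = k \<cdot>\<^sub>m 1\<^sub>m N + A"
    using A by (intro eq_matI) (auto simp: char_matrix_def)
  show ?thesis unfolding poly_cpoly[OF A] eigenvalue_det[OF A] e ..
qed

lemma cpoly_degree: "A \<in> carrier_mat N N \<Longrightarrow> degree (cpoly A) = N \<and> coeff (cpoly A) N = 1"
  unfolding cpoly_def using degree_monic_char_poly[of "- A" N] by auto

lemma pos_coeff_prod:
  fixes as :: "real list"
  shows "\<exists>c. \<forall>j. coeff (\<Prod>a\<leftarrow>as. [:complex_of_real a, 1:]) j = complex_of_real (c j) \<and> 
     ((\<forall>a\<in>set as. 0 < a) \<longrightarrow> (0 \<le> c j \<and> (j \<le> length as \<longrightarrow> 0 < c j)))"
proof (induction as)
  case Nil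
  show ?case by (intro exI[of _ "\<lambda>j. if j = 0 then 1 else 0"]) (auto simp: coeff_1 coeff_eq_0)
next
  case (Cons a as)
  then obtain c where c: "\<And>j. coeff (\<Prod>a\<leftarrow>as. [:complex_of_real a, 1:]) j = complex_of_real (c j)"
    "\<And>j. \<forall>a\<in>set as. 0 < a \<Longrightarrow> 0 \<le> c j" "\<And>j. \<forall>a\<in>set as. 0 < a \<Longrightarrow> j \<le> length as \<Longrightarrow> 0 < c j" by blast
  let ?c = "\<lambda>j. a * c j + (if j = 0 then 0 else c (j - 1))"
  show ?case
  proof (intro exI[of _ ?c] allI conjI impI)
    fix j
    show "coeff (\<Prod>a\<leftarrow>a # as. [:complex_of_real a, 1:]) j = complex_of_real (?c j)"
      by (cases j) (simp_all add: c(1) coeff_pCons)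
    assume pos: "\<forall>a\<in>set (a # as). 0 < a"
    then show "0 \<le> ?c j" using c(2) by (auto intro!: add_nonneg_nonneg)
    assume "j \<le> length (a # as)"
    then show "0 < ?c j"
      using pos c(2)[of j] c(2)[of "j - 1"] c(3)[of j] c(3)[of "j - 1"]
      by (cases j) (auto intro!: add_nonneg_pos)
  qed
qed

definition cpos :: "nat \<Rightarrow> complex mat \<Rightarrow> bool" where
  "cpos N A \<longleftrightarrow> (\<forall>j\<le>N. 0 < Re (coeff (cpoly A) j))"

definition cnonneg :: "nat \<Rightarrow> complex mat \<Rightarrow> bool" where
  "cnonneg N A \<longleftrightarrow> (\<forall>j\<le>N. 0 \<le> Re (coeff (cpoly A) j))"

lemma Re_poly_cpoly:
  assumes "A \<in> carrier_mat N N"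
  shows "Re (poly (cpoly A) (of_real r)) = (\<Sum>j\<le>N. Re (coeff (cpoly A) j) * r ^ j)"
proof -
  have "Re (c * of_real r ^ j) = Re c * r ^ j" for c j by (simp flip: of_real_power)
  then show ?thesis using cpoly_degree[OF assms] by (simp add: poly_altdef)
qed

text \<open>A negative eigenvalue would be minus a positive root of \<open>cpoly A\<close>, but a
  monic polynomial with nonnegative coefficients has no positive root. Nonnegativity of the
  coefficients is what survives on the closure of the domain.\<close>

lemma cnonneg_eigenvalue:
  assumes h: "herm N A" and c: "cnonneg N A" and k: "eigenvalue A k" shows "0 \<le> Re k"
proof (rule ccontr)
  have A: "A \<in> carrier_mat N N" using h by (simp add: herm_def)
  assume "\<not> 0 \<le> Re k"
  then have r: "0 < - Re k" by simp
  have "poly (cpoly A) (of_real (- Re k)) = 0"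
    using k cpoly_root[OF A] herm_eigenvalue_real[OF h k] by simp
  then have "(\<Sum>j\<le>N. Re (coeff (cpoly A) j) * (- Re k) ^ j) = 0" using Re_poly_cpoly[OF A, of "- Re k"] by simp
  moreover have "0 < (\<Sum>j\<le>N. Re (coeff (cpoly A) j) * (- Re k) ^ j)"
  proof (rule sum_pos2)
    show "0 < Re (coeff (cpoly A) N) * (- Re k) ^ N" using cpoly_degree[OF A] r by simp
    show "0 \<le> Re (coeff (cpoly A) j) * (- Re k) ^ j" if "j \<in> {..N}" for j
      using c that r unfolding cnonneg_def by (intro mult_nonneg_nonneg zero_le_power) auto
  qed auto
  ultimately show False by simp
qed

lemma eigenvalue_0_det:
  fixes A :: "complex mat"
  assumes "A \<in> carrier_mat N N" shows "eigenvalue A 0 \<longleftrightarrow> Determinant.det A = 0"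
proof -
  have "char_matrix A 0 = A" using assms by (intro eq_matI) (auto simp: char_matrix_def)
  then show ?thesis unfolding eigenvalue_det[OF assms] by simp
qed

text \<open>Forward, positive coefficients exclude nonnegative roots, 0 being excluded by the
  constant coefficient, which is the determinant. Backward, \<open>cpoly A\<close> splits into
  factors \<open>t + k\<close> over the eigenvalues \<open>k > 0\<close>, and such a product has
  only positive coefficients.\<close>

lemma cpos_iff:
  assumes h: "herm N A"
  shows "cpos N A \<longleftrightarrow> (\<forall>k. eigenvalue A k \<longrightarrow> 0 < Re k)"
proof
  have A: "A \<in> carrier_mat N N" using h by (simp add: herm_def)
  assume c: "cpos N A"
  then have "cnonneg N A" by (auto simp: cpos_def cnonneg_def intro: less_imp_le)
  moreover have "Determinant.det A \<noteq> 0" using c cpoly_0[OF A] unfolding cpos_def by (metis le0 less_irrefl zero_complex.simps(1))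
  ultimately show "\<forall>k. eigenvalue A k \<longrightarrow> 0 < Re k"
    using cnonneg_eigenvalue[OF h] herm_eigenvalue_real[OF h] eigenvalue_0_det[OF A]
    by (metis less_eq_real_def of_real_0)
next
  have A: "A \<in> carrier_mat N N" using h by (simp add: herm_def)
  assume pos: "\<forall>k. eigenvalue A k \<longrightarrow> 0 < Re k"
  obtain as where as: "cpoly A = (\<Prod>a\<leftarrow>as. [:- a, 1:])" "length as = N"
    using char_poly_factorized[of "- A" N] A unfolding cpoly_def by auto
  have root: "0 < - Re a \<and> - a = of_real (- Re a)" if "a \<in> set as" for a
  proof -
    have "poly (cpoly A) a = 0" unfolding as(1) using that by (simp add: poly_prod_list prod_list_zero_iff)
    then have e: "eigenvalue A (- a)" using cpoly_root[OF A] by simp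
    show ?thesis using pos[rule_format, OF e] herm_eigenvalue_real[OF h e] by simp
  qed
  have e: "cpoly A = (\<Prod>a\<leftarrow>map (\<lambda>a. - Re a) as. [:complex_of_real a, 1:])"
    unfolding as(1) map_map using root by (intro arg_cong[of _ _ prod_list] map_cong refl) simp
  obtain c where c: "\<And>j. coeff (cpoly A) j = complex_of_real (c j)"
    "\<And>j. \<forall>a\<in>set (map (\<lambda>a. - Re a) as). 0 < a \<Longrightarrow> j \<le> length (map (\<lambda>a. - Re a) as) \<Longrightarrow> 0 < c j"
    unfolding e using pos_coeff_prod[of "map (\<lambda>a. - Re a) as"] by blast
  have "\<forall>a\<in>set (map (\<lambda>a. - Re a) as). 0 < a" using root by auto
  then show "cpos N A" unfolding cpos_def c(1) using c(2) as(2) by auto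
qed

lemma cpos_closed:
  assumes h: "herm N A" and "cnonneg N A" "Determinant.det A \<noteq> 0" shows "cpos N A"
proof -
  have A: "A \<in> carrier_mat N N" using h by (simp add: herm_def)
  show ?thesis unfolding cpos_iff[OF h]
    using cnonneg_eigenvalue[OF h assms(2)] herm_eigenvalue_real[OF h] eigenvalue_0_det[OF A] assms(3)
    by (metis less_eq_real_def of_real_0)
qed

lemma cpos_det: 
  assumes h: "herm N A" and "cpos N A" shows "0 < Re (Determinant.det A)"
  using assms cpoly_0[of A N] unfolding cpos_def herm_def by (metis le0)

section \<open>Positive definiteness\<close>

text \<open>A shift argument takes the place of a diagonalization. Let \<open>t0\<close> be the
  least shift that makes \<open>A + t\<close> positive semidefinite. As \<open>- t0\<close> is no
  eigenvalue, \<open>A + t0\<close> is invertible, and an invertible semidefinite form is coercive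
  (\<open>coer\<close>). If \<open>t0\<close> were positive, coercivity would leave room for a
  smaller shift; hence \<open>t0 = 0\<close> and \<open>A\<close> itself is coercive.\<close>

lemma eigenvalues_pos_imp_posdef:
  assumes h: "herm N A" and pos: "\<forall>k. eigenvalue A k \<longrightarrow> 0 < Re k"
  shows "posdef N A"
proof -
  have A: "A \<in> carrier_mat N N" using h by (simp add: herm_def)
  define C where "C = (\<Sum>i<N. \<Sum>j<N. norm (A $$ (i, j)))"
  have C0: "0 \<le> C" unfolding C_def by (intro sum_nonneg) auto
  have qC: "\<bar>Re (bform N A v v)\<bar> \<le> C * nsq N v" for v
    using bform_bound[of N A v] abs_Re_le_cmod[of "bform N A v v"] unfolding C_def by linarith
  define T where "T = {t. 0 \<le> t \<and> (\<forall>v. 0 \<le> Re (bform N A v v) + t * nsq N v)}"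
  have CT: "C \<in> T" unfolding T_def
  proof (intro CollectI conjI allI)
    show "0 \<le> C" by (rule C0)
    show "0 \<le> Re (bform N A v v) + C * nsq N v" for v using qC[of v] by (simp add: abs_le_iff)
  qed
  have bdd: "bdd_below T" by (rule bdd_belowI[of _ 0]) (auto simp: T_def)
  define t0 where "t0 = Inf T"
  have t00: "0 \<le> t0" unfolding t0_def using CT by (intro cInf_greatest) (auto simp: T_def)
  have psd: "0 \<le> Re (bform N A v v) + t0 * nsq N v" for v
  proof (rule ccontr)
    assume n: "\<not> ?thesis"
    define d where "d = - (Re (bform N A v v) + t0 * nsq N v)"
    have d: "0 < d" using n by (simp add: d_def)
    have "t0 < t0 + d / (nsq N v + 1)" using d nsq_nonneg[of N v] by simp
    then obtain t where t: "t \<in> T" "t < t0 + d / (nsq N v + 1)"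
      unfolding t0_def using cInf_less_iff[of T] CT bdd by blast
    have "t * nsq N v \<le> (t0 + d / (nsq N v + 1)) * nsq N v"
      using t(2) nsq_nonneg by (intro mult_right_mono) auto
    also have "\<dots> = t0 * nsq N v + d * (nsq N v / (nsq N v + 1))" by (simp add: algebra_simps)
    also have "\<dots> < t0 * nsq N v + d"
    proof -
      have "nsq N v / (nsq N v + 1) < 1" using nsq_nonneg[of N v] by (simp add: divide_less_eq)
      then have "d * (nsq N v / (nsq N v + 1)) < d * 1" using d by (rule mult_strict_left_mono)
      then show ?thesis by simp
    qed
    finally have "t * nsq N v < t0 * nsq N v + d" .
    moreover have "0 \<le> Re (bform N A v v) + t * nsq N v" using t(1) unfolding T_def by blast
    ultimately show False unfolding d_def by linarith
  qed
  let ?Z = "of_real t0 \<cdot>\<^sub>m 1\<^sub>m N + A"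
  have Z: "?Z \<in> carrier_mat N N" using A by simp
  have hZ: "herm N ?Z" unfolding herm_def
  proof (intro conjI allI impI Z)
    fix i j assume "i < N" "j < N"
    then show "?Z $$ (j, i) = cnj (?Z $$ (i, j))" using A hermD[OF h, of i j] by simp
  qed
  have bZ: "bform N ?Z u v = bform N A u v + of_real t0 * (\<Sum>i<N. cnj (u i) * v i)" for u v
  proof -
    have "bform N ?Z u v = (\<Sum>i<N. (\<Sum>j<N. cnj (u i) * A $$ (i, j) * v j) + (\<Sum>j<N. if i = j then of_real t0 * (cnj (u i) * v i) else 0))"
      unfolding bform_def sum.distrib[symmetric]
      using A by (intro sum.cong refl) (auto simp: algebra_simps)
    then show ?thesis by (simp add: bform_def sum.distrib sum_distrib_left)
  qed
  have bZv: "Re (bform N ?Z v v) = Re (bform N A v v) + t0 * nsq N v" for v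
  proof -
    have "(\<Sum>i<N. cnj (v i) * v i) = of_real (nsq N v)"
      unfolding nsq_def of_real_sum by (intro sum.cong refl) (simp add: complex_norm_square mult.commute del: of_real_power)
    then show ?thesis unfolding bZ by simp
  qed
  have "\<not> eigenvalue A (- of_real t0)" using pos t00 by fastforce
  then have detZ: "Determinant.det ?Z \<noteq> 0" using cpoly_root[OF A, of "of_real t0"] poly_cpoly[OF A, of "of_real t0"] by simp
  define B where "B = inverse (Determinant.det ?Z) \<cdot>\<^sub>m adj_mat ?Z"
  have Bc: "B \<in> carrier_mat N N" unfolding B_def using adj_mat(1)[OF Z] by simp
  have BZ: "B * ?Z = 1\<^sub>m N"
    unfolding B_def using adj_mat(1,3)[OF Z] Z detZ
    by (subst mult_smult_assoc_mat[of _ N N _ N]) (auto intro!: eq_matI)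
  define Zv where "Zv v i = (\<Sum>j<N. ?Z $$ (i, j) * v j)" for v i
  have inv: "v i = (\<Sum>j<N. B $$ (i, j) * Zv v j)" if i: "i < N" for v i
  proof -
    have "(\<Sum>j<N. B $$ (i, j) * Zv v j) = (\<Sum>j<N. \<Sum>l<N. B $$ (i, j) * ?Z $$ (j, l) * v l)"
      by (simp add: Zv_def sum_distrib_left mult.assoc)
    also have "\<dots> = (\<Sum>l<N. (\<Sum>j<N. B $$ (i, j) * ?Z $$ (j, l)) * v l)"
      by (subst sum.swap) (simp add: sum_distrib_right)
    also have "\<dots> = (\<Sum>l<N. (B * ?Z) $$ (i, l) * v l)"
      using i by (intro sum.cong refl) (simp only: index_mult_mat_sum[OF Bc Z] lessThan_iff)
    also have "\<dots> = (\<Sum>l<N. if l = i then v l else 0)" unfolding BZ using i by (intro sum.cong refl) auto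
    finally show ?thesis using i by simp
  qed
  define K where "K = (\<Sum>i<N. \<Sum>j<N. norm (B $$ (i, j)))"
  have K0: "0 \<le> K" unfolding K_def by (intro sum_nonneg) auto
  have nv: "nsq N v \<le> real N * K\<^sup>2 * nsq N (Zv v)" for v
  proof -
    let ?s = "sqrt (nsq N (Zv v))"
    have "norm (v i) \<le> K * ?s" if i: "i < N" for i
    proof -
      have "norm (v i) \<le> (\<Sum>j<N. norm (B $$ (i, j)) * ?s)"
        unfolding inv[OF i, of v]
      proof (rule sum_norm_le)
        fix j assume "j \<in> {..<N}"
        then have "norm (Zv v j) \<le> ?s" using norm_le_nsq[of j N "Zv v"] by (simp add: real_le_rsqrt)
        then show "norm (B $$ (i, j) * Zv v j) \<le> norm (B $$ (i, j)) * ?s" by (simp add: norm_mult mult_left_mono)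
      qed
      also have "\<dots> = (\<Sum>j<N. norm (B $$ (i, j))) * ?s" by (simp add: sum_distrib_right)
      also have "\<dots> \<le> K * ?s"
        unfolding K_def using i by (intro mult_right_mono member_le_sum[of i "{..<N}" "\<lambda>i. \<Sum>j<N. norm (B $$ (i, j))"]) (auto simp: nsq_nonneg intro: sum_nonneg)
      finally show ?thesis .
    qed
    then have "nsq N v \<le> (\<Sum>i<N. (K * ?s)\<^sup>2)" unfolding nsq_def[of N v] by (intro sum_mono power_mono) auto
    also have "\<dots> = real N * K\<^sup>2 * nsq N (Zv v)" by (simp add: power_mult_distrib nsq_nonneg)
    finally show ?thesis .
  qed
  define C' where "C' = C + t0 + 1"
  have C'0: "0 < C'" using C0 t00 by (simp add: C'_def)
  have qC': "Re (bform N ?Z u u) \<le> C' * nsq N u" for u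
    unfolding bZv C'_def using qC[of u] nsq_nonneg[of N u] by (simp add: algebra_simps)
  have uZ: "nsq N (Zv v) \<le> C' * Re (bform N ?Z v v)" for v
  proof -
    let ?u = "Zv v" and ?s = "1 / C'"
    have uv: "bform N ?Z ?u v = of_real (nsq N ?u)"
    proof -
      have "bform N ?Z ?u v = (\<Sum>i<N. cnj (?u i) * ?u i)"
        unfolding bform_def Zv_def[of v] by (simp add: sum_distrib_left mult.assoc)
      then show ?thesis unfolding nsq_def of_real_sum
        by (simp add: complex_norm_square mult.commute del: of_real_power)
    qed
    have vu: "bform N ?Z v ?u = of_real (nsq N ?u)" using bform_sym[OF hZ, of v ?u] uv by simp
    \<comment> \<open>Semidefiniteness is tested on \<open>v\<close> minus a multiple of
      \<open>Zv v\<close>. The step \<open>1 / C'\<close> balances the linear against the quadratic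
      term, so that the square norm of \<open>Zv v\<close> is bounded by the form at
      \<open>v\<close>.\<close>
    have "0 \<le> Re (bform N ?Z (\<lambda>i. v i - of_real ?s * ?u i) (\<lambda>i. v i - of_real ?s * ?u i))"
      unfolding bZv by (rule psd)
    also have "\<dots> = Re (bform N ?Z v v) - 2 * ?s * nsq N ?u + ?s\<^sup>2 * Re (bform N ?Z ?u ?u)"
      unfolding bform_diff uv vu by (simp flip: of_real_power of_real_mult of_real_divide)
    also have "\<dots> \<le> Re (bform N ?Z v v) - 2 * ?s * nsq N ?u + ?s\<^sup>2 * (C' * nsq N ?u)"
      using qC'[of ?u] by (intro add_left_mono mult_left_mono) auto
    also have "\<dots> = Re (bform N ?Z v v) - nsq N ?u / C'"
      using C'0 by (simp add: power2_eq_square field_simps)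
    finally show ?thesis using C'0 by (simp add: field_simps)
  qed
  define L where "L = real N * K\<^sup>2 * C' + 1"
  have L0: "0 < L" unfolding L_def using C'0 by (intro add_nonneg_pos) auto
  have coer: "nsq N v \<le> L * Re (bform N ?Z v v)" for v
  proof -
    have q: "0 \<le> Re (bform N ?Z v v)" unfolding bZv by (rule psd)
    have "nsq N v \<le> real N * K\<^sup>2 * (C' * Re (bform N ?Z v v))"
      by (rule order_trans[OF nv mult_left_mono[OF uZ]]) auto
    also have "\<dots> \<le> L * Re (bform N ?Z v v)" unfolding L_def using q by (simp add: algebra_simps)
    finally show ?thesis .
  qed
  have "t0 = 0"
  proof (rule ccontr)
    assume "t0 \<noteq> 0"
    then have t0p: "0 < t0" using t00 by simp
    define d where "d = min (1 / L) t0"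
    have d: "0 < d" "d \<le> t0" "d * L \<le> 1" using L0 t0p by (auto simp: d_def min_def field_simps)
    have "t0 - d \<in> T" unfolding T_def
    proof (intro CollectI conjI allI)
      show "0 \<le> t0 - d" using d by simp
      fix v
      have q: "0 \<le> Re (bform N ?Z v v)" unfolding bZv by (rule psd)
      have "d * nsq N v \<le> d * (L * Re (bform N ?Z v v))" using d coer by (intro mult_left_mono) auto
      also have "\<dots> \<le> 1 * Re (bform N ?Z v v)" using d(3) q by (simp only: mult.assoc[symmetric] mult_right_mono)
      finally show "0 \<le> Re (bform N A v v) + (t0 - d) * nsq N v" unfolding bZv by (simp add: algebra_simps)
    qed
    then have "t0 \<le> t0 - d" unfolding t0_def using bdd by (rule cInf_lower)
    then show False using d by simp
  qed
  show ?thesis unfolding posdef_def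
  proof (intro allI impI)
    fix v :: "nat \<Rightarrow> complex" assume v: "\<exists>i<N. v i \<noteq> 0"
    have "0 < L * Re (bform N ?Z v v)" using coer[of v] nsq_pos[OF v] by linarith
    then show "0 < Re (bform N A v v)" unfolding bZv using L0 \<open>t0 = 0\<close> by (simp add: zero_less_mult_iff)
  qed
qed

lemma cpos_iff_posdef: "herm N A \<Longrightarrow> cpos N A \<longleftrightarrow> posdef N A"
  unfolding cpos_iff using eigenvalues_pos_imp_posdef posdef_eigenvalue by (metis herm_def)

section \<open>The domain of integration\<close>

definition good :: "nat \<Rightarrow> (nat \<times> nat \<Rightarrow> real) \<Rightarrow> bool" where
  "good N x \<longleftrightarrow> cpos N (herm_of N x) \<and> cpos N (1\<^sub>m N - herm_of N x)"

abbreviation idx :: "nat \<Rightarrow> (nat \<times> nat) set" where "idx N \<equiv> {..<N} \<times> {..<N}"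

lemma eigenvalue_one_minus:
  fixes A :: "complex mat"
  assumes A: "A \<in> carrier_mat N N"
  shows "eigenvalue (1\<^sub>m N - A) k \<longleftrightarrow> eigenvalue A (1 - k)"
proof -
  have A': "1\<^sub>m N - A \<in> carrier_mat N N" by (rule minus_carrier_mat[OF A])
  have e: "char_matrix (1\<^sub>m N - A) k = (- 1) \<cdot>\<^sub>m char_matrix A (1 - k)"
    using A by (intro eq_matI) (auto simp: char_matrix_def)
  have "char_matrix A (1 - k) \<in> carrier_mat N N" using A by (simp add: char_matrix_def)
  then have "Determinant.det ((- 1) \<cdot>\<^sub>m char_matrix A (1 - k)) = (- 1) ^ N * Determinant.det (char_matrix A (1 - k))"
    by (simp add: det_smult)
  then show ?thesis unfolding eigenvalue_det[OF A] eigenvalue_det[OF A'] e by simp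
qed

lemma one_minus_carrier [simp]: "1\<^sub>m N - herm_of N x \<in> carrier_mat N N"
  by (rule minus_carrier_mat) simp

lemma herm01_iff: "x \<in> herm01 N \<longleftrightarrow> x \<in> space (herm_lebesgue N) \<and> good N x"
proof -
  let ?X = "herm_of N x"
  have h: "herm N ?X" by (rule herm_herm_of)
  have "(\<forall>k. eigenvalue ?X k \<longrightarrow> k \<in> complex_of_real ` {0<..<1}) \<longleftrightarrow>
    (\<forall>k. eigenvalue ?X k \<longrightarrow> 0 < Re k) \<and> (\<forall>k. eigenvalue (1\<^sub>m N - ?X) k \<longrightarrow> 0 < Re k)"
    (is "?L \<longleftrightarrow> ?R1 \<and> ?R2")
  proof (intro iffI conjI allI impI)
    fix k assume L: ?L and k: "eigenvalue ?X k"
    then show "0 < Re k" by auto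
  next
    fix k assume L: ?L and k: "eigenvalue (1\<^sub>m N - ?X) k"
    then have "1 - k \<in> complex_of_real ` {0<..<1}" using eigenvalue_one_minus[OF herm_of_carrier] by blast
    then obtain r where r: "r \<in> {0<..<1}" "1 - k = complex_of_real r" by blast
    then have "1 - Re k = r" by (metis Re_complex_of_real minus_complex.simps(1) one_complex.simps(1))
    then show "0 < Re k" using r by simp
  next
    fix k assume R: "?R1 \<and> ?R2" and k: "eigenvalue ?X k"
    have "eigenvalue (1\<^sub>m N - ?X) (1 - k)" using k eigenvalue_one_minus[OF herm_of_carrier, of N x "1 - k"] by simp
    then have "0 < Re k" "0 < Re (1 - k)" using R k by blast+
    then show "k \<in> complex_of_real ` {0<..<1}"
      using herm_eigenvalue_real[OF h k] by (intro image_eqI[of _ _ "Re k"]) auto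
  qed
  then show ?thesis unfolding herm01_def good_def cpos_iff[OF h] cpos_iff[OF herm_one_minus[OF h]] by simp
qed

lemma pf_entry:
  assumes "i < N" "j < N" shows "pf (idx N) (\<lambda>x. herm_of N x $$ (i, j))"
proof -
  have "(\<lambda>x. herm_of N x $$ (i, j)) = (\<lambda>x. if i = j then complex_of_real (x (i, i))
     else if i < j then complex_of_real (x (i, j)) + \<i> * complex_of_real (x (j, i))
     else complex_of_real (x (j, i)) + (- \<i>) * complex_of_real (x (i, j)))"
    using assms by (auto simp: herm_of_def fun_eq_iff complex_eq_iff)
  then show ?thesis using assms
    by (cases i j rule: linorder_cases) (auto intro!: pf_intros)
qed

lemma pf_entry1:
  assumes "i < N" "j < N" shows "pf (idx N) (\<lambda>x. (1\<^sub>m N - herm_of N x) $$ (i, j))"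
proof -
  have "(\<lambda>x. (1\<^sub>m N - herm_of N x) $$ (i, j)) = (\<lambda>x. (1\<^sub>m N :: complex mat) $$ (i, j) - herm_of N x $$ (i, j))"
    using assms carrier_matD[OF herm_of_carrier] by (auto simp: fun_eq_iff)
  then show ?thesis using pf_diff[OF pf_const pf_entry[OF assms]] by simp
qed

lemma pf_cpoly:
  assumes A: "\<And>x. A x \<in> carrier_mat N N" and e: "\<And>i j. i < N \<Longrightarrow> j < N \<Longrightarrow> pf P (\<lambda>x. A x $$ (i, j))"
  shows "pf P (\<lambda>x. coeff (cpoly (A x)) k)"
  unfolding cpoly_def char_poly_def
proof (rule pf_coeff_det)
  show "char_poly_matrix (- A x) \<in> carrier_mat N N" for x using A by simp
  fix i j k assume ij: "i < N" "j < N"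
  have "(\<lambda>x. coeff (char_poly_matrix (- A x) $$ (i, j)) k) =
    (\<lambda>x. (if i = j \<and> k = 1 then 1 else 0) + (if k = 0 then A x $$ (i, j) else 0))"
    using ij carrier_matD[OF A] 
    by (auto simp: char_poly_matrix_def fun_eq_iff coeff_pCons split: nat.splits)
  moreover have "pf P (\<lambda>x. if k = 0 then A x $$ (i, j) else 0)" using e[OF ij] by (cases "k = 0") (auto intro: pf_const)
  ultimately show "pf P (\<lambda>x. coeff (char_poly_matrix (- A x) $$ (i, j)) k)" by (simp add: pf_add pf_const)
qed

definition dt :: "nat \<Rightarrow> (nat \<times> nat \<Rightarrow> real) \<Rightarrow> real" where "dt N x = Re (Determinant.det (herm_of N x))"
definition du :: "nat \<Rightarrow> (nat \<times> nat \<Rightarrow> real) \<Rightarrow> real" where "du N x = Re (Determinant.det (1\<^sub>m N - herm_of N x))"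

lemma det_dt: "Determinant.det (herm_of N x) = of_real (dt N x)"
  unfolding dt_def by (rule det_cnj[OF herm_herm_of])

lemma det_du: "Determinant.det (1\<^sub>m N - herm_of N x) = of_real (du N x)"
  unfolding du_def by (rule det_cnj[OF herm_one_minus[OF herm_herm_of]])

lemma good_det: "good N x \<Longrightarrow> 0 < dt N x" "good N x \<Longrightarrow> 0 < du N x"
  unfolding good_def dt_def du_def using cpos_det herm_herm_of herm_one_minus by blast+

lemma pf_dt: "pf (idx N) (\<lambda>x. of_real (dt N x))"
  unfolding det_dt[symmetric] by (rule pf_det[OF herm_of_carrier pf_entry])

lemma pf_du: "pf (idx N) (\<lambda>x. of_real (du N x))"
  unfolding det_du[symmetric] by (rule pf_det[OF one_minus_carrier pf_entry1])

lemma pf_Re_measurable: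
  assumes "pf P f" shows "(\<lambda>x. Re (f x)) \<in> borel_measurable (\<Pi>\<^sub>M p\<in>P. lborel)"
  using pf_measurable[OF assms] by measurable

lemma dt_measurable [measurable]: "dt N \<in> borel_measurable (herm_lebesgue N)"
  using pf_Re_measurable[OF pf_dt] unfolding herm_lebesgue_def by simp

lemma du_measurable [measurable]: "du N \<in> borel_measurable (herm_lebesgue N)"
  using pf_Re_measurable[OF pf_du] unfolding herm_lebesgue_def by simp

lemma herm01_sets [measurable]: "herm01 N \<in> sets (herm_lebesgue N)"
proof -
  have m: "(\<lambda>x. Re (coeff (cpoly (herm_of N x)) j)) \<in> borel_measurable (herm_lebesgue N)"
    "(\<lambda>x. Re (coeff (cpoly (1\<^sub>m N - herm_of N x)) j)) \<in> borel_measurable (herm_lebesgue N)" for j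
    unfolding herm_lebesgue_def
    by (rule pf_Re_measurable[OF pf_cpoly[OF herm_of_carrier pf_entry]], assumption+)
       (rule pf_Re_measurable[OF pf_cpoly[OF one_minus_carrier pf_entry1]], assumption+)
  have "herm01 N = {x \<in> space (herm_lebesgue N). (\<forall>j\<le>N. 0 < Re (coeff (cpoly (herm_of N x)) j)) \<and>
      (\<forall>j\<le>N. 0 < Re (coeff (cpoly (1\<^sub>m N - herm_of N x)) j))}"
    by (auto simp: herm01_iff good_def cpos_def)
  also have "\<dots> \<in> sets (herm_lebesgue N)"
    using m by measurable
  finally show ?thesis .
qed

lemma pf_Re_isCont:
  assumes "pf P f" shows "isCont (\<lambda>t. Re (f (x(p := t)))) t0"
proof -
  have "continuous_on UNIV (\<lambda>t. Re (f (x(p := t))))" by (intro continuous_on_Re pf_cont[OF assms])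
  then show ?thesis by (simp add: continuous_on_eq_continuous_at)
qed

text \<open>Openness along coordinate lines is what partial derivatives require. It holds because
  the domain is given by finitely many strict polynomial inequalities.\<close>

lemma good_open_slice:
  assumes "good N (x(p := t0))" shows "eventually (\<lambda>t. good N (x(p := t))) (nhds t0)"
proof -
  have ev: "eventually (\<lambda>t. 0 < Re (f (x(p := t)))) (nhds t0)" if "pf (idx N) f" "0 < Re (f (x(p := t0)))" for f
  proof -
    have "((\<lambda>t. Re (f (x(p := t)))) \<longlongrightarrow> Re (f (x(p := t0)))) (nhds t0)"
      using pf_Re_isCont[OF that(1), where x=x and p=p and ?t0.0=t0] by (simp add: isCont_def tendsto_nhds_iff)
    then show ?thesis using that(2) by (rule order_tendstoD(1))
  qed
  have "\<forall>j\<in>{..N}. eventually (\<lambda>t. 0 < Re (coeff (cpoly (herm_of N (x(p := t)))) j)) (nhds t0)"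
    using assms by (intro ballI ev[OF pf_cpoly[OF herm_of_carrier pf_entry]]) (auto simp: good_def cpos_def)
  moreover have "\<forall>j\<in>{..N}. eventually (\<lambda>t. 0 < Re (coeff (cpoly (1\<^sub>m N - herm_of N (x(p := t)))) j)) (nhds t0)"
    using assms by (intro ballI ev[OF pf_cpoly[OF one_minus_carrier pf_entry1]]) (auto simp: good_def cpos_def)
  ultimately have "eventually (\<lambda>t. (\<forall>j\<in>{..N}. 0 < Re (coeff (cpoly (herm_of N (x(p := t)))) j)) \<and>
     (\<forall>j\<in>{..N}. 0 < Re (coeff (cpoly (1\<^sub>m N - herm_of N (x(p := t)))) j))) (nhds t0)"
    by (intro eventually_conj eventually_ball_finite) auto
  then show ?thesis by (rule eventually_mono) (auto simp: good_def cpos_def)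
qed

text \<open>The closure of the domain meets the open set where both determinants are nonzero only inside
  the domain: on the closure all coefficients of the characteristic polynomials are nonnegative.\<close>

lemma not_good_open_slice:
  assumes "\<not> (good N (x(p := t0)) \<and> eps \<le> dt N (x(p := t0)) * du N (x(p := t0)))" "0 < eps"
  shows "eventually (\<lambda>t. \<not> (good N (x(p := t)) \<and> eps \<le> dt N (x(p := t)) * du N (x(p := t)))) (nhds t0)"
proof (cases "dt N (x(p := t0)) * du N (x(p := t0)) < eps")
  case True
  have c: "((\<lambda>t. Re (f (x(p := t)))) \<longlongrightarrow> Re (f (x(p := t0)))) (nhds t0)" if "pf (idx N) f" for f
    using pf_Re_isCont[OF that(1), where x=x and p=p and ?t0.0=t0] by (simp add: isCont_def tendsto_nhds_iff)
  have "((\<lambda>t. dt N (x(p := t)) * du N (x(p := t))) \<longlongrightarrow> dt N (x(p := t0)) * du N (x(p := t0))) (nhds t0)"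
    using c[OF pf_dt] c[OF pf_du] by (auto intro: tendsto_mult)
  then have "eventually (\<lambda>t. dt N (x(p := t)) * du N (x(p := t)) < eps) (nhds t0)" using True by (rule order_tendstoD(2))
  then show ?thesis by (rule eventually_mono) auto
next
  case False
  let ?x = "x(p := t0)"
  have d0: "dt N ?x \<noteq> 0" "du N ?x \<noteq> 0" using False assms(2) by auto
  have "\<not> good N ?x" using assms(1) False by simp
  then have "\<not> cnonneg N (herm_of N ?x) \<or> \<not> cnonneg N (1\<^sub>m N - herm_of N ?x)"
    using cpos_closed[OF herm_herm_of] cpos_closed[OF herm_one_minus[OF herm_herm_of]] d0
    unfolding good_def det_dt det_du by auto
  then have "\<exists>f. pf (idx N) f \<and> Re (f ?x) < 0 \<and> (\<forall>y. good N y \<longrightarrow> 0 < Re (f y))"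
  proof
    assume "\<not> cnonneg N (herm_of N ?x)"
    then obtain j where j: "j \<le> N" "Re (coeff (cpoly (herm_of N ?x)) j) < 0" by (auto simp: cnonneg_def not_le)
    have "pf (idx N) (\<lambda>x. coeff (cpoly (herm_of N x)) j)" by (rule pf_cpoly[OF herm_of_carrier pf_entry])
    then show ?thesis using j by (intro exI[of _ "\<lambda>x. coeff (cpoly (herm_of N x)) j"]) (auto simp: good_def cpos_def)
  next
    assume "\<not> cnonneg N (1\<^sub>m N - herm_of N ?x)"
    then obtain j where j: "j \<le> N" "Re (coeff (cpoly (1\<^sub>m N - herm_of N ?x)) j) < 0" by (auto simp: cnonneg_def not_le)
    have "pf (idx N) (\<lambda>x. coeff (cpoly (1\<^sub>m N - herm_of N x)) j)" by (rule pf_cpoly[OF one_minus_carrier pf_entry1])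
    then show ?thesis using j by (intro exI[of _ "\<lambda>x. coeff (cpoly (1\<^sub>m N - herm_of N x)) j"]) (auto simp: good_def cpos_def)
  qed
  then obtain f where f: "pf (idx N) f" "Re (f ?x) < 0" "\<And>y. good N y \<Longrightarrow> 0 < Re (f y)" by blast
  have "((\<lambda>t. Re (f (x(p := t)))) \<longlongrightarrow> Re (f ?x)) (nhds t0)"
    using pf_Re_isCont[OF f(1), where x=x and p=p and ?t0.0=t0] by (simp add: isCont_def tendsto_nhds_iff)
  then have "eventually (\<lambda>t. Re (f (x(p := t))) < 0) (nhds t0)" using f(2) by (rule order_tendstoD(2))
  then show ?thesis by (rule eventually_mono) (use f(3) less_asym in blast)
qed

section \<open>Bounds for the domain and a box inside it\<close>

lemma good_posdef: "good N x \<longleftrightarrow> posdef N (herm_of N x) \<and> posdef N (1\<^sub>m N - herm_of N x)"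
  unfolding good_def using cpos_iff_posdef herm_herm_of herm_one_minus by blast

lemma bform_support2:
  assumes "i < N" "j < N" "i \<noteq> j" "\<And>k. k \<noteq> i \<Longrightarrow> k \<noteq> j \<Longrightarrow> v k = 0"
  shows "bform N A v v = cnj (v i) * A $$ (i, i) * v i + cnj (v i) * A $$ (i, j) * v j
     + cnj (v j) * A $$ (j, i) * v i + cnj (v j) * A $$ (j, j) * v j"
proof -
  have s: "(\<Sum>k<N. f k) = f i + f j" if "\<And>k. k \<noteq> i \<Longrightarrow> k \<noteq> j \<Longrightarrow> f k = 0" for f :: "nat \<Rightarrow> complex"
  proof -
    have "(\<Sum>k<N. f k) = (\<Sum>k\<in>{i, j}. f k)" using assms that by (intro sum.mono_neutral_right) auto
    then show ?thesis using assms(3) by simp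
  qed
  show ?thesis unfolding bform_def by (subst s, use assms(4) in simp)+ (simp add: add.assoc)
qed

lemma bform_unit:
  assumes "i < N" shows "bform N A (\<lambda>k. if k = i then 1 else 0) (\<lambda>k. if k = i then 1 else 0) = A $$ (i, i)"
proof -
  have s: "(\<Sum>k<N. f k) = f i" if "\<And>k. k \<noteq> i \<Longrightarrow> f k = 0" for f :: "nat \<Rightarrow> complex"
  proof -
    have "(\<Sum>k<N. f k) = (\<Sum>k\<in>{i}. f k)" using assms that by (intro sum.mono_neutral_right) auto
    then show ?thesis by simp
  qed
  show ?thesis unfolding bform_def by (subst s, simp)+ simp
qed

lemma posdef_diag:
  assumes "posdef N A" "i < N" shows "0 < Re (A $$ (i, i))"
proof -
  have "0 < Re (bform N A (\<lambda>k. if k = i then 1 else 0) (\<lambda>k. if k = i then 1 else 0))"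
    by (rule assms(1)[unfolded posdef_def, rule_format]) (use assms(2) in auto)
  then show ?thesis by (simp only: bform_unit[OF assms(2)])
qed

lemma good_entries:
  assumes g: "good N x" and ij: "i < N" "j < N" shows "norm (herm_of N x $$ (i, j)) \<le> 1"
proof -
  let ?X = "herm_of N x"
  have pd: "posdef N ?X" "posdef N (1\<^sub>m N - ?X)" using g good_posdef by auto
  have h: "herm N ?X" by (rule herm_herm_of)
  have d: "0 < Re (?X $$ (k, k)) \<and> Re (?X $$ (k, k)) < 1" if "k < N" for k
    using posdef_diag[OF pd(1) that] posdef_diag[OF pd(2) that] that carrier_matD[OF herm_of_carrier[of N x]] by simp
  show ?thesis
  proof (cases "i = j")
    case True
    have "Im (?X $$ (i, i)) = 0" using hermD[OF h ij(1) ij(1)] by (simp add: complex_eq_iff)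
    then have "norm (?X $$ (i, i)) = \<bar>Re (?X $$ (i, i))\<bar>" by (simp add: cmod_def)
    then show ?thesis using d[OF ij(1)] True by simp
  next
    case False
    show ?thesis
    proof (cases "?X $$ (i, j) = 0")
      case nz: False
      define z where "z = ?X $$ (i, j)"
      \<comment> \<open>The phase \<open>w\<close> makes the cross term \<open>z * w\<close> equal
        to \<open>- norm z\<close>. Positivity of the form on the vector with entries 1 and
        \<open>w\<close> then bounds \<open>2 * norm z\<close> by the sum of two diagonal entries,
        which is less than 2.\<close>
      define w where "w = - (cnj z / of_real (norm z))"
      have z0: "z \<noteq> 0" using nz by (simp add: z_def)
      have zw: "z * w = - of_real (norm z)"
      proof -
        have "z * w = - (of_real ((norm z)\<^sup>2) / of_real (norm z))"
          unfolding w_def complex_norm_square by simp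
        then show ?thesis by (simp add: power2_eq_square)
      qed
      have nw: "cnj w * w = 1"
      proof -
        have "norm w = 1" using z0 by (simp add: w_def norm_divide)
        then show ?thesis using complex_norm_square[of w] by (simp add: mult.commute)
      qed
      let ?v = "\<lambda>k. if k = i then 1 else if k = j then w else 0"
      have "0 < Re (bform N ?X ?v ?v)" by (rule pd(1)[unfolded posdef_def, rule_format]) (use ij(1) in auto)
      also have "bform N ?X ?v ?v = ?X $$ (i, i) + z * w + cnj (z * w) + ?X $$ (j, j)"
      proof -
        have "bform N ?X ?v ?v = ?X $$ (i, i) + z * w + cnj w * ?X $$ (j, i) + (cnj w * w) * ?X $$ (j, j)"
          using bform_support2[OF ij False, of ?v ?X] False by (simp add: z_def mult_ac)
        then show ?thesis unfolding nw hermD[OF h ij] z_def[symmetric] by (simp add: mult.commute)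
      qed
      also have "Re \<dots> = Re (?X $$ (i, i)) + Re (?X $$ (j, j)) - 2 * norm z" unfolding zw by simp
      finally show ?thesis using d[OF ij(1)] d[OF ij(2)] unfolding z_def by linarith
    qed simp
  qed
qed

lemma good_coords:
  assumes g: "good N x" and p: "p \<in> idx N" shows "\<bar>x p\<bar> \<le> 1"
proof -
  obtain i j where ij: "p = (i, j)" "i < N" "j < N" using p by auto
  have n: "norm (herm_of N x $$ (i, j)) \<le> 1" "norm (herm_of N x $$ (j, i)) \<le> 1" using good_entries[OF g] ij by auto
  show ?thesis
  proof (cases i j rule: linorder_cases)
    case less
    then have "x p = Re (herm_of N x $$ (i, j))" using ij by (simp add: herm_of_def)
    then show ?thesis using n(1) abs_Re_le_cmod order_trans by metis
  next
    case equal
    then have "x p = Re (herm_of N x $$ (i, j))" using ij by (simp add: herm_of_def)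
    then show ?thesis using n(1) abs_Re_le_cmod order_trans by metis
  next
    case greater
    then have "x p = Im (herm_of N x $$ (j, i))" using ij by (simp add: herm_of_def)
    then show ?thesis using n(2) abs_Im_le_cmod order_trans by metis
  qed
qed

lemma pf_bounded_good: "pf (idx N) f \<Longrightarrow> \<exists>C. \<forall>x. good N x \<longrightarrow> norm (f x) \<le> C"
  using pf_bounded[of "idx N" f 1] good_coords by blast

text \<open>Gershgorin's argument at the largest component of an eigenvector. Off-diagonal entries
  are allowed twice the diagonal deviation because their real and imaginary parts are bounded
  separately; the total \<open>r + 2 * r * (N - 1)\<close> stays below
  \<open>2 * r * N\<close>.\<close>

lemma gershgorin_half:
  fixes A :: "complex mat"
  assumes A: "A \<in> carrier_mat N N" and e: "eigenvalue A k"
    and d: "\<And>i. i < N \<Longrightarrow> norm (A $$ (i, i) - c) \<le> r" and o: "\<And>i j. i < N \<Longrightarrow> j < N \<Longrightarrow> i \<noteq> j \<Longrightarrow> norm (A $$ (i, j)) \<le> 2 * r"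
    and r: "0 < r"
  shows "norm (k - c) < 2 * r * real N"
proof -
  obtain v where v: "\<exists>i<N. v i \<noteq> 0" "\<And>i. i < N \<Longrightarrow> (\<Sum>j<N. A $$ (i, j) * v j) = k * v i"
    using eigenvalueE_fun[OF A e] by blast
  define m where "m = Max ((\<lambda>i. norm (v i)) ` {..<N})"
  have N0: "0 < N" using v(1) by auto
  have le: "norm (v i) \<le> m" if "i < N" for i unfolding m_def using that by (intro Max_ge) auto
  have "m \<in> (\<lambda>i. norm (v i)) ` {..<N}" unfolding m_def using N0 by (intro Max_in) auto
  then obtain i where i: "i < N" "m = norm (v i)" by auto
  have m0: "0 < m" using v(1) le by (metis less_le_trans zero_less_norm_iff)
  have "(\<Sum>j<N. A $$ (i, j) * v j) = A $$ (i, i) * v i + (\<Sum>j\<in>{..<N}-{i}. A $$ (i, j) * v j)"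
    using i by (intro sum.remove) auto
  then have "(k - c) * v i = (A $$ (i, i) - c) * v i + (\<Sum>j\<in>{..<N}-{i}. A $$ (i, j) * v j)"
    using v(2)[OF i(1)] by (simp add: algebra_simps)
  then have "norm (k - c) * norm (v i) \<le> norm ((A $$ (i, i) - c) * v i) + norm (\<Sum>j\<in>{..<N}-{i}. A $$ (i, j) * v j)"
    unfolding norm_mult[of "k - c", symmetric] by (simp only: norm_triangle_ineq)
  then have "norm (k - c) * m \<le> norm ((A $$ (i, i) - c) * v i) + norm (\<Sum>j\<in>{..<N}-{i}. A $$ (i, j) * v j)"
    by (simp only: i(2))
  also have "\<dots> \<le> r * m + (\<Sum>j\<in>{..<N}-{i}. 2 * r * m)"
  proof (intro add_mono sum_norm_le)
    show "norm ((A $$ (i, i) - c) * v i) \<le> r * m"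
      unfolding norm_mult i(2) using d[OF i(1)] by (intro mult_right_mono) auto
    fix j assume "j \<in> {..<N} - {i}"
    then have "j < N" "norm (A $$ (i, j)) \<le> 2 * r" using o[OF i(1)] by auto
    then show "norm (A $$ (i, j) * v j) \<le> 2 * r * m"
      unfolding norm_mult using le[of j] r by (intro mult_mono) auto
  qed
  also have "(\<Sum>j\<in>{..<N}-{i}. 2 * r * m) = (real N - 1) * (2 * r * m)" using i N0 by (simp add: of_nat_diff)
  finally have "norm (k - c) * m \<le> (2 * r * real N - r) * m" by (simp add: algebra_simps)
  then have "norm (k - c) \<le> 2 * r * real N - r" using m0 by simp
  then show ?thesis using r by simp
qed

text \<open>This box around half the identity matrix shows that the domain has positive measure. The
  radius \<open>1 / (4 * N)\<close> makes the Gershgorin bound \<open>2 * r * N\<close> equal to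
  1/2.\<close>

lemma good_near_half:
  assumes "0 < N" and x: "\<And>i j. i < N \<Longrightarrow> j < N \<Longrightarrow> \<bar>x (i, j) - (if i = j then 1/2 else 0)\<bar> \<le> 1 / (4 * real N)"
  shows "good N x"
proof -
  let ?X = "herm_of N x"
  have d: "norm (?X $$ (i, i) - of_real (1/2)) \<le> 1 / (4 * real N)" if "i < N" for i
  proof -
    have "?X $$ (i, i) - of_real (1/2) = of_real (x (i, i) - 1/2)" using that by (simp add: herm_of_def)
    then have "norm (?X $$ (i, i) - of_real (1/2)) = \<bar>x (i, i) - 1/2\<bar>" by (simp only: norm_of_real)
    then show ?thesis using x[OF that that] by simp
  qed
  have o: "norm (?X $$ (i, j)) \<le> 2 * (1 / (4 * real N))" if ij: "i < N" "j < N" "i \<noteq> j" for i j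
  proof -
    have "norm (?X $$ (i, j)) \<le> \<bar>Re (?X $$ (i, j))\<bar> + \<bar>Im (?X $$ (i, j))\<bar>" by (rule cmod_le)
    also have "\<dots> \<le> 1 / (4 * real N) + 1 / (4 * real N)"
      using ij x[OF ij(1,2)] x[OF ij(2,1)] by (intro add_mono) (auto simp: herm_of_def)
    finally show ?thesis by simp
  qed
  have k: "0 < Re k \<and> Re k < 1" if "eigenvalue ?X k" for k
  proof -
    have "norm (k - of_real (1/2)) < 2 * (1 / (4 * real N)) * real N"
      by (rule gershgorin_half[OF herm_of_carrier that d o]) (use assms in auto)
    then have "norm (k - of_real (1/2)) < 1/2" using assms(1) by simp
    then have "\<bar>Re (k - of_real (1/2))\<bar> < 1/2" using abs_Re_le_cmod le_less_trans by blast
    then have "\<bar>Re k - 1/2\<bar> < 1/2" by simp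
    then show ?thesis by linarith
  qed
  have "0 < Re k" if "eigenvalue (1\<^sub>m N - ?X) k" for k
    using k[of "1 - k"] that eigenvalue_one_minus[OF herm_of_carrier] by auto
  then show ?thesis unfolding good_def cpos_iff[OF herm_herm_of] cpos_iff[OF herm_one_minus[OF herm_herm_of]] using k by blast
qed

lemma emeasure_herm01_pos:
  assumes "0 < N" shows "emeasure (herm_lebesgue N) (herm01 N) \<noteq> 0"
proof -
  interpret product_sigma_finite "\<lambda>_ :: nat \<times> nat. lborel :: real measure" ..
  define c where "c p = (if fst p = snd p then 1/2 else 0 :: real)" for p :: "nat \<times> nat"
  define r where "r = 1 / (4 * real N)"
  have r: "0 < r" using assms by (simp add: r_def)
  let ?B = "\<Pi>\<^sub>E p\<in>idx N. {c p - r..c p + r}"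
  have sub: "?B \<subseteq> herm01 N"
  proof
    fix x assume x: "x \<in> ?B"
    have "good N x"
    proof (rule good_near_half[OF assms])
      fix i j assume "i < N" "j < N"
      then have "x (i, j) \<in> {c (i, j) - r..c (i, j) + r}" using x by (auto simp: PiE_iff)
      then show "\<bar>x (i, j) - (if i = j then 1/2 else 0)\<bar> \<le> 1 / (4 * real N)"
        unfolding r_def[symmetric] c_def by auto
    qed
    moreover have "x \<in> space (herm_lebesgue N)" using x by (auto simp: herm_lebesgue_def space_PiM PiE_iff)
    ultimately show "x \<in> herm01 N" by (simp add: herm01_iff)
  qed
  have "emeasure (herm_lebesgue N) ?B = (\<Prod>p\<in>idx N. emeasure lborel {c p - r..c p + r})"
    unfolding herm_lebesgue_def by (rule emeasure_PiM) auto
  also have "\<dots> = (\<Prod>p\<in>idx N. ennreal (2 * r))" using r by (intro prod.cong refl) simp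
  also have "\<dots> \<noteq> 0" using r by (simp add: ennreal_eq_0_iff)
  finally have "0 < emeasure (herm_lebesgue N) ?B" by (simp add: zero_less_iff_neq_zero)
  also have "\<dots> \<le> emeasure (herm_lebesgue N) (herm01 N)" by (rule emeasure_mono[OF sub herm01_sets])
  finally show ?thesis by simp
qed

section \<open>Beta integrals in one and two real variables\<close>

text \<open>The affine substitution onto the unit interval extracts the power of the length, and the
  constant is the Beta value with both exponents raised by 1.\<close>

lemma beta_bound:
  fixes a b :: real
  assumes "-1 < a" "-1 < b"
  shows "\<exists>K\<ge>0. \<forall>s r. s < r \<longrightarrow> (\<integral>\<^sup>+x. ennreal ((x - s) powr a * (r - x) powr b) * indicator {s<..<r} x \<partial>lborel)
     \<le> ennreal (K * (r - s) powr (a + b + 1))"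
proof (intro exI[of _ "Beta (a + 1) (b + 1)"] conjI allI impI)
  let ?g = "\<lambda>t. t powr a * (1 - t) powr b" and ?K = "Beta (a + 1) (b + 1)"
  have I: "(?g has_integral ?K) {0..1}" using has_integral_Beta_real[of "a + 1" "b + 1"] assms by simp
  show K: "0 \<le> ?K" by (rule has_integral_nonneg[OF I]) auto
  have N: "(\<integral>\<^sup>+t. ennreal (?g t) * indicator {0..1} t \<partial>lborel) = ennreal ?K"
    by (rule nn_integral_has_integral_lebesgue'[OF _ I]) auto
  fix s r :: real assume sr: "s < r"
  let ?F = "\<lambda>x. ennreal ((x - s) powr a * (r - x) powr b) * indicator {s<..<r} x"
  have 1: "(\<integral>\<^sup>+x. ?F x \<partial>lborel) = ennreal \<bar>r - s\<bar> * (\<integral>\<^sup>+y. ?F (s + (r - s) * y) \<partial>lborel)"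
    using sr by (intro nn_integral_real_affine) auto
  have 2: "(\<integral>\<^sup>+y. ?F (s + (r - s) * y) \<partial>lborel) \<le> (\<integral>\<^sup>+y. ennreal ((r - s) powr (a + b)) * (ennreal (?g y) * indicator {0..1} y) \<partial>lborel)"
  proof (rule nn_integral_mono)
    fix y
    show "?F (s + (r - s) * y) \<le> ennreal ((r - s) powr (a + b)) * (ennreal (?g y) * indicator {0..1} y)"
    proof (cases "s + (r - s) * y \<in> {s<..<r}")
      case True
      then have "s < s + (r - s) * y" "s + (r - s) * y < r" by (simp_all only: greaterThanLessThan_iff)
      then have a: "0 < (r - s) * y" "(r - s) * y < (r - s) * 1"
        unfolding mult_1_right less_diff_eq by (simp_all only: less_add_same_cancel1 add.commute)
      have y1: "y < 1" by (rule mult_less_cancel_left_pos[THEN iffD1, OF _ a(2)]) (use sr in simp)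
      have y: "0 < y" "y < 1" using a(1) sr y1 by (simp_all add: zero_less_mult_iff)
      have "s + (r - s) * y - s = (r - s) * y" "r - (s + (r - s) * y) = (r - s) * (1 - y)" by (simp_all add: algebra_simps)
      then have "(s + (r - s) * y - s) powr a * (r - (s + (r - s) * y)) powr b = (r - s) powr (a + b) * ?g y"
        using y sr by (simp add: powr_mult powr_add)
      then show ?thesis using True y by (simp add: ennreal_mult' ennreal_mult)
    qed simp
  qed
  have 3: "(\<integral>\<^sup>+y. ennreal ((r - s) powr (a + b)) * (ennreal (?g y) * indicator {0..1} y) \<partial>lborel) = ennreal ((r - s) powr (a + b)) * ennreal ?K"
    using N by (subst nn_integral_cmult) auto
  have 4: "ennreal \<bar>r - s\<bar> * (ennreal ((r - s) powr (a + b)) * ennreal ?K) = ennreal (?K * (r - s) powr (a + b + 1))"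
    using sr K by (simp add: ennreal_mult[symmetric] powr_add mult_ac)
  show "(\<integral>\<^sup>+x. ?F x \<partial>lborel) \<le> ennreal (?K * (r - s) powr (a + b + 1))"
    unfolding 1 4[symmetric] by (rule mult_left_mono) (use 2 3 in simp_all)
qed

text \<open>The exponent \<open>c\<close> may be negative, so the integrand can be unbounded near
  the circle where the quadratic expression vanishes. Each of the two real integrations is a Beta
  integral between the zeros and raises the exponent by 1/2. What remains is a constant times
  \<open>C powr (c + 1) / A\<close>, and this is at most the constant for \<open>1 \<le> A\<close>
  and \<open>C \<le> 1\<close>.\<close>

lemma quad_bound:
  fixes c :: real
  assumes c: "-1 < c"
  shows "\<exists>K\<ge>0. \<forall>A C u0 y0. 1 \<le> A \<longrightarrow> C \<le> 1 \<longrightarrow>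
    (\<integral>\<^sup>+y. \<integral>\<^sup>+u. (if 0 < C - A * ((u - u0)\<^sup>2 + (y - y0)\<^sup>2) then ennreal ((C - A * ((u - u0)\<^sup>2 + (y - y0)\<^sup>2)) powr c) else 0) \<partial>lborel \<partial>lborel) \<le> ennreal K"
proof -
  obtain K1 where K1: "0 \<le> K1" "\<And>s r. s < r \<Longrightarrow> (\<integral>\<^sup>+x. ennreal ((x - s) powr c * (r - x) powr c) * indicator {s<..<r} x \<partial>lborel)
     \<le> ennreal (K1 * (r - s) powr (c + c + 1))" using beta_bound[OF c c] by blast
  have c2: "-1 < c + 1/2" using c by simp
  obtain K2 where K2: "0 \<le> K2" "\<And>s r. s < r \<Longrightarrow> (\<integral>\<^sup>+x. ennreal ((x - s) powr (c + 1/2) * (r - x) powr (c + 1/2)) * indicator {s<..<r} x \<partial>lborel)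
     \<le> ennreal (K2 * (r - s) powr ((c + 1/2) + (c + 1/2) + 1))" using beta_bound[OF c2 c2] by blast
  define K where "K = K1 * 2 powr (2 * c + 1) * (K2 * 2 powr (2 * c + 2))"
  have K0: "0 \<le> K" using K1 K2 by (simp add: K_def)
  have dbl: "(2 * sqrt k) powr (2 * d) = 2 powr (2 * d) * k powr d" if "0 < k" for k d :: real
    using that by (simp add: powr_mult powr_half_sqrt[symmetric] powr_powr)
  have "(\<integral>\<^sup>+y. \<integral>\<^sup>+u. (if 0 < C - A * ((u - u0)\<^sup>2 + (y - y0)\<^sup>2) then ennreal ((C - A * ((u - u0)\<^sup>2 + (y - y0)\<^sup>2)) powr c) else 0) \<partial>lborel \<partial>lborel) \<le> ennreal K"
    if A: "1 \<le> A" and C: "C \<le> 1" for A C u0 y0 :: real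
  proof -
    let ?L = "\<lambda>u y. C - A * ((u - u0)\<^sup>2 + (y - y0)\<^sup>2)"
    let ?k = "\<lambda>y. C / A - (y - y0)\<^sup>2"
    define K3 where "K3 = A powr c * (K1 * 2 powr (2 * c + 1))"
    have K3: "0 \<le> K3" using K1 by (simp add: K3_def)
    have Lk: "?L u y = A * (?k y - (u - u0)\<^sup>2)" for u y using A by (simp add: field_simps)
    have inner: "(\<integral>\<^sup>+u. (if 0 < ?L u y then ennreal (?L u y powr c) else 0) \<partial>lborel) \<le> (if 0 < ?k y then ennreal (K3 * ?k y powr (c + 1/2)) else 0)" for y
    proof (cases "0 < ?k y")
      case True
      define w where "w = sqrt (?k y)"
      have w: "0 < w" "w\<^sup>2 = ?k y" using True by (simp_all add: w_def)
      have "(if 0 < ?L u y then ennreal (?L u y powr c) else 0) \<le>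
        ennreal (A powr c) * (ennreal ((u - (u0 - w)) powr c * ((u0 + w) - u) powr c) * indicator {u0 - w<..<u0 + w} u)" for u
      proof (cases "0 < ?L u y")
        case L: True
        then have "(u - u0)\<^sup>2 < w\<^sup>2" unfolding Lk w(2) using A by (simp add: zero_less_mult_iff)
        then have uw: "\<bar>u - u0\<bar> < w" using w(1) by (metis abs_le_square_iff abs_of_pos not_le)
        have "?k y - (u - u0)\<^sup>2 = (u - (u0 - w)) * ((u0 + w) - u)" unfolding w(2)[symmetric] by (simp add: algebra_simps power2_eq_square)
        moreover have p: "0 < u - (u0 - w)" "0 < (u0 + w) - u" using uw by linarith+
        ultimately have "?L u y powr c = A powr c * ((u - (u0 - w)) powr c * ((u0 + w) - u) powr c)"
          unfolding Lk using A by (simp add: powr_mult)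
        then show ?thesis using L p by (simp add: ennreal_mult)
      qed simp
      then have "(\<integral>\<^sup>+u. (if 0 < ?L u y then ennreal (?L u y powr c) else 0) \<partial>lborel) \<le>
        (\<integral>\<^sup>+u. ennreal (A powr c) * (ennreal ((u - (u0 - w)) powr c * ((u0 + w) - u) powr c) * indicator {u0 - w<..<u0 + w} u) \<partial>lborel)"
        by (intro nn_integral_mono) auto
      also have "\<dots> = ennreal (A powr c) * (\<integral>\<^sup>+u. (ennreal ((u - (u0 - w)) powr c * ((u0 + w) - u) powr c) * indicator {u0 - w<..<u0 + w} u) \<partial>lborel)"
        by (rule nn_integral_cmult) auto
      also have "\<dots> \<le> ennreal (A powr c) * ennreal (K1 * (u0 + w - (u0 - w)) powr (c + c + 1))"
        using w by (intro mult_left_mono K1(2)) auto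
      also have "u0 + w - (u0 - w) = 2 * sqrt (?k y)" by (simp add: w_def)
      also have "(2 * sqrt (?k y)) powr (c + c + 1) = 2 powr (2 * c + 1) * ?k y powr (c + 1/2)"
        using dbl[OF True, of "c + 1/2"] by (simp add: algebra_simps)
      also have "ennreal (A powr c) * ennreal (K1 * (2 powr (2 * c + 1) * ?k y powr (c + 1/2))) = ennreal (K3 * ?k y powr (c + 1/2))"
        using K1 by (simp add: K3_def ennreal_mult[symmetric] mult_ac)
      finally show ?thesis using True by simp
    next
      case False
      then have "\<not> 0 < ?L u y" for u 
      proof -
        have "?k y - (u - u0)\<^sup>2 \<le> 0" using False zero_le_power2[of "u - u0"] by linarith
        then show ?thesis unfolding Lk using A by (simp add: mult_nonneg_nonpos not_less)
      qed
      then show ?thesis by simp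
    qed
    have "(\<integral>\<^sup>+y. \<integral>\<^sup>+u. (if 0 < ?L u y then ennreal (?L u y powr c) else 0) \<partial>lborel \<partial>lborel)
      \<le> (\<integral>\<^sup>+y. (if 0 < ?k y then ennreal (K3 * ?k y powr (c + 1/2)) else 0) \<partial>lborel)"
      by (intro nn_integral_mono inner)
    also have "\<dots> \<le> ennreal K"
    proof (cases "0 < C")
      case True
      define p where "p = sqrt (C / A)"
      have p: "0 < p" "p\<^sup>2 = C / A" using True A by (simp_all add: p_def)
      have "(if 0 < ?k y then ennreal (K3 * ?k y powr (c + 1/2)) else 0) \<le>
        ennreal K3 * (ennreal ((y - (y0 - p)) powr (c + 1/2) * ((y0 + p) - y) powr (c + 1/2)) * indicator {y0 - p<..<y0 + p} y)" for y
      proof (cases "0 < ?k y")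
        case L: True
        then have "(y - y0)\<^sup>2 < p\<^sup>2" unfolding p(2) by simp
        then have yp: "\<bar>y - y0\<bar> < p" using p(1) by (metis abs_le_square_iff abs_of_pos not_le)
        have "?k y = (y - (y0 - p)) * ((y0 + p) - y)" unfolding p(2)[symmetric] by (simp add: algebra_simps power2_eq_square)
        moreover have q: "0 < y - (y0 - p)" "0 < (y0 + p) - y" using yp by linarith+
        ultimately have "?k y powr (c + 1/2) = (y - (y0 - p)) powr (c + 1/2) * ((y0 + p) - y) powr (c + 1/2)"
          by (simp add: powr_mult)
        then show ?thesis using L q K3 by (simp add: ennreal_mult)
      qed simp
      then have "(\<integral>\<^sup>+y. (if 0 < ?k y then ennreal (K3 * ?k y powr (c + 1/2)) else 0) \<partial>lborel) \<le>
        (\<integral>\<^sup>+y. ennreal K3 * (ennreal ((y - (y0 - p)) powr (c + 1/2) * ((y0 + p) - y) powr (c + 1/2)) * indicator {y0 - p<..<y0 + p} y) \<partial>lborel)"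
        by (intro nn_integral_mono) auto
      also have "\<dots> = ennreal K3 * (\<integral>\<^sup>+y. (ennreal ((y - (y0 - p)) powr (c + 1/2) * ((y0 + p) - y) powr (c + 1/2)) * indicator {y0 - p<..<y0 + p} y) \<partial>lborel)"
        by (rule nn_integral_cmult) auto
      also have "\<dots> \<le> ennreal K3 * ennreal (K2 * (y0 + p - (y0 - p)) powr ((c + 1/2) + (c + 1/2) + 1))"
        using p by (intro mult_left_mono K2(2)) auto
      also have "y0 + p - (y0 - p) = 2 * sqrt (C / A)" by (simp add: p_def)
      also have "(2 * sqrt (C / A)) powr ((c + 1/2) + (c + 1/2) + 1) = 2 powr (2 * c + 2) * (C / A) powr (c + 1)"
        using dbl[of "C / A" "c + 1"] True A by (simp add: algebra_simps)
      also have "ennreal K3 * ennreal (K2 * (2 powr (2 * c + 2) * (C / A) powr (c + 1))) = ennreal (K * (A powr c * (C / A) powr (c + 1)))"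
        using K1 K2 K3 by (simp add: K3_def K_def ennreal_mult[symmetric] mult_ac)
      also have "\<dots> \<le> ennreal (K * 1)"
      proof (intro ennreal_leI mult_left_mono K0)
        have "A powr c * (C / A) powr (c + 1) = C powr (c + 1) / A"
          using True A by (simp add: powr_divide powr_add)
        also have "\<dots> \<le> 1 / 1" using True A C c by (intro frac_le powr_le1) auto
        finally show "A powr c * (C / A) powr (c + 1) \<le> 1" by simp
      qed
      finally show ?thesis by simp
    next
      case False
      have "C / A \<le> 0" using False A by (simp add: divide_nonpos_pos)
      then have "\<not> 0 < ?k y" for y using zero_le_power2[of "y - y0"] by linarith
      then show ?thesis by simp
    qed
    finally show ?thesis .
  qed
  then show ?thesis using K0 by blast
qed

section \<open>Schur complements\<close>

text \<open>Right multiplication by the unitriangular block matrix \<open>?U\<close> clears the last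
  column above the diagonal, since \<open>A0 * B = 1\<close>; the corner entry becomes the Schur
  complement.\<close>

lemma schur_det:
  fixes A :: "complex mat"
  assumes A: "A \<in> carrier_mat (Suc m) (Suc m)" and B: "B \<in> carrier_mat m m"
    and A0: "A0 \<in> carrier_mat m m" "\<And>i j. i < m \<Longrightarrow> j < m \<Longrightarrow> A0 $$ (i, j) = A $$ (i, j)"
    and inv: "A0 * B = 1\<^sub>m m"
  shows "Determinant.det A = Determinant.det A0 * (A $$ (m, m) - (\<Sum>i<m. \<Sum>j<m. A $$ (m, i) * B $$ (i, j) * A $$ (j, m)))"
proof -
  define V where "V = mat m 1 (\<lambda>(i, _). A $$ (i, m))"
  define W where "W = mat 1 m (\<lambda>(_, j). A $$ (m, j))"
  define D where "D = mat 1 1 (\<lambda>_. A $$ (m, m))"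
  have c: "V \<in> carrier_mat m 1" "W \<in> carrier_mat 1 m" "D \<in> carrier_mat 1 1" by (simp_all add: V_def W_def D_def)
  have BV: "B * V \<in> carrier_mat m 1" using B c by simp
  have Ab: "A = four_block_mat A0 V W D"
    by (rule eq_matI) (use A A0 in \<open>auto simp: V_def W_def D_def four_block_mat_def Let_def less_Suc_eq\<close>)
  let ?U = "four_block_mat (1\<^sub>m m) (- (B * V)) (0\<^sub>m 1 m) (1\<^sub>m 1) :: complex mat"
  have U: "?U \<in> carrier_mat (m + 1) (m + 1)" by (rule four_block_carrier_mat) auto
  have nBV: "- (B * V) \<in> carrier_mat m 1" using BV by simp
  have dU: "Determinant.det ?U = 1"
    by (subst det_four_block_mat_lower_left_zero[OF _ nBV refl]) auto
  have "A * ?U = four_block_mat (A0 * 1\<^sub>m m + V * 0\<^sub>m 1 m) (A0 * (- (B * V)) + V * 1\<^sub>m 1) (W * 1\<^sub>m m + D * 0\<^sub>m 1 m) (W * (- (B * V)) + D * 1\<^sub>m 1)"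
    unfolding Ab by (rule mult_four_block_mat[OF A0(1) c(1,2,3) _ nBV]) auto
  also have "A0 * (- (B * V)) + V * 1\<^sub>m 1 = 0\<^sub>m m 1"
  proof -
    have "A0 * (- (B * V)) = - (A0 * (B * V))" using A0(1) BV by (intro eq_matI) (auto simp: scalar_prod_def sum_negf)
    also have "A0 * (B * V) = A0 * B * V" using A0 B c by (simp add: assoc_mult_mat[of _ m m _ m _ 1])
    also have "\<dots> = V" using inv c by simp
    finally show ?thesis using c by (intro eq_matI) auto
  qed
  finally have "Determinant.det (A * ?U) = Determinant.det (A0 * 1\<^sub>m m + V * 0\<^sub>m 1 m) * Determinant.det (W * (- (B * V)) + D * 1\<^sub>m 1)"
    using A0 c nBV by (subst det_four_block_mat_upper_right_zero[OF _ refl, symmetric, of _ m _ 1]) auto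
  moreover have "A0 * 1\<^sub>m m + V * 0\<^sub>m 1 m = A0" using A0 c by (intro eq_matI) auto
  moreover have "Determinant.det (A * ?U) = Determinant.det A" using det_mult[of A "Suc m" ?U] A U dU by simp
  moreover have "Determinant.det (W * (- (B * V)) + D * 1\<^sub>m 1) = A $$ (m, m) - (\<Sum>i<m. \<Sum>j<m. A $$ (m, i) * B $$ (i, j) * A $$ (j, m))"
  proof -
    have e: "(B * V) $$ (i, 0) = (\<Sum>j<m. B $$ (i, j) * A $$ (j, m))" if "i < m" for i
    proof -
      have "(B * V) $$ (i, 0) = (\<Sum>j\<in>{0..<m}. B $$ (i, j) * V $$ (j, 0))" using that B c by (simp add: scalar_prod_def)
      also have "\<dots> = (\<Sum>j<m. B $$ (i, j) * A $$ (j, m))" unfolding atLeast0LessThan by (intro sum.cong) (auto simp: V_def)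
      finally show ?thesis .
    qed
    define M where "M = - (B * V)"
    have Mc: "M \<in> carrier_mat m 1" unfolding M_def by (rule nBV)
    have Mi: "M $$ (i, 0) = - (\<Sum>j<m. B $$ (i, j) * A $$ (j, m))" if "i < m" for i
      unfolding M_def using e[OF that] that carrier_matD[OF BV] by simp
    have "(W * M) $$ (0, 0) = (\<Sum>i\<in>{0..<m}. W $$ (0, i) * M $$ (i, 0))" using c Mc by (simp add: scalar_prod_def)
    also have "\<dots> = (\<Sum>i<m. - (\<Sum>j<m. A $$ (m, i) * B $$ (i, j) * A $$ (j, m)))"
      unfolding atLeast0LessThan using Mi by (intro sum.cong refl) (auto simp: W_def sum_distrib_left mult.assoc)
    finally have "(W * M) $$ (0, 0) = (\<Sum>i<m. - (\<Sum>j<m. A $$ (m, i) * B $$ (i, j) * A $$ (j, m)))" .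
    then have w: "(W * (- (B * V))) $$ (0, 0) = - (\<Sum>i<m. \<Sum>j<m. A $$ (m, i) * B $$ (i, j) * A $$ (j, m))"
      unfolding M_def by (simp only: sum_negf)
    have M: "W * (- (B * V)) + D * 1\<^sub>m 1 \<in> carrier_mat 1 1" using c nBV by simp
    have "Determinant.det (W * (- (B * V)) + D * 1\<^sub>m 1) = (W * (- (B * V)) + D * 1\<^sub>m 1) $$ (0, 0)"
      using det_single[OF M] by simp
    also have "\<dots> = (W * (- (B * V))) $$ (0, 0) + D $$ (0, 0)" using c nBV by simp
    finally show ?thesis using w by (simp add: D_def)
  qed
  ultimately show ?thesis by simp
qed

lemma bform_cong:
  assumes "\<And>i. i < m \<Longrightarrow> v i = v' i" "\<And>i j. i < m \<Longrightarrow> j < m \<Longrightarrow> A $$ (i, j) = A' $$ (i, j)"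
  shows "bform m A v v = bform m A' v' v'"
  unfolding bform_def using assms by (intro sum.cong refl) auto

text \<open>The conjugate transpose of the inverse is again a left inverse, which makes
  \<open>B\<close> hermitian, and the form of \<open>B\<close> at \<open>v\<close> is the form of
  \<open>Y\<close> at \<open>B v\<close>. The bound on the first diagonal entry is prepared for the
  assumption \<open>1 \<le> A\<close> of \<open>quad_bound\<close>.\<close>

lemma posdef_inverse:
  assumes h: "herm m Y" and pd: "posdef m Y"
  shows "\<exists>B. herm m B \<and> posdef m B \<and> Y * B = 1\<^sub>m m \<and> (0 < m \<longrightarrow> Re (Y $$ (0, 0)) \<le> 1 \<longrightarrow> 1 \<le> Re (B $$ (0, 0)))"
proof -
  have Y: "Y \<in> carrier_mat m m" by (rule herm_carrier[OF h])
  have "Determinant.det Y \<noteq> 0" using cpos_det[OF h] cpos_iff_posdef[OF h] pd by auto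
  define B where "B = inverse (Determinant.det Y) \<cdot>\<^sub>m adj_mat Y"
  have B: "B \<in> carrier_mat m m" unfolding B_def using adj_mat(1)[OF Y] by simp
  have BY: "B * Y = 1\<^sub>m m"
    unfolding B_def using adj_mat(1,3)[OF Y] Y \<open>Determinant.det Y \<noteq> 0\<close>
    by (subst mult_smult_assoc_mat[of _ m m _ m]) (auto intro!: eq_matI)
  have YB: "Y * B = 1\<^sub>m m" using mat_mult_left_right_inverse[OF B Y BY] .
  define C where "C = mat m m (\<lambda>(i, j). cnj (B $$ (j, i)))"
  have C: "C \<in> carrier_mat m m" by (simp add: C_def)
  have CY: "C * Y = 1\<^sub>m m"
  proof (rule eq_matI)
    fix i j assume "i < dim_row (1\<^sub>m m :: complex mat)" "j < dim_col (1\<^sub>m m :: complex mat)"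
    then have ij: "i < m" "j < m" by auto
    have "(C * Y) $$ (i, j) = (\<Sum>k<m. C $$ (i, k) * Y $$ (k, j))" by (rule index_mult_mat_sum[OF C Y ij])
    also have "\<dots> = (\<Sum>k<m. cnj (Y $$ (j, k) * B $$ (k, i)))"
      using ij hermD[OF h ij(2)] by (intro sum.cong refl) (simp add: C_def mult.commute)
    also have "\<dots> = cnj ((Y * B) $$ (j, i))" unfolding index_mult_mat_sum[OF Y B ij(2,1)] by simp
    finally show "(C * Y) $$ (i, j) = 1\<^sub>m m $$ (i, j)" unfolding YB using ij by auto
  qed (use C Y in auto)
  have "C = C * (Y * B)" unfolding YB using C by simp
  also have "\<dots> = B" using assoc_mult_mat[OF C Y B] CY B by simp
  finally have CB: "C = B" .
  have hB: "herm m B" unfolding herm_def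
  proof (intro conjI B allI impI)
    fix i j assume "i < m" "j < m"
    then have "C $$ (j, i) = cnj (B $$ (i, j))" by (simp add: C_def)
    then show "B $$ (j, i) = cnj (B $$ (i, j))" unfolding CB .
  qed
  have YBv: "(\<Sum>j<m. Y $$ (i, j) * (\<Sum>l<m. B $$ (j, l) * v l)) = v i" if i: "i < m" for v i
  proof -
    have "(\<Sum>j<m. Y $$ (i, j) * (\<Sum>l<m. B $$ (j, l) * v l)) = (\<Sum>l<m. (\<Sum>j<m. Y $$ (i, j) * B $$ (j, l)) * v l)"
      by (subst sum_distrib_left, subst sum.swap) (simp add: sum_distrib_right mult.assoc)
    also have "\<dots> = (\<Sum>l<m. if l = i then v l else 0)"
      using i by (intro sum.cong refl) (auto simp: index_mult_mat_sum[OF Y B, symmetric] YB)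
    finally show ?thesis using i by simp
  qed
  have bw: "bform m B v v = bform m Y (\<lambda>j. \<Sum>l<m. B $$ (j, l) * v l) (\<lambda>j. \<Sum>l<m. B $$ (j, l) * v l)" for v
  proof -
    let ?w = "\<lambda>j. \<Sum>l<m. B $$ (j, l) * v l"
    have "bform m Y ?w ?w = (\<Sum>i<m. cnj (?w i) * (\<Sum>j<m. Y $$ (i, j) * ?w j))"
      unfolding bform_def by (simp only: sum_distrib_left mult.assoc)
    also have "\<dots> = (\<Sum>i<m. cnj (?w i) * v i)" using YBv by (intro sum.cong refl) simp
    also have "\<dots> = cnj (bform m B v v)"
      unfolding bform_def by (simp add: sum_distrib_left sum_distrib_right mult_ac)
    finally show ?thesis using bform_real[OF hB, of v] by (metis complex_cnj_complex_of_real)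
  qed
  have pB: "posdef m B" unfolding posdef_def
  proof (intro allI impI)
    fix v :: "nat \<Rightarrow> complex" assume v: "\<exists>i<m. v i \<noteq> 0"
    have "\<exists>i<m. (\<Sum>l<m. B $$ (i, l) * v l) \<noteq> 0"
    proof (rule ccontr)
      assume "\<not> ?thesis"
      then have "v i = 0" if "i < m" for i using YBv[OF that, of v] by simp
      then show False using v by blast
    qed
    then show "0 < Re (bform m B v v)" unfolding bw by (rule pd[unfolded posdef_def, rule_format])
  qed
  have "1 \<le> Re (B $$ (0, 0))" if m: "0 < m" and Y0: "Re (Y $$ (0, 0)) \<le> 1"
  proof -
    let ?e = "\<lambda>k. if k = 0 then 1 else 0 :: complex"
    let ?w = "\<lambda>j. \<Sum>l<m. B $$ (j, l) * ?e l"
    have q1: "bform m Y ?w ?w = B $$ (0, 0)" unfolding bw[of ?e, symmetric] by (rule bform_unit[OF m])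
    have q2: "bform m Y ?e ?w = 1"
    proof -
      have "bform m Y ?e ?w = (\<Sum>i<m. cnj (?e i) * (\<Sum>j<m. Y $$ (i, j) * ?w j))"
        unfolding bform_def by (simp only: sum_distrib_left mult.assoc)
      also have "\<dots> = (\<Sum>i<m. cnj (?e i) * ?e i)" using YBv[of _ ?e] by (intro sum.cong refl) (simp only: lessThan_iff)
      also have "\<dots> = (\<Sum>i<m. if i = 0 then 1 else 0)" by (intro sum.cong) auto
      also have "\<dots> = 1" using m by simp
      finally show ?thesis .
    qed
    have q3: "bform m Y ?w ?e = 1" using bform_sym[OF h, of ?w ?e] q2 by simp
    have q4: "bform m Y ?e ?e = Y $$ (0, 0)" by (rule bform_unit[OF m])
    \<comment> \<open>With \<open>w\<close> the image under \<open>B\<close> of the first unit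
      vector \<open>e\<close>, the form of \<open>Y\<close> at \<open>w - e\<close> has real part
      equal to that of the first diagonal entries of \<open>B\<close> and \<open>Y\<close> added,
      minus 2.\<close>
    have "0 \<le> Re (bform m Y (\<lambda>i. ?w i - of_real 1 * ?e i) (\<lambda>i. ?w i - of_real 1 * ?e i))"
    proof (cases "\<exists>i<m. ?w i - of_real 1 * ?e i \<noteq> 0")
      case True
      then show ?thesis using pd unfolding posdef_def by (simp add: less_imp_le)
    next
      case False
      then have "bform m Y (\<lambda>i. ?w i - of_real 1 * ?e i) (\<lambda>i. ?w i - of_real 1 * ?e i) = bform m Y (\<lambda>_. 0) (\<lambda>_. 0)"
        by (intro bform_cong) auto
      then show ?thesis by (simp add: bform_def)
    qed
    then have "0 \<le> Re (B $$ (0, 0)) - 2 + Re (Y $$ (0, 0))"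
      unfolding bform_diff[of m Y ?w 1 ?e] q1 q2 q3 q4 by simp
    then show ?thesis using Y0 by simp
  qed
  then show ?thesis using hB pB YB by blast
qed

lemma herm_of_index:
  assumes "i < N" "j < N"
  shows "herm_of N x $$ (i, j) = (if i = j then complex_of_real (x (i, i))
     else if i < j then Complex (x (i, j)) (x (j, i)) else Complex (x (j, i)) (- x (i, j)))"
  using assms by (simp add: herm_of_def)

lemma herm_of_cong:
  assumes "\<And>p. p \<in> idx N \<Longrightarrow> x p = y p" shows "herm_of N x = herm_of N y"
  by (rule eq_matI) (use assms in \<open>auto simp: herm_of_def\<close>)

lemma good_cong: "(\<And>p. p \<in> idx N \<Longrightarrow> x p = y p) \<Longrightarrow> good N x = good N y"
  unfolding good_def using herm_of_cong[of N x y] by simp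

lemma dt_cong: "(\<And>p. p \<in> idx N \<Longrightarrow> x p = y p) \<Longrightarrow> dt N x = dt N y"
  unfolding dt_def using herm_of_cong[of N x y] by simp

lemma du_cong: "(\<And>p. p \<in> idx N \<Longrightarrow> x p = y p) \<Longrightarrow> du N x = du N y"
  unfolding du_def using herm_of_cong[of N x y] by simp

lemma posdef_restrict:
  assumes "posdef (Suc m) A" "\<And>i j. i < m \<Longrightarrow> j < m \<Longrightarrow> A0 $$ (i, j) = A $$ (i, j)" shows "posdef m A0"
  unfolding posdef_def
proof (intro allI impI)
  fix v :: "nat \<Rightarrow> complex" assume v: "\<exists>i<m. v i \<noteq> 0"
  let ?v = "v(m := 0)"
  have "\<exists>i<Suc m. ?v i \<noteq> 0" using v by (metis fun_upd_other less_SucI less_irrefl)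
  then have "0 < Re (bform (Suc m) A ?v ?v)" using assms(1) unfolding posdef_def by blast
  moreover have "bform (Suc m) A ?v ?v = bform m A0 v v"
    unfolding bform_def using assms(2) by (simp add: lessThan_Suc)
  ultimately show "0 < Re (bform m A0 v v)" by simp
qed

lemma good_restrict:
  assumes "good (Suc m) x" shows "good m x"
proof -
  have "posdef m (herm_of m x)" using assms good_posdef
    by (intro posdef_restrict[of m "herm_of (Suc m) x"]) (auto simp: herm_of_index)
  moreover have "posdef m (1\<^sub>m m - herm_of m x)"
    using assms good_posdef carrier_matD[OF herm_of_carrier]
    by (intro posdef_restrict[of m "1\<^sub>m (Suc m) - herm_of (Suc m) x"]) (auto simp: herm_of_index)
  ultimately show ?thesis by (simp add: good_posdef)
qed

definition vcol :: "nat \<Rightarrow> (nat \<times> nat \<Rightarrow> real) \<Rightarrow> nat \<Rightarrow> complex" where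
  "vcol m x i = Complex (x (i, m)) (x (m, i))"

text \<open>\<open>B\<close> and \<open>B'\<close> are the inverses of the upper left blocks of
  \<open>X\<close> and \<open>1 - X\<close>, hence the same for all extensions \<open>x'\<close> by
  a further row and column. Both determinants become affine in the new diagonal entry, with slopes
  of opposite sign.\<close>

lemma good_schur:
  assumes g: "good m x"
  shows "\<exists>B B'. herm m B \<and> posdef m B \<and> herm m B' \<and> posdef m B' \<and> (0 < m \<longrightarrow> 1 \<le> Re (B $$ (0, 0))) \<and>
    (\<forall>x'. (\<forall>p\<in>idx m. x' p = x p) \<longrightarrow>
      dt (Suc m) x' = dt m x * (x' (m, m) - Re (bform m B (vcol m x') (vcol m x'))) \<and>
      du (Suc m) x' = du m x * (1 - Re (bform m B' (vcol m x') (vcol m x')) - x' (m, m)))"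
proof -
  let ?Y = "herm_of m x" and ?Y' = "1\<^sub>m m - herm_of m x"
  have pd: "posdef m ?Y" "posdef m ?Y'" using g good_posdef by auto
  have h: "herm m ?Y" "herm m ?Y'" using herm_herm_of herm_one_minus by blast+
  obtain B where B: "herm m B" "posdef m B" "?Y * B = 1\<^sub>m m" "0 < m \<Longrightarrow> Re (?Y $$ (0, 0)) \<le> 1 \<Longrightarrow> 1 \<le> Re (B $$ (0, 0))"
    using posdef_inverse[OF h(1) pd(1)] by blast
  obtain B' where B': "herm m B'" "posdef m B'" "?Y' * B' = 1\<^sub>m m"
    using posdef_inverse[OF h(2) pd(2)] by blast
  have B0: "1 \<le> Re (B $$ (0, 0))" if m: "0 < m"
    using good_entries[OF g m m] abs_Re_le_cmod[of "?Y $$ (0, 0)"] by (intro B(4) m) linarith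
  have "dt (Suc m) x' = dt m x * (x' (m, m) - Re (bform m B (vcol m x') (vcol m x'))) \<and>
      du (Suc m) x' = du m x * (1 - Re (bform m B' (vcol m x') (vcol m x')) - x' (m, m))"
    if x': "\<forall>p\<in>idx m. x' p = x p" for x'
  proof
    let ?X = "herm_of (Suc m) x'"
    have ent: "?Y $$ (i, j) = ?X $$ (i, j)" if "i < m" "j < m" for i j
      using that x' by (simp add: herm_of_index)
    have col: "?X $$ (i, m) = vcol m x' i" "?X $$ (m, i) = cnj (vcol m x' i)" if "i < m" for i
      using that by (simp_all add: herm_of_index vcol_def complex_eq_iff)
    have mm: "?X $$ (m, m) = of_real (x' (m, m))" by (simp add: herm_of_index)
    have "Determinant.det ?X = Determinant.det ?Y * (?X $$ (m, m) - (\<Sum>i<m. \<Sum>j<m. ?X $$ (m, i) * B $$ (i, j) * ?X $$ (j, m)))"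
      by (rule schur_det[OF herm_of_carrier herm_carrier[OF B(1)] herm_of_carrier ent B(3)])
    also have "(\<Sum>i<m. \<Sum>j<m. ?X $$ (m, i) * B $$ (i, j) * ?X $$ (j, m)) = bform m B (vcol m x') (vcol m x')"
      unfolding bform_def by (intro sum.cong refl) (simp add: col)
    also have "\<dots> = of_real (Re (bform m B (vcol m x') (vcol m x')))" by (rule bform_real[OF B(1)])
    finally have "of_real (dt (Suc m) x') = (of_real (dt m x * (x' (m, m) - Re (bform m B (vcol m x') (vcol m x')))) :: complex)"
      unfolding det_dt mm by simp
    then show "dt (Suc m) x' = dt m x * (x' (m, m) - Re (bform m B (vcol m x') (vcol m x')))" by (simp only: of_real_eq_iff)
    let ?X' = "1\<^sub>m (Suc m) - herm_of (Suc m) x'"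
    have ix: "?X' $$ (i, j) = (if i = j then 1 else 0) - ?X $$ (i, j)" if "i < Suc m" "j < Suc m" for i j
      using that carrier_matD[OF herm_of_carrier[of "Suc m" x']] by simp
    have ent': "?Y' $$ (i, j) = ?X' $$ (i, j)" if "i < m" "j < m" for i j
      using that ix[of i j] ent carrier_matD[OF herm_of_carrier[of m x]] by simp
    have "Determinant.det ?X' = Determinant.det ?Y' * (?X' $$ (m, m) - (\<Sum>i<m. \<Sum>j<m. ?X' $$ (m, i) * B' $$ (i, j) * ?X' $$ (j, m)))"
      by (rule schur_det[OF one_minus_carrier herm_carrier[OF B'(1)] one_minus_carrier ent' B'(3)])
    also have "(\<Sum>i<m. \<Sum>j<m. ?X' $$ (m, i) * B' $$ (i, j) * ?X' $$ (j, m)) = bform m B' (vcol m x') (vcol m x')"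
      unfolding bform_def by (intro sum.cong refl) (simp add: ix col)
    also have "\<dots> = of_real (Re (bform m B' (vcol m x') (vcol m x')))" by (rule bform_real[OF B'(1)])
    also have "?X' $$ (m, m) = of_real (1 - x' (m, m))" using ix[of m m] mm by simp
    finally have "of_real (du (Suc m) x') = (of_real (du m x * (1 - x' (m, m) - Re (bform m B' (vcol m x') (vcol m x')))) :: complex)"
      unfolding det_du by simp
    then show "du (Suc m) x' = du m x * (1 - Re (bform m B' (vcol m x') (vcol m x')) - x' (m, m))"
      by (simp only: of_real_eq_iff) simp
  qed
  then show ?thesis using B(1,2) B'(1,2) B0 by blast
qed

text \<open>Completing the square in the first entry \<open>z\<close> of the column, with centre
  \<open>z0\<close>. The constant \<open>C\<close> is the value at \<open>z0\<close>, hence 1 minus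
  a nonnegative number.\<close>

lemma quad_form:
  assumes hH: "herm m H" and pd: "posdef m H" and m: "0 < m" and H1: "1 \<le> Re (H $$ (0, 0))"
  shows "\<exists>C z0. C \<le> 1 \<and> (\<forall>z. 1 - Re (bform m H (v(0 := z)) (v(0 := z))) =
     C - Re (H $$ (0, 0)) * ((Re z - Re z0)\<^sup>2 + (Im z - Im z0)\<^sup>2))"
proof -
  define h where "h = Re (H $$ (0, 0))"
  define b where "b = (\<Sum>j\<in>{1..<m}. H $$ (0, j) * v j)"
  define q where "q = Re (bform m H (v(0 := 0)) (v(0 := 0)))"
  have h0: "H $$ (0, 0) = of_real h" using hermD[OF hH m m] by (simp add: complex_eq_iff h_def)
  have sp: "(\<Sum>i<m. f i) = f 0 + (\<Sum>i\<in>{1..<m}. f i)" for f :: "nat \<Rightarrow> complex"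
  proof -
    have "{..<m} = insert 0 {1..<m}" using m by auto
    then show ?thesis by simp
  qed
  have e: "bform m H (v(0 := z)) (v(0 := z)) =
     of_real h * (cnj z * z) + cnj z * b + cnj (cnj z * b) + (\<Sum>i\<in>{1..<m}. \<Sum>j\<in>{1..<m}. cnj (v i) * H $$ (i, j) * v j)" for z
  proof -
    have c: "(\<Sum>i\<in>{1..<m}. cnj (v i) * H $$ (i, 0) * z) = cnj (cnj z * b)"
      unfolding b_def cnj_sum sum_distrib_left using m by (intro sum.cong refl) (auto simp: hermD[OF hH, of 0] mult_ac)
    have "bform m H (v(0 := z)) (v(0 := z)) = cnj z * H $$ (0, 0) * z + (\<Sum>j\<in>{1..<m}. cnj z * H $$ (0, j) * v j) +
       ((\<Sum>i\<in>{1..<m}. cnj (v i) * H $$ (i, 0) * z) + (\<Sum>i\<in>{1..<m}. \<Sum>j\<in>{1..<m}. cnj (v i) * H $$ (i, j) * v j))"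
      unfolding bform_def sp sum.distrib[symmetric]
      by (intro arg_cong2[of _ _ _ _ "(+)"] sum.cong refl) auto
    then show ?thesis unfolding c h0 by (simp add: b_def sum_distrib_left mult_ac)
  qed
  have q': "q = Re (\<Sum>i\<in>{1..<m}. \<Sum>j\<in>{1..<m}. cnj (v i) * H $$ (i, j) * v j)" unfolding q_def e by simp
  have Re: "Re (bform m H (v(0 := z)) (v(0 := z))) = h * ((Re z)\<^sup>2 + (Im z)\<^sup>2) + 2 * (Re z * Re b + Im z * Im b) + q" for z
    unfolding e q' by (simp add: power2_eq_square algebra_simps)
  define z0 where "z0 = - b / of_real h"
  define C where "C = 1 - q + ((Re b)\<^sup>2 + (Im b)\<^sup>2) / h"
  have main: "1 - Re (bform m H (v(0 := z)) (v(0 := z))) = C - h * ((Re z - Re z0)\<^sup>2 + (Im z - Im z0)\<^sup>2)" for z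
  proof -
    have h1: "1 \<le> h" using H1 by (simp add: h_def)
    have rb: "Re b = - (h * Re z0)" "Im b = - (h * Im z0)" using h1 by (simp_all add: z0_def)
    show ?thesis unfolding Re C_def rb using h1 by (simp add: power2_eq_square field_simps)
  qed
  have "0 \<le> Re (bform m H (v(0 := z0)) (v(0 := z0)))"
  proof (cases "\<exists>i<m. (v(0 := z0)) i \<noteq> 0")
    case True
    then show ?thesis using pd unfolding posdef_def by (simp add: less_imp_le)
  next
    case False
    then have "bform m H (v(0 := z0)) (v(0 := z0)) = bform m H (\<lambda>_. 0) (\<lambda>_. 0)" by (intro bform_cong) auto
    then show ?thesis by (simp add: bform_def)
  qed
  then have "C \<le> 1" using main[of z0] by simp
  then show ?thesis using main unfolding h_def by blast
qed

section \<open>Integrability of the weight by induction on the size\<close>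

definition wabs :: "real \<Rightarrow> real \<Rightarrow> nat \<Rightarrow> (nat \<times> nat \<Rightarrow> real) \<Rightarrow> ennreal" where
  "wabs a b N x = (if good N x then ennreal (dt N x powr a * du N x powr b) else 0)"

lemma wabs_cong: "(\<And>p. p \<in> idx N \<Longrightarrow> x p = y p) \<Longrightarrow> wabs a b N x = wabs a b N y"
  unfolding wabs_def using good_cong[of N x y] dt_cong[of N x y] du_cong[of N x y] by simp

lemma wabs_measurable [measurable]: "wabs a b N \<in> borel_measurable (herm_lebesgue N)"
proof -
  have "(\<lambda>x. ennreal (dt N x powr a * du N x powr b) * indicator (herm01 N) x) \<in> borel_measurable (herm_lebesgue N)"
    by measurable
  then show ?thesis
    by (rule measurable_cong[THEN iffD1, rotated]) (auto simp: wabs_def herm01_iff)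
qed

text \<open>Integrating out the last diagonal entry is a Beta integral over an interval of length \<open>L\<close>,
  the difference of the two Schur complements.\<close>

lemma wabs_inner:
  fixes a b :: real
  assumes ab: "-1 < a" "-1 < b"
  shows "\<exists>K\<ge>0. \<forall>m x. good m x \<longrightarrow> (\<exists>H. herm m H \<and> posdef m H \<and> (0 < m \<longrightarrow> 1 \<le> Re (H $$ (0, 0))) \<and>
    (\<forall>x'. (\<forall>p\<in>idx m. x' p = x p) \<longrightarrow>
      (\<integral>\<^sup>+t. wabs a b (Suc m) (x'((m, m) := t)) \<partial>lborel) \<le>
        wabs a b m x * ennreal K * (if 0 < 1 - Re (bform m H (vcol m x') (vcol m x'))
          then ennreal ((1 - Re (bform m H (vcol m x') (vcol m x'))) powr (a + b + 1)) else 0)))"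
proof -
  obtain K where K: "0 \<le> K" "\<And>s r. s < r \<Longrightarrow> (\<integral>\<^sup>+x. ennreal ((x - s) powr a * (r - x) powr b) * indicator {s<..<r} x \<partial>lborel)
     \<le> ennreal (K * (r - s) powr (a + b + 1))" using beta_bound[OF ab] by blast
  show ?thesis
  proof (intro exI[of _ K] conjI K(1) allI impI)
    fix m x assume g: "good m x"
    obtain B B' where B: "herm m B" "posdef m B" and B': "herm m B'" "posdef m B'" and B1: "0 < m \<Longrightarrow> 1 \<le> Re (B $$ (0, 0))"
      and D: "\<And>x'. \<forall>p\<in>idx m. x' p = x p \<Longrightarrow>
      dt (Suc m) x' = dt m x * (x' (m, m) - Re (bform m B (vcol m x') (vcol m x'))) \<and>
      du (Suc m) x' = du m x * (1 - Re (bform m B' (vcol m x') (vcol m x')) - x' (m, m))"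
      using good_schur[OF g] by blast
    define H where "H = B + B'"
    have Bc: "B \<in> carrier_mat m m" "B' \<in> carrier_mat m m" using B B' herm_carrier by auto
    have Hi: "H $$ (i, j) = B $$ (i, j) + B' $$ (i, j)" if "i < m" "j < m" for i j using that Bc by (simp add: H_def)
    have hH: "herm m H" unfolding herm_def
    proof (intro conjI allI impI)
      show "H \<in> carrier_mat m m" using Bc by (simp add: H_def)
      fix i j assume "i < m" "j < m"
      then show "H $$ (j, i) = cnj (H $$ (i, j))" using hermD[OF B(1), of i j] hermD[OF B'(1), of i j] by (simp add: Hi)
    qed
    have bH: "bform m H v v = bform m B v v + bform m B' v v" for v
      unfolding bform_def sum.distrib[symmetric] by (intro sum.cong refl) (simp add: Hi algebra_simps)
    have pH: "posdef m H" using B(2) B'(2) unfolding posdef_def bH by (simp add: add_pos_pos)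
    have H1: "1 \<le> Re (H $$ (0, 0))" if "0 < m"
      using B1[OF that] posdef_diag[OF B'(2) that] Hi[OF that that] by simp
    have pq: "0 < dt m x" "0 < du m x" using good_det[OF g] by auto
    have "(\<integral>\<^sup>+t. wabs a b (Suc m) (x'((m, m) := t)) \<partial>lborel) \<le>
        wabs a b m x * ennreal K * (if 0 < 1 - Re (bform m H (vcol m x') (vcol m x'))
          then ennreal ((1 - Re (bform m H (vcol m x') (vcol m x'))) powr (a + b + 1)) else 0)"
      if x': "\<forall>p\<in>idx m. x' p = x p" for x'
    proof -
      define s where "s = Re (bform m B (vcol m x') (vcol m x'))"
      define r where "r = 1 - Re (bform m B' (vcol m x') (vcol m x'))"
      have rs: "1 - Re (bform m H (vcol m x') (vcol m x')) = r - s" unfolding bH r_def s_def by simp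
      have vc: "bform m M (vcol m (x'((m, m) := t))) (vcol m (x'((m, m) := t))) = bform m M (vcol m x') (vcol m x')" for M t
        by (rule bform_cong) (auto simp: vcol_def)
      have d: "dt (Suc m) (x'((m, m) := t)) = dt m x * (t - s) \<and> du (Suc m) (x'((m, m) := t)) = du m x * (r - t)" for t
        using D[of "x'((m, m) := t)"] x' unfolding vc s_def r_def by auto
      have le: "wabs a b (Suc m) (x'((m, m) := t)) \<le> wabs a b m x * (ennreal ((t - s) powr a * (r - t) powr b) * indicator {s<..<r} t)" for t
      proof (cases "good (Suc m) (x'((m, m) := t))")
        case True
        have "0 < dt m x * (t - s)" "0 < du m x * (r - t)" using good_det[OF True] d[of t] by auto
        then have t: "s < t" "t < r" using pq by (auto simp: zero_less_mult_iff)
        have "wabs a b (Suc m) (x'((m, m) := t)) = ennreal ((dt m x * (t - s)) powr a * (du m x * (r - t)) powr b)"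
          using True d by (simp add: wabs_def)
        also have "(dt m x * (t - s)) powr a * (du m x * (r - t)) powr b = (dt m x powr a * du m x powr b) * ((t - s) powr a * (r - t) powr b)"
          using pq t by (simp add: powr_mult)
        also have "ennreal \<dots> = wabs a b m x * ennreal ((t - s) powr a * (r - t) powr b)"
          using g by (simp add: wabs_def ennreal_mult)
        finally have E: "wabs a b (Suc m) (x'((m, m) := t)) = wabs a b m x * ennreal ((t - s) powr a * (r - t) powr b)" .
        have "indicator {s<..<r} t = (1 :: ennreal)" using t by simp
        then show ?thesis unfolding E by (simp only: mult_1_right order_refl)
      qed (simp add: wabs_def)
      have "(\<integral>\<^sup>+t. wabs a b (Suc m) (x'((m, m) := t)) \<partial>lborel) \<le>
         (\<integral>\<^sup>+t. wabs a b m x * (ennreal ((t - s) powr a * (r - t) powr b) * indicator {s<..<r} t) \<partial>lborel)"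
        by (intro nn_integral_mono le)
      also have "\<dots> = wabs a b m x * (\<integral>\<^sup>+t. ennreal ((t - s) powr a * (r - t) powr b) * indicator {s<..<r} t \<partial>lborel)"
        by (rule nn_integral_cmult) auto
      also have "\<dots> \<le> wabs a b m x * (ennreal K * (if 0 < r - s then ennreal ((r - s) powr (a + b + 1)) else 0))"
      proof (rule mult_left_mono)
        show "(\<integral>\<^sup>+t. ennreal ((t - s) powr a * (r - t) powr b) * indicator {s<..<r} t \<partial>lborel) \<le>
          ennreal K * (if 0 < r - s then ennreal ((r - s) powr (a + b + 1)) else 0)"
          using K(2)[of s r] K(1) by (cases "s < r") (auto simp: ennreal_mult)
      qed simp
      finally show ?thesis unfolding rs by (simp only: mult.assoc)
    qed
    then show "\<exists>H. herm m H \<and> posdef m H \<and> (0 < m \<longrightarrow> 1 \<le> Re (H $$ (0, 0))) \<and>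
    (\<forall>x'. (\<forall>p\<in>idx m. x' p = x p) \<longrightarrow>
      (\<integral>\<^sup>+t. wabs a b (Suc m) (x'((m, m) := t)) \<partial>lborel) \<le>
        wabs a b m x * ennreal K * (if 0 < 1 - Re (bform m H (vcol m x') (vcol m x'))
          then ennreal ((1 - Re (bform m H (vcol m x') (vcol m x'))) powr (a + b + 1)) else 0))"
      using hH pH H1 by blast
  qed
qed

lemma nn_slice_measurable:
  fixes f :: "('i \<Rightarrow> real) \<Rightarrow> ennreal"
  assumes [measurable]: "f \<in> borel_measurable (\<Pi>\<^sub>M p\<in>insert i I. lborel)"
  shows "(\<lambda>x. \<integral>\<^sup>+t. f (x(i := t)) \<partial>lborel) \<in> borel_measurable (\<Pi>\<^sub>M p\<in>I. lborel)"
proof -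
  have "(\<lambda>(x, t). f (x(i := t))) \<in> borel_measurable ((\<Pi>\<^sub>M p\<in>I. lborel) \<Otimes>\<^sub>M lborel)"
    using measurable_compose[OF measurable_add_dim[of i I "\<lambda>_. lborel"] assms] by (simp add: split_def)
  then show ?thesis by (rule lborel.borel_measurable_nn_integral)
qed

lemma nn_integral_PiM_empty: "(\<integral>\<^sup>+x. f x \<partial>(\<Pi>\<^sub>M p\<in>{}. M p)) = f (\<lambda>_. undefined)"
  by (simp add: PiM_empty nn_integral_count_space_finite)

text \<open>Integrating the last diagonal entry leaves the length of its interval with exponent
  \<open>a + b + 1\<close>, which may be negative. Integrating one complex entry of the last column
  by \<open>quad_bound\<close> removes this singularity; the other entries of the column are
  confined to the interval from -1 to 1 and contribute a finite volume. For \<open>m = 0\<close>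
  there is no column and the interval has length 1.\<close>

lemma wabs_finite:
  fixes a b :: real
  assumes ab: "-1 < a" "-1 < b"
  shows "(\<integral>\<^sup>+x. wabs a b N x \<partial>herm_lebesgue N) < \<infinity>"
proof (induction N)
  case 0
  interpret product_sigma_finite "\<lambda>_ :: nat \<times> nat. lborel :: real measure" ..
  have "idx 0 = {}" by simp
  then show ?case unfolding herm_lebesgue_def by (simp add: PiM_empty nn_integral_count_space_finite wabs_def)
next
  case (Suc m)
  interpret product_sigma_finite "\<lambda>_ :: nat \<times> nat. lborel :: real measure" ..
  obtain K where K: "0 \<le> K" and KH: "\<And>x. good m x \<Longrightarrow> (\<exists>H. herm m H \<and> posdef m H \<and> (0 < m \<longrightarrow> 1 \<le> Re (H $$ (0, 0))) \<and>
    (\<forall>x'. (\<forall>p\<in>idx m. x' p = x p) \<longrightarrow>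
      (\<integral>\<^sup>+t. wabs a b (Suc m) (x'((m, m) := t)) \<partial>lborel) \<le>
        wabs a b m x * ennreal K * (if 0 < 1 - Re (bform m H (vcol m x') (vcol m x'))
          then ennreal ((1 - Re (bform m H (vcol m x') (vcol m x'))) powr (a + b + 1)) else 0)))"
    using wabs_inner[OF ab] by blast
  have fm: "wabs a b (Suc m) \<in> borel_measurable (\<Pi>\<^sub>M p\<in>idx (Suc m). lborel)"
    using wabs_measurable unfolding herm_lebesgue_def .
  have bad: "wabs a b (Suc m) x' = 0" if "\<not> good m x'" for x' using that good_restrict by (auto simp: wabs_def)
  show ?case
  proof (cases "m = 0")
    case True
    have i1: "idx (Suc m) = insert (0, 0) {}" using True by auto
    have g0: "good 0 x" for x unfolding good_posdef posdef_def by simp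
    obtain H where H: "\<And>x'. (\<integral>\<^sup>+t. wabs a b (Suc m) (x'((m, m) := t)) \<partial>lborel) \<le>
        wabs a b m (\<lambda>_. 0) * ennreal K * (if 0 < 1 - Re (bform m H (vcol m x') (vcol m x'))
          then ennreal ((1 - Re (bform m H (vcol m x') (vcol m x'))) powr (a + b + 1)) else 0)"
      using KH[of "\<lambda>_. 0"] g0 True by auto
    have "(\<integral>\<^sup>+x. wabs a b (Suc m) x \<partial>herm_lebesgue (Suc m)) = (\<integral>\<^sup>+x. \<integral>\<^sup>+t. wabs a b (Suc m) (x((0, 0) := t)) \<partial>lborel \<partial>(\<Pi>\<^sub>M p\<in>{}. lborel))"
      unfolding herm_lebesgue_def i1 by (rule product_nn_integral_insert) (use fm i1 in auto)
    also have "\<dots> = (\<integral>\<^sup>+t. wabs a b (Suc m) ((\<lambda>_. undefined)((0, 0) := t)) \<partial>lborel)" by (rule nn_integral_PiM_empty)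
    also have "\<dots> < \<infinity>"
    proof (rule le_less_trans)
      show "(\<integral>\<^sup>+t. wabs a b (Suc m) ((\<lambda>_. undefined)((0, 0) := t)) \<partial>lborel) \<le> wabs a b 0 (\<lambda>_. 0) * ennreal K *
        (if 0 < 1 - Re (bform 0 H (vcol 0 (\<lambda>_. undefined)) (vcol 0 (\<lambda>_. undefined)))
          then ennreal ((1 - Re (bform 0 H (vcol 0 (\<lambda>_. undefined)) (vcol 0 (\<lambda>_. undefined)))) powr (a + b + 1)) else 0)"
        using H[of "\<lambda>_. undefined"] by (simp only: True)
    qed (auto simp: wabs_def bform_def ennreal_mult_less_top)
    finally show ?thesis .
  next
    case False
    then have m: "0 < m" by simp
    have "- 1 < a + b + 1" using ab by simp
    then obtain K2 where K2: "0 \<le> K2" "\<And>A C u0 y0. 1 \<le> A \<Longrightarrow> C \<le> 1 \<Longrightarrow>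
    (\<integral>\<^sup>+y. \<integral>\<^sup>+u. (if 0 < C - A * ((u - u0)\<^sup>2 + (y - y0)\<^sup>2) then ennreal ((C - A * ((u - u0)\<^sup>2 + (y - y0)\<^sup>2)) powr (a + b + 1)) else 0) \<partial>lborel \<partial>lborel) \<le> ennreal K2"
      using quad_bound by blast
    define R where "R = idx (Suc m) - idx m - {(m, m), (0, m), (m, 0)}"
    define I2 where "I2 = idx m \<union> R"
    define I1 where "I1 = insert (m, 0) I2"
    define I0 where "I0 = insert (0, m) I1"
    have iI: "idx (Suc m) = insert (m, m) I0" unfolding I0_def I1_def I2_def R_def using m by auto
    have fin: "finite I2" "finite I1" "finite I0" "finite R" unfolding I0_def I1_def I2_def R_def by auto
    have nin: "(m, m) \<notin> I0" "(0, m) \<notin> I1" "(m, 0) \<notin> I2" unfolding I0_def I1_def I2_def R_def using m by auto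
    let ?f0 = "\<lambda>x. \<integral>\<^sup>+t. wabs a b (Suc m) (x((m, m) := t)) \<partial>lborel"
    let ?f1 = "\<lambda>x. \<integral>\<^sup>+u. ?f0 (x((0, m) := u)) \<partial>lborel"
    let ?f2 = "\<lambda>x. \<integral>\<^sup>+y. ?f1 (x((m, 0) := y)) \<partial>lborel"
    have m0: "?f0 \<in> borel_measurable (\<Pi>\<^sub>M p\<in>I0. lborel)" by (rule nn_slice_measurable[OF fm[unfolded iI]])
    have m1: "?f1 \<in> borel_measurable (\<Pi>\<^sub>M p\<in>I1. lborel)" by (rule nn_slice_measurable[OF m0[unfolded I0_def]])
    have boxm: "(\<Pi>\<^sub>E p\<in>R. {-1..1 :: real}) \<in> sets (\<Pi>\<^sub>M p\<in>R. lborel)" by (rule sets_PiM_I_finite[OF fin(4)]) auto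
    have gm: "(\<lambda>x. wabs a b m x * indicator (\<Pi>\<^sub>E p\<in>R. {-1..1 :: real}) (restrict x R)) \<in> borel_measurable (\<Pi>\<^sub>M p\<in>I2. lborel)"
    proof (rule borel_measurable_times_ennreal)
      have "(\<lambda>x. restrict x (idx m)) \<in> (\<Pi>\<^sub>M p\<in>I2. lborel :: real measure) \<rightarrow>\<^sub>M (\<Pi>\<^sub>M p\<in>idx m. lborel)"
        by (rule measurable_restrict_subset) (auto simp: I2_def)
      from measurable_compose[OF this wabs_measurable[unfolded herm_lebesgue_def]]
      show "wabs a b m \<in> borel_measurable (\<Pi>\<^sub>M p\<in>I2. lborel)"
        by (rule measurable_cong[THEN iffD1, rotated]) (rule wabs_cong, simp)
      have "(\<lambda>x. restrict x R) \<in> (\<Pi>\<^sub>M p\<in>I2. lborel :: real measure) \<rightarrow>\<^sub>M (\<Pi>\<^sub>M p\<in>R. lborel)"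
        by (rule measurable_restrict_subset) (auto simp: I2_def)
      from measurable_compose[OF this borel_measurable_indicator[OF boxm]]
      show "(\<lambda>x. indicator (\<Pi>\<^sub>E p\<in>R. {-1..1 :: real}) (restrict x R) :: ennreal) \<in> borel_measurable (\<Pi>\<^sub>M p\<in>I2. lborel)" .
    qed
    have "(\<integral>\<^sup>+x. wabs a b (Suc m) x \<partial>herm_lebesgue (Suc m)) = (\<integral>\<^sup>+x. ?f0 x \<partial>(\<Pi>\<^sub>M p\<in>I0. lborel))"
      unfolding herm_lebesgue_def iI by (rule product_nn_integral_insert) (use fm iI fin nin in auto)
    also have "\<dots> = (\<integral>\<^sup>+x. ?f1 x \<partial>(\<Pi>\<^sub>M p\<in>I1. lborel))"
      unfolding I0_def by (rule product_nn_integral_insert) (use m0 I0_def fin nin in auto)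
    also have "\<dots> = (\<integral>\<^sup>+x. ?f2 x \<partial>(\<Pi>\<^sub>M p\<in>I2. lborel))"
      unfolding I1_def by (rule product_nn_integral_insert) (use m1 I1_def fin nin in auto)
    also have le2: "\<dots> \<le> (\<integral>\<^sup>+x. ennreal (K * K2) * (wabs a b m x * indicator (\<Pi>\<^sub>E p\<in>R. {-1..1 :: real}) (restrict x R)) \<partial>(\<Pi>\<^sub>M p\<in>I2. lborel))"
    proof (rule nn_integral_mono)
      fix x :: "nat \<times> nat \<Rightarrow> real"
      show "?f2 x \<le> ennreal (K * K2) * (wabs a b m x * indicator (\<Pi>\<^sub>E p\<in>R. {-1..1 :: real}) (restrict x R))"
      proof (cases "good m x \<and> restrict x R \<in> (\<Pi>\<^sub>E p\<in>R. {-1..1 :: real})")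
        case True
        then have g: "good m x" by simp
        obtain H where H: "herm m H" "posdef m H" "1 \<le> Re (H $$ (0, 0))" and
          HI: "\<And>x'. (\<forall>p\<in>idx m. x' p = x p) \<Longrightarrow> (\<integral>\<^sup>+t. wabs a b (Suc m) (x'((m, m) := t)) \<partial>lborel) \<le>
            wabs a b m x * ennreal K * (if 0 < 1 - Re (bform m H (vcol m x') (vcol m x'))
            then ennreal ((1 - Re (bform m H (vcol m x') (vcol m x'))) powr (a + b + 1)) else 0)"
          using KH[OF g] m by blast
        obtain C z0 where C: "C \<le> 1" and Cz: "\<And>z. 1 - Re (bform m H ((vcol m x)(0 := z)) ((vcol m x)(0 := z))) =
          C - Re (H $$ (0, 0)) * ((Re z - Re z0)\<^sup>2 + (Im z - Im z0)\<^sup>2)" using quad_form[OF H(1,2) m H(3)] by blast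
        let ?L = "\<lambda>u y. C - Re (H $$ (0, 0)) * ((u - Re z0)\<^sup>2 + (y - Im z0)\<^sup>2)"
        have vc: "bform m H (vcol m (x((m, 0) := y, (0, m) := u))) (vcol m (x((m, 0) := y, (0, m) := u))) =
          bform m H ((vcol m x)(0 := Complex u y)) ((vcol m x)(0 := Complex u y))" for u y
          by (rule bform_cong) (use m in \<open>auto simp: vcol_def\<close>)
        have le: "?f0 (x((m, 0) := y, (0, m) := u)) \<le> wabs a b m x * ennreal K * (if 0 < ?L u y then ennreal (?L u y powr (a + b + 1)) else 0)" for u y
        proof -
          have ag: "\<forall>p\<in>idx m. (x((m, 0) := y, (0, m) := u)) p = x p" by auto
          show ?thesis using HI[OF ag] unfolding vc Cz complex.sel .
        qed
        have "?f2 x \<le> (\<integral>\<^sup>+y. \<integral>\<^sup>+u. wabs a b m x * ennreal K * (if 0 < ?L u y then ennreal (?L u y powr (a + b + 1)) else 0) \<partial>lborel \<partial>lborel)"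
          by (intro nn_integral_mono le)
        also have "\<dots> = wabs a b m x * ennreal K * (\<integral>\<^sup>+y. \<integral>\<^sup>+u. (if 0 < ?L u y then ennreal (?L u y powr (a + b + 1)) else 0) \<partial>lborel \<partial>lborel)"
        proof -
          have 1: "(\<integral>\<^sup>+u. wabs a b m x * ennreal K * (if 0 < ?L u y then ennreal (?L u y powr (a + b + 1)) else 0) \<partial>lborel)
             = wabs a b m x * ennreal K * (\<integral>\<^sup>+u. (if 0 < ?L u y then ennreal (?L u y powr (a + b + 1)) else 0) \<partial>lborel)" for y
            by (rule nn_integral_cmult) measurable
          have "(\<lambda>(y, u). if 0 < ?L u y then ennreal (?L u y powr (a + b + 1)) else 0) \<in> borel_measurable (lborel \<Otimes>\<^sub>M lborel)"
            by measurable
          then have "(\<lambda>y. \<integral>\<^sup>+u. (if 0 < ?L u y then ennreal (?L u y powr (a + b + 1)) else 0) \<partial>lborel) \<in> borel_measurable lborel"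
            by (rule lborel.borel_measurable_nn_integral)
          then show ?thesis unfolding 1 by (rule nn_integral_cmult)
        qed
        also have "\<dots> \<le> wabs a b m x * ennreal K * ennreal K2"
          by (intro mult_left_mono K2(2) H(3) C) simp
        also have "\<dots> = ennreal (K * K2) * wabs a b m x" using K K2(1) by (simp add: ennreal_mult mult_ac)
        finally show ?thesis using True by simp
      next
        case F: False
        have z: "wabs a b (Suc m) (x((m, 0) := y, (0, m) := u, (m, m) := t)) = 0" for y u t
        proof -
          let ?x = "x((m, 0) := y, (0, m) := u, (m, m) := t)"
          have "\<not> good (Suc m) ?x"
          proof
            assume g: "good (Suc m) ?x"
            then have "good m ?x" by (rule good_restrict)
            moreover have "good m ?x = good m x" by (rule good_cong) auto
            moreover have "restrict x R \<in> (\<Pi>\<^sub>E p\<in>R. {-1..1 :: real})"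
            proof (rule PiE_I)
              fix p assume p: "p \<in> R"
              then have "?x p = x p" "p \<in> idx (Suc m)" unfolding R_def by auto
              then have "\<bar>x p\<bar> \<le> 1" using good_coords[OF g, of p] by simp
              then show "restrict x R p \<in> {-1..1 :: real}" using p by auto
            qed auto
            ultimately show False using F by simp
          qed
          then show ?thesis by (simp add: wabs_def)
        qed
        show ?thesis unfolding z by simp
      qed
    qed
    also have "\<dots> = ennreal (K * K2) * (\<integral>\<^sup>+x. wabs a b m x * indicator (\<Pi>\<^sub>E p\<in>R. {-1..1 :: real}) (restrict x R) \<partial>(\<Pi>\<^sub>M p\<in>I2. lborel))"
      by (rule nn_integral_cmult[OF gm])
    also have "(\<integral>\<^sup>+x. wabs a b m x * indicator (\<Pi>\<^sub>E p\<in>R. {-1..1 :: real}) (restrict x R) \<partial>(\<Pi>\<^sub>M p\<in>I2. lborel)) =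
         (\<integral>\<^sup>+x. \<integral>\<^sup>+y. wabs a b m x * indicator (\<Pi>\<^sub>E p\<in>R. {-1..1 :: real}) y \<partial>(\<Pi>\<^sub>M p\<in>R. lborel) \<partial>herm_lebesgue m)"
    proof -
      have dis: "idx m \<inter> R = {}" by (auto simp: R_def)
      have "(\<integral>\<^sup>+x. wabs a b m x * indicator (\<Pi>\<^sub>E p\<in>R. {-1..1 :: real}) (restrict x R) \<partial>(\<Pi>\<^sub>M p\<in>I2. lborel)) =
        (\<integral>\<^sup>+x. \<integral>\<^sup>+y. wabs a b m (merge (idx m) R (x, y)) * indicator (\<Pi>\<^sub>E p\<in>R. {-1..1 :: real}) (restrict (merge (idx m) R (x, y)) R) \<partial>(\<Pi>\<^sub>M p\<in>R. lborel) \<partial>(\<Pi>\<^sub>M p\<in>idx m. lborel))"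
        unfolding I2_def by (rule product_nn_integral_fold) (use dis fin gm I2_def in auto)
      also have "\<dots> = (\<integral>\<^sup>+x. \<integral>\<^sup>+y. wabs a b m x * indicator (\<Pi>\<^sub>E p\<in>R. {-1..1 :: real}) y \<partial>(\<Pi>\<^sub>M p\<in>R. lborel) \<partial>herm_lebesgue m)"
        unfolding herm_lebesgue_def
      proof (intro nn_integral_cong)
        fix x y :: "nat \<times> nat \<Rightarrow> real" assume y: "y \<in> space (\<Pi>\<^sub>M p\<in>R. lborel)"
        have "wabs a b m (merge (idx m) R (x, y)) = wabs a b m x"
          by (rule wabs_cong) (auto simp: merge_def)
        moreover have "restrict (merge (idx m) R (x, y)) R = y"
          using y dis by (auto simp: space_PiM merge_def fun_eq_iff PiE_iff extensional_def restrict_def)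
        ultimately show "wabs a b m (merge (idx m) R (x, y)) * indicator (\<Pi>\<^sub>E p\<in>R. {-1..1 :: real}) (restrict (merge (idx m) R (x, y)) R) =
          wabs a b m x * indicator (\<Pi>\<^sub>E p\<in>R. {-1..1 :: real}) y" by simp
      qed
      finally show ?thesis .
    qed
    also have "\<dots> = (\<integral>\<^sup>+x. wabs a b m x * emeasure (\<Pi>\<^sub>M p\<in>R. lborel) (\<Pi>\<^sub>E p\<in>R. {-1..1 :: real}) \<partial>herm_lebesgue m)"
      using boxm by (intro nn_integral_cong) (simp add: nn_integral_cmult_indicator)
    also have "\<dots> = (\<integral>\<^sup>+x. wabs a b m x \<partial>herm_lebesgue m) * emeasure (\<Pi>\<^sub>M p\<in>R. lborel) (\<Pi>\<^sub>E p\<in>R. {-1..1 :: real})"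
      by (rule nn_integral_multc) measurable
    finally have le: "(\<integral>\<^sup>+x. wabs a b (Suc m) x \<partial>herm_lebesgue (Suc m)) \<le> ennreal (K * K2) *
      ((\<integral>\<^sup>+x. wabs a b m x \<partial>herm_lebesgue m) * emeasure (\<Pi>\<^sub>M p\<in>R. lborel) (\<Pi>\<^sub>E p\<in>R. {-1..1 :: real}))" .
    have "emeasure (\<Pi>\<^sub>M p\<in>R. lborel) (\<Pi>\<^sub>E p\<in>R. {-1..1 :: real}) = (\<Prod>p\<in>R. emeasure lborel {-1..1 :: real})"
      by (rule emeasure_PiM[OF fin(4)]) auto
    also have "\<dots> < \<infinity>" by (simp add: power_less_top_ennreal)
    finally have "emeasure (\<Pi>\<^sub>M p\<in>R. lborel) (\<Pi>\<^sub>E p\<in>R. {-1..1 :: real}) < \<infinity>" .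
    then show ?thesis using Suc.IH by (intro le_less_trans[OF le]) (auto simp: ennreal_mult_less_top)
  qed
qed

lemma integrable_wabs:
  assumes "-1 < a" "-1 < b"
  shows "integrable (herm_lebesgue N) (\<lambda>x. indicator (herm01 N) x * (dt N x powr a * du N x powr b))"
proof (rule integrableI_bounded)
  show "(\<lambda>x. indicator (herm01 N) x * (dt N x powr a * du N x powr b)) \<in> borel_measurable (herm_lebesgue N)" by measurable
  have "(\<integral>\<^sup>+x. ennreal (norm (indicator (herm01 N) x * (dt N x powr a * du N x powr b))) \<partial>herm_lebesgue N) =
     (\<integral>\<^sup>+x. wabs a b N x \<partial>herm_lebesgue N)"
    by (intro nn_integral_cong) (auto simp: wabs_def herm01_iff indicator_def)
  then show "(\<integral>\<^sup>+x. ennreal (norm (indicator (herm01 N) x * (dt N x powr a * du N x powr b))) \<partial>herm_lebesgue N) < \<infinity>"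
    using wabs_finite[OF assms, of N] by simp
qed

section \<open>Integration by parts\<close>

text \<open>A relation instead of a function, so that each derivative carries differentiability with
  it; real and complex values are treated alike.\<close>

definition pd :: "'i \<Rightarrow> (('i \<Rightarrow> real) \<Rightarrow> 'b::real_normed_vector) \<Rightarrow> 'b \<Rightarrow> ('i \<Rightarrow> real) \<Rightarrow> bool" where
  "pd p f f' x \<longleftrightarrow> ((\<lambda>t. f (x(p := t))) has_vector_derivative f') (at (x p))"

lemma pd_const: "pd p (\<lambda>x. c) 0 x" by (simp add: pd_def)

lemma pd_add: "pd p f f' x \<Longrightarrow> pd p g g' x \<Longrightarrow> pd p (\<lambda>x. f x + g x) (f' + g') x"
  unfolding pd_def by (rule has_vector_derivative_add)

lemma pd_diff: "pd p f f' x \<Longrightarrow> pd p g g' x \<Longrightarrow> pd p (\<lambda>x. f x - g x) (f' - g') x"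
  unfolding pd_def by (rule has_vector_derivative_diff)

lemma pd_mult:
  fixes f g :: "('i \<Rightarrow> real) \<Rightarrow> 'b::real_normed_algebra"
  shows "pd p f f' x \<Longrightarrow> pd p g g' x \<Longrightarrow> pd p (\<lambda>x. f x * g x) (f' * g x + f x * g') x"
  unfolding pd_def using has_vector_derivative_mult[of "\<lambda>t. f (x(p := t))" f' "x p" UNIV "\<lambda>t. g (x(p := t))" g']
  by (simp add: add.commute)

lemma pd_sum: "(\<And>i. i \<in> I \<Longrightarrow> pd p (f i) (f' i) x) \<Longrightarrow> pd p (\<lambda>x. \<Sum>i\<in>I. f i x) (\<Sum>i\<in>I. f' i) x"
  unfolding pd_def by (rule has_vector_derivative_sum)

lemma pd_cmult:
  fixes f :: "('i \<Rightarrow> real) \<Rightarrow> complex"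
  shows "pd p f f' x \<Longrightarrow> pd p (\<lambda>x. c * f x) (c * f') x"
  using pd_mult[OF pd_const, of p f f' x c] by simp

lemma pd_eq: "pd p f f' x \<Longrightarrow> f' = f'' \<Longrightarrow> pd p f f'' x" by simp

lemma pd_prod:
  fixes f :: "'k \<Rightarrow> ('i \<Rightarrow> real) \<Rightarrow> complex"
  assumes "finite I" "\<And>i. i \<in> I \<Longrightarrow> pd p (f i) (f' i) x"
  shows "pd p (\<lambda>x. \<Prod>i\<in>I. f i x) (\<Sum>m\<in>I. f' m * (\<Prod>i\<in>I-{m}. f i x)) x"
  using assms
proof (induction I rule: finite_induct)
  case empty
  show ?case by (simp add: pd_const)
next
  case (insert k I)
  have "pd p (\<lambda>x. f k x * (\<Prod>i\<in>I. f i x)) (f' k * (\<Prod>i\<in>I. f i x) + f k x * (\<Sum>m\<in>I. f' m * (\<Prod>i\<in>I-{m}. f i x))) x"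
    using insert by (intro pd_mult) auto
  moreover have "f k x * (\<Sum>m\<in>I. f' m * (\<Prod>i\<in>I-{m}. f i x)) = (\<Sum>m\<in>I. f' m * (\<Prod>i\<in>insert k I-{m}. f i x))"
    unfolding sum_distrib_left
  proof (intro sum.cong refl)
    fix m assume m: "m \<in> I"
    then have "insert k I - {m} = insert k (I - {m})" using insert by auto
    then show "f k x * (f' m * (\<Prod>i\<in>I-{m}. f i x)) = f' m * (\<Prod>i\<in>insert k I-{m}. f i x)"
      using insert by (simp add: mult_ac)
  qed
  ultimately show ?case using insert by (simp add: insert_Diff_if)
qed

lemma pd_unique:
  "pd p f f' x \<Longrightarrow> pd p f f'' x \<Longrightarrow> f' = f''"
  unfolding pd_def by (rule vector_derivative_unique_at)

lemma pd_eventually: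
  assumes "pd p g f' x" "eventually (\<lambda>t. f (x(p := t)) = g (x(p := t))) (nhds (x p))"
  shows "pd p f f' x"
proof -
  have e: "\<forall>\<^sub>F t in nhds (x p). g (x(p := t)) = f (x(p := t))" using assms(2) by (rule eventually_mono) simp
  have e0: "g (x(p := x p)) = f (x(p := x p))" using eventually_nhds_x_imp_x[OF e] .
  show ?thesis using assms(1) unfolding pd_def has_vector_derivative_def
    using has_derivative_transform_eventually[of "\<lambda>t. g (x(p := t))" _ "x p" UNIV "\<lambda>t. f (x(p := t))"] e e0
    by (metis (mono_tags, lifting) UNIV_I eventually_nhds_conv_at)
qed

text \<open>By Fubini the coordinate \<open>p\<close> is integrated first. On each line
  \<open>G\<close> vanishes at both ends of a large interval, and \<open>G'\<close> vanishes outside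
  it because \<open>G\<close> is zero on an open set there.\<close>

lemma ibp:
  fixes G :: "('i \<Rightarrow> real) \<Rightarrow> complex"
  assumes fin: "finite P" and p: "p \<in> P" and int: "integrable (\<Pi>\<^sub>M q\<in>P. lborel) G'"
    and der: "\<And>x. pd p G (G' x) x" and supp: "\<And>x. R < \<bar>x p\<bar> \<Longrightarrow> G x = 0"
  shows "(\<integral>x. G' x \<partial>(\<Pi>\<^sub>M q\<in>P. lborel)) = 0"
proof -
  interpret product_sigma_finite "\<lambda>_ :: 'i. lborel :: real measure" ..
  define I where "I = P - {p}"
  have I: "finite I" "p \<notin> I" "insert p I = P" using fin p by (auto simp: I_def)
  have zero: "(\<integral>t. G' (x(p := t)) \<partial>lborel) = 0" for x
  proof (cases "integrable lborel (\<lambda>t. G' (x(p := t)))")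
    case True
    define F where "F t = G (x(p := t))" for t
    define F' where "F' t = G' (x(p := t))" for t
    have d: "(F has_vector_derivative F' t) (at t)" for t
      using der[of "x(p := t)"] unfolding pd_def F_def F'_def by simp
    have z: "F t = 0" if "R < \<bar>t\<bar>" for t unfolding F_def using that by (intro supp) simp
    define r where "r = \<bar>R\<bar> + 1"
    have r: "0 < r" "R < r" by (auto simp: r_def)
    have "(F' has_integral (F r - F (- r))) {- r..r}"
      using r d by (intro fundamental_theorem_of_calculus) (auto intro: has_vector_derivative_at_within)
    moreover have "F r = 0" "F (- r) = 0" using r by (auto intro!: z)
    ultimately have i1: "(F' has_integral 0) {- r..r}" by simp
    have "F' t = 0" if "t \<notin> {- r..r}" for t
    proof -
      have t: "R < \<bar>t\<bar>" using that r by auto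
      have "open {s. R < \<bar>s\<bar>}" by (intro open_Collect_less continuous_intros)
      then have "eventually (\<lambda>s. s \<in> {s. R < \<bar>s\<bar>}) (nhds t)" using t by (intro eventually_nhds_in_open) auto
      then have "eventually (\<lambda>s. G ((x(p := t))(p := s)) = 0) (nhds ((x(p := t)) p))"
        by (simp, elim eventually_mono) (use supp in simp)
      then have "pd p G 0 (x(p := t))" by (rule pd_eventually[OF pd_const])
      then show ?thesis unfolding F'_def using pd_unique[OF der[of "x(p := t)"]] by blast
    qed
    then have i2: "(F' has_integral 0) UNIV" using has_integral_on_superset[OF i1, of UNIV] by auto
    have "(F' has_integral (\<integral>t. F' t \<partial>lborel)) UNIV"
      using True unfolding F'_def by (rule has_integral_integral_lborel)
    then have "(\<integral>t. F' t \<partial>lborel) = 0" using i2 has_integral_unique by blast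
    then show ?thesis unfolding F'_def .
  next
    \<comment> \<open>A slice that is not integrable has Bochner integral 0 by default, which agrees
      with the claim.\<close>
    case False
    then show ?thesis by (rule not_integrable_integral_eq)
  qed
  have "(\<integral>x. G' x \<partial>(\<Pi>\<^sub>M q\<in>P. lborel)) = (\<integral>x. \<integral>t. G' (x(p := t)) \<partial>lborel \<partial>(\<Pi>\<^sub>M q\<in>I. lborel))"
    unfolding I(3)[symmetric] by (rule product_integral_insert[OF I(1,2)]) (use int I(3) in simp)
  then show ?thesis unfolding zero by simp
qed

section \<open>A basis of the Hermitian matrices and its dual\<close>

text \<open>\<open>bas p\<close> is the derivative of \<open>herm_of N x\<close> in the coordinate
  \<open>x p\<close>. For \<open>p = (a, b)\<close> with \<open>b < a\<close> that coordinate is the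
  imaginary part of the entry at \<open>(b, a)\<close>.\<close>

definition bas :: "nat \<times> nat \<Rightarrow> nat \<Rightarrow> nat \<Rightarrow> complex" where
  "bas p i j = (let (a, b) = p in
     if a = b then (if i = a \<and> j = a then 1 else 0)
     else if a < b then (if i = a \<and> j = b \<or> i = b \<and> j = a then 1 else 0)
     else (if i = b \<and> j = a then \<i> else if i = a \<and> j = b then - \<i> else 0))"

text \<open>Off the diagonal the square of \<open>bas p\<close> has trace 2, so half of it is dual
  to \<open>bas p\<close> for the trace form.\<close>

definition bs :: "nat \<times> nat \<Rightarrow> nat \<Rightarrow> nat \<Rightarrow> complex" where
  "bs p i j = (if fst p = snd p then bas p i j else bas p i j / 2)"

lemma pd_coord: "pd p (\<lambda>x. complex_of_real (x q)) (if q = p then 1 else 0) x"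
proof (cases "q = p")
  case True
  have "((\<lambda>t. complex_of_real t) has_vector_derivative complex_of_real 1) (at (x p))"
    by (rule has_vector_derivative_of_real) (rule DERIV_ident)
  then show ?thesis using True by (simp add: pd_def)
qed (simp add: pd_def)

lemma herm_entry_expand:
  assumes "i < N" "j < N"
  shows "herm_of N x $$ (i, j) = (if i = j then complex_of_real (x (i, i))
     else if i < j then complex_of_real (x (i, j)) + \<i> * complex_of_real (x (j, i))
     else complex_of_real (x (j, i)) + (- \<i>) * complex_of_real (x (i, j)))"
  using assms by (auto simp: herm_of_def complex_eq_iff)

lemma pd_entry:
  assumes ij: "i < N" "j < N"
  shows "pd p (\<lambda>x. herm_of N x $$ (i, j)) (bas p i j) x"
proof (cases i j rule: linorder_cases)
  case less
  have "pd p (\<lambda>x. complex_of_real (x (i, j)) + \<i> * complex_of_real (x (j, i)))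
      ((if (i, j) = p then 1 else 0) + \<i> * (if (j, i) = p then 1 else 0)) x"
    by (intro pd_add pd_cmult pd_coord)
  moreover have "(if (i, j) = p then 1 else 0) + \<i> * (if (j, i) = p then 1 else 0) = bas p i j"
    using less by (cases p) (auto simp: bas_def)
  ultimately show ?thesis using less by (simp add: herm_entry_expand[OF ij])
next
  case equal
  have "(if (i, i) = p then 1 else 0) = bas p i j" using equal by (cases p) (auto simp: bas_def)
  then show ?thesis using equal ij pd_coord[of p "(i, i)" x] by (simp add: herm_of_def)
next
  case greater
  have "pd p (\<lambda>x. complex_of_real (x (j, i)) + (- \<i>) * complex_of_real (x (i, j)))
      ((if (j, i) = p then 1 else 0) + (- \<i>) * (if (i, j) = p then 1 else 0)) x"
    by (intro pd_add pd_cmult pd_coord)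
  moreover have "(if (j, i) = p then 1 else 0) + (- \<i>) * (if (i, j) = p then 1 else 0) = bas p i j"
    using greater by (cases p) (auto simp: bas_def)
  ultimately show ?thesis using greater by (simp add: herm_entry_expand[OF ij])
qed

text \<open>Summed over \<open>p\<close>, the tensor product of \<open>bas p\<close> and
  \<open>bs p\<close> is the operator that exchanges two tensor factors. The transpositions in the
  loop equations originate here. Only the coordinates \<open>(i, j)\<close> and
  \<open>(j, i)\<close> contribute to a given entry.\<close>

lemma bas_complete:
  assumes ij: "i < N" "j < N"
  shows "(\<Sum>p\<in>idx N. bas p i j * bs p k l) = (if i = l \<and> j = k then 1 else 0)"
proof -
  have z: "bas p i j = 0" if "p \<notin> {(i, j), (j, i)}" for p
  proof -
    obtain a b where p: "p = (a, b)" by (cases p)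
    have n: "\<not> (i = a \<and> j = b)" "\<not> (i = b \<and> j = a)" using that p by auto
    show ?thesis
    proof (cases "a = b")
      case True then show ?thesis using n p by (simp add: bas_def)
    next
      case False then show ?thesis using n p by (simp only: bas_def Let_def prod.case if_False disj_not1 simp_thms) (simp add: n)
    qed
  qed
  have "(\<Sum>p\<in>idx N. bas p i j * bs p k l) = (\<Sum>p\<in>{(i, j), (j, i)}. bas p i j * bs p k l)"
    using ij z by (intro sum.mono_neutral_right) auto
  also have "\<dots> = (if i = l \<and> j = k then 1 else 0)"
  proof (cases i j rule: linorder_cases)
    case less
    then have v: "(i, j) \<noteq> (j, i)" "bas (i, j) i j = 1" "bas (j, i) i j = \<i>" by (simp_all add: bas_def)
    have "bs (i, j) k l = (if k = i \<and> l = j then 1/2 else if k = j \<and> l = i then 1/2 else 0)"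
      "bs (j, i) k l = (if k = i \<and> l = j then \<i>/2 else if k = j \<and> l = i then - \<i>/2 else 0)"
      using less by (simp_all add: bas_def bs_def)
    then show ?thesis using v less by simp
  next
    case equal
    then show ?thesis by (simp add: bas_def bs_def)
  next
    case greater
    then have v: "(i, j) \<noteq> (j, i)" "bas (i, j) i j = - \<i>" "bas (j, i) i j = 1" by (simp_all add: bas_def)
    have "bs (j, i) k l = (if k = j \<and> l = i then 1/2 else if k = i \<and> l = j then 1/2 else 0)"
      "bs (i, j) k l = (if k = j \<and> l = i then \<i>/2 else if k = i \<and> l = j then - \<i>/2 else 0)"
      using greater by (simp_all add: bas_def bs_def)
    then show ?thesis using v greater by simp
  qed
  finally show ?thesis .
qed

definition mm :: "nat \<Rightarrow> (nat \<Rightarrow> nat \<Rightarrow> complex) \<Rightarrow> (nat \<Rightarrow> nat \<Rightarrow> complex) \<Rightarrow> nat \<Rightarrow> nat \<Rightarrow> complex" where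
  "mm N A B a b = (\<Sum>c<N. A a c * B c b)"

lemma mm3: "mm N (mm N A B) C a b = (\<Sum>c<N. \<Sum>d<N. A a c * B c d * C d b)"
  unfolding mm_def by (simp add: sum_distrib_right) (rule sum.swap)

lemma bas_contract:
  "(\<Sum>p\<in>idx N. mm N (mm N C (bas p)) D a b * mm N (mm N E (bs p)) F c d) = mm N C F a d * mm N E D c b"
proof -
  have "(\<Sum>p\<in>idx N. mm N (mm N C (bas p)) D a b * mm N (mm N E (bs p)) F c d) =
    (\<Sum>p\<in>idx N. \<Sum>c2<N. \<Sum>d2<N. \<Sum>c1<N. \<Sum>d1<N. (C a c1 * D d1 b * E c c2 * F d2 d) * (bas p c1 d1 * bs p c2 d2))"
    unfolding mm3 sum_distrib_left sum_distrib_right by (intro sum.cong refl) (simp add: mult_ac)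
  also have "\<dots> = (\<Sum>c2<N. \<Sum>d2<N. \<Sum>c1<N. \<Sum>d1<N. \<Sum>p\<in>idx N. (C a c1 * D d1 b * E c c2 * F d2 d) * (bas p c1 d1 * bs p c2 d2))"
    by (simp only: sum.swap[of _ _ "idx N"])
  also have "\<dots> = (\<Sum>c2<N. \<Sum>d2<N. \<Sum>c1<N. \<Sum>d1<N. (if d1 = c2 then if c1 = d2 then C a c1 * D d1 b * E c c2 * F d2 d else 0 else 0))"
    unfolding sum_distrib_left[symmetric]
    by (intro sum.cong refl) (simp add: bas_complete)
  also have "\<dots> = (\<Sum>c2<N. \<Sum>d2<N. C a d2 * D c2 b * E c c2 * F d2 d)"
    by (intro sum.cong refl) simp
  also have "\<dots> = (\<Sum>d2<N. \<Sum>c2<N. C a d2 * D c2 b * E c c2 * F d2 d)" by (rule sum.swap)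
  also have "\<dots> = mm N C F a d * mm N E D c b"
    unfolding mm_def sum_product by (intro sum.cong refl) (simp add: mult_ac)
  finally show ?thesis .
qed

section \<open>One varying matrix in a permuted tensor product\<close>

lemma tperm_split2:
  assumes fin: "finite S" and mn: "m \<in> S" "n \<in> S" "m \<noteq> n"
  shows "tperm N S s (A(m := U, n := V)) = (\<Sum>i\<in>S \<rightarrow>\<^sub>E {..<N}. U (i m) (i (s m)) * V (i n) (i (s n)) * (\<Prod>k\<in>S-{m,n}. A k (i k) (i (s k))))"
  unfolding tperm_def
proof (intro sum.cong refl)
  fix i :: "'a \<Rightarrow> nat"
  have "(\<Prod>k\<in>S. (A(m := U, n := V)) k (i k) (i (s k))) =
     (A(m := U, n := V)) n (i n) (i (s n)) * (\<Prod>k\<in>S-{n}. (A(m := U, n := V)) k (i k) (i (s k)))"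
    by (rule prod.remove[OF fin mn(2)])
  also have "(\<Prod>k\<in>S-{n}. (A(m := U, n := V)) k (i k) (i (s k))) =
     (A(m := U, n := V)) m (i m) (i (s m)) * (\<Prod>k\<in>S-{n}-{m}. (A(m := U, n := V)) k (i k) (i (s k)))"
    using fin mn by (intro prod.remove) auto
  also have "(\<Prod>k\<in>S-{n}-{m}. (A(m := U, n := V)) k (i k) (i (s k))) = (\<Prod>k\<in>S-{m,n}. A k (i k) (i (s k)))"
    by (intro prod.cong) auto
  finally show "(\<Prod>k\<in>S. (A(m := U, n := V)) k (i k) (i (s k))) = U (i m) (i (s m)) * V (i n) (i (s n)) * (\<Prod>k\<in>S-{m,n}. A k (i k) (i (s k)))"
    using mn(3) by (simp only: fun_upd_same fun_upd_other mult_ac not_False_eq_True)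
qed

lemma tperm_split1:
  assumes fin: "finite S" and n: "n \<in> S"
  shows "tperm N S s (A(n := V)) = (\<Sum>i\<in>S \<rightarrow>\<^sub>E {..<N}. V (i n) (i (s n)) * (\<Prod>k\<in>S-{n}. A k (i k) (i (s k))))"
  unfolding tperm_def
proof (intro sum.cong refl)
  fix i :: "'a \<Rightarrow> nat"
  have "(\<Prod>k\<in>S. (A(n := V)) k (i k) (i (s k))) = (A(n := V)) n (i n) (i (s n)) * (\<Prod>k\<in>S-{n}. (A(n := V)) k (i k) (i (s k)))"
    by (rule prod.remove[OF fin n])
  also have "(\<Prod>k\<in>S-{n}. (A(n := V)) k (i k) (i (s k))) = (\<Prod>k\<in>S-{n}. A k (i k) (i (s k)))" by (intro prod.cong) auto
  finally show "(\<Prod>k\<in>S. (A(n := V)) k (i k) (i (s k))) = V (i n) (i (s n)) * (\<Prod>k\<in>S-{n}. A k (i k) (i (s k)))" by simp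
qed

lemma tperm_slot_sum:
  assumes "finite S" "n \<in> S"
  shows "tperm N S s (A(n := \<lambda>a b. \<Sum>q\<in>Q. c q * V q a b)) = (\<Sum>q\<in>Q. c q * tperm N S s (A(n := V q)))"
proof -
  have "tperm N S s (A(n := \<lambda>a b. \<Sum>q\<in>Q. c q * V q a b)) =
    (\<Sum>i\<in>S \<rightarrow>\<^sub>E {..<N}. \<Sum>q\<in>Q. c q * (V q (i n) (i (s n)) * (\<Prod>k\<in>S-{n}. A k (i k) (i (s k)))))"
    unfolding tperm_split1[OF assms] by (simp add: sum_distrib_right mult.assoc)
  also have "\<dots> = (\<Sum>q\<in>Q. c q * tperm N S s (A(n := V q)))"
    unfolding tperm_split1[OF assms] sum_distrib_left by (rule sum.swap)
  finally show ?thesis .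
qed

lemma tperm_slot_linear:
  assumes "finite S" "n \<in> S"
  shows "tperm N S s (A(n := \<lambda>a b. c * U a b + d * V a b)) = c * tperm N S s (A(n := U)) + d * tperm N S s (A(n := V))"
  unfolding tperm_split1[OF assms] by (simp add: sum_distrib_left sum.distrib[symmetric] algebra_simps)

text \<open>A basis matrix in slot \<open>m\<close> against its dual in slot \<open>n\<close>
  exchanges the continuations of the two slots: the permutation is multiplied by their
  transposition, and the right factors \<open>D\<close> and \<open>F\<close> change places.\<close>

lemma tperm_contract:
  assumes fin: "finite S" and mn: "m \<in> S" "n \<in> S" "m \<noteq> n"
  shows "(\<Sum>p\<in>idx N. tperm N S s (A(m := mm N (mm N C (bas p)) D, n := mm N (mm N E (bs p)) F))) =
    tperm N S (s \<circ> Transposition.transpose m n) (A(m := mm N C F, n := mm N E D))"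
proof -
  let ?R = "\<lambda>i. \<Prod>k\<in>S-{m,n}. A k (i k) (i (s k))"
  have R: "(\<Prod>k\<in>S-{m,n}. A k (i k) (i ((s \<circ> Transposition.transpose m n) k))) = ?R i" for i :: "'a \<Rightarrow> nat"
    by (intro prod.cong refl) auto
  have "(\<Sum>p\<in>idx N. tperm N S s (A(m := mm N (mm N C (bas p)) D, n := mm N (mm N E (bs p)) F))) =
    (\<Sum>i\<in>S \<rightarrow>\<^sub>E {..<N}. (\<Sum>p\<in>idx N. mm N (mm N C (bas p)) D (i m) (i (s m)) * mm N (mm N E (bs p)) F (i n) (i (s n))) * ?R i)"
    unfolding tperm_split2[OF fin mn] sum_distrib_right by (rule sum.swap)
  also have "\<dots> = (\<Sum>i\<in>S \<rightarrow>\<^sub>E {..<N}. mm N C F (i m) (i (s n)) * mm N E D (i n) (i (s m)) * ?R i)"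
    unfolding bas_contract ..
  also have "\<dots> = tperm N S (s \<circ> Transposition.transpose m n) (A(m := mm N C F, n := mm N E D))"
    unfolding tperm_split2[OF fin mn] R by simp
  finally show ?thesis .
qed

lemma pd_tperm:
  assumes fin: "finite S" and s: "s permutes S"
    and A: "\<And>k a b. k \<in> S \<Longrightarrow> a < N \<Longrightarrow> b < N \<Longrightarrow> pd p (\<lambda>x. A x k a b) (A' k a b) x"
  shows "pd p (\<lambda>x. tperm N S s (A x)) (\<Sum>m\<in>S. tperm N S s ((A x)(m := A' m))) x"
proof -
  have "pd p (\<lambda>x. \<Sum>i\<in>S \<rightarrow>\<^sub>E {..<N}. \<Prod>k\<in>S. A x k (i k) (i (s k)))
     (\<Sum>i\<in>S \<rightarrow>\<^sub>E {..<N}. \<Sum>m\<in>S. A' m (i m) (i (s m)) * (\<Prod>k\<in>S-{m}. A x k (i k) (i (s k)))) x"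
  proof (intro pd_sum pd_prod fin A)
    fix i k assume "i \<in> S \<rightarrow>\<^sub>E {..<N}" "k \<in> S"
    then show "i k < N" "i (s k) < N" using permutes_in_image[OF s, of k] by (auto simp: PiE_iff)
  qed
  moreover have "(\<Sum>i\<in>S \<rightarrow>\<^sub>E {..<N}. \<Sum>m\<in>S. A' m (i m) (i (s m)) * (\<Prod>k\<in>S-{m}. A x k (i k) (i (s k)))) =
     (\<Sum>m\<in>S. tperm N S s ((A x)(m := A' m)))"
    by (subst sum.swap, intro sum.cong refl) (simp only: tperm_split1[OF fin])
  ultimately show ?thesis unfolding tperm_def[of N S s "A _"] by simp
qed

section \<open>Derivatives of the determinants and of the inverse matrix\<close>

lemma pd_chain:
  fixes f :: "('i \<Rightarrow> real) \<Rightarrow> complex"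
  assumes "pd p f f' x" "(g has_field_derivative g') (at (f x))"
  shows "pd p (\<lambda>x. g (f x)) (f' * g') x"
  using field_vector_diff_chain_at[of "\<lambda>t. f (x(p := t))" f' "x p" g g'] assms unfolding pd_def by (simp add: o_def)

lemma pd_of_real:
  "pd p f f' x \<Longrightarrow> pd p (\<lambda>x. complex_of_real (f x)) (of_real f') x"
  unfolding pd_def
  by (rule has_vector_derivative_of_real) (simp add: has_real_derivative_iff_has_vector_derivative)

lemma pd_Re: "pd p f f' x \<Longrightarrow> pd p (\<lambda>x. Re (f x)) (Re f') x"
  unfolding pd_def using bounded_linear.has_vector_derivative[OF bounded_linear_Re] by blast

lemma pd_Im: "pd p f f' x \<Longrightarrow> pd p (\<lambda>x. Im (f x)) (Im f') x"
  unfolding pd_def using bounded_linear.has_vector_derivative[OF bounded_linear_Im] by blast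

lemma pd_real_chain:
  fixes f :: "('i \<Rightarrow> real) \<Rightarrow> real"
  assumes "pd p f f' x" "(g has_real_derivative g') (at (f x))"
  shows "pd p (\<lambda>x. g (f x)) (f' * g') x"
proof -
  have "((\<lambda>t. f (x(p := t))) has_real_derivative f') (at (x p))"
    using assms(1) unfolding pd_def has_real_derivative_iff_has_vector_derivative .
  then have "((\<lambda>t. g (f (x(p := t)))) has_real_derivative (g' * f')) (at (x p))"
    using DERIV_chain2[of g g' "\<lambda>t. f (x(p := t))" "x p" f' UNIV] assms(2) by simp
  then show ?thesis unfolding pd_def has_real_derivative_iff_has_vector_derivative by (simp only: mult.commute)
qed

text \<open>Jacobi's formula. The Leibniz expansion is differentiated row by row, and the
  determinant of \<open>M m\<close>, with row \<open>m\<close> differentiated, is expanded along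
  that row.\<close>

lemma pd_det:
  fixes A :: "('i \<Rightarrow> real) \<Rightarrow> complex mat"
  assumes A: "\<And>x. A x \<in> carrier_mat N N"
    and d: "\<And>i j. i < N \<Longrightarrow> j < N \<Longrightarrow> pd p (\<lambda>x. A x $$ (i, j)) (A' i j) x"
  shows "pd p (\<lambda>x. Determinant.det (A x)) (\<Sum>i<N. \<Sum>j<N. A' i j * cofactor (A x) i j) x"
proof -
  let ?Q = "{q. q permutes {0..<N}}"
  have 1: "pd p (\<lambda>x. \<Sum>q\<in>?Q. of_int (sign q) * (\<Prod>i=0..<N. A x $$ (i, q i)))
     (\<Sum>q\<in>?Q. of_int (sign q) * (\<Sum>m=0..<N. A' m (q m) * (\<Prod>i\<in>{0..<N}-{m}. A x $$ (i, q i)))) x"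
  proof (rule pd_sum, rule pd_cmult)
    fix q assume q: "q \<in> ?Q"
    have "\<And>i. i \<in> {0..<N} \<Longrightarrow> pd p (\<lambda>x. A x $$ (i, q i)) (A' i (q i)) x"
      using q permutes_in_image[of q "{0..<N}"] by (intro d) auto
    from pd_prod[OF finite_atLeastLessThan this]
    show "pd p (\<lambda>x. \<Prod>i=0..<N. A x $$ (i, q i)) (\<Sum>m=0..<N. A' m (q m) * (\<Prod>i\<in>{0..<N}-{m}. A x $$ (i, q i))) x" .
  qed
  define M where "M m = mat N N (\<lambda>(i, j). if i = m then A' i j else A x $$ (i, j))" for m
  have M: "M m \<in> carrier_mat N N" for m by (simp add: M_def)
  have "(\<Sum>q\<in>?Q. of_int (sign q) * (\<Sum>m=0..<N. A' m (q m) * (\<Prod>i\<in>{0..<N}-{m}. A x $$ (i, q i)))) =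
     (\<Sum>m=0..<N. \<Sum>q\<in>?Q. of_int (sign q) * (A' m (q m) * (\<Prod>i\<in>{0..<N}-{m}. A x $$ (i, q i))))"
    unfolding sum_distrib_left by (rule sum.swap)
  also have "\<dots> = (\<Sum>m=0..<N. Determinant.det (M m))"
  proof (rule sum.cong[OF refl])
    fix m assume m: "m \<in> {0..<N}"
    show "(\<Sum>q\<in>?Q. of_int (sign q) * (A' m (q m) * (\<Prod>i\<in>{0..<N}-{m}. A x $$ (i, q i)))) = Determinant.det (M m)"
      unfolding det_def'[OF M]
    proof (intro sum.cong refl arg_cong2[of _ _ _ _ "(*)"])
      fix q assume q: "q \<in> ?Q"
      have qi: "i < N \<Longrightarrow> q i < N" for i using q permutes_in_image[of q "{0..<N}" i] by auto
      have "(\<Prod>i=0..<N. M m $$ (i, q i)) = M m $$ (m, q m) * (\<Prod>i\<in>{0..<N}-{m}. M m $$ (i, q i))"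
        using m by (intro prod.remove) auto
      also have "(\<Prod>i\<in>{0..<N}-{m}. M m $$ (i, q i)) = (\<Prod>i\<in>{0..<N}-{m}. A x $$ (i, q i))"
        using qi by (intro prod.cong refl) (auto simp: M_def)
      also have "M m $$ (m, q m) = A' m (q m)" using m qi by (simp add: M_def)
      finally show "A' m (q m) * (\<Prod>i\<in>{0..<N}-{m}. A x $$ (i, q i)) = (\<Prod>i=0..<N. M m $$ (i, q i))" ..
    qed
  qed
  also have "\<dots> = (\<Sum>m<N. \<Sum>j<N. A' m j * cofactor (A x) m j)"
    unfolding atLeast0LessThan
  proof (rule sum.cong[OF refl])
    fix m assume "m \<in> {..<N}"
    then have m: "m < N" by simp
    have "Determinant.det (M m) = (\<Sum>j<N. M m $$ (m, j) * cofactor (M m) m j)" by (rule laplace_expansion_row[OF M m])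
    also have "\<dots> = (\<Sum>j<N. A' m j * cofactor (A x) m j)"
    proof (rule sum.cong[OF refl])
      fix j assume j: "j \<in> {..<N}"
      have "mat_delete (M m) m j = mat_delete (A x) m j"
        unfolding mat_delete_def using A[of x] m j
        by (intro eq_matI) (auto simp: M_def)
      then show "M m $$ (m, j) * cofactor (M m) m j = A' m j * cofactor (A x) m j"
        using m j by (simp add: cofactor_def M_def)
    qed
    finally show "Determinant.det (M m) = (\<Sum>j<N. A' m j * cofactor (A x) m j)" .
  qed
  finally show ?thesis using 1 by (simp only: det_def'[OF A])
qed

lemma pf_pd: "pf P f \<Longrightarrow> \<exists>f'. pd p f f' x"
proof (induction rule: pf.induct)
  case (pf_const c)
  show ?case by (rule exI, rule pd_const)
next
  case (pf_coord q)
  show ?case by (rule exI, rule pd_coord)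
next
  case (pf_add f g)
  then obtain f' g' where "pd p f f' x" "pd p g g' x" by blast
  from pd_add[OF this] show ?case by (rule exI)
next
  case (pf_mult f g)
  then obtain f' g' where "pd p f f' x" "pd p g g' x" by blast
  from pd_mult[OF this] show ?case by (rule exI)
qed

definition Im1 :: "nat \<Rightarrow> nat \<Rightarrow> complex" where "Im1 a b = (if a = b then 1 else 0)"
definition Xm :: "nat \<Rightarrow> (nat \<times> nat \<Rightarrow> real) \<Rightarrow> nat \<Rightarrow> nat \<Rightarrow> complex" where "Xm N x a b = herm_of N x $$ (a, b)"
definition Um :: "nat \<Rightarrow> (nat \<times> nat \<Rightarrow> real) \<Rightarrow> nat \<Rightarrow> nat \<Rightarrow> complex" where "Um N x a b = Im1 a b - Xm N x a b"
text \<open>The inverse matrix by cofactors, a polynomial over \<open>dt\<close>, to which the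
  bounds and derivatives of polynomial functions apply. It is identified with
  \<open>mat_inverse\<close> on the domain in \<open>mat_inverse_Xi\<close>.\<close>

definition Xi :: "nat \<Rightarrow> (nat \<times> nat \<Rightarrow> real) \<Rightarrow> nat \<Rightarrow> nat \<Rightarrow> complex" where
  "Xi N x a b = cofactor (herm_of N x) b a * inverse (of_real (dt N x))"
definition Ui :: "nat \<Rightarrow> (nat \<times> nat \<Rightarrow> real) \<Rightarrow> nat \<Rightarrow> nat \<Rightarrow> complex" where
  "Ui N x a b = cofactor (1\<^sub>m N - herm_of N x) b a * inverse (of_real (du N x))"

lemma Um_index: "a < N \<Longrightarrow> b < N \<Longrightarrow> (1\<^sub>m N - herm_of N x) $$ (a, b) = Um N x a b"
  using carrier_matD[OF herm_of_carrier[of N x]] by (simp add: Um_def Im1_def Xm_def)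

lemma cofactor_inverse:
  fixes A :: "complex mat"
  assumes A: "A \<in> carrier_mat N N" and d: "Determinant.det A \<noteq> 0" and ab: "a < N" "b < N"
  shows "(\<Sum>c<N. A $$ (a, c) * (cofactor A b c * inverse (Determinant.det A))) = Im1 a b"
    "(\<Sum>c<N. (cofactor A c a * inverse (Determinant.det A)) * A $$ (c, b)) = Im1 a b"
proof -
  have adj: "adj_mat A $$ (i, j) = cofactor A j i" if "i < N" "j < N" for i j
    using that A by (simp add: adj_mat_def)
  have "(\<Sum>c<N. A $$ (a, c) * (cofactor A b c * inverse (Determinant.det A))) =
    (\<Sum>c<N. A $$ (a, c) * adj_mat A $$ (c, b)) * inverse (Determinant.det A)"
    unfolding sum_distrib_right using ab adj by (intro sum.cong refl) (simp add: mult.assoc)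
  also have "(\<Sum>c<N. A $$ (a, c) * adj_mat A $$ (c, b)) = (A * adj_mat A) $$ (a, b)"
    by (rule index_mult_mat_sum[symmetric, OF A adj_mat(1)[OF A] ab])
  finally show "(\<Sum>c<N. A $$ (a, c) * (cofactor A b c * inverse (Determinant.det A))) = Im1 a b"
    unfolding adj_mat(2)[OF A] using ab d by (simp add: Im1_def)
  have "(\<Sum>c<N. (cofactor A c a * inverse (Determinant.det A)) * A $$ (c, b)) =
    (\<Sum>c<N. adj_mat A $$ (a, c) * A $$ (c, b)) * inverse (Determinant.det A)"
    unfolding sum_distrib_right using ab adj by (intro sum.cong refl) (simp add: mult_ac)
  also have "(\<Sum>c<N. adj_mat A $$ (a, c) * A $$ (c, b)) = (adj_mat A * A) $$ (a, b)"
    by (rule index_mult_mat_sum[symmetric, OF adj_mat(1)[OF A] A ab])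
  finally show "(\<Sum>c<N. (cofactor A c a * inverse (Determinant.det A)) * A $$ (c, b)) = Im1 a b"
    unfolding adj_mat(3)[OF A] using ab d by (simp add: Im1_def)
qed

lemma mm_Xi:
  assumes "dt N x \<noteq> 0" "a < N" "b < N"
  shows "mm N (Xm N x) (Xi N x) a b = Im1 a b" "mm N (Xi N x) (Xm N x) a b = Im1 a b"
  using cofactor_inverse[OF herm_of_carrier[of N x] _ assms(2,3)] assms(1)
  unfolding mm_def Xm_def Xi_def det_dt by simp_all

lemma mm_Ui:
  assumes "du N x \<noteq> 0" "a < N" "b < N"
  shows "mm N (Um N x) (Ui N x) a b = Im1 a b"
proof -
  have "(\<Sum>c<N. (1\<^sub>m N - herm_of N x) $$ (a, c) * (cofactor (1\<^sub>m N - herm_of N x) b c * inverse (of_real (du N x)))) = Im1 a b"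
    using cofactor_inverse(1)[OF one_minus_carrier[of N x] _ assms(2,3)] assms(1) unfolding det_du by simp
  moreover have "(\<Sum>c<N. (1\<^sub>m N - herm_of N x) $$ (a, c) * (cofactor (1\<^sub>m N - herm_of N x) b c * inverse (of_real (du N x))))
     = mm N (Um N x) (Ui N x) a b"
    unfolding mm_def Ui_def using assms by (intro sum.cong refl) (simp add: Um_index)
  ultimately show ?thesis by simp
qed

lemma mm_assoc: "mm N (mm N A B) C a b = mm N A (mm N B C) a b"
  unfolding mm3 unfolding mm_def by (simp add: sum_distrib_left mult.assoc)

lemma mm_cong: "(\<And>c. c < N \<Longrightarrow> A a c = A' a c) \<Longrightarrow> (\<And>c. c < N \<Longrightarrow> B c b = B' c b) \<Longrightarrow> mm N A B a b = mm N A' B' a b"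
  unfolding mm_def by (intro sum.cong refl) auto

lemma mm_Im1: "b < N \<Longrightarrow> mm N A Im1 a b = A a b" "a < N \<Longrightarrow> mm N Im1 A a b = A a b"
  unfolding mm_def Im1_def by (simp_all add: if_distrib[of "\<lambda>x. _ * x"] if_distrib[of "\<lambda>x. x * _"] cong: if_cong)

lemma pd_Xm: "a < N \<Longrightarrow> b < N \<Longrightarrow> pd p (\<lambda>x. Xm N x a b) (bas p a b) x"
  unfolding Xm_def by (rule pd_entry)

lemma pd_Um: "a < N \<Longrightarrow> b < N \<Longrightarrow> pd p (\<lambda>x. Um N x a b) (- bas p a b) x"
  unfolding Um_def using pd_diff[OF pd_const[of p "Im1 a b" x] pd_Xm[of a N b p x]] by simp

lemma pf_cofactor:
  assumes A: "\<And>x. A x \<in> carrier_mat N N" and e: "\<And>i j. i < N \<Longrightarrow> j < N \<Longrightarrow> pf P (\<lambda>x. A x $$ (i, j))"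
    and ab: "a < N" "b < N"
  shows "pf P (\<lambda>x. cofactor (A x) a b)"
proof -
  have "pf P (\<lambda>x. Determinant.det (mat_delete (A x) a b))"
  proof (rule pf_det)
    show "mat_delete (A x) a b \<in> carrier_mat (N - 1) (N - 1)" for x by (rule mat_delete_carrier[OF A])
    fix i j assume ij: "i < N - 1" "j < N - 1"
    have "mat_delete (A x) a b $$ (i, j) = A x $$ (if i < a then i else Suc i, if j < b then j else Suc j)" for x
      unfolding mat_delete_def using A[of x] ij by simp
    then show "pf P (\<lambda>x. mat_delete (A x) a b $$ (i, j))"
      using ij by (simp only:) (rule e; simp add: less_diff_conv)
  qed
  then show ?thesis unfolding cofactor_def by (intro pf_mult pf_const)
qed

text \<open>The logarithmic derivative of \<open>det X\<close> in the coordinate \<open>p\<close>.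
  For \<open>det (1 - X)\<close> it is \<open>- trU\<close>, the sign coming from the derivative
  \<open>- bas p\<close> of \<open>1 - X\<close>.\<close>

definition trX :: "nat \<Rightarrow> (nat \<times> nat) \<Rightarrow> (nat \<times> nat \<Rightarrow> real) \<Rightarrow> complex" where
  "trX N p x = (\<Sum>a<N. \<Sum>b<N. bas p a b * Xi N x b a)"
definition trU :: "nat \<Rightarrow> (nat \<times> nat) \<Rightarrow> (nat \<times> nat \<Rightarrow> real) \<Rightarrow> complex" where
  "trU N p x = (\<Sum>a<N. \<Sum>b<N. bas p a b * Ui N x b a)"

lemma pd_dt:
  assumes "dt N x \<noteq> 0"
  shows "pd p (dt N) (dt N x * Re (trX N p x)) x" "of_real (Re (trX N p x)) = trX N p x"
proof -
  have "pd p (\<lambda>x. Determinant.det (herm_of N x)) (\<Sum>i<N. \<Sum>j<N. bas p i j * cofactor (herm_of N x) i j) x"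
    by (rule pd_det[OF herm_of_carrier pd_entry])
  moreover have "(\<Sum>i<N. \<Sum>j<N. bas p i j * cofactor (herm_of N x) i j) = of_real (dt N x) * trX N p x"
    unfolding trX_def Xi_def sum_distrib_left using assms by (intro sum.cong refl) simp
  ultimately have d: "pd p (\<lambda>x. complex_of_real (dt N x)) (of_real (dt N x) * trX N p x) x" unfolding det_dt by simp
  from pd_Re[OF d] show "pd p (dt N) (dt N x * Re (trX N p x)) x" by simp
  \<comment> \<open>The determinant is real at every point, so the imaginary part of its derivative
    vanishes; this makes the trace real.\<close>
  from pd_Im[OF d] have "pd p (\<lambda>x. 0 :: real) (dt N x * Im (trX N p x)) x" by simp
  then have "dt N x * Im (trX N p x) = 0" by (rule pd_unique[OF _ pd_const])
  then show "of_real (Re (trX N p x)) = trX N p x" using assms by (simp add: complex_eq_iff)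
qed

lemma pd_du:
  assumes "du N x \<noteq> 0"
  shows "pd p (du N) (- (du N x * Re (trU N p x))) x" "of_real (Re (trU N p x)) = trU N p x"
proof -
  have "pd p (\<lambda>x. Determinant.det (1\<^sub>m N - herm_of N x)) (\<Sum>i<N. \<Sum>j<N. (- bas p i j) * cofactor (1\<^sub>m N - herm_of N x) i j) x"
    by (rule pd_det[OF one_minus_carrier]) (simp only: Um_index pd_Um)
  moreover have "(\<Sum>i<N. \<Sum>j<N. (- bas p i j) * cofactor (1\<^sub>m N - herm_of N x) i j) = - (of_real (du N x) * trU N p x)"
    unfolding trU_def Ui_def sum_distrib_left sum_negf[symmetric] using assms by (intro sum.cong refl) simp
  ultimately have d: "pd p (\<lambda>x. complex_of_real (du N x)) (- (of_real (du N x) * trU N p x)) x" unfolding det_du by simp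
  from pd_Re[OF d] show "pd p (du N) (- (du N x * Re (trU N p x))) x" by simp
  from pd_Im[OF d] have "pd p (\<lambda>x. 0 :: real) (- (du N x * Im (trU N p x))) x" by simp
  then have "- (du N x * Im (trU N p x)) = 0" by (rule pd_unique[OF _ pd_const])
  then show "of_real (Re (trU N p x)) = trU N p x" using assms by (simp add: complex_eq_iff)
qed

lemma eventually_dt_nonzero:
  assumes "dt N x \<noteq> 0" shows "eventually (\<lambda>t. dt N (x(p := t)) \<noteq> 0) (nhds (x p))"
proof -
  have "isCont (\<lambda>t. Re (complex_of_real (dt N (x(p := t))))) (x p)" by (rule pf_Re_isCont[OF pf_dt])
  then have "((\<lambda>t. dt N (x(p := t))) \<longlongrightarrow> dt N (x(p := x p))) (nhds (x p))" by (simp add: isCont_def tendsto_nhds_iff)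
  then show ?thesis using assms by (simp add: tendsto_imp_eventually_ne)
qed

text \<open>As a cofactor over the determinant, each entry has some derivative \<open>E\<close>. Its
  value follows by differentiating the identity that the inverse times \<open>X\<close> is 1, which
  holds nearby on the coordinate line, and multiplying by the inverse from the right.\<close>

lemma pd_Xi:
  assumes d: "dt N x \<noteq> 0" and ab: "a < N" "b < N"
  shows "pd p (\<lambda>x. Xi N x a b) (- mm N (mm N (Xi N x) (bas p)) (Xi N x) a b) x"
proof -
  have "\<exists>E. pd p (\<lambda>x. Xi N x a b) E x" if ab: "a < N" "b < N" for a b
  proof -
    obtain c where c: "pd p (\<lambda>x. cofactor (herm_of N x) b a) c x"
      using pf_pd[OF pf_cofactor[OF herm_of_carrier pf_entry ab(2,1)]] by blast
    obtain e where e: "pd p (\<lambda>x. complex_of_real (dt N x)) e x" using pf_pd[OF pf_dt] by blast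
    have "pd p (\<lambda>x. inverse (complex_of_real (dt N x))) (e * (- (inverse (of_real (dt N x)) ^ Suc (Suc 0)))) x"
      by (rule pd_chain[OF e]) (rule DERIV_inverse, use d in simp)
    from pd_mult[OF c this] show ?thesis unfolding Xi_def by blast
  qed
  then obtain E where E: "\<And>a b. a < N \<Longrightarrow> b < N \<Longrightarrow> pd p (\<lambda>x. Xi N x a b) (E a b) x" by metis
  have e: "mm N E (Xm N x) a b = - mm N (Xi N x) (bas p) a b" if ab: "a < N" "b < N" for a b
  proof -
    have "pd p (\<lambda>x. mm N (Xi N x) (Xm N x) a b) (\<Sum>c<N. E a c * Xm N x c b + Xi N x a c * bas p c b) x"
      unfolding mm_def using ab by (intro pd_sum pd_mult E pd_Xm) auto
    moreover have "pd p (\<lambda>x. mm N (Xi N x) (Xm N x) a b) 0 x"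
      by (rule pd_eventually[OF pd_const[of p "Im1 a b"]], rule eventually_mono[OF eventually_dt_nonzero[OF d]])
         (use mm_Xi(2) ab in blast)
    ultimately have "(\<Sum>c<N. E a c * Xm N x c b + Xi N x a c * bas p c b) = 0" by (rule pd_unique)
    then show ?thesis by (simp add: mm_def sum.distrib eq_neg_iff_add_eq_0)
  qed
  have "E a b = mm N E Im1 a b" using mm_Im1(1)[OF ab(2)] by simp
  also have "\<dots> = mm N E (mm N (Xm N x) (Xi N x)) a b" by (rule mm_cong) (simp_all add: mm_Xi(1)[OF d _ ab(2)])
  also have "\<dots> = mm N (mm N E (Xm N x)) (Xi N x) a b" by (rule mm_assoc[symmetric])
  also have "\<dots> = mm N (\<lambda>a b. - mm N (Xi N x) (bas p) a b) (Xi N x) a b"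
    by (rule mm_cong) (simp_all add: e[OF ab(1)])
  also have "\<dots> = - mm N (mm N (Xi N x) (bas p)) (Xi N x) a b"
    unfolding mm_def[of N "\<lambda>a b. - mm N (Xi N x) (bas p) a b"] mm_def[of N "mm N (Xi N x) (bas p)"] by (simp add: sum_negf)
  finally show ?thesis using E[OF ab] by simp
qed

section \<open>A cutoff near the boundary of the domain\<close>

text \<open>The square removes the kink at \<open>d = e\<close>, so that the cutoff is
  differentiable for all \<open>d \<noteq> 0\<close>; it vanishes for
  \<open>0 < d \<le> e\<close>.\<close>

definition cutoff :: "real \<Rightarrow> real \<Rightarrow> real" where "cutoff e d = (max 0 (1 - e / d))\<^sup>2"
text \<open>This is \<open>d\<close> times the derivative of the cutoff. For positive
  \<open>d\<close> it is at most 2, uniformly in \<open>e\<close>, and tends to 0 with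
  \<open>e\<close>; dominated convergence therefore disposes of the terms that the cutoff
  creates.\<close>

definition cutoff1 :: "real \<Rightarrow> real \<Rightarrow> real" where "cutoff1 e d = 2 * max 0 (1 - e / d) * (e / d)"

lemma DERIV_max_sq: "((\<lambda>y. (max 0 y)\<^sup>2) has_real_derivative 2 * max 0 y) (at (y :: real))"
proof (cases y "0 :: real" rule: linorder_cases)
  case less
  have "eventually (\<lambda>y. y \<in> {..<0 :: real}) (nhds y)" using less by (intro eventually_nhds_in_open) auto
  then have "eventually (\<lambda>y :: real. (max 0 y)\<^sup>2 = 0) (nhds y)" by (rule eventually_mono) (auto simp: max_def)
  from DERIV_cong_ev[OF refl this refl]
  show ?thesis using less by (simp add: max_def)
next
  case greater
  have "eventually (\<lambda>y. y \<in> {0 :: real<..}) (nhds y)" using greater by (intro eventually_nhds_in_open) auto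
  then have "eventually (\<lambda>y :: real. (max 0 y)\<^sup>2 = y\<^sup>2) (nhds y)" by (rule eventually_mono) (auto simp: max_def)
  note e = DERIV_cong_ev[OF refl this refl]
  have "((\<lambda>y :: real. y\<^sup>2) has_real_derivative 2 * y) (at y)" by (auto intro!: derivative_eq_intros)
  then show ?thesis using greater unfolding e by (simp add: max_def)
next
  case equal
  have "((\<lambda>h :: real. (max 0 h)\<^sup>2 / h) \<longlongrightarrow> 0) (at 0)"
  proof (rule Lim_null_comparison)
    show "\<forall>\<^sub>F h in at 0. norm ((max 0 h)\<^sup>2 / h) \<le> \<bar>h :: real\<bar>"
      by (rule always_eventually) (auto simp: max_def power2_eq_square)
    show "((\<lambda>h :: real. \<bar>h\<bar>) \<longlongrightarrow> 0) (at 0)" by (rule tendsto_eq_intros tendsto_rabs_zero tendsto_ident_at)+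
  qed
  then show ?thesis using equal by (simp add: DERIV_def)
qed

lemma DERIV_cut:
  assumes "d \<noteq> 0" shows "(cutoff e has_real_derivative cutoff1 e d / d) (at d)"
proof -
  have "((\<lambda>d. 1 - e / d) has_real_derivative e / d\<^sup>2) (at d)"
    using assms by (auto intro!: derivative_eq_intros simp: power2_eq_square)
  from DERIV_chain2[OF DERIV_max_sq this] show ?thesis
    unfolding cutoff_def[abs_def] cutoff1_def using assms by (simp add: power2_eq_square)
qed

lemma cut_small: "0 < e \<Longrightarrow> 0 < d \<Longrightarrow> d \<le> e \<Longrightarrow> cutoff e d = 0 \<and> cutoff1 e d = 0"
  by (simp add: cutoff_def cutoff1_def max_def)

lemma cut_bounds:
  assumes "0 < e" "0 < d" shows "0 \<le> cutoff e d" "cutoff e d \<le> 1" "0 \<le> cutoff1 e d" "cutoff1 e d \<le> 2"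
proof -
  have m: "0 \<le> max 0 (1 - e / d)" "max 0 (1 - e / d) \<le> 1" using assms by auto
  show "0 \<le> cutoff e d" by (simp add: cutoff_def)
  show "cutoff e d \<le> 1" unfolding cutoff_def using m by (intro power_le_one)
  show "0 \<le> cutoff1 e d" unfolding cutoff1_def using m assms by (intro mult_nonneg_nonneg) auto
  show "cutoff1 e d \<le> 2"
  proof (cases "d \<le> e")
    case True then show ?thesis using cut_small assms by simp
  next
    case False
    then have "e / d \<le> 1" using assms by simp
    then have "2 * max 0 (1 - e / d) * (e / d) \<le> 2 * 1 * 1" using m assms by (intro mult_mono) auto
    then show ?thesis by (simp add: cutoff1_def)
  qed
qed

lemma cut_tendsto:
  assumes "0 < d" shows "(\<lambda>i. cutoff (1 / real (Suc i)) d) \<longlonglongrightarrow> 1" "(\<lambda>i. cutoff1 (1 / real (Suc i)) d) \<longlonglongrightarrow> 0"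
proof -
  have z: "(\<lambda>i. 1 / real (Suc i) / d) \<longlonglongrightarrow> 0"
    using tendsto_divide[OF LIMSEQ_Suc[OF lim_1_over_n] tendsto_const[of d]] assms by simp
  have m: "(\<lambda>i. max 0 (1 - 1 / real (Suc i) / d)) \<longlonglongrightarrow> max 0 (1 - 0)"
    by (intro tendsto_max tendsto_diff tendsto_const z)
  show "(\<lambda>i. cutoff (1 / real (Suc i)) d) \<longlonglongrightarrow> 1" unfolding cutoff_def using tendsto_power[OF m, of 2] by simp
  show "(\<lambda>i. cutoff1 (1 / real (Suc i)) d) \<longlonglongrightarrow> 0"
    unfolding cutoff1_def using tendsto_mult[OF tendsto_mult[OF tendsto_const[of 2] m] z] by simp
qed

section \<open>Weighted integrals\<close>

text \<open>Written with logarithms because their derivatives are the traces \<open>trX\<close> and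
  \<open>- trU\<close>. On the domain it agrees with \<open>jue_weight\<close>, see
  \<open>jue_weight_wt\<close>.\<close>

definition wt :: "nat \<Rightarrow> complex \<Rightarrow> complex \<Rightarrow> (nat \<times> nat \<Rightarrow> real) \<Rightarrow> complex" where
  "wt N \<alpha> \<beta> x = exp (\<alpha> * of_real (ln (dt N x)) + \<beta> * of_real (ln (du N x)))"

definition jint :: "nat \<Rightarrow> complex \<Rightarrow> complex \<Rightarrow> ((nat \<times> nat \<Rightarrow> real) \<Rightarrow> complex) \<Rightarrow> complex" where
  "jint N \<alpha> \<beta> F = (\<integral>x. (if good N x then F x * wt N \<alpha> \<beta> x else 0) \<partial>herm_lebesgue N)"

definition jintegrable :: "nat \<Rightarrow> complex \<Rightarrow> complex \<Rightarrow> ((nat \<times> nat \<Rightarrow> real) \<Rightarrow> complex) \<Rightarrow> bool" where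
  "jintegrable N \<alpha> \<beta> F = integrable (herm_lebesgue N) (\<lambda>x. if good N x then F x * wt N \<alpha> \<beta> x else 0)"

lemma wt_measurable [measurable]: "wt N \<alpha> \<beta> \<in> borel_measurable (herm_lebesgue N)"
  unfolding wt_def[abs_def] by measurable

lemma norm_wt: "good N x \<Longrightarrow> norm (wt N \<alpha> \<beta> x) = dt N x powr Re \<alpha> * du N x powr Re \<beta>"
  using good_det[of N x] by (simp add: wt_def powr_def exp_add norm_mult)

lemma good_measurable:
  assumes "f \<in> borel_measurable (herm_lebesgue N)"
  shows "(\<lambda>x. if good N x then f x else 0 :: complex) \<in> borel_measurable (herm_lebesgue N)"
proof -
  have "(\<lambda>x. indicator (herm01 N) x *\<^sub>R f x) \<in> borel_measurable (herm_lebesgue N)" using assms by measurable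
  then show ?thesis by (rule measurable_cong[THEN iffD1, rotated]) (auto simp: herm01_iff indicator_def)
qed

text \<open>Boundedness away from the part of the boundary where one of the two determinants vanishes.\<close>

definition tame :: "nat \<Rightarrow> ((nat \<times> nat \<Rightarrow> real) \<Rightarrow> complex) \<Rightarrow> bool" where
  "tame N f \<longleftrightarrow> f \<in> borel_measurable (herm_lebesgue N) \<and>
     (\<forall>e>0. \<exists>C. \<forall>x. good N x \<and> e \<le> dt N x * du N x \<longrightarrow> norm (f x) \<le> C)"

lemma tameD: "tame N f \<Longrightarrow> 0 < e \<Longrightarrow> \<exists>C. \<forall>x. good N x \<and> e \<le> dt N x * du N x \<longrightarrow> norm (f x) \<le> C"
  by (simp add: tame_def)

lemma tame_const: "tame N (\<lambda>x. c)"
  unfolding tame_def by auto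

lemma tame_pf: assumes "pf (idx N) f" shows "tame N f"
  unfolding tame_def herm_lebesgue_def using pf_measurable[OF assms] pf_bounded_good[OF assms] by blast

lemma tame_add: assumes "tame N f" "tame N g" shows "tame N (\<lambda>x. f x + g x)"
  unfolding tame_def
proof (intro conjI allI impI)
  show "(\<lambda>x. f x + g x) \<in> borel_measurable (herm_lebesgue N)" using assms unfolding tame_def by (auto intro: borel_measurable_add borel_measurable_times)
  fix e :: real assume e: "0 < e"
  obtain C D where "\<forall>x. good N x \<and> e \<le> dt N x * du N x \<longrightarrow> norm (f x) \<le> C"
    "\<forall>x. good N x \<and> e \<le> dt N x * du N x \<longrightarrow> norm (g x) \<le> D" using tameD[OF assms(1) e] tameD[OF assms(2) e] by blast
  then show "\<exists>C. \<forall>x. good N x \<and> e \<le> dt N x * du N x \<longrightarrow> norm (f x + g x) \<le> C"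
    by (intro exI[of _ "C + D"]) (meson add_mono norm_triangle_le)
qed

lemma tame_mult: assumes "tame N f" "tame N g" shows "tame N (\<lambda>x. f x * g x)"
  unfolding tame_def
proof (intro conjI allI impI)
  show "(\<lambda>x. f x * g x) \<in> borel_measurable (herm_lebesgue N)" using assms unfolding tame_def by (auto intro: borel_measurable_add borel_measurable_times)
  fix e :: real assume e: "0 < e"
  obtain C D where "\<forall>x. good N x \<and> e \<le> dt N x * du N x \<longrightarrow> norm (f x) \<le> C"
    "\<forall>x. good N x \<and> e \<le> dt N x * du N x \<longrightarrow> norm (g x) \<le> D" using tameD[OF assms(1) e] tameD[OF assms(2) e] by blast
  then have "norm (f x * g x) \<le> \<bar>C\<bar> * \<bar>D\<bar>" if "good N x \<and> e \<le> dt N x * du N x" for x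
    unfolding norm_mult using that by (intro mult_mono) force+
  then show "\<exists>C. \<forall>x. good N x \<and> e \<le> dt N x * du N x \<longrightarrow> norm (f x * g x) \<le> C" by blast
qed

lemma tame_sum: "(\<And>i. i \<in> I \<Longrightarrow> tame N (f i)) \<Longrightarrow> tame N (\<lambda>x. \<Sum>i\<in>I. f i x)"
  by (induction I rule: infinite_finite_induct) (auto intro: tame_add tame_const)

lemma tame_prod: "(\<And>i. i \<in> I \<Longrightarrow> tame N (f i)) \<Longrightarrow> tame N (\<lambda>x. \<Prod>i\<in>I. f i x)"
  by (induction I rule: infinite_finite_induct) (auto intro: tame_mult tame_const)

lemma tame_diff: assumes "tame N f" "tame N g" shows "tame N (\<lambda>x. f x - g x)"
  using tame_add[OF assms(1) tame_mult[OF tame_const[of N "-1"] assms(2)]] by simp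

text \<open>Both determinants are bounded above by \<open>D\<close> on the domain, so a lower bound
  \<open>e\<close> for their product keeps each of them above \<open>e / D\<close>.\<close>

lemma dets_range:
  assumes "0 < e"
  obtains d D where "0 < d" "0 < D" "\<And>x. good N x \<Longrightarrow> e \<le> dt N x * du N x \<Longrightarrow> d \<le> dt N x \<and> dt N x \<le> D \<and> d \<le> du N x \<and> du N x \<le> D"
proof -
  obtain C1 C2 where C: "\<And>x. good N x \<Longrightarrow> norm (complex_of_real (dt N x)) \<le> C1" "\<And>x. good N x \<Longrightarrow> norm (complex_of_real (du N x)) \<le> C2"
    using pf_bounded_good[OF pf_dt] pf_bounded_good[OF pf_du] by metis
  define D where "D = max 1 (max C1 C2)"
  have D: "0 < D" by (simp add: D_def)
  have le: "dt N x \<le> D" "du N x \<le> D" if "good N x" for x using C[of x] that by (auto simp: D_def)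
  show thesis
  proof (rule that[of "e / D" D])
    show "0 < e / D" using assms D by simp
    show "0 < D" by (rule D)
    fix x assume g: "good N x" and e: "e \<le> dt N x * du N x"
    have "dt N x * du N x \<le> dt N x * D" "dt N x * du N x \<le> D * du N x"
      using good_det[OF g] le[OF g] by (auto intro: mult_left_mono mult_right_mono)
    then show "e / D \<le> dt N x \<and> dt N x \<le> D \<and> e / D \<le> du N x \<and> du N x \<le> D"
      using e D le[OF g] by (simp add: divide_le_eq mult.commute)
  qed
qed

lemma tame_inverse:
  "tame N (\<lambda>x. inverse (complex_of_real (dt N x)))" "tame N (\<lambda>x. inverse (complex_of_real (du N x)))"
proof -
  have "\<exists>C. \<forall>x. good N x \<and> e \<le> dt N x * du N x \<longrightarrow> norm (inverse (complex_of_real (dt N x))) \<le> C"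
    "\<exists>C. \<forall>x. good N x \<and> e \<le> dt N x * du N x \<longrightarrow> norm (inverse (complex_of_real (du N x))) \<le> C" if "0 < e" for e
  proof -
    from dets_range[OF that, of N] obtain d D where d: "0 < d" "\<And>x. good N x \<Longrightarrow> e \<le> dt N x * du N x \<Longrightarrow> d \<le> dt N x \<and> dt N x \<le> D \<and> d \<le> du N x \<and> du N x \<le> D"
      by metis
    have "inverse y \<le> inverse d" if "d \<le> y" for y using d(1) that by (simp add: le_imp_inverse_le)
    then have "norm (inverse (complex_of_real (dt N x))) \<le> inverse d" "norm (inverse (complex_of_real (du N x))) \<le> inverse d"
      if "good N x" "e \<le> dt N x * du N x" for x
      using d(2)[OF that] good_det[OF that(1)] by (auto simp: norm_inverse)
    then show "\<exists>C. \<forall>x. good N x \<and> e \<le> dt N x * du N x \<longrightarrow> norm (inverse (complex_of_real (dt N x))) \<le> C"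
      "\<exists>C. \<forall>x. good N x \<and> e \<le> dt N x * du N x \<longrightarrow> norm (inverse (complex_of_real (du N x))) \<le> C" by blast+
  qed
  then show "tame N (\<lambda>x. inverse (complex_of_real (dt N x)))" "tame N (\<lambda>x. inverse (complex_of_real (du N x)))"
    unfolding tame_def by (auto intro!: borel_measurable_inverse)
qed

lemma tame_wt: "tame N (wt N \<alpha> \<beta>)"
  unfolding tame_def
proof (intro conjI allI impI wt_measurable)
  fix e :: real assume "0 < e"
  from dets_range[OF this, of N] obtain d D where d: "0 < d" "0 < D" "\<And>x. good N x \<Longrightarrow> e \<le> dt N x * du N x \<Longrightarrow> d \<le> dt N x \<and> dt N x \<le> D \<and> d \<le> du N x \<and> du N x \<le> D"
    by metis
  define L where "L = \<bar>ln d\<bar> + \<bar>ln D\<bar>"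
  have L: "\<bar>ln y\<bar> \<le> L" if "d \<le> y" "y \<le> D" for y
  proof -
    have "ln d \<le> ln y" "ln y \<le> ln D" using d(1,2) that by auto
    then show ?thesis unfolding L_def by linarith
  qed
  have "norm (wt N \<alpha> \<beta> x) \<le> exp (\<bar>Re \<alpha>\<bar> * L + \<bar>Re \<beta>\<bar> * L)" if x: "good N x" "e \<le> dt N x * du N x" for x
  proof -
    have b: "c * y \<le> \<bar>c\<bar> * L" if "\<bar>y\<bar> \<le> L" for c y :: real
      using mult_left_mono[OF that, of "\<bar>c\<bar>"] abs_ge_self[of "c * y"] by (simp add: abs_mult)
    have "Re \<alpha> * ln (dt N x) \<le> \<bar>Re \<alpha>\<bar> * L" "Re \<beta> * ln (du N x) \<le> \<bar>Re \<beta>\<bar> * L"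
      using d(3)[OF x] by (simp_all add: b L)
    then show ?thesis by (simp add: wt_def)
  qed
  then show "\<exists>C. \<forall>x. good N x \<and> e \<le> dt N x * du N x \<longrightarrow> norm (wt N \<alpha> \<beta> x) \<le> C" by blast
qed

lemma tame_tperm:
  assumes "finite S" "s permutes S" "\<And>k a b. k \<in> S \<Longrightarrow> a < N \<Longrightarrow> b < N \<Longrightarrow> tame N (\<lambda>x. A x k a b)"
  shows "tame N (\<lambda>x. tperm N S s (A x))"
  unfolding tperm_def
proof (intro tame_sum tame_prod assms(3))
  fix i k assume "i \<in> S \<rightarrow>\<^sub>E {..<N}" "k \<in> S"
  then show "i k < N" "i (s k) < N" using permutes_in_image[OF assms(2), of k] by (auto simp: PiE_iff)
qed

lemma tame_mm:
  assumes "\<And>c. c < N \<Longrightarrow> tame N (\<lambda>x. A x a c)" "\<And>c. c < N \<Longrightarrow> tame N (\<lambda>x. B x c b)"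
  shows "tame N (\<lambda>x. mm N (A x) (B x) a b)"
  unfolding mm_def using assms by (intro tame_sum tame_mult) auto

lemma tame_entries:
  assumes "a < N" "b < N"
  shows "tame N (\<lambda>x. Xm N x a b)" "tame N (\<lambda>x. Um N x a b)" "tame N (\<lambda>x. Xi N x a b)" "tame N (\<lambda>x. Ui N x a b)"
proof -
  show X: "tame N (\<lambda>x. Xm N x a b)" unfolding Xm_def by (rule tame_pf[OF pf_entry[OF assms]])
  show "tame N (\<lambda>x. Um N x a b)" unfolding Um_def by (rule tame_diff[OF tame_const X])
  show "tame N (\<lambda>x. Xi N x a b)" unfolding Xi_def
    by (rule tame_mult[OF tame_pf[OF pf_cofactor[OF herm_of_carrier pf_entry assms(2,1)]] tame_inverse(1)])
  show "tame N (\<lambda>x. Ui N x a b)" unfolding Ui_def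
    by (rule tame_mult[OF tame_pf[OF pf_cofactor[OF one_minus_carrier pf_entry1 assms(2,1)]] tame_inverse(2)])
qed

lemma tame_tr: "tame N (trX N p)" "tame N (trU N p)"
  unfolding trX_def[abs_def] trU_def[abs_def] by (intro tame_sum tame_mult tame_const tame_entries; simp)+

lemma tame_cut:
  assumes "0 < e" shows "tame N (\<lambda>x. of_real (cutoff e (dt N x * du N x)))" "tame N (\<lambda>x. of_real (cutoff1 e (dt N x * du N x)))"
proof -
  have "norm (complex_of_real (cutoff e (dt N x * du N x))) \<le> 1" "norm (complex_of_real (cutoff1 e (dt N x * du N x))) \<le> 2" if "good N x" for x
    using cut_bounds[OF assms, of "dt N x * du N x"] good_det[OF that] by (simp_all add: abs_of_nonneg)
  moreover have "(\<lambda>x. complex_of_real (cutoff e (dt N x * du N x))) \<in> borel_measurable (herm_lebesgue N)"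
    "(\<lambda>x. complex_of_real (cutoff1 e (dt N x * du N x))) \<in> borel_measurable (herm_lebesgue N)"
    unfolding cutoff_def cutoff1_def by measurable
  ultimately show "tame N (\<lambda>x. of_real (cutoff e (dt N x * du N x)))" "tame N (\<lambda>x. of_real (cutoff1 e (dt N x * du N x)))"
    unfolding tame_def by blast+
qed

lemma emeasure_herm01_finite: "integrable (herm_lebesgue N) (\<lambda>x. indicator (herm01 N) x :: real)"
proof -
  have "integrable (herm_lebesgue N) (\<lambda>x. indicator (herm01 N) x * (dt N x powr 0 * du N x powr 0))"
    by (rule integrable_wabs) auto
  then show ?thesis
    by (rule Bochner_Integration.integrable_cong[THEN iffD1, rotated 2]) (auto simp: indicator_def herm01_iff dest: good_det)
qed

lemma tame_integrable:
  assumes f: "tame N f" and e: "0 < e" and z: "\<And>x. good N x \<Longrightarrow> dt N x * du N x < e \<Longrightarrow> f x = 0"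
  shows "integrable (herm_lebesgue N) (\<lambda>x. if good N x then f x else 0)"
proof -
  obtain C where C: "\<And>x. good N x \<Longrightarrow> e \<le> dt N x * du N x \<Longrightarrow> norm (f x) \<le> C" using tameD[OF f e] by blast
  show ?thesis
  proof (rule Bochner_Integration.integrable_bound)
    show "integrable (herm_lebesgue N) (\<lambda>x. \<bar>C\<bar> * indicator (herm01 N) x :: real)"
      using emeasure_herm01_finite by simp
    show "(\<lambda>x. if good N x then f x else 0) \<in> borel_measurable (herm_lebesgue N)"
      using f by (intro good_measurable) (simp add: tame_def)
    show "AE x in herm_lebesgue N. norm (if good N x then f x else 0) \<le> norm (\<bar>C\<bar> * indicator (herm01 N) x :: real)"
    proof (rule AE_I2)
      fix x assume x: "x \<in> space (herm_lebesgue N)"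
      show "norm (if good N x then f x else 0) \<le> norm (\<bar>C\<bar> * indicator (herm01 N) x :: real)"
        using z[of x] C[of x] x by (cases "e \<le> dt N x * du N x") (auto simp: indicator_def herm01_iff)
    qed
  qed
qed

lemma pd_mm:
  assumes "\<And>c. c < N \<Longrightarrow> pd p (\<lambda>x. A x a c) (A' a c) x" "\<And>c. c < N \<Longrightarrow> pd p (\<lambda>x. B x c b) (B' c b) x"
  shows "pd p (\<lambda>x. mm N (A x) (B x) a b) (mm N A' (B x) a b + mm N (A x) B' a b) x"
proof -
  have "pd p (\<lambda>x. \<Sum>c<N. A x a c * B x c b) (\<Sum>c<N. A' a c * B x c b + A x a c * B' c b) x"
    using assms by (intro pd_sum pd_mult) auto
  then show ?thesis unfolding mm_def sum.distrib .
qed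

lemma pd_wt:
  assumes "good N x" shows "pd p (wt N \<alpha> \<beta>) ((\<alpha> * trX N p x - \<beta> * trU N p x) * wt N \<alpha> \<beta> x) x"
proof -
  note d = good_det[OF assms]
  have "pd p (\<lambda>x. ln (dt N x)) (dt N x * Re (trX N p x) * (1 / dt N x)) x"
    by (rule pd_real_chain[OF pd_dt(1)]) (use d in \<open>auto intro: DERIV_ln_divide\<close>)
  then have X: "pd p (\<lambda>x. complex_of_real (ln (dt N x))) (trX N p x) x"
    using pd_of_real pd_dt(2)[of N x p] d by fastforce
  have "pd p (\<lambda>x. ln (du N x)) (- (du N x * Re (trU N p x)) * (1 / du N x)) x"
    by (rule pd_real_chain[OF pd_du(1)]) (use d in \<open>auto intro: DERIV_ln_divide\<close>)
  then have "pd p (\<lambda>x. complex_of_real (ln (du N x))) (of_real (- Re (trU N p x))) x"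
    using pd_of_real[of p "\<lambda>x. ln (du N x)" "- Re (trU N p x)" x] d by simp
  then have U: "pd p (\<lambda>x. complex_of_real (ln (du N x))) (- trU N p x) x"
    using pd_du(2)[of N x p] d by simp
  have "pd p (\<lambda>x. \<alpha> * of_real (ln (dt N x)) + \<beta> * of_real (ln (du N x))) (\<alpha> * trX N p x + \<beta> * - trU N p x) x"
    by (intro pd_add pd_cmult X U)
  from pd_chain[OF this DERIV_exp] show ?thesis unfolding wt_def[abs_def] by simp
qed

lemma pd_cut:
  assumes "good N x"
  shows "pd p (\<lambda>x. complex_of_real (cutoff e (dt N x * du N x))) (of_real (cutoff1 e (dt N x * du N x)) * (trX N p x - trU N p x)) x"
proof -
  note d = good_det[OF assms]
  let ?d = "dt N x * du N x"
  have "pd p (\<lambda>x. dt N x * du N x) (dt N x * Re (trX N p x) * du N x + dt N x * - (du N x * Re (trU N p x))) x"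
    using d by (intro pd_mult pd_dt(1) pd_du(1)) auto
  then have "pd p (\<lambda>x. dt N x * du N x) (?d * (Re (trX N p x) - Re (trU N p x))) x"
    by (rule pd_eq) (simp add: algebra_simps)
  then have "pd p (\<lambda>x. cutoff e (dt N x * du N x)) (?d * (Re (trX N p x) - Re (trU N p x)) * (cutoff1 e ?d / ?d)) x"
    by (rule pd_real_chain) (rule DERIV_cut, use d in simp)
  then have "pd p (\<lambda>x. cutoff e (dt N x * du N x)) (cutoff1 e ?d * (Re (trX N p x) - Re (trU N p x))) x"
    by (rule pd_eq) (use d in simp)
  from pd_of_real[OF this] show ?thesis using pd_du(2)[of N x p] pd_dt(2)[of N x p] d by simp
qed

section \<open>The loop equations\<close>

definition tp :: "nat \<Rightarrow> nat \<Rightarrow> (nat \<Rightarrow> nat) \<Rightarrow> (nat \<Rightarrow> nat \<Rightarrow> complex) \<Rightarrow> (nat \<Rightarrow> nat \<Rightarrow> complex) \<Rightarrow> complex" where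
  "tp N n \<sigma> Y V = tperm N {1..n} \<sigma> ((\<lambda>_. Y)(n := V))"

lemma tp_sum: "0 < n \<Longrightarrow> tp N n \<sigma> Y (\<lambda>a b. \<Sum>q\<in>Q. c q * V q a b) = (\<Sum>q\<in>Q. c q * tp N n \<sigma> Y (V q))"
  unfolding tp_def by (rule tperm_slot_sum) auto

lemma tp_linear: "0 < n \<Longrightarrow> tp N n \<sigma> Y (\<lambda>a b. c * U a b + d * V a b) = c * tp N n \<sigma> Y U + d * tp N n \<sigma> Y V"
  unfolding tp_def by (rule tperm_slot_linear) auto

lemma tp_cong:
  assumes "\<sigma> permutes {1..n}" "\<And>a b. a < N \<Longrightarrow> b < N \<Longrightarrow> Y a b = Y' a b" "\<And>a b. a < N \<Longrightarrow> b < N \<Longrightarrow> V a b = V' a b"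
  shows "tp N n \<sigma> Y V = tp N n \<sigma> Y' V'"
  unfolding tp_def
proof (rule tperm_cong[OF assms(1)])
  fix k a b assume ab: "a < N" "b < N"
  show "((\<lambda>_. Y)(n := V)) k a b = ((\<lambda>_. Y')(n := V')) k a b"
    using assms(2,3)[OF ab] by (cases "k = n") simp_all
qed

lemma tp_self: "tp N n \<sigma> Y Y = tperm N {1..n} \<sigma> (\<lambda>_. Y)"
proof -
  have "(\<lambda>_. Y)(n := Y) = (\<lambda>_. Y)" by (rule ext) (simp only: fun_upd_apply if_cancel)
  then show ?thesis unfolding tp_def by (rule arg_cong)
qed

lemma tp_tame:
  assumes "\<sigma> permutes {1..n}" "\<And>a b. a < N \<Longrightarrow> b < N \<Longrightarrow> tame N (\<lambda>x. Y x a b)" "\<And>a b. a < N \<Longrightarrow> b < N \<Longrightarrow> tame N (\<lambda>x. V x a b)"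
  shows "tame N (\<lambda>x. tp N n \<sigma> (Y x) (V x))"
  unfolding tp_def
proof (rule tame_tperm[OF _ assms(1)])
  fix k a b assume "a < N" "b < N"
  then show "tame N (\<lambda>x. ((\<lambda>_. Y x)(n := V x)) k a b)" using assms(2,3) by (cases "k = n") auto
qed simp

text \<open>The trace pairs \<open>M\<close> with the basis, and completeness then puts
  \<open>M\<close> in the place of the dual basis matrix.\<close>

lemma tr_contract:
  assumes "a < N" "b < N"
  shows "(\<Sum>p\<in>idx N. (\<Sum>i<N. \<Sum>j<N. bas p i j * M j i) * mm N (mm N U (bs p)) Z a b) = mm N (mm N U M) Z a b"
proof -
  have "(\<Sum>p\<in>idx N. (\<Sum>i<N. \<Sum>j<N. bas p i j * M j i) * mm N (mm N U (bs p)) Z a b) =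
    (\<Sum>p\<in>idx N. \<Sum>c<N. \<Sum>d<N. \<Sum>i<N. \<Sum>j<N. (M j i * U a c * Z d b) * (bas p i j * bs p c d))"
    unfolding mm3 sum_distrib_left sum_distrib_right by (intro sum.cong refl) (simp add: mult_ac)
  also have "\<dots> = (\<Sum>c<N. \<Sum>d<N. \<Sum>i<N. \<Sum>j<N. \<Sum>p\<in>idx N. (M j i * U a c * Z d b) * (bas p i j * bs p c d))"
    by (simp only: sum.swap[of _ _ "idx N"])
  also have "\<dots> = (\<Sum>c<N. \<Sum>d<N. \<Sum>i<N. \<Sum>j<N. (if j = c then if i = d then M j i * U a c * Z d b else 0 else 0))"
    unfolding sum_distrib_left[symmetric] by (intro sum.cong refl) (simp add: bas_complete)
  also have "\<dots> = (\<Sum>c<N. \<Sum>d<N. M c d * U a c * Z d b)"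
    by (intro sum.cong refl) simp
  also have "\<dots> = mm N (mm N U M) Z a b" unfolding mm3 by (intro sum.cong refl) (simp add: mult_ac)
  finally show ?thesis .
qed

lemma bas_bs:
  assumes "a < N" "b < N"
  shows "(\<Sum>p\<in>idx N. mm N (bas p) (bs p) a b) = of_nat N * Im1 a b"
    "(\<Sum>p\<in>idx N. mm N (bs p) (bas p) a b) = of_nat N * Im1 a b"
proof -
  have "(\<Sum>p\<in>idx N. mm N (bas p) (bs p) a b) = (\<Sum>c<N. \<Sum>p\<in>idx N. bas p a c * bs p c b)"
    unfolding mm_def by (rule sum.swap)
  then show "(\<Sum>p\<in>idx N. mm N (bas p) (bs p) a b) = of_nat N * Im1 a b"
    using assms by (simp add: bas_complete Im1_def)
  have "(\<Sum>p\<in>idx N. mm N (bs p) (bas p) a b) = (\<Sum>c<N. \<Sum>p\<in>idx N. bas p c b * bs p a c)"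
    unfolding mm_def by (subst sum.swap) (simp only: mult.commute)
  then show "(\<Sum>p\<in>idx N. mm N (bs p) (bas p) a b) = of_nat N * Im1 a b"
    using assms by (simp add: bas_complete Im1_def)
qed

lemma mm_sum_left: "mm N (\<lambda>a b. \<Sum>q\<in>Q. A q a b) B a b = (\<Sum>q\<in>Q. mm N (A q) B a b)"
  unfolding mm_def sum_distrib_right by (rule sum.swap)

lemma mm_sum_right: "mm N A (\<lambda>a b. \<Sum>q\<in>Q. B q a b) a b = (\<Sum>q\<in>Q. mm N A (B q) a b)"
  unfolding mm_def sum_distrib_left by (rule sum.swap)

section \<open>Linearity of the weighted integral\<close>

lemma jint_add:
  assumes "jintegrable N \<alpha> \<beta> f" "jintegrable N \<alpha> \<beta> g"
  shows "jintegrable N \<alpha> \<beta> (\<lambda>x. f x + g x)" "jint N \<alpha> \<beta> (\<lambda>x. f x + g x) = jint N \<alpha> \<beta> f + jint N \<alpha> \<beta> g"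
proof -
  have e: "(\<lambda>x. if good N x then (f x + g x) * wt N \<alpha> \<beta> x else 0) =
    (\<lambda>x. (if good N x then f x * wt N \<alpha> \<beta> x else 0) + (if good N x then g x * wt N \<alpha> \<beta> x else 0))"
    by (auto simp: fun_eq_iff distrib_right)
  show "jintegrable N \<alpha> \<beta> (\<lambda>x. f x + g x)" "jint N \<alpha> \<beta> (\<lambda>x. f x + g x) = jint N \<alpha> \<beta> f + jint N \<alpha> \<beta> g"
    using assms unfolding jintegrable_def jint_def e by simp_all
qed

lemma jint_cmult:
  shows "jintegrable N \<alpha> \<beta> f \<Longrightarrow> jintegrable N \<alpha> \<beta> (\<lambda>x. c * f x)" "jint N \<alpha> \<beta> (\<lambda>x. c * f x) = c * jint N \<alpha> \<beta> f"
proof -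
  have e: "(\<lambda>x. if good N x then (c * f x) * wt N \<alpha> \<beta> x else 0) =
    (\<lambda>x. c * (if good N x then f x * wt N \<alpha> \<beta> x else 0))"
    by (auto simp: fun_eq_iff)
  show "jintegrable N \<alpha> \<beta> f \<Longrightarrow> jintegrable N \<alpha> \<beta> (\<lambda>x. c * f x)" "jint N \<alpha> \<beta> (\<lambda>x. c * f x) = c * jint N \<alpha> \<beta> f"
    unfolding jintegrable_def jint_def e by simp_all
qed

lemma jint_zero: "jintegrable N \<alpha> \<beta> (\<lambda>x. 0)" "jint N \<alpha> \<beta> (\<lambda>x. 0) = 0"
  unfolding jintegrable_def jint_def mult_zero_left if_cancel by simp_all

lemma jint_sum:
  "(\<And>i. i \<in> I \<Longrightarrow> jintegrable N \<alpha> \<beta> (f i)) \<Longrightarrow> jintegrable N \<alpha> \<beta> (\<lambda>x. \<Sum>i\<in>I. f i x) \<and>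
     jint N \<alpha> \<beta> (\<lambda>x. \<Sum>i\<in>I. f i x) = (\<Sum>i\<in>I. jint N \<alpha> \<beta> (f i))"
  by (induction I rule: infinite_finite_induct) (auto simp: jint_zero jint_add)

lemma jint_cong: "(\<And>x. good N x \<Longrightarrow> f x = g x) \<Longrightarrow> jint N \<alpha> \<beta> f = jint N \<alpha> \<beta> g"
  unfolding jint_def by (intro Bochner_Integration.integral_cong refl) simp

text \<open>Two instances are used: \<open>Y = Z = X\<close>, \<open>L = 1\<close>, \<open>s = z = 1\<close> for positive powers, and
  \<open>Y = L = X\<^sup>-\<^sup>1\<close>, \<open>Z = 1\<close>, \<open>s = -1\<close>, \<open>z = 0\<close> for negative ones. The growth of \<open>Y\<close> at \<open>det X = 0\<close> is
  measured by \<open>\<kappa>\<close>.\<close>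

locale loop_data =
  fixes N :: nat and Y L Z :: "(nat \<times> nat \<Rightarrow> real) \<Rightarrow> nat \<Rightarrow> nat \<Rightarrow> complex" and s z :: complex and \<kappa> :: real
  assumes LZ: "good N x \<Longrightarrow> a < N \<Longrightarrow> b < N \<Longrightarrow> mm N (L x) (Z x) a b = Y x a b"
    and UL: "good N x \<Longrightarrow> a < N \<Longrightarrow> b < N \<Longrightarrow> mm N (Um N x) (L x) a b = s * (Im1 a b - Y x a b)"
    and UXZ: "good N x \<Longrightarrow> a < N \<Longrightarrow> b < N \<Longrightarrow> mm N (mm N (Um N x) (Xi N x)) (Z x) a b = s * (Im1 a b - Y x a b)"
    and UUZ: "good N x \<Longrightarrow> a < N \<Longrightarrow> b < N \<Longrightarrow> mm N (mm N (Um N x) (Ui N x)) (Z x) a b = Z x a b"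
    and zU: "a < N \<Longrightarrow> b < N \<Longrightarrow> z * Um N x a b = z * (Im1 a b - Y x a b)"
    and dY: "good N x \<Longrightarrow> a < N \<Longrightarrow> b < N \<Longrightarrow> pd p (\<lambda>x. Y x a b) (s * mm N (mm N (L x) (bas p)) (L x) a b) x"
    and dZ: "good N x \<Longrightarrow> a < N \<Longrightarrow> b < N \<Longrightarrow> pd p (\<lambda>x. Z x a b) (z * bas p a b) x"
    and ss: "s * s = 1"
    and tame_YLZ: "a < N \<Longrightarrow> b < N \<Longrightarrow> tame N (\<lambda>x. Y x a b)" "a < N \<Longrightarrow> b < N \<Longrightarrow> tame N (\<lambda>x. L x a b)"
      "a < N \<Longrightarrow> b < N \<Longrightarrow> tame N (\<lambda>x. Z x a b)"
    and bnd: "\<exists>C. \<forall>x a b. good N x \<longrightarrow> a < N \<longrightarrow> b < N \<longrightarrow> norm (Y x a b) \<le> C * dt N x powr (- \<kappa>)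
       \<and> norm (Z x a b) \<le> C * dt N x powr (- \<kappa>) \<and> 1 \<le> C * dt N x powr (- \<kappa>)"
begin

text \<open>The vector field of the integration by parts is \<open>(1 - X) \<cdot> E \<cdot> Z\<close> in the last slot, with \<open>E\<close>
  running through the basis dual to the coordinates. The factor \<open>1 - X\<close> (and \<open>Z = X\<close>) cancels the poles of
  the logarithmic derivative of the weight.\<close>

definition P :: "nat \<times> nat \<Rightarrow> (nat \<times> nat \<Rightarrow> real) \<Rightarrow> nat \<Rightarrow> nat \<Rightarrow> complex" where
  "P p x = mm N (mm N (Um N x) (bs p)) (Z x)"

definition dP :: "nat \<times> nat \<Rightarrow> (nat \<times> nat \<Rightarrow> real) \<Rightarrow> nat \<Rightarrow> nat \<Rightarrow> complex" where
  "dP p x a b = - mm N (mm N (bas p) (bs p)) (Z x) a b + z * mm N (mm N (Um N x) (bs p)) (bas p) a b"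

text \<open>The factor \<open>s\<close> is attached to the right matrix so that
  \<open>tperm_contract\<close> applies with \<open>s * L\<close> as its \<open>D\<close>.\<close>

definition dY' :: "nat \<times> nat \<Rightarrow> (nat \<times> nat \<Rightarrow> real) \<Rightarrow> nat \<Rightarrow> nat \<Rightarrow> complex" where
  "dY' p x = mm N (mm N (L x) (bas p)) (\<lambda>a b. s * L x a b)"

definition dpsi :: "nat \<Rightarrow> (nat \<Rightarrow> nat) \<Rightarrow> nat \<times> nat \<Rightarrow> (nat \<times> nat \<Rightarrow> real) \<Rightarrow> complex" where
  "dpsi n \<sigma> p x = (\<Sum>m\<in>{1..<n}. tperm N {1..n} \<sigma> ((\<lambda>_. Y x)(m := dY' p x, n := P p x))) + tp N n \<sigma> (Y x) (dP p x)"

lemma pd_P: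
  assumes g: "good N x" and ab: "a < N" "b < N" shows "pd p (\<lambda>x. P p x a b) (dP p x a b) x"
proof -
  have "pd p (\<lambda>x. mm N (mm N (Um N x) (bs p)) (Z x) a b)
     (mm N (\<lambda>a c. mm N (\<lambda>a b. - bas p a b) (bs p) a c + mm N (Um N x) (\<lambda>_ _. 0) a c) (Z x) a b +
      mm N (mm N (Um N x) (bs p)) (\<lambda>a b. z * bas p a b) a b) x"
  proof (rule pd_mm)
    fix c assume c: "c < N"
    show "pd p (\<lambda>x. mm N (Um N x) (bs p) a c) (mm N (\<lambda>a b. - bas p a b) (bs p) a c + mm N (Um N x) (\<lambda>_ _. 0) a c) x"
      by (rule pd_mm[where B = "\<lambda>_. bs p", OF pd_Um pd_const]) (use ab in auto)
    show "pd p (\<lambda>x. Z x c b) (z * bas p c b) x" by (rule dZ[OF g c ab(2)])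
  qed
  then show ?thesis unfolding P_def
    by (rule pd_eq) (simp add: dP_def mm_def sum_negf sum_distrib_left mult.left_commute)
qed

lemma pd_psi:
  assumes g: "good N x" and \<sigma>: "\<sigma> permutes {1..n}" and n: "0 < n"
  shows "pd p (\<lambda>x. tp N n \<sigma> (Y x) (P p x)) (dpsi n \<sigma> p x) x"
proof -
  let ?D = "\<lambda>m. if m = n then dP p x else dY' p x"
  have "pd p (\<lambda>x. tperm N {1..n} \<sigma> ((\<lambda>_. Y x)(n := P p x)))
     (\<Sum>m\<in>{1..n}. tperm N {1..n} \<sigma> (((\<lambda>_. Y x)(n := P p x))(m := ?D m))) x"
  proof (rule pd_tperm[OF _ \<sigma>])
    fix k a b assume ab: "a < N" "b < N"
    show "pd p (\<lambda>x. ((\<lambda>_. Y x)(n := P p x)) k a b) (?D k a b) x"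
    proof (cases "k = n")
      case True then show ?thesis using pd_P[OF g ab] by simp
    next
      case False
      have "s * mm N (mm N (L x) (bas p)) (L x) a b = dY' p x a b"
        unfolding dY'_def mm_def by (simp add: sum_distrib_left mult_ac)
      then show ?thesis using dY[OF g ab, of p] False by simp
    qed
  qed simp
  moreover have "(\<Sum>m\<in>{1..n}. tperm N {1..n} \<sigma> (((\<lambda>_. Y x)(n := P p x))(m := ?D m))) = dpsi n \<sigma> p x"
  proof -
    have e: "{1..n} = insert n {1..<n}" using n by auto
    have "(\<Sum>m\<in>{1..n}. tperm N {1..n} \<sigma> (((\<lambda>_. Y x)(n := P p x))(m := ?D m))) =
      tperm N {1..n} \<sigma> (((\<lambda>_. Y x)(n := P p x))(n := ?D n)) +
      (\<Sum>m\<in>{1..<n}. tperm N {1..n} \<sigma> (((\<lambda>_. Y x)(n := P p x))(m := ?D m)))"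
      by (subst e, subst sum.insert) (simp_all only: finite_atLeastLessThan atLeastLessThan_iff less_irrefl simp_thms e[symmetric])
    also have "tperm N {1..n} \<sigma> (((\<lambda>_. Y x)(n := P p x))(n := ?D n)) = tp N n \<sigma> (Y x) (dP p x)"
      unfolding tp_def by (simp only: fun_upd_upd if_True simp_thms)
    also have "(\<Sum>m\<in>{1..<n}. tperm N {1..n} \<sigma> (((\<lambda>_. Y x)(n := P p x))(m := ?D m))) =
      (\<Sum>m\<in>{1..<n}. tperm N {1..n} \<sigma> ((\<lambda>_. Y x)(m := dY' p x, n := P p x)))"
    proof (rule sum.cong[OF refl])
      fix m assume "m \<in> {1..<n}"
      then have m: "m \<noteq> n" by simp
      show "tperm N {1..n} \<sigma> (((\<lambda>_. Y x)(n := P p x))(m := ?D m)) = tperm N {1..n} \<sigma> ((\<lambda>_. Y x)(m := dY' p x, n := P p x))"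
        unfolding if_not_P[OF m] fun_upd_twist[OF m[symmetric]] ..
    qed
    finally show ?thesis unfolding dpsi_def by (simp only: add.commute)
  qed
  ultimately show ?thesis unfolding tp_def by simp
qed

text \<open>The trace with \<open>1 - Y\<close> in the last slot. The part with 1 leads down to
  level \<open>n - 1\<close> and the part with \<open>Y\<close> stays at level \<open>n\<close>;
  this is how the recursion links two levels.\<close>

definition Gd :: "nat \<Rightarrow> (nat \<Rightarrow> nat) \<Rightarrow> (nat \<times> nat \<Rightarrow> real) \<Rightarrow> complex" where
  "Gd n \<sigma> x = tp N n \<sigma> (Y x) Im1 - tp N n \<sigma> (Y x) (Y x)"

lemma tp_diff:
  assumes "0 < n" shows "tp N n \<sigma> A (\<lambda>a b. c * (U a b - V a b)) = c * (tp N n \<sigma> A U - tp N n \<sigma> A V)"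
proof -
  have "tp N n \<sigma> A (\<lambda>a b. c * U a b + (- c) * V a b) = c * tp N n \<sigma> A U + (- c) * tp N n \<sigma> A V"
    by (rule tp_linear[OF assms])
  then show ?thesis by (simp add: right_diff_distrib)
qed

text \<open>In a slot \<open>m < n\<close> the derivative of \<open>Y\<close> contracts with the
  dual basis in slot \<open>n\<close>: the transposition appears, slot \<open>m\<close> receives
  \<open>L Z = Y\<close>, and slot \<open>n\<close> receives \<open>1 - Y\<close> by
  \<open>UL\<close> and \<open>ss\<close>. In slot \<open>n\<close> itself the basis meets its dual
  within one matrix product, which gives the factor \<open>N\<close>.\<close>

lemma sum_dpsi:
  assumes g: "good N x" and \<sigma>: "\<sigma> permutes {1..n}" and n: "0 < n"
  shows "(\<Sum>p\<in>idx N. dpsi n \<sigma> p x) = (\<Sum>m\<in>{1..<n}. Gd n (\<sigma> \<circ> Transposition.transpose m n) x)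
     + (z * of_nat N * Gd n \<sigma> x - of_nat N * tp N n \<sigma> (Y x) (Z x))"
proof -
  have 1: "(\<Sum>p\<in>idx N. tperm N {1..n} \<sigma> ((\<lambda>_. Y x)(m := dY' p x, n := P p x))) = Gd n (\<sigma> \<circ> Transposition.transpose m n) x"
    if m: "m \<in> {1..<n}" for m
  proof -
    have \<sigma>': "(\<sigma> \<circ> Transposition.transpose m n) permutes {1..n}"
      by (rule permutes_compose[OF permutes_swap_id \<sigma>]) (use m in auto)
    have "(\<Sum>p\<in>idx N. tperm N {1..n} \<sigma> ((\<lambda>_. Y x)(m := dY' p x, n := P p x))) =
      tperm N {1..n} (\<sigma> \<circ> Transposition.transpose m n) ((\<lambda>_. Y x)(m := mm N (L x) (Z x), n := mm N (Um N x) (\<lambda>a b. s * L x a b)))"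
      unfolding dY'_def P_def by (rule tperm_contract) (use m in auto)
    also have "\<dots> = tp N n (\<sigma> \<circ> Transposition.transpose m n) (Y x) (\<lambda>a b. 1 * (Im1 a b - Y x a b))"
      unfolding tp_def
    proof (rule tperm_cong[OF \<sigma>'])
      fix k a b assume ab: "a < N" "b < N"
      have "mm N (Um N x) (\<lambda>a b. s * L x a b) a b = s * mm N (Um N x) (L x) a b"
        unfolding mm_def by (simp add: sum_distrib_left mult.left_commute)
      also have "\<dots> = Im1 a b - Y x a b" unfolding UL[OF g ab] using ss by (simp add: mult.assoc[symmetric])
      finally show "((\<lambda>_. Y x)(m := mm N (L x) (Z x), n := mm N (Um N x) (\<lambda>a b. s * L x a b))) k a b =
         ((\<lambda>_. Y x)(n := \<lambda>a b. 1 * (Im1 a b - Y x a b))) k a b"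
        unfolding fun_upd_apply using LZ[OF g ab] by (simp split: if_split)
    qed
    also have "\<dots> = Gd n (\<sigma> \<circ> Transposition.transpose m n) x" unfolding tp_diff[OF n] Gd_def by simp
    finally show ?thesis .
  qed
  have 2: "(\<Sum>p\<in>idx N. tp N n \<sigma> (Y x) (dP p x)) = z * of_nat N * Gd n \<sigma> x - of_nat N * tp N n \<sigma> (Y x) (Z x)"
  proof -
    have "(\<Sum>p\<in>idx N. tp N n \<sigma> (Y x) (dP p x)) = tp N n \<sigma> (Y x) (\<lambda>a b. \<Sum>p\<in>idx N. 1 * dP p x a b)"
      unfolding tp_sum[OF n] by simp
    also have "\<dots> = tp N n \<sigma> (Y x) (\<lambda>a b. of_nat N * (z * (Im1 a b - Y x a b)) + (- of_nat N) * Z x a b)"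
    proof (rule tp_cong[OF \<sigma> refl])
      fix a b assume ab: "a < N" "b < N"
      have "(\<Sum>p\<in>idx N. mm N (mm N (bas p) (bs p)) (Z x) a b) = mm N (\<lambda>a b. \<Sum>p\<in>idx N. mm N (bas p) (bs p) a b) (Z x) a b"
        by (rule mm_sum_left[symmetric])
      also have "\<dots> = mm N (\<lambda>a b. of_nat N * Im1 a b) (Z x) a b" by (rule mm_cong) (simp_all add: bas_bs ab)
      also have "\<dots> = of_nat N * mm N Im1 (Z x) a b" unfolding mm_def by (simp add: sum_distrib_left mult.assoc)
      finally have e1: "(\<Sum>p\<in>idx N. mm N (mm N (bas p) (bs p)) (Z x) a b) = of_nat N * Z x a b" using mm_Im1(2)[OF ab(1)] by simp
      have "(\<Sum>p\<in>idx N. mm N (mm N (Um N x) (bs p)) (bas p) a b) = mm N (Um N x) (\<lambda>a b. \<Sum>p\<in>idx N. mm N (bs p) (bas p) a b) a b"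
        unfolding mm_sum_right by (simp only: mm_assoc)
      also have "\<dots> = mm N (Um N x) (\<lambda>a b. of_nat N * Im1 a b) a b" by (rule mm_cong) (simp_all add: bas_bs ab)
      also have "\<dots> = of_nat N * mm N (Um N x) Im1 a b" unfolding mm_def by (simp add: sum_distrib_left mult.left_commute)
      finally have e2: "(\<Sum>p\<in>idx N. mm N (mm N (Um N x) (bs p)) (bas p) a b) = of_nat N * Um N x a b" using mm_Im1(1)[OF ab(2)] by simp
      have "(\<Sum>p\<in>idx N. 1 * dP p x a b) = - (of_nat N * Z x a b) + z * (of_nat N * Um N x a b)"
        unfolding dP_def using e1 e2 by (simp add: sum_subtractf sum_distrib_left[symmetric])
      also have "z * (of_nat N * Um N x a b) = of_nat N * (z * Um N x a b)" by (simp add: mult.left_commute)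
      finally show "(\<Sum>p\<in>idx N. 1 * dP p x a b) = of_nat N * (z * (Im1 a b - Y x a b)) + (- of_nat N) * Z x a b"
        unfolding zU[OF ab] by simp
    qed
    also have "\<dots> = of_nat N * (z * Gd n \<sigma> x) + (- of_nat N) * tp N n \<sigma> (Y x) (Z x)"
      unfolding tp_linear[OF n] tp_diff[OF n] Gd_def ..
    finally show ?thesis by simp
  qed
  show ?thesis unfolding dpsi_def sum.distrib 2 using 1 by (subst sum.swap) simp
qed

text \<open>Contraction with a logarithmic derivative inserts the inverse of \<open>X\<close> or of
  \<open>1 - X\<close> between \<open>1 - X\<close> and \<open>Z\<close>. The relations
  \<open>UXZ\<close> and \<open>UUZ\<close> absorb it, leaving only \<open>Y\<close> and
  \<open>Z\<close>.\<close>

lemma sum_psi_tr: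
  assumes g: "good N x" and \<sigma>: "\<sigma> permutes {1..n}" and n: "0 < n"
  shows "(\<Sum>p\<in>idx N. trX N p x * tp N n \<sigma> (Y x) (P p x)) = s * Gd n \<sigma> x"
    "(\<Sum>p\<in>idx N. trU N p x * tp N n \<sigma> (Y x) (P p x)) = tp N n \<sigma> (Y x) (Z x)"
proof -
  have "(\<Sum>p\<in>idx N. trX N p x * tp N n \<sigma> (Y x) (P p x)) = tp N n \<sigma> (Y x) (\<lambda>a b. \<Sum>p\<in>idx N. trX N p x * P p x a b)"
    unfolding tp_sum[OF n] ..
  also have "\<dots> = tp N n \<sigma> (Y x) (\<lambda>a b. s * (Im1 a b - Y x a b))"
    by (rule tp_cong[OF \<sigma> refl]) (simp only: trX_def P_def tr_contract UXZ[OF g])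
  finally show "(\<Sum>p\<in>idx N. trX N p x * tp N n \<sigma> (Y x) (P p x)) = s * Gd n \<sigma> x" unfolding tp_diff[OF n] Gd_def .
  have "(\<Sum>p\<in>idx N. trU N p x * tp N n \<sigma> (Y x) (P p x)) = tp N n \<sigma> (Y x) (\<lambda>a b. \<Sum>p\<in>idx N. trU N p x * P p x a b)"
    unfolding tp_sum[OF n] ..
  also have "\<dots> = tp N n \<sigma> (Y x) (Z x)"
    by (rule tp_cong[OF \<sigma> refl]) (simp only: trU_def P_def tr_contract UUZ[OF g])
  finally show "(\<Sum>p\<in>idx N. trU N p x * tp N n \<sigma> (Y x) (P p x)) = tp N n \<sigma> (Y x) (Z x)" .
qed

end

section \<open>Integrability of the terms and removal of the cutoff\<close>

lemma norm_tperm_le: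
  assumes S: "finite S" "\<sigma> permutes S" and A: "\<And>k a b. k \<in> S \<Longrightarrow> a < N \<Longrightarrow> b < N \<Longrightarrow> norm (A k a b) \<le> B"
  shows "norm (tperm N S \<sigma> A) \<le> real (card (S \<rightarrow>\<^sub>E {..<N})) * B ^ card S"
proof -
  have "norm (\<Prod>k\<in>S. A k (i k) (i (\<sigma> k))) \<le> B ^ card S" if i: "i \<in> S \<rightarrow>\<^sub>E {..<N}" for i
  proof -
    have "norm (\<Prod>k\<in>S. A k (i k) (i (\<sigma> k))) = (\<Prod>k\<in>S. norm (A k (i k) (i (\<sigma> k))))" by (rule prod_norm[symmetric])
    also have "\<dots> \<le> (\<Prod>k\<in>S. B)"
    proof (rule prod_mono, intro conjI norm_ge_zero A)
      fix k assume "k \<in> S"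
      then show "k \<in> S" "i k < N" "i (\<sigma> k) < N" using i permutes_in_image[OF S(2), of k] by (auto simp: PiE_iff)
    qed
    finally show ?thesis by simp
  qed
  then have "norm (tperm N S \<sigma> A) \<le> (\<Sum>i\<in>S \<rightarrow>\<^sub>E {..<N}. B ^ card S)"
    unfolding tperm_def by (intro order_trans[OF norm_sum] sum_mono)
  then show ?thesis by simp
qed

context loop_data begin

lemma tame_psi:
  assumes \<sigma>: "\<sigma> permutes {1..n}" shows "tame N (\<lambda>x. tp N n \<sigma> (Y x) (P p x))" "tame N (dpsi n \<sigma> p)"
proof -
  have tP: "tame N (\<lambda>x. P p x a b)" and tdP: "tame N (\<lambda>x. dP p x a b)" and tdY: "tame N (\<lambda>x. dY' p x a b)"
    if ab: "a < N" "b < N" for a b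
  proof -
    show "tame N (\<lambda>x. P p x a b)" unfolding P_def
      by (intro tame_mm[where A = "\<lambda>x. mm N (Um N x) (bs p)"] tame_mm[where B = "\<lambda>x. bs p"] tame_const tame_entries tame_YLZ ab)
    have "tame N (\<lambda>x. (- 1) * mm N (mm N (bas p) (bs p)) (Z x) a b + z * mm N (mm N (Um N x) (bs p)) (bas p) a b)"
      by (intro tame_add tame_mult tame_const tame_mm[where A = "\<lambda>x. mm N (bas p) (bs p)"] tame_YLZ
          tame_mm[where A = "\<lambda>x. mm N (Um N x) (bs p)" and B = "\<lambda>x. bas p"] tame_mm[where B = "\<lambda>x. bs p"] tame_entries ab)
    then show "tame N (\<lambda>x. dP p x a b)" unfolding dP_def by simp
    show "tame N (\<lambda>x. dY' p x a b)" unfolding dY'_def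
      by (intro tame_mm[where A = "\<lambda>x. mm N (L x) (bas p)"] tame_mm[where B = "\<lambda>x. bas p"] tame_mult tame_const tame_YLZ ab)
  qed
  show "tame N (\<lambda>x. tp N n \<sigma> (Y x) (P p x))" by (rule tp_tame[OF \<sigma> tame_YLZ(1) tP])
  have "tame N (\<lambda>x. tperm N {1..n} \<sigma> ((\<lambda>_. Y x)(m := dY' p x, n := P p x)))" for m
  proof (rule tame_tperm[OF _ \<sigma>])
    fix k a b assume "a < N" "b < N"
    then show "tame N (\<lambda>x. ((\<lambda>_. Y x)(m := dY' p x, n := P p x)) k a b)"
      using tP tdY tame_YLZ(1) by (cases "k = n"; cases "k = m") simp_all
  qed simp
  then show "tame N (dpsi n \<sigma> p)" unfolding dpsi_def[abs_def]
    by (intro tame_add tame_sum tp_tame[OF \<sigma> tame_YLZ(1) tdP]) auto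
qed

text \<open>Each of the \<open>n\<close> slots costs at most a factor
  \<open>dt N x powr (- \<kappa>)\<close>, so the exponent of \<open>det X\<close> drops by
  \<open>n * \<kappa>\<close> and \<open>integrable_wabs\<close> applies.\<close>

lemma jintegrable_tp:
  assumes \<sigma>: "\<sigma> permutes {1..n}" and V: "V = Y \<or> V = Z \<or> V = (\<lambda>_. Im1)"
    and a: "-1 < Re \<alpha> - real n * \<kappa>" "-1 < Re \<beta>"
  shows "jintegrable N \<alpha> \<beta> (\<lambda>x. tp N n \<sigma> (Y x) (V x))"
proof -
  obtain C where C: "\<And>x a b. good N x \<Longrightarrow> a < N \<Longrightarrow> b < N \<Longrightarrow> norm (Y x a b) \<le> C * dt N x powr (- \<kappa>) \<and>
     norm (Z x a b) \<le> C * dt N x powr (- \<kappa>) \<and> 1 \<le> C * dt N x powr (- \<kappa>)" using bnd by blast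
  define K where "K = real (card ({1..n} \<rightarrow>\<^sub>E {..<N})) * C ^ n"
  have bd: "norm (tp N n \<sigma> (Y x) (V x) * wt N \<alpha> \<beta> x) \<le> K * (dt N x powr (Re \<alpha> - real n * \<kappa>) * du N x powr Re \<beta>)"
    if g: "good N x" for x
  proof -
    have "norm (tp N n \<sigma> (Y x) (V x)) \<le> real (card ({1..n} \<rightarrow>\<^sub>E {..<N})) * (C * dt N x powr (- \<kappa>)) ^ card {1..n}"
      unfolding tp_def
    proof (rule norm_tperm_le[OF _ \<sigma>])
      fix k a b assume ab: "a < N" "b < N"
      have "norm (V x a b) \<le> C * dt N x powr (- \<kappa>)"
        using C[OF g ab] V by (auto simp: Im1_def)
      then show "norm (((\<lambda>_. Y x)(n := V x)) k a b) \<le> C * dt N x powr (- \<kappa>)"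
        using C[OF g ab] by (cases "k = n") simp_all
    qed simp
    also have "\<dots> = K * (dt N x powr (- \<kappa>)) ^ n" by (simp add: K_def power_mult_distrib)
    also have "(dt N x powr (- \<kappa>)) ^ n = dt N x powr (- (real n * \<kappa>))"
      using good_det(1)[OF g] by (simp add: powr_power mult.commute)
    finally have "norm (tp N n \<sigma> (Y x) (V x)) * norm (wt N \<alpha> \<beta> x) \<le>
      K * dt N x powr (- (real n * \<kappa>)) * (dt N x powr Re \<alpha> * du N x powr Re \<beta>)"
      unfolding norm_wt[OF g] by (rule mult_right_mono) simp
    also have "\<dots> = K * ((dt N x powr (- (real n * \<kappa>)) * dt N x powr Re \<alpha>) * du N x powr Re \<beta>)" by simp
    also have "dt N x powr (- (real n * \<kappa>)) * dt N x powr Re \<alpha> = dt N x powr (Re \<alpha> - real n * \<kappa>)"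
      by (simp add: powr_add[symmetric])
    finally show ?thesis by (simp add: norm_mult)
  qed
  have t: "tame N (\<lambda>x. tp N n \<sigma> (Y x) (V x))"
    by (rule tp_tame[OF \<sigma>]) (use V tame_YLZ tame_const in auto)
  show ?thesis unfolding jintegrable_def
  proof (rule Bochner_Integration.integrable_bound)
    show "integrable (herm_lebesgue N) (\<lambda>x. K * (indicator (herm01 N) x * (dt N x powr (Re \<alpha> - real n * \<kappa>) * du N x powr Re \<beta>)))"
      by (intro integrable_mult_right integrable_wabs a)
    show "(\<lambda>x. if good N x then tp N n \<sigma> (Y x) (V x) * wt N \<alpha> \<beta> x else 0) \<in> borel_measurable (herm_lebesgue N)"
      using t by (intro good_measurable borel_measurable_times wt_measurable) (simp add: tame_def)
    show "AE x in herm_lebesgue N. norm (if good N x then tp N n \<sigma> (Y x) (V x) * wt N \<alpha> \<beta> x else 0)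
       \<le> norm (K * (indicator (herm01 N) x * (dt N x powr (Re \<alpha> - real n * \<kappa>) * du N x powr Re \<beta>)))"
    proof (rule AE_I2)
      fix x assume "x \<in> space (herm_lebesgue N)"
      then show "norm (if good N x then tp N n \<sigma> (Y x) (V x) * wt N \<alpha> \<beta> x else 0)
       \<le> norm (K * (indicator (herm01 N) x * (dt N x powr (Re \<alpha> - real n * \<kappa>) * du N x powr Re \<beta>)))"
        using order_trans[OF bd[of x] abs_ge_self] by (cases "good N x") (simp_all add: herm01_iff indicator_def)
    qed
  qed
qed

text \<open>The divergence of the field times the weight, divided by the weight: the derivatives of
  the field, plus \<alpha> and \<beta> times its contractions with the logarithmic
  derivatives.\<close>

definition Lam :: "complex \<Rightarrow> complex \<Rightarrow> nat \<Rightarrow> (nat \<Rightarrow> nat) \<Rightarrow> (nat \<times> nat \<Rightarrow> real) \<Rightarrow> complex" where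
  "Lam \<alpha> \<beta> n \<sigma> x = (\<Sum>m\<in>{1..<n}. Gd n (\<sigma> \<circ> Transposition.transpose m n) x) +
     (z * of_nat N + \<alpha> * s) * Gd n \<sigma> x + (- (of_nat N + \<beta>)) * tp N n \<sigma> (Y x) (Z x)"

text \<open>The contraction of the field with the logarithmic derivative of
  \<open>det X det (1 - X)\<close>. It is the coefficient with which the derivative of the cutoff
  enters the divergence.\<close>

definition Ob :: "nat \<Rightarrow> (nat \<Rightarrow> nat) \<Rightarrow> (nat \<times> nat \<Rightarrow> real) \<Rightarrow> complex" where
  "Ob n \<sigma> x = s * Gd n \<sigma> x + (- 1) * tp N n \<sigma> (Y x) (Z x)"

text \<open>The product rule for the derivative, in the coordinate \<open>p\<close>, of the field
  times the weight times the cutoff.\<close>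

definition Ed :: "real \<Rightarrow> complex \<Rightarrow> complex \<Rightarrow> nat \<Rightarrow> (nat \<Rightarrow> nat) \<Rightarrow> nat \<times> nat \<Rightarrow> (nat \<times> nat \<Rightarrow> real) \<Rightarrow> complex" where
  "Ed e \<alpha> \<beta> n \<sigma> p x = (dpsi n \<sigma> p x * wt N \<alpha> \<beta> x + tp N n \<sigma> (Y x) (P p x) * ((\<alpha> * trX N p x - \<beta> * trU N p x) * wt N \<alpha> \<beta> x)) *
      of_real (cutoff e (dt N x * du N x)) +
     tp N n \<sigma> (Y x) (P p x) * wt N \<alpha> \<beta> x * (of_real (cutoff1 e (dt N x * du N x)) * (trX N p x - trU N p x))"

lemma sum_Ed:
  assumes g: "good N x" and \<sigma>: "\<sigma> permutes {1..n}" and n: "0 < n"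
  shows "(\<Sum>p\<in>idx N. Ed e \<alpha> \<beta> n \<sigma> p x) =
    (of_real (cutoff e (dt N x * du N x)) * Lam \<alpha> \<beta> n \<sigma> x + of_real (cutoff1 e (dt N x * du N x)) * Ob n \<sigma> x) * wt N \<alpha> \<beta> x"
proof -
  let ?c = "of_real (cutoff e (dt N x * du N x)) :: complex" and ?c1 = "of_real (cutoff1 e (dt N x * du N x)) :: complex"
  let ?T = "\<lambda>p. tp N n \<sigma> (Y x) (P p x)" and ?w = "wt N \<alpha> \<beta> x"
  have "Ed e \<alpha> \<beta> n \<sigma> p x = (?w * ?c) * dpsi n \<sigma> p x + (?w * ?c * \<alpha> + ?w * ?c1) * (trX N p x * ?T p)
     - (?w * ?c * \<beta> + ?w * ?c1) * (trU N p x * ?T p)" for p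
    unfolding Ed_def by (simp add: algebra_simps)
  then have "(\<Sum>p\<in>idx N. Ed e \<alpha> \<beta> n \<sigma> p x) = (?w * ?c) * (\<Sum>p\<in>idx N. dpsi n \<sigma> p x) + (?w * ?c * \<alpha> + ?w * ?c1) * (\<Sum>p\<in>idx N. trX N p x * ?T p)
     - (?w * ?c * \<beta> + ?w * ?c1) * (\<Sum>p\<in>idx N. trU N p x * ?T p)"
    by (simp only: sum.distrib sum_subtractf sum_distrib_left)
  also have "\<dots> = (?c * Lam \<alpha> \<beta> n \<sigma> x + ?c1 * Ob n \<sigma> x) * ?w"
    unfolding sum_dpsi[OF g \<sigma> n] sum_psi_tr[OF g \<sigma> n] Lam_def Ob_def by (simp add: algebra_simps)
  finally show ?thesis .
qed

lemma int_Ed: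
  assumes p: "p \<in> idx N" and e: "0 < e" and \<sigma>: "\<sigma> permutes {1..n}" and n: "0 < n"
  shows "integrable (herm_lebesgue N) (\<lambda>x. if good N x then Ed e \<alpha> \<beta> n \<sigma> p x else 0)"
    "(\<integral>x. (if good N x then Ed e \<alpha> \<beta> n \<sigma> p x else 0) \<partial>herm_lebesgue N) = 0"
proof -
  have cz: "cutoff e (dt N x * du N x) = 0 \<and> cutoff1 e (dt N x * du N x) = 0" if "good N x" "dt N x * du N x \<le> e" for x
    using cut_small[OF e] good_det[OF that(1)] that(2) by simp
  show int: "integrable (herm_lebesgue N) (\<lambda>x. if good N x then Ed e \<alpha> \<beta> n \<sigma> p x else 0)"
  proof (rule tame_integrable[OF _ e])
    show "tame N (Ed e \<alpha> \<beta> n \<sigma> p)" unfolding Ed_def[abs_def]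
      by (intro tame_add tame_mult tame_diff tame_const tame_cut[OF e] tame_wt tame_tr tame_psi \<sigma>)
    show "Ed e \<alpha> \<beta> n \<sigma> p x = 0" if "good N x" "dt N x * du N x < e" for x
      unfolding Ed_def using cz[OF that(1)] that(2) by simp
  qed
  \<comment> \<open>Extended by zero, the cut-off field is differentiable along every coordinate
    line: at a point of the domain the line stays inside for a while, and at any other point the
    field vanishes nearby by \<open>not_good_open_slice\<close>.\<close>
  define G where "G x = (if good N x then tp N n \<sigma> (Y x) (P p x) * wt N \<alpha> \<beta> x * of_real (cutoff e (dt N x * du N x)) else 0)" for x
  have G0: "G x = 0" if "\<not> (good N x \<and> e \<le> dt N x * du N x)" for x
    unfolding G_def using cz[of x] that by auto
  show "(\<integral>x. (if good N x then Ed e \<alpha> \<beta> n \<sigma> p x else 0) \<partial>herm_lebesgue N) = 0"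
    unfolding herm_lebesgue_def
  proof (rule ibp[OF _ p, where G = G and R = 1])
    show "integrable (\<Pi>\<^sub>M q\<in>idx N. lborel) (\<lambda>x. if good N x then Ed e \<alpha> \<beta> n \<sigma> p x else 0)"
      using int unfolding herm_lebesgue_def .
    show "G x = 0" if "1 < \<bar>x p\<bar>" for x using that good_coords[OF _ p, of x] by (auto simp: G_def)
    show "pd p G (if good N x then Ed e \<alpha> \<beta> n \<sigma> p x else 0) x" for x
    proof (cases "good N x")
      case True
      have "pd p (\<lambda>x. tp N n \<sigma> (Y x) (P p x) * wt N \<alpha> \<beta> x * of_real (cutoff e (dt N x * du N x))) (Ed e \<alpha> \<beta> n \<sigma> p x) x"
        unfolding Ed_def by (intro pd_mult pd_psi pd_wt pd_cut True \<sigma> n)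
      moreover have "eventually (\<lambda>t. good N (x(p := t))) (nhds (x p))"
        by (rule good_open_slice) (use True in simp)
      then have "eventually (\<lambda>t. G (x(p := t)) = (\<lambda>x. tp N n \<sigma> (Y x) (P p x) * wt N \<alpha> \<beta> x * of_real (cutoff e (dt N x * du N x))) (x(p := t))) (nhds (x p))"
        by (rule eventually_mono) (simp add: G_def)
      ultimately have "pd p G (Ed e \<alpha> \<beta> n \<sigma> p x) x" by (rule pd_eventually)
      then show ?thesis using True by simp
    next
      case False
      have "eventually (\<lambda>t. \<not> (good N (x(p := t)) \<and> e \<le> dt N (x(p := t)) * du N (x(p := t)))) (nhds (x p))"
        by (rule not_good_open_slice[OF _ e]) (use False in simp)
      then have "eventually (\<lambda>t. G (x(p := t)) = 0) (nhds (x p))" by (rule eventually_mono) (rule G0)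
      then have "pd p G 0 x" by (rule pd_eventually[OF pd_const])
      then show ?thesis using False by simp
    qed
  qed simp
qed

lemma int_cut:
  assumes e: "0 < e" and \<sigma>: "\<sigma> permutes {1..n}" and n: "0 < n"
  shows "(\<integral>x. (if good N x then (of_real (cutoff e (dt N x * du N x)) * Lam \<alpha> \<beta> n \<sigma> x + of_real (cutoff1 e (dt N x * du N x)) * Ob n \<sigma> x) * wt N \<alpha> \<beta> x else 0) \<partial>herm_lebesgue N) = 0"
proof -
  have "0 = (\<Sum>p\<in>idx N. \<integral>x. (if good N x then Ed e \<alpha> \<beta> n \<sigma> p x else 0) \<partial>herm_lebesgue N)"
    using int_Ed(2)[OF _ e \<sigma> n] by simp
  also have "\<dots> = (\<integral>x. (\<Sum>p\<in>idx N. if good N x then Ed e \<alpha> \<beta> n \<sigma> p x else 0) \<partial>herm_lebesgue N)"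
    by (rule Bochner_Integration.integral_sum[symmetric]) (rule int_Ed(1)[OF _ e \<sigma> n])
  also have "\<dots> = (\<integral>x. (if good N x then (of_real (cutoff e (dt N x * du N x)) * Lam \<alpha> \<beta> n \<sigma> x + of_real (cutoff1 e (dt N x * du N x)) * Ob n \<sigma> x) * wt N \<alpha> \<beta> x else 0) \<partial>herm_lebesgue N)"
    by (intro Bochner_Integration.integral_cong refl) (simp add: sum_Ed[OF _ \<sigma> n])
  finally show ?thesis by simp
qed

lemma jint_Gd:
  assumes \<sigma>: "\<sigma> permutes {1..n}" and a: "-1 < Re \<alpha> - real n * \<kappa>" "-1 < Re \<beta>"
  shows "jintegrable N \<alpha> \<beta> (Gd n \<sigma>)"
    "jint N \<alpha> \<beta> (Gd n \<sigma>) = jint N \<alpha> \<beta> (\<lambda>x. tp N n \<sigma> (Y x) Im1) - jint N \<alpha> \<beta> (\<lambda>x. tp N n \<sigma> (Y x) (Y x))"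
proof -
  have 1: "jintegrable N \<alpha> \<beta> (\<lambda>x. tp N n \<sigma> (Y x) Im1)" "jintegrable N \<alpha> \<beta> (\<lambda>x. tp N n \<sigma> (Y x) (Y x))"
    using jintegrable_tp[OF \<sigma> _ a, of "\<lambda>_. Im1"] jintegrable_tp[OF \<sigma> _ a, of Y] by simp_all
  from jint_add[OF 1(1) jint_cmult(1)[OF 1(2), of "-1"]]
  show "jintegrable N \<alpha> \<beta> (Gd n \<sigma>)"
    "jint N \<alpha> \<beta> (Gd n \<sigma>) = jint N \<alpha> \<beta> (\<lambda>x. tp N n \<sigma> (Y x) Im1) - jint N \<alpha> \<beta> (\<lambda>x. tp N n \<sigma> (Y x) (Y x))"
    unfolding Gd_def[abs_def] jint_cmult(2) by simp_all
qed

text \<open>The cutoff parameter runs through \<open>1 / Suc i\<close>. The cutoff is at most 1 and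
  tends to 1, its rescaled derivative is at most 2 and tends to 0. The norms of \<open>Lam\<close>
  and of twice \<open>Ob\<close>, times the weight, give an integrable majorant, and
  \<open>Ob\<close> drops out in the limit.\<close>

theorem loop_equation:
  assumes \<sigma>: "\<sigma> permutes {1..n}" and n: "0 < n" and a: "-1 < Re \<alpha> - real n * \<kappa>" "-1 < Re \<beta>"
  shows "(\<Sum>m\<in>{1..<n}. jint N \<alpha> \<beta> (Gd n (\<sigma> \<circ> Transposition.transpose m n))) + (z * of_nat N + \<alpha> * s) * jint N \<alpha> \<beta> (Gd n \<sigma>)
     - (of_nat N + \<beta>) * jint N \<alpha> \<beta> (\<lambda>x. tp N n \<sigma> (Y x) (Z x)) = 0"
proof -
  have \<sigma>': "(\<sigma> \<circ> Transposition.transpose m n) permutes {1..n}" if "m \<in> {1..<n}" for m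
    by (rule permutes_compose[OF permutes_swap_id \<sigma>]) (use that in auto)
  have Z: "jintegrable N \<alpha> \<beta> (\<lambda>x. tp N n \<sigma> (Y x) (Z x))" by (rule jintegrable_tp[OF \<sigma> _ a]) simp
  note Gd = jint_Gd[OF \<sigma> a]
  have S: "jintegrable N \<alpha> \<beta> (\<lambda>x. \<Sum>m\<in>{1..<n}. Gd n (\<sigma> \<circ> Transposition.transpose m n) x)"
    "jint N \<alpha> \<beta> (\<lambda>x. \<Sum>m\<in>{1..<n}. Gd n (\<sigma> \<circ> Transposition.transpose m n) x) = (\<Sum>m\<in>{1..<n}. jint N \<alpha> \<beta> (Gd n (\<sigma> \<circ> Transposition.transpose m n)))"
    using jint_sum[of "{1..<n}" N \<alpha> \<beta> "\<lambda>m. Gd n (\<sigma> \<circ> Transposition.transpose m n)"] jint_Gd(1)[OF \<sigma>' a] by auto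
  note A = jint_add[OF jint_add(1)[OF S(1) jint_cmult(1)[OF Gd(1), of "z * of_nat N + \<alpha> * s"]] jint_cmult(1)[OF Z, of "- (of_nat N + \<beta>)"]]
  have LamI: "jintegrable N \<alpha> \<beta> (Lam \<alpha> \<beta> n \<sigma>)" using A(1) unfolding Lam_def[abs_def] .
  have LamJ: "jint N \<alpha> \<beta> (Lam \<alpha> \<beta> n \<sigma>) = (\<Sum>m\<in>{1..<n}. jint N \<alpha> \<beta> (Gd n (\<sigma> \<circ> Transposition.transpose m n))) + (z * of_nat N + \<alpha> * s) * jint N \<alpha> \<beta> (Gd n \<sigma>)
     - (of_nat N + \<beta>) * jint N \<alpha> \<beta> (\<lambda>x. tp N n \<sigma> (Y x) (Z x))"
    using A(2) jint_add(2)[OF S(1) jint_cmult(1)[OF Gd(1), of "z * of_nat N + \<alpha> * s"]]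
    unfolding Lam_def[abs_def] S(2) jint_cmult(2) by (simp add: algebra_simps)
  have ObI: "jintegrable N \<alpha> \<beta> (Ob n \<sigma>)" unfolding Ob_def[abs_def] by (intro jint_add(1) jint_cmult(1) Gd(1) Z)
  define F where "F i x = (if good N x then (of_real (cutoff (1 / real (Suc i)) (dt N x * du N x)) * Lam \<alpha> \<beta> n \<sigma> x + of_real (cutoff1 (1 / real (Suc i)) (dt N x * du N x)) * Ob n \<sigma> x) * wt N \<alpha> \<beta> x else 0)" for i x
  have "(\<lambda>i. \<integral>x. F i x \<partial>herm_lebesgue N) \<longlonglongrightarrow> (\<integral>x. (if good N x then Lam \<alpha> \<beta> n \<sigma> x * wt N \<alpha> \<beta> x else 0) \<partial>herm_lebesgue N)"
  proof (rule integral_dominated_convergence[where w = "\<lambda>x. norm (if good N x then Lam \<alpha> \<beta> n \<sigma> x * wt N \<alpha> \<beta> x else 0) + 2 * norm (if good N x then Ob n \<sigma> x * wt N \<alpha> \<beta> x else 0)"])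
    have mL: "(\<lambda>x. if good N x then Lam \<alpha> \<beta> n \<sigma> x * wt N \<alpha> \<beta> x else 0) \<in> borel_measurable (herm_lebesgue N)"
      and mO: "(\<lambda>x. if good N x then Ob n \<sigma> x * wt N \<alpha> \<beta> x else 0) \<in> borel_measurable (herm_lebesgue N)"
      using LamI ObI unfolding jintegrable_def by (simp_all add: borel_measurable_integrable)
    show "(\<lambda>x. if good N x then Lam \<alpha> \<beta> n \<sigma> x * wt N \<alpha> \<beta> x else 0) \<in> borel_measurable (herm_lebesgue N)" by (rule mL)
    show "integrable (herm_lebesgue N) (\<lambda>x. norm (if good N x then Lam \<alpha> \<beta> n \<sigma> x * wt N \<alpha> \<beta> x else 0) + 2 * norm (if good N x then Ob n \<sigma> x * wt N \<alpha> \<beta> x else 0))"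
      using LamI ObI unfolding jintegrable_def by (intro Bochner_Integration.integrable_add integrable_mult_right integrable_norm)
    show "F i \<in> borel_measurable (herm_lebesgue N)" for i
    proof -
      have c: "(\<lambda>x. complex_of_real (cutoff (1 / real (Suc i)) (dt N x * du N x))) \<in> borel_measurable (herm_lebesgue N)"
        "(\<lambda>x. complex_of_real (cutoff1 (1 / real (Suc i)) (dt N x * du N x))) \<in> borel_measurable (herm_lebesgue N)"
        using tame_cut[of "1 / real (Suc i)" N] unfolding tame_def by simp_all
      have "F i = (\<lambda>x. of_real (cutoff (1 / real (Suc i)) (dt N x * du N x)) * (if good N x then Lam \<alpha> \<beta> n \<sigma> x * wt N \<alpha> \<beta> x else 0) +
         of_real (cutoff1 (1 / real (Suc i)) (dt N x * du N x)) * (if good N x then Ob n \<sigma> x * wt N \<alpha> \<beta> x else 0))"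
        by (auto simp: fun_eq_iff F_def algebra_simps)
      then show ?thesis using c mL mO by simp
    qed
    show "AE x in herm_lebesgue N. (\<lambda>i. F i x) \<longlonglongrightarrow> (if good N x then Lam \<alpha> \<beta> n \<sigma> x * wt N \<alpha> \<beta> x else 0)"
    proof (rule AE_I2)
      fix x
      show "(\<lambda>i. F i x) \<longlonglongrightarrow> (if good N x then Lam \<alpha> \<beta> n \<sigma> x * wt N \<alpha> \<beta> x else 0)"
      proof (cases "good N x")
        case True
        note c = cut_tendsto[OF mult_pos_pos[OF good_det[OF True]]]
        have "(\<lambda>i. (complex_of_real (cutoff (1 / real (Suc i)) (dt N x * du N x)) * Lam \<alpha> \<beta> n \<sigma> x + complex_of_real (cutoff1 (1 / real (Suc i)) (dt N x * du N x)) * Ob n \<sigma> x) * wt N \<alpha> \<beta> x)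
          \<longlonglongrightarrow> (complex_of_real 1 * Lam \<alpha> \<beta> n \<sigma> x + complex_of_real 0 * Ob n \<sigma> x) * wt N \<alpha> \<beta> x"
          by (intro tendsto_intros c)
        then show ?thesis using True by (simp add: F_def)
      qed (simp add: F_def)
    qed
    show "AE x in herm_lebesgue N. norm (F i x) \<le> norm (if good N x then Lam \<alpha> \<beta> n \<sigma> x * wt N \<alpha> \<beta> x else 0) + 2 * norm (if good N x then Ob n \<sigma> x * wt N \<alpha> \<beta> x else 0)" for i
    proof (rule AE_I2)
      fix x
      show "norm (F i x) \<le> norm (if good N x then Lam \<alpha> \<beta> n \<sigma> x * wt N \<alpha> \<beta> x else 0) + 2 * norm (if good N x then Ob n \<sigma> x * wt N \<alpha> \<beta> x else 0)"
      proof (cases "good N x")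
        case True
        let ?c = "cutoff (1 / real (Suc i)) (dt N x * du N x)" and ?c1 = "cutoff1 (1 / real (Suc i)) (dt N x * du N x)"
        have c: "0 \<le> ?c" "?c \<le> 1" "0 \<le> ?c1" "?c1 \<le> 2"
          using cut_bounds[of "1 / real (Suc i)" "dt N x * du N x"] mult_pos_pos[OF good_det[OF True]] by simp_all
        have "norm (of_real ?c * Lam \<alpha> \<beta> n \<sigma> x + of_real ?c1 * Ob n \<sigma> x) \<le> ?c * norm (Lam \<alpha> \<beta> n \<sigma> x) + ?c1 * norm (Ob n \<sigma> x)"
          by (rule order_trans[OF norm_triangle_ineq]) (use c in \<open>simp add: norm_mult\<close>)
        also have "\<dots> \<le> 1 * norm (Lam \<alpha> \<beta> n \<sigma> x) + 2 * norm (Ob n \<sigma> x)"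
          by (intro add_mono mult_right_mono c norm_ge_zero)
        finally have "norm (of_real ?c * Lam \<alpha> \<beta> n \<sigma> x + of_real ?c1 * Ob n \<sigma> x) * norm (wt N \<alpha> \<beta> x) \<le>
          (1 * norm (Lam \<alpha> \<beta> n \<sigma> x) + 2 * norm (Ob n \<sigma> x)) * norm (wt N \<alpha> \<beta> x)"
          by (rule mult_right_mono) simp
        then show ?thesis unfolding F_def if_P[OF True] norm_mult by (simp only: mult_1 distrib_right mult.assoc)
      qed (simp add: F_def)
    qed
  qed
  moreover have "(\<integral>x. F i x \<partial>herm_lebesgue N) = 0" for i
    unfolding F_def by (rule int_cut[OF _ \<sigma> n]) simp
  ultimately have "jint N \<alpha> \<beta> (Lam \<alpha> \<beta> n \<sigma>) = 0" unfolding jint_def by (simp add: LIMSEQ_const_iff)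
  then show ?thesis unfolding LamJ .
qed

end

section \<open>The recursion in terms of Jucys--Murphy elements\<close>

definition tf :: "nat \<Rightarrow> nat \<Rightarrow> (nat \<Rightarrow> nat) \<Rightarrow> (nat \<Rightarrow> nat \<Rightarrow> complex) \<Rightarrow> complex" where
  "tf N n \<sigma> Y = (if \<sigma> permutes {1..n} then tperm N {1..n} \<sigma> (\<lambda>_. Y) else 0)"

text \<open>An identity matrix in slot \<open>Suc n\<close> can be traced out. If \<sigma> fixes
  \<open>Suc n\<close> this gives the factor \<open>N\<close>; otherwise \<open>Suc n\<close> is cut
  out of its cycle, and the result is the only term of the sum \<open>jm (Suc n)\<close> whose
  permutation fixes \<open>Suc n\<close>.\<close>

lemma tp_Im1:
  fixes n :: nat
  assumes \<sigma>: "\<sigma> permutes {1..Suc n}"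
  shows "tp N (Suc n) \<sigma> Y Im1 = of_nat N * tf N n \<sigma> Y + jm (Suc n) (\<lambda>\<sigma>. tf N n \<sigma> Y) \<sigma>"
proof -
  have e: "{1..Suc n} = insert (Suc n) {1..n}" by auto
  have i: "inj \<sigma>" using \<sigma> by (rule permutes_inj)
  show ?thesis
  proof (cases "\<sigma> (Suc n) = Suc n")
    case True
    have p: "\<sigma> permutes {1..n}"
      using permutes_superset[OF \<sigma>, of "{1..n}"] True unfolding e by auto
    have "tp N (Suc n) \<sigma> Y Im1 = (\<Sum>c<N. ((\<lambda>_. Y)(Suc n := Im1)) (Suc n) c c) * tperm N {1..n} \<sigma> ((\<lambda>_. Y)(Suc n := Im1))"
      unfolding tp_def e by (rule tperm_fixed[OF p]) auto
    also have "(\<Sum>c<N. ((\<lambda>_. Y)(Suc n := Im1)) (Suc n) c c) = of_nat N" unfolding fun_upd_same Im1_def by simp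
    also have "tperm N {1..n} \<sigma> ((\<lambda>_. Y)(Suc n := Im1)) = tperm N {1..n} \<sigma> (\<lambda>_. Y)"
    proof (rule tperm_cong[OF p])
      fix k a b assume "k \<in> {1..n}"
      then show "((\<lambda>_. Y)(Suc n := Im1)) k a b = Y a b" by (cases "k = Suc n") auto
    qed
    also have "tperm N {1..n} \<sigma> (\<lambda>_. Y) = tf N n \<sigma> Y" using p by (simp only: tf_def if_True)
    finally have 1: "tp N (Suc n) \<sigma> Y Im1 = of_nat N * tf N n \<sigma> Y" .
    have "tf N n (\<sigma> \<circ> Transposition.transpose m (Suc n)) Y = 0" if m: "m \<in> {1..<Suc n}" for m
    proof -
      have "\<sigma> m \<noteq> \<sigma> (Suc n)" using i m by (auto dest: injD)
      then have "(\<sigma> \<circ> Transposition.transpose m (Suc n)) (Suc n) \<noteq> Suc n" using True by simp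
      then have "\<not> (\<sigma> \<circ> Transposition.transpose m (Suc n)) permutes {1..n}"
        using permutes_not_in[of "\<sigma> \<circ> Transposition.transpose m (Suc n)" "{1..n}" "Suc n"] by fastforce
      then show ?thesis unfolding tf_def by (rule if_not_P)
    qed
    then have "jm (Suc n) (\<lambda>\<sigma>. tf N n \<sigma> Y) \<sigma> = 0" unfolding jm_def by (intro sum.neutral) blast
    then show ?thesis using 1 by simp
  next
    case False
    obtain m where m: "\<sigma> m = Suc n" using permutes_surj[OF \<sigma>] by (metis surjD)
    have mS: "m \<in> {1..n}" using permutes_in_image[OF \<sigma>, of m] m False unfolding e by auto
    let ?q = "\<sigma> \<circ> Transposition.transpose m (Suc n)"
    have "tp N (Suc n) \<sigma> Y Im1 = tperm N {1..n} ?q (((\<lambda>_. Y)(Suc n := Im1))(m := \<lambda>a b. \<Sum>c<N. ((\<lambda>_. Y)(Suc n := Im1)) m a c * ((\<lambda>_. Y)(Suc n := Im1)) (Suc n) c b))"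
      unfolding tp_def e by (rule tperm_remove) (use \<sigma> e m mS in auto)
    also have q: "?q permutes {1..n}"
    proof (rule permutes_superset)
      show "?q permutes {1..Suc n}" by (rule permutes_compose[OF permutes_swap_id \<sigma>]) (use mS in auto)
      fix x assume "x \<in> {1..Suc n} - {1..n}"
      then have "x = Suc n" by auto
      then show "?q x = x" using m by simp
    qed
    have "tperm N {1..n} ?q (((\<lambda>_. Y)(Suc n := Im1))(m := \<lambda>a b. \<Sum>c<N. ((\<lambda>_. Y)(Suc n := Im1)) m a c * ((\<lambda>_. Y)(Suc n := Im1)) (Suc n) c b))
      = tperm N {1..n} ?q (\<lambda>_. Y)"
    proof (rule tperm_cong[OF q])
      fix k a b assume k: "k \<in> {1..n}" and ab: "a < N" "b < N"
      have "m \<noteq> Suc n" using mS by auto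
      then have "(\<Sum>c<N. ((\<lambda>_. Y)(Suc n := Im1)) m a c * ((\<lambda>_. Y)(Suc n := Im1)) (Suc n) c b) = mm N Y Im1 a b"
        unfolding mm_def by simp
      then show "(((\<lambda>_. Y)(Suc n := Im1))(m := \<lambda>a b. \<Sum>c<N. ((\<lambda>_. Y)(Suc n := Im1)) m a c * ((\<lambda>_. Y)(Suc n := Im1)) (Suc n) c b)) k a b = Y a b"
        using k mm_Im1(1)[OF ab(2), of Y a] by (cases "k = m"; cases "k = Suc n") auto
    qed
    finally have 1: "tp N (Suc n) \<sigma> Y Im1 = tf N n ?q Y" using q by (simp only: tf_def if_True)
    have z: "tf N n \<sigma> Y = 0"
      using permutes_not_in[of \<sigma> "{1..n}" "Suc n"] False by (auto simp: tf_def)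
    have "tf N n (\<sigma> \<circ> Transposition.transpose k (Suc n)) Y = 0" if k: "k \<in> {1..<Suc n} - {m}" for k
    proof -
      have "\<sigma> k \<noteq> \<sigma> m" using i k by (auto dest: injD)
      then have "(\<sigma> \<circ> Transposition.transpose k (Suc n)) (Suc n) \<noteq> Suc n" using m by simp
      then have "\<not> (\<sigma> \<circ> Transposition.transpose k (Suc n)) permutes {1..n}"
        using permutes_not_in[of "\<sigma> \<circ> Transposition.transpose k (Suc n)" "{1..n}" "Suc n"] by fastforce
      then show ?thesis unfolding tf_def by (rule if_not_P)
    qed
    then have "jm (Suc n) (\<lambda>\<sigma>. tf N n \<sigma> Y) \<sigma> = (\<Sum>k\<in>{m}. tf N n (\<sigma> \<circ> Transposition.transpose k (Suc n)) Y)"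
      unfolding jm_def using mS by (intro sum.mono_neutral_right) auto
    then show ?thesis using 1 z by simp
  qed
qed

context loop_data begin

lemma jintegrable_tf:
  assumes "-1 < Re \<alpha> - real n * \<kappa>" "-1 < Re \<beta>"
  shows "jintegrable N \<alpha> \<beta> (\<lambda>x. tf N n \<sigma> (Y x))"
proof (cases "\<sigma> permutes {1..n}")
  case True
  have "jintegrable N \<alpha> \<beta> (\<lambda>x. tp N n \<sigma> (Y x) (Y x))" by (rule jintegrable_tp[OF True _ assms]) simp
  then show ?thesis unfolding tp_self using True by (simp only: tf_def if_True)
next
  case False
  then show ?thesis by (simp only: tf_def if_False jint_zero)
qed

text \<open>By \<open>tp_Im1\<close> the part of \<open>Gd\<close> with 1 becomes
  \<open>N + J\<close> applied to level \<open>n\<close>, while the part with \<open>Y\<close> is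
  level \<open>Suc n\<close>. The sum over transpositions in the loop equation is one more
  \<open>J\<close> on both parts. The integral with \<open>Z\<close> is kept aside, as its meaning
  depends on the instance.\<close>

lemma jint_loop:
  fixes n :: nat
  assumes \<sigma>: "\<sigma> permutes {1..Suc n}" and a: "-1 < Re \<alpha> - real (Suc n) * \<kappa>" "-1 < Re \<beta>" and \<kappa>: "0 \<le> \<kappa>"
  defines "u \<equiv> \<lambda>n \<sigma>. jint N \<alpha> \<beta> (\<lambda>x. tf N n \<sigma> (Y x))"
  shows "(z * of_nat N + \<alpha> * s) * u (Suc n) \<sigma> + jm (Suc n) (u (Suc n)) \<sigma> + (of_nat N + \<beta>) * jint N \<alpha> \<beta> (\<lambda>x. tp N (Suc n) \<sigma> (Y x) (Z x)) =
     loop_rhs n (of_nat N) (z * of_nat N + \<alpha> * s) (u n) \<sigma>"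
    "jint N \<alpha> \<beta> (\<lambda>x. tp N (Suc n) \<sigma> (Y x) Im1) = of_nat N * u n \<sigma> + jm (Suc n) (u n) \<sigma>"
proof -
  have a': "-1 < Re \<alpha> - real n * \<kappa>" using a(1) \<kappa> by (simp add: algebra_simps)
  have w: "jint N \<alpha> \<beta> (\<lambda>x. tp N (Suc n) \<tau> (Y x) Im1) = of_nat N * u n \<tau> + jm (Suc n) (u n) \<tau>"
    if \<tau>: "\<tau> permutes {1..Suc n}" for \<tau>
  proof -
    note i = jintegrable_tf[OF a' a(2)]
    have S: "jintegrable N \<alpha> \<beta> (\<lambda>x. jm (Suc n) (\<lambda>\<sigma>. tf N n \<sigma> (Y x)) \<tau>) \<and>
      jint N \<alpha> \<beta> (\<lambda>x. jm (Suc n) (\<lambda>\<sigma>. tf N n \<sigma> (Y x)) \<tau>) = jm (Suc n) (u n) \<tau>"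
      unfolding jm_def u_def by (rule jint_sum) (rule i)
    show ?thesis unfolding tp_Im1[OF \<tau>]
      using jint_add(2)[OF jint_cmult(1)[OF i[of \<tau>], of "of_nat N"] conjunct1[OF S]] S
      unfolding jint_cmult(2) by (simp only: u_def)
  qed
  show "jint N \<alpha> \<beta> (\<lambda>x. tp N (Suc n) \<sigma> (Y x) Im1) = of_nat N * u n \<sigma> + jm (Suc n) (u n) \<sigma>" by (rule w[OF \<sigma>])
  have G: "jint N \<alpha> \<beta> (Gd (Suc n) \<tau>) = of_nat N * u n \<tau> + jm (Suc n) (u n) \<tau> - u (Suc n) \<tau>"
    if \<tau>: "\<tau> permutes {1..Suc n}" for \<tau>
    unfolding jint_Gd(2)[OF \<tau> a] w[OF \<tau>] tp_self u_def using \<tau> by (simp only: tf_def if_True)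
  have "(\<Sum>m\<in>{1..<Suc n}. jint N \<alpha> \<beta> (Gd (Suc n) (\<sigma> \<circ> Transposition.transpose m (Suc n)))) =
    (\<Sum>m\<in>{1..<Suc n}. (of_nat N * u n (\<sigma> \<circ> Transposition.transpose m (Suc n)) + jm (Suc n) (u n) (\<sigma> \<circ> Transposition.transpose m (Suc n))) - u (Suc n) (\<sigma> \<circ> Transposition.transpose m (Suc n)))"
  proof (rule sum.cong[OF refl], rule G)
    fix m assume "m \<in> {1..<Suc n}"
    then show "(\<sigma> \<circ> Transposition.transpose m (Suc n)) permutes {1..Suc n}"
      by (intro permutes_compose[OF permutes_swap_id \<sigma>]) auto
  qed
  also have "\<dots> = jm (Suc n) (\<lambda>s. of_nat N * u n s + jm (Suc n) (u n) s) \<sigma> - jm (Suc n) (u (Suc n)) \<sigma>"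
    unfolding sum_subtractf unfolding jm_def[of "Suc n" "\<lambda>s. of_nat N * u n s + jm (Suc n) (u n) s"] jm_def[of "Suc n" "u (Suc n)"] ..
  finally have S: "(\<Sum>m\<in>{1..<Suc n}. jint N \<alpha> \<beta> (Gd (Suc n) (\<sigma> \<circ> Transposition.transpose m (Suc n)))) =
     jm (Suc n) (\<lambda>s. of_nat N * u n s + jm (Suc n) (u n) s) \<sigma> - jm (Suc n) (u (Suc n)) \<sigma>" .
  show "(z * of_nat N + \<alpha> * s) * u (Suc n) \<sigma> + jm (Suc n) (u (Suc n)) \<sigma> + (of_nat N + \<beta>) * jint N \<alpha> \<beta> (\<lambda>x. tp N (Suc n) \<sigma> (Y x) (Z x)) =
     loop_rhs n (of_nat N) (z * of_nat N + \<alpha> * s) (u n) \<sigma>"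
    using loop_equation[OF \<sigma> zero_less_Suc a] unfolding S G[OF \<sigma>] loop_rhs_def by (simp only: right_diff_distrib) (simp add: algebra_simps)
qed

end

section \<open>The two instances, for positive and for negative powers\<close>

lemma loop_data_pos: "loop_data N (Xm N) (\<lambda>_. Im1) (Xm N) 1 1 0"
proof
  fix x and a b :: nat assume g: "good N x" and ab: "a < N" "b < N"
  note d = good_det[OF g]
  show "mm N Im1 (Xm N x) a b = Xm N x a b" by (rule mm_Im1(2)[OF ab(1)])
  show "mm N (Um N x) Im1 a b = 1 * (Im1 a b - Xm N x a b)" unfolding mm_Im1(1)[OF ab(2)] by (simp add: Um_def)
  have "mm N (mm N (Um N x) (Xi N x)) (Xm N x) a b = mm N (Um N x) (mm N (Xi N x) (Xm N x)) a b" by (rule mm_assoc)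
  also have "\<dots> = mm N (Um N x) Im1 a b" by (rule mm_cong) (use d ab in \<open>simp_all add: mm_Xi\<close>)
  finally show "mm N (mm N (Um N x) (Xi N x)) (Xm N x) a b = 1 * (Im1 a b - Xm N x a b)"
    unfolding mm_Im1(1)[OF ab(2)] by (simp add: Um_def)
  have "mm N (mm N (Um N x) (Ui N x)) (Xm N x) a b = mm N Im1 (Xm N x) a b" by (rule mm_cong) (use d ab in \<open>simp_all add: mm_Ui\<close>)
  then show "mm N (mm N (Um N x) (Ui N x)) (Xm N x) a b = Xm N x a b" unfolding mm_Im1(2)[OF ab(1)] .
  fix p
  have "1 * mm N (mm N Im1 (bas p)) Im1 a b = bas p a b"
    using mm_Im1(1)[OF ab(2), of "mm N Im1 (bas p)" a] mm_Im1(2)[OF ab(1), of "bas p" b] by simp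
  then show "pd p (\<lambda>x. Xm N x a b) (1 * mm N (mm N Im1 (bas p)) Im1 a b) x" using pd_Xm[OF ab] by simp
  show "pd p (\<lambda>x. Xm N x a b) (1 * bas p a b) x" using pd_Xm[OF ab] by simp
next
  have "norm (Xm N x a b) \<le> 1 * dt N x powr (- 0) \<and> norm (Xm N x a b) \<le> 1 * dt N x powr (- 0) \<and> 1 \<le> 1 * dt N x powr (- 0)"
    if "good N x" "a < N" "b < N" for x a b
    using good_entries[OF that(1)] that good_det(1)[OF that(1)] by (simp add: Xm_def)
  then show "\<exists>C. \<forall>x a b. good N x \<longrightarrow> a < N \<longrightarrow> b < N \<longrightarrow> norm (Xm N x a b) \<le> C * dt N x powr (- 0)
       \<and> norm (Xm N x a b) \<le> C * dt N x powr (- 0) \<and> 1 \<le> C * dt N x powr (- 0)" by blast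
qed (auto simp: Um_def intro: tame_entries tame_const)

lemma loop_data_neg: "loop_data N (Xi N) (Xi N) (\<lambda>_. Im1) (- 1) 0 1"
proof
  fix x and a b :: nat assume g: "good N x" and ab: "a < N" "b < N"
  note d = good_det[OF g]
  show "mm N (Xi N x) Im1 a b = Xi N x a b" by (rule mm_Im1(1)[OF ab(2)])
  have "mm N (Um N x) (Xi N x) a b = mm N Im1 (Xi N x) a b - mm N (Xm N x) (Xi N x) a b"
    unfolding mm_def Um_def by (simp add: left_diff_distrib sum_subtractf)
  then show U: "mm N (Um N x) (Xi N x) a b = - 1 * (Im1 a b - Xi N x a b)"
    using d ab by (simp add: mm_Im1 mm_Xi)
  show "mm N (mm N (Um N x) (Xi N x)) Im1 a b = - 1 * (Im1 a b - Xi N x a b)"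
    unfolding mm_Im1(1)[OF ab(2)] by (rule U)
  show "mm N (mm N (Um N x) (Ui N x)) Im1 a b = Im1 a b"
    unfolding mm_Im1(1)[OF ab(2)] using d ab by (simp add: mm_Ui)
  fix p
  show "pd p (\<lambda>x. Xi N x a b) (- 1 * mm N (mm N (Xi N x) (bas p)) (Xi N x) a b) x"
    using pd_Xi[OF _ ab, of x p] d by simp
  show "pd p (\<lambda>x. Im1 a b) (0 * bas p a b) x" using pd_const by simp
next
  have "\<exists>C. \<forall>x. good N x \<longrightarrow> norm (cofactor (herm_of N x) b a) \<le> C" if "a < N" "b < N" for a b
    by (rule pf_bounded_good[OF pf_cofactor[OF herm_of_carrier pf_entry that(2,1)]])
  then obtain C where C: "\<And>a b x. a < N \<Longrightarrow> b < N \<Longrightarrow> good N x \<Longrightarrow> norm (cofactor (herm_of N x) b a) \<le> C a b" by metis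
  obtain D where D: "\<And>x. good N x \<Longrightarrow> norm (complex_of_real (dt N x)) \<le> D" using pf_bounded_good[OF pf_dt] by blast
  \<comment> \<open>The bound \<open>D\<close> for \<open>dt\<close> is included so that
    \<open>1 \<le> K * inverse (dt N x)\<close>, as \<open>bnd\<close> demands for slots that
    contain the identity.\<close>
  define K where "K = (\<Sum>p\<in>idx N. \<bar>C (fst p) (snd p)\<bar>) + \<bar>D\<bar>"
  have "norm (Xi N x a b) \<le> K * dt N x powr (- 1) \<and> norm (Im1 a b) \<le> K * dt N x powr (- 1) \<and> 1 \<le> K * dt N x powr (- 1)"
    if g: "good N x" and ab: "a < N" "b < N" for x a b
  proof -
    note d = good_det(1)[OF g]
    have "\<bar>C (fst (a, b)) (snd (a, b))\<bar> \<le> (\<Sum>p\<in>idx N. \<bar>C (fst p) (snd p)\<bar>)" by (rule member_le_sum) (use ab in auto)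
    then have K: "norm (cofactor (herm_of N x) b a) \<le> K" "dt N x \<le> K"
      using C[OF ab g] D[OF g] sum_nonneg[of "idx N" "\<lambda>p. \<bar>C (fst p) (snd p)\<bar>"] by (auto simp: K_def)
    have p: "dt N x powr (- 1) = inverse (dt N x)" using d by (simp add: powr_minus)
    have "norm (Xi N x a b) \<le> K * inverse (dt N x)"
      unfolding Xi_def norm_mult using d K(1) by (simp add: norm_inverse mult_right_mono)
    moreover have "1 \<le> K * inverse (dt N x)" using K(2) d by (simp add: field_simps)
    moreover have "norm (Im1 a b) \<le> 1" by (simp add: Im1_def)
    ultimately show ?thesis unfolding p by linarith
  qed
  then show "\<exists>C. \<forall>x a b. good N x \<longrightarrow> a < N \<longrightarrow> b < N \<longrightarrow> norm (Xi N x a b) \<le> C * dt N x powr (- 1)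
       \<and> norm (Im1 a b) \<le> C * dt N x powr (- 1) \<and> 1 \<le> C * dt N x powr (- 1)" by blast
qed (auto intro: tame_entries tame_const)

lemma loop_rhs_divide: "loop_rhs n N e (\<lambda>s. f s / c) s = loop_rhs n N e f s / c"
  unfolding loop_rhs_def jm_def by (simp add: sum_divide_distrib[symmetric] add_divide_distrib[symmetric] sum_distrib_left[symmetric])

lemma jm_divide: "jm n (\<lambda>s. f s / c) s = jm n f s / c"
  unfolding jm_def by (simp add: sum_divide_distrib)

lemma loop_sol_jint:
  assumes Z: "jint N \<alpha> \<beta> (\<lambda>_. 1) \<noteq> 0"
    and eq: "\<And>n \<sigma>. n < M \<Longrightarrow> \<sigma> permutes {1..Suc n} \<Longrightarrow> c * jint N \<alpha> \<beta> (\<lambda>x. tf N (Suc n) \<sigma> (Y x)) + jm (Suc n) (\<lambda>\<sigma>. jint N \<alpha> \<beta> (\<lambda>x. tf N (Suc n) \<sigma> (Y x))) \<sigma> =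
       loop_rhs n K e (\<lambda>\<sigma>. jint N \<alpha> \<beta> (\<lambda>x. tf N n \<sigma> (Y x))) \<sigma>"
  shows "loop_sol M K e c (\<lambda>n \<sigma>. jint N \<alpha> \<beta> (\<lambda>x. tf N n \<sigma> (Y x)) / jint N \<alpha> \<beta> (\<lambda>_. 1))"
  unfolding loop_sol_def loop_rhs_divide jm_divide
proof (intro conjI allI impI)
  have "id permutes {1..0 :: nat}" by (rule permutes_id)
  then have "tf N 0 id y = 1" for y unfolding tf_def by simp
  then show "jint N \<alpha> \<beta> (\<lambda>x. tf N 0 id (Y x)) / jint N \<alpha> \<beta> (\<lambda>_. 1) = 1" using Z by simp
  show "jint N \<alpha> \<beta> (\<lambda>x. tf N n \<sigma> (Y x)) / jint N \<alpha> \<beta> (\<lambda>_. 1) = 0" if "\<not> \<sigma> permutes {1..n}" for n \<sigma>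
    using that by (simp only: tf_def if_False jint_zero div_0)
  show "c * (jint N \<alpha> \<beta> (\<lambda>x. tf N (Suc n) \<sigma> (Y x)) / jint N \<alpha> \<beta> (\<lambda>_. 1)) + jm (Suc n) (\<lambda>\<sigma>. jint N \<alpha> \<beta> (\<lambda>x. tf N (Suc n) \<sigma> (Y x))) \<sigma> / jint N \<alpha> \<beta> (\<lambda>_. 1) =
     loop_rhs n K e (\<lambda>\<sigma>. jint N \<alpha> \<beta> (\<lambda>x. tf N n \<sigma> (Y x))) \<sigma> / jint N \<alpha> \<beta> (\<lambda>_. 1)" if "n < M" "\<sigma> permutes {1..Suc n}" for n \<sigma>
    unfolding eq[OF that, symmetric] by (simp add: add_divide_distrib)
qed

text \<open>With \<open>Z = Y = X\<close> the integral kept aside in \<open>jint_loop\<close> is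
  \<open>u (Suc n)\<close> itself; its coefficient \<open>N + \<beta>\<close> joins
  \<open>N + \<alpha>\<close> on the left to form
  \<open>c = 2 * N + \<alpha> + \<beta>\<close>.\<close>

lemma jint_loop_pos:
  fixes N n :: nat
  assumes \<sigma>: "\<sigma> permutes {1..Suc n}" and a: "-1 < Re \<alpha>" "-1 < Re \<beta>"
  defines "u \<equiv> \<lambda>n \<sigma>. jint N \<alpha> \<beta> (\<lambda>x. tf N n \<sigma> (Xm N x))"
  shows "(2 * of_nat N + \<alpha> + \<beta>) * u (Suc n) \<sigma> + jm (Suc n) (u (Suc n)) \<sigma> = loop_rhs n (of_nat N) (of_nat N + \<alpha>) (u n) \<sigma>"
proof -
  have 1: "(of_nat N + \<alpha>) * u (Suc n) \<sigma> + jm (Suc n) (u (Suc n)) \<sigma> + (of_nat N + \<beta>) * jint N \<alpha> \<beta> (\<lambda>x. tp N (Suc n) \<sigma> (Xm N x) (Xm N x)) =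
     loop_rhs n (of_nat N) (of_nat N + \<alpha>) (u n) \<sigma>"
    using loop_data.jint_loop(1)[OF loop_data_pos \<sigma>, of \<alpha> \<beta>] a unfolding u_def by simp
  have "jint N \<alpha> \<beta> (\<lambda>x. tp N (Suc n) \<sigma> (Xm N x) (Xm N x)) = u (Suc n) \<sigma>"
    unfolding tp_self u_def using \<sigma> by (simp only: tf_def if_True)
  with 1 show ?thesis by (simp add: algebra_simps)
qed

text \<open>With \<open>Z = 1\<close> the integral kept aside is \<open>N + J\<close> applied to
  \<open>u n\<close>; moved to the right, its coefficient \<open>N + \<beta>\<close> turns
  \<open>- \<alpha>\<close> into \<open>e = - (N + \<alpha> + \<beta>)\<close>. The condition on
  \<alpha> tightens by 1 with each factor of the inverse matrix.\<close>

lemma jint_loop_neg: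
  fixes N n :: nat
  assumes \<sigma>: "\<sigma> permutes {1..Suc n}" and a: "-1 < Re \<alpha> - real (Suc n)" "-1 < Re \<beta>"
  defines "u \<equiv> \<lambda>n \<sigma>. jint N \<alpha> \<beta> (\<lambda>x. tf N n \<sigma> (Xi N x))"
  shows "(- \<alpha>) * u (Suc n) \<sigma> + jm (Suc n) (u (Suc n)) \<sigma> = loop_rhs n (of_nat N) (- (of_nat N + \<alpha> + \<beta>)) (u n) \<sigma>"
proof -
  have 1: "(- \<alpha>) * u (Suc n) \<sigma> + jm (Suc n) (u (Suc n)) \<sigma> + (of_nat N + \<beta>) * jint N \<alpha> \<beta> (\<lambda>x. tp N (Suc n) \<sigma> (Xi N x) Im1) =
     loop_rhs n (of_nat N) (- \<alpha>) (u n) \<sigma>"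
    using loop_data.jint_loop(1)[OF loop_data_neg \<sigma>, of \<alpha> \<beta>] a unfolding u_def by simp
  have 2: "jint N \<alpha> \<beta> (\<lambda>x. tp N (Suc n) \<sigma> (Xi N x) Im1) = of_nat N * u n \<sigma> + jm (Suc n) (u n) \<sigma>"
    using loop_data.jint_loop(2)[OF loop_data_neg \<sigma>, of \<alpha> \<beta>] a unfolding u_def by simp
  from 1 show ?thesis unfolding 2 loop_rhs_def by (simp add: algebra_simps)
qed

section \<open>The normalization constant\<close>

definition alt :: "nat \<Rightarrow> ((nat \<Rightarrow> nat) \<Rightarrow> complex) \<Rightarrow> complex" where
  "alt n f = (\<Sum>\<sigma>\<in>{\<sigma>. \<sigma> permutes {1..n}}. of_int (sign \<sigma>) * f \<sigma>)"

text \<open>Under the sign character each of the \<open>n\<close> transpositions in the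
  Jucys--Murphy element of \<open>Suc n\<close> contributes -1.\<close>

lemma alt_jm: "alt (Suc n) (jm (Suc n) g) = - of_nat n * alt (Suc n) g"
proof -
  let ?S = "{\<sigma>. \<sigma> permutes {1..Suc n}}"
  have "alt (Suc n) (jm (Suc n) g) = (\<Sum>m\<in>{1..<Suc n}. \<Sum>\<sigma>\<in>?S. of_int (sign \<sigma>) * g (\<sigma> \<circ> Transposition.transpose m (Suc n)))"
    unfolding alt_def jm_def sum_distrib_left by (rule sum.swap)
  also have "\<dots> = (\<Sum>m\<in>{1..<Suc n}. - alt (Suc n) g)"
  proof (rule sum.cong[OF refl])
    fix m assume m: "m \<in> {1..<Suc n}"
    have t: "Transposition.transpose m (Suc n) permutes {1..Suc n}" by (rule permutes_swap_id) (use m in auto)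
    have "- alt (Suc n) g = (\<Sum>\<sigma>\<in>?S. - (of_int (sign \<sigma>) * g \<sigma>))" by (simp add: alt_def sum_negf)
    also have "\<dots> = (\<Sum>\<sigma>\<in>?S. - (of_int (sign (\<sigma> \<circ> Transposition.transpose m (Suc n))) * g (\<sigma> \<circ> Transposition.transpose m (Suc n))))"
      by (rule sum_permutations_compose_right[OF t])
    also have "\<dots> = (\<Sum>\<sigma>\<in>?S. of_int (sign \<sigma>) * g (\<sigma> \<circ> Transposition.transpose m (Suc n)))"
    proof (rule sum.cong[OF refl])
      fix \<sigma> assume "\<sigma> \<in> ?S"
      then have "permutation \<sigma>" "permutation (Transposition.transpose m (Suc n))"
        using permutation_permutes[of \<sigma>] t permutation_permutes[of "Transposition.transpose m (Suc n)"] by blast+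
      then have s: "sign (\<sigma> \<circ> Transposition.transpose m (Suc n)) = - sign \<sigma>"
        using m by (simp only: sign_compose sign_swap_id) simp
      show "- (of_int (sign (\<sigma> \<circ> Transposition.transpose m (Suc n))) * g (\<sigma> \<circ> Transposition.transpose m (Suc n))) =
        of_int (sign \<sigma>) * g (\<sigma> \<circ> Transposition.transpose m (Suc n))"
        unfolding s by simp
    qed
    finally show "(\<Sum>\<sigma>\<in>?S. of_int (sign \<sigma>) * g (\<sigma> \<circ> Transposition.transpose m (Suc n))) = - alt (Suc n) g" by (rule sym)
  qed
  also have "\<dots> = - of_nat n * alt (Suc n) g" by simp
  finally show ?thesis .
qed

lemma alt_add: "alt n (\<lambda>s. f s + g s) = alt n f + alt n g"
  unfolding alt_def by (simp add: distrib_left sum.distrib)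

lemma alt_cmult: "alt n (\<lambda>s. c * f s) = c * alt n f"
  unfolding alt_def by (simp add: sum_distrib_left mult.left_commute)

lemma alt_extend:
  assumes "\<And>s. \<not> s permutes {1..n} \<Longrightarrow> f s = 0" shows "alt (Suc n) f = alt n f"
  unfolding alt_def
proof (rule sum.mono_neutral_right)
  show "finite {\<sigma>. \<sigma> permutes {1..Suc n}}" by (rule finite_permutations) simp
  show "{\<sigma>. \<sigma> permutes {1..n}} \<subseteq> {\<sigma>. \<sigma> permutes {1..Suc n}}" by (auto intro: permutes_subset)
  show "\<forall>i\<in>{\<sigma>. \<sigma> permutes {1..Suc n}} - {\<sigma>. \<sigma> permutes {1..n}}. of_int (sign i) * f i = 0" using assms by simp
qed

lemma alt_loop:
  assumes eq: "\<And>s. s permutes {1..Suc n} \<Longrightarrow> c * f1 s + jm (Suc n) f1 s = loop_rhs n N e f s"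
    and z: "\<And>s. \<not> s permutes {1..n} \<Longrightarrow> f s = 0"
  shows "(c - of_nat n) * alt (Suc n) f1 = (e - of_nat n) * (N - of_nat n) * alt n f"
proof -
  define w where "w s = N * f s + jm (Suc n) f s" for s
  have x: "alt (Suc n) f = alt n f" by (rule alt_extend[OF z])
  have w: "alt (Suc n) w = (N - of_nat n) * alt n f"
    unfolding w_def alt_add alt_cmult alt_jm x by (simp add: x algebra_simps)
  have "alt (Suc n) (\<lambda>s. c * f1 s + jm (Suc n) f1 s) = alt (Suc n) (\<lambda>s. e * w s + jm (Suc n) w s)"
    unfolding alt_def
  proof (rule sum.cong[OF refl])
    fix s assume "s \<in> {s. s permutes {1..Suc n}}"
    then have "s permutes {1..Suc n}" by simp
    from eq[OF this] show "of_int (sign s) * (c * f1 s + jm (Suc n) f1 s) = of_int (sign s) * (e * w s + jm (Suc n) w s)"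
      unfolding loop_rhs_def w_def by simp
  qed
  then have "c * alt (Suc n) f1 - of_nat n * alt (Suc n) f1 = e * alt (Suc n) w - of_nat n * alt (Suc n) w"
    unfolding alt_add alt_cmult alt_jm by simp
  then show ?thesis unfolding w by (simp add: algebra_simps)
qed

lemma alt_term_bij:
  fixes A :: "complex mat"
  assumes A: "A \<in> carrier_mat N N" and i: "bij_betw i {1..N} {0..<N}"
  shows "(\<Sum>\<sigma>\<in>{\<sigma>. \<sigma> permutes {1..N}}. of_int (sign \<sigma>) * (\<Prod>k\<in>{1..N}. A $$ (i k, i (\<sigma> k)))) = Determinant.det A"
proof -
  let ?F = "\<lambda>\<pi> x. if x \<in> {0..<N} then i (\<pi> (inv_into {1..N} i x)) else x"
  have F: "?F \<sigma> = map_permutation {1..N} i \<sigma>" for \<sigma>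
    using bij_betw_imp_surj_on[OF i] by (auto simp: fun_eq_iff map_permutation_def restrict_id_def)
  have inj: "inj_on i {1..N}" by (rule bij_betw_imp_inj_on[OF i])
  have "Determinant.det A = (\<Sum>\<sigma>\<in>{\<sigma>. \<sigma> permutes {1..N}}. of_int (sign (?F \<sigma>)) * (\<Prod>j=0..<N. A $$ (j, ?F \<sigma> j)))"
    unfolding det_def'[OF A] by (rule sum.reindex_bij_betw[OF bij_betw_permutations[OF i], symmetric])
  also have "\<dots> = (\<Sum>\<sigma>\<in>{\<sigma>. \<sigma> permutes {1..N}}. of_int (sign \<sigma>) * (\<Prod>k\<in>{1..N}. A $$ (i k, i (\<sigma> k))))"
  proof (intro sum.cong refl arg_cong2[of _ _ _ _ "(*)"])
    fix \<sigma> assume "\<sigma> \<in> {\<sigma>. \<sigma> permutes {1..N}}"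
    then have p: "\<sigma> permutes {1..N}" by simp
    have "sign (?F \<sigma>) = sign \<sigma>" unfolding F by (rule sign_map_permutation[OF inj p]) simp
    then show "complex_of_int (sign (?F \<sigma>)) = of_int (sign \<sigma>)" by simp
    have "(\<Prod>j\<in>{0..<N}. A $$ (j, ?F \<sigma> j)) = (\<Prod>k\<in>{1..N}. A $$ (i k, ?F \<sigma> (i k)))"
      by (rule prod.reindex_bij_betw[OF i, symmetric])
    also have "\<dots> = (\<Prod>k\<in>{1..N}. A $$ (i k, i (\<sigma> k)))"
    proof (rule prod.cong[OF refl])
      fix k assume k: "k \<in> {1..N}"
      have "i k \<in> {0..<N}" using i k by (rule bij_betwE[THEN bspec])
      then show "A $$ (i k, ?F \<sigma> (i k)) = A $$ (i k, i (\<sigma> k))" using inv_into_f_f[OF inj k] by simp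
    qed
    finally show "(\<Prod>j\<in>{0..<N}. A $$ (j, ?F \<sigma> j)) = (\<Prod>k\<in>{1..N}. A $$ (i k, i (\<sigma> k)))" .
  qed
  finally show ?thesis by (rule sym)
qed

lemma alt_term_noninj:
  fixes n :: nat
  assumes ab: "a \<in> {1..n}" "b \<in> {1..n}" "a \<noteq> b" "i a = i b"
  shows "(\<Sum>\<sigma>\<in>{\<sigma>. \<sigma> permutes {1..n}}. of_int (sign \<sigma>) * (\<Prod>k\<in>{1..n}. A (i k) (i (\<sigma> k)))) = (0 :: complex)"
    (is "?L = 0")
proof -
  let ?t = "Transposition.transpose a b"
  have t: "?t permutes {1..n}" by (rule permutes_swap_id[OF ab(1,2)])
  have it: "i (?t k) = i k" for k using ab(4) by (cases "k = a"; cases "k = b") simp_all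
  have "?L = (\<Sum>\<sigma>\<in>{\<sigma>. \<sigma> permutes {1..n}}. of_int (sign (?t \<circ> \<sigma>)) * (\<Prod>k\<in>{1..n}. A (i k) (i ((?t \<circ> \<sigma>) k))))"
    by (rule setum_permutations_compose_left[OF t])
  also have "\<dots> = (\<Sum>\<sigma>\<in>{\<sigma>. \<sigma> permutes {1..n}}. - (of_int (sign \<sigma>) * (\<Prod>k\<in>{1..n}. A (i k) (i (\<sigma> k)))))"
  proof (rule sum.cong[OF refl])
    fix \<sigma> assume "\<sigma> \<in> {\<sigma>. \<sigma> permutes {1..n}}"
    then have "\<sigma> permutes {1..n}" by simp
    note p = permutes_imp_permutation[OF finite_atLeastAtMost this] permutes_imp_permutation[OF finite_atLeastAtMost t]
    have "sign ?t = - 1" using ab(3) by (simp add: sign_swap_id)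
    then have s: "sign (?t \<circ> \<sigma>) = - sign \<sigma>" unfolding sign_compose[OF p(2,1)] by (simp only: mult_minus1)
    show "of_int (sign (?t \<circ> \<sigma>)) * (\<Prod>k\<in>{1..n}. A (i k) (i ((?t \<circ> \<sigma>) k))) = - (of_int (sign \<sigma>) * (\<Prod>k\<in>{1..n}. A (i k) (i (\<sigma> k))))"
      by (simp only: s o_apply it of_int_minus mult_minus_left)
  qed
  also have "\<dots> = - ?L" by (rule sum_negf)
  finally have "?L = - ?L" .
  moreover have "x = - x \<Longrightarrow> x = 0" for x :: complex by (simp add: complex_eq_iff)
  ultimately show ?thesis by blast
qed

text \<open>The antisymmetric part of the \<open>N\<close>-fold tensor power of an
  \<open>N\<close>-dimensional space is one-dimensional. Index maps that are not injective
  contribute zero, as exchanging two equal indices flips the sign; each injective one gives a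
  Leibniz expansion of the determinant, and \<open>K\<close> counts them.\<close>

lemma alt_tperm:
  "\<exists>K>0. \<forall>A \<in> carrier_mat N N. alt N (\<lambda>\<sigma>. tperm N {1..N} \<sigma> (\<lambda>_ a b. A $$ (a, b))) = of_nat K * Determinant.det (A :: complex mat)"
proof -
  let ?I = "{i \<in> {1..N} \<rightarrow>\<^sub>E {..<N}. inj_on i {1..N}}"
  have "alt N (\<lambda>\<sigma>. tperm N {1..N} \<sigma> (\<lambda>_ a b. A $$ (a, b))) = of_nat (card ?I) * Determinant.det A"
    if A: "A \<in> carrier_mat N N" for A :: "complex mat"
  proof -
  let ?E = "{1..N} \<rightarrow>\<^sub>E {..<N}"
  define T where "T i = (\<Sum>\<sigma>\<in>{\<sigma>. \<sigma> permutes {1..N}}. of_int (sign \<sigma>) * (\<Prod>k\<in>{1..N}. A $$ (i k, i (\<sigma> k))))" for i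
  have "alt N (\<lambda>\<sigma>. tperm N {1..N} \<sigma> (\<lambda>_ a b. A $$ (a, b))) = (\<Sum>i\<in>?E. T i)"
    unfolding alt_def tperm_def T_def sum_distrib_left by (rule sum.swap)
  also have "\<dots> = (\<Sum>i\<in>?I. T i)"
  proof (rule sum.mono_neutral_right)
    show "finite ?E" by (rule finite_PiE) auto
    show "\<forall>i\<in>?E - ?I. T i = 0"
    proof
      fix i assume "i \<in> ?E - ?I"
      then obtain a b where "a \<in> {1..N}" "b \<in> {1..N}" "a \<noteq> b" "i a = i b" by (auto simp: inj_on_def)
      then show "T i = 0" unfolding T_def by (rule alt_term_noninj[where A = "\<lambda>a b. A $$ (a, b)"])
    qed
  qed auto
  also have "\<dots> = (\<Sum>i\<in>?I. Determinant.det A)"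
  proof (rule sum.cong[OF refl])
    fix i assume i: "i \<in> ?I"
    then have s: "i ` {1..N} \<subseteq> {0..<N}" by (auto simp: PiE_iff)
    have "card (i ` {1..N}) = card {0..<N}" using i by (simp add: card_image)
    then have "i ` {1..N} = {0..<N}" using s by (intro card_subset_eq) auto
    then have "bij_betw i {1..N} {0..<N}" using i by (simp add: bij_betw_def)
    then show "T i = Determinant.det A" unfolding T_def by (rule alt_term_bij[OF A])
  qed
  also have "\<dots> = of_nat (card ?I) * Determinant.det A" by simp
  finally show ?thesis .
  qed
  moreover have "0 < card ?I"
  proof -
    have "(\<lambda>k\<in>{1..N}. k - 1) \<in> ?I" by (auto simp: inj_on_def)
    moreover have "finite ?I" by (rule finite_subset[of _ "{1..N} \<rightarrow>\<^sub>E {..<N}"]) (auto intro: finite_PiE)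
    ultimately show ?thesis unfolding card_gt_0_iff by blast
  qed
  ultimately show ?thesis by blast
qed

lemma alt_jint:
  assumes "\<And>\<sigma>. jintegrable N \<alpha> \<beta> (\<lambda>x. f \<sigma> x)"
  shows "jint N \<alpha> \<beta> (\<lambda>x. alt n (\<lambda>\<sigma>. f \<sigma> x)) = alt n (\<lambda>\<sigma>. jint N \<alpha> \<beta> (f \<sigma>))"
  unfolding alt_def using jint_sum[of "{\<sigma>. \<sigma> permutes {1..n}}" N \<alpha> \<beta> "\<lambda>\<sigma> x. of_int (sign \<sigma>) * f \<sigma> x"] jint_cmult assms by simp

lemma jint_shift: "jint N \<alpha> \<beta> (\<lambda>x. of_real (dt N x)) = jint N (\<alpha> + 1) \<beta> (\<lambda>_. 1)"
proof -
  have "of_real (dt N x) * wt N \<alpha> \<beta> x = 1 * wt N (\<alpha> + 1) \<beta> x" if "good N x" for x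
    using good_det(1)[OF that] by (simp add: wt_def exp_add distrib_right exp_of_real)
  then show ?thesis unfolding jint_def by (intro Bochner_Integration.integral_cong refl) simp
qed

text \<open>Antisymmetrizing the loop equation over the permutations gives a scalar recursion, and the
  antisymmetrized \<open>N\<close>-th trace is a multiple of \<open>det X\<close>.\<close>

lemma norm_shift_alpha:
  assumes a: "-1 < Re \<alpha>" "-1 < Re \<beta>" and Z: "jint N \<alpha> \<beta> (\<lambda>_. 1) = 0"
  shows "jint N (\<alpha> + 1) \<beta> (\<lambda>_. 1) = 0"
proof -
  define u where "u n \<sigma> = jint N \<alpha> \<beta> (\<lambda>x. tf N n \<sigma> (Xm N x))" for n \<sigma>
  have A: "alt n (u n) = 0" if "n \<le> N" for n
    using that
  proof (induction n)
    case 0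
    have "{\<sigma> :: nat \<Rightarrow> nat. \<sigma> permutes {1..0}} = {id}" by auto
    moreover have "tf N 0 id y = 1" for y unfolding tf_def by (simp add: permutes_id)
    ultimately show ?case using Z by (simp add: alt_def u_def)
  next
    case (Suc n)
    have "(2 * of_nat N + \<alpha> + \<beta> - of_nat n) * alt (Suc n) (u (Suc n)) = (of_nat N + \<alpha> - of_nat n) * (of_nat N - of_nat n) * alt n (u n)"
    proof (rule alt_loop)
      show "(2 * of_nat N + \<alpha> + \<beta>) * u (Suc n) s + jm (Suc n) (u (Suc n)) s = loop_rhs n (of_nat N) (of_nat N + \<alpha>) (u n) s"
        if "s permutes {1..Suc n}" for s
        unfolding u_def by (rule jint_loop_pos[OF that a])
      show "u n s = 0" if "\<not> s permutes {1..n}" for s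
        unfolding u_def using that by (simp only: tf_def if_False jint_zero)
    qed
    then have e: "(2 * of_nat N + \<alpha> + \<beta> - of_nat n) * alt (Suc n) (u (Suc n)) = 0" using Suc by simp
    \<comment> \<open>For \<open>Suc n \<le> N\<close> one has
      \<open>2 * N - n \<ge> N + 1 \<ge> 2\<close>, which outweighs the sum of the real parts of
      \<alpha> and \<beta>, larger than -2. Thus the zero passes to the next level.\<close>
    have "Re (2 * of_nat N + \<alpha> + \<beta> - of_nat n) > 0" using a Suc.prems by simp
    then have "2 * of_nat N + \<alpha> + \<beta> - of_nat n \<noteq> 0" by force
    then show ?case using e by simp
  qed
  obtain K :: nat where K: "0 < K" "\<And>x. alt N (\<lambda>\<sigma>. tperm N {1..N} \<sigma> (\<lambda>_ a b. herm_of N x $$ (a, b))) = of_nat K * of_real (dt N x)"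
    using alt_tperm[of N] herm_of_carrier[of N] unfolding det_dt[symmetric] by blast
  have t: "alt N (\<lambda>\<sigma>. tf N N \<sigma> (Xm N x)) = alt N (\<lambda>\<sigma>. tperm N {1..N} \<sigma> (\<lambda>_ a b. herm_of N x $$ (a, b)))" for x
    unfolding alt_def by (intro sum.cong refl) (simp add: tf_def Xm_def[abs_def])
  have "0 = alt N (u N)" using A by simp
  also have "\<dots> = jint N \<alpha> \<beta> (\<lambda>x. alt N (\<lambda>\<sigma>. tf N N \<sigma> (Xm N x)))"
    unfolding u_def by (rule alt_jint[symmetric]) (rule loop_data.jintegrable_tf[OF loop_data_pos], use a in auto)
  also have "\<dots> = of_nat K * jint N (\<alpha> + 1) \<beta> (\<lambda>_. 1)" unfolding t K(2) jint_cmult(2) jint_shift ..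
  finally show ?thesis using K(1) by simp
qed

section \<open>The reflection taking X to 1 - X\<close>

text \<open>The coordinates of \<open>1 - X\<close>. The reflection preserves \<open>dX\<close> and
  exchanges the two determinants, so a zero of the normalization can be shifted in \<beta> as well
  as in \<alpha>. The form \<open>t + (-1) * x\<close> matches
  \<open>lborel_real_affine\<close>.\<close>

definition refl_coord :: "nat \<Rightarrow> (nat \<times> nat \<Rightarrow> real) \<Rightarrow> nat \<times> nat \<Rightarrow> real" where
  "refl_coord N x = (\<lambda>p\<in>idx N. (if fst p = snd p then 1 else 0) + (-1) * x p)"

lemma lborel_reflect: "distr lborel borel (\<lambda>x :: real. t + (-1) * x) = lborel"
proof -
  have "lborel = density (distr lborel borel (\<lambda>x :: real. t + (-1) * x)) (\<lambda>_. ennreal \<bar>-1\<bar>)"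
    by (rule lborel_real_affine) simp
  also have "\<dots> = distr lborel borel (\<lambda>x :: real. t + (-1) * x)" by (simp add: density_1)
  finally show ?thesis by (rule sym)
qed

lemma refl_coord_measurable [measurable]: "refl_coord N \<in> measurable (herm_lebesgue N) (herm_lebesgue N)"
  unfolding refl_coord_def[abs_def] herm_lebesgue_def by (rule measurable_restrict) measurable

lemma distr_refl_coord: "distr (herm_lebesgue N) (herm_lebesgue N) (refl_coord N) = herm_lebesgue N"
proof -
  interpret product_sigma_finite "\<lambda>_ :: nat \<times> nat. lborel :: real measure" ..
  have "distr (herm_lebesgue N) (herm_lebesgue N) (refl_coord N) = (\<Pi>\<^sub>M p\<in>idx N. lborel)"
  proof (rule PiM_eqI)
    show "finite (idx N)" by simp
    show "sets (distr (herm_lebesgue N) (herm_lebesgue N) (refl_coord N)) = sets (\<Pi>\<^sub>M p\<in>idx N. lborel)" by (simp add: herm_lebesgue_def)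
    fix A :: "nat \<times> nat \<Rightarrow> real set" assume A: "\<And>p. p \<in> idx N \<Longrightarrow> A p \<in> sets lborel"
    let ?r = "\<lambda>p x. (if fst p = snd p then 1 else 0) + (-1) * x :: real"
    let ?B = "\<lambda>p. ?r p -` A p"
    have B: "?B p \<in> sets lborel" if "p \<in> idx N" for p
      using measurable_sets[of "?r p" borel borel "A p"] A[OF that] by simp
    have AE: "Pi\<^sub>E (idx N) A \<in> sets (herm_lebesgue N)"
      unfolding herm_lebesgue_def by (rule sets_PiM_I_finite) (use A in auto)
    have "emeasure (distr (herm_lebesgue N) (herm_lebesgue N) (refl_coord N)) (Pi\<^sub>E (idx N) A) =
      emeasure (herm_lebesgue N) (refl_coord N -` Pi\<^sub>E (idx N) A \<inter> space (herm_lebesgue N))"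
      by (rule emeasure_distr[OF refl_coord_measurable AE])
    also have "refl_coord N -` Pi\<^sub>E (idx N) A \<inter> space (herm_lebesgue N) = Pi\<^sub>E (idx N) ?B"
      unfolding herm_lebesgue_def by (auto simp: space_PiM PiE_iff refl_coord_def)
    also have "emeasure (herm_lebesgue N) (Pi\<^sub>E (idx N) ?B) = (\<Prod>p\<in>idx N. emeasure lborel (?B p))"
      unfolding herm_lebesgue_def by (rule emeasure_PiM) (use B in auto)
    also have "\<dots> = (\<Prod>p\<in>idx N. emeasure lborel (A p))"
    proof (rule prod.cong[OF refl])
      fix p assume p: "p \<in> idx N"
      have "emeasure lborel (A p) = emeasure (distr lborel borel (?r p)) (A p)" unfolding lborel_reflect ..
      also have "\<dots> = emeasure lborel (?B p)" using emeasure_distr[of "?r p" lborel borel "A p"] A[OF p] by simp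
      finally show "emeasure lborel (?B p) = emeasure lborel (A p)" by (rule sym)
    qed
    finally show "emeasure (distr (herm_lebesgue N) (herm_lebesgue N) (refl_coord N)) (Pi\<^sub>E (idx N) A) = (\<Prod>p\<in>idx N. emeasure lborel (A p))" .
  qed
  then show ?thesis unfolding herm_lebesgue_def .
qed

lemma herm_of_refl: "herm_of N (refl_coord N x) = 1\<^sub>m N - herm_of N x"
proof (rule eq_matI)
  fix i j assume "i < dim_row (1\<^sub>m N - herm_of N x)" "j < dim_col (1\<^sub>m N - herm_of N x)"
  then have ij: "i < N" "j < N" using carrier_matD[OF one_minus_carrier[of N x]] by auto
  show "herm_of N (refl_coord N x) $$ (i, j) = (1\<^sub>m N - herm_of N x) $$ (i, j)"
    unfolding Um_index[OF ij] Um_def Xm_def Im1_def herm_entry_expand[OF ij] using ij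
    by (auto simp: refl_coord_def complex_eq_iff)
qed (use carrier_matD[OF one_minus_carrier[of N x]] carrier_matD[OF herm_of_carrier[of N "refl_coord N x"]] in auto)

lemma one_minus_refl: "1\<^sub>m N - herm_of N (refl_coord N x) = herm_of N x"
  unfolding herm_of_refl using carrier_matD[OF herm_of_carrier[of N x]]
  by (intro eq_matI) auto

lemma good_refl: "good N (refl_coord N x) \<longleftrightarrow> good N x"
  unfolding good_def one_minus_refl unfolding herm_of_refl by blast

lemma wt_refl: "wt N \<alpha> \<beta> (refl_coord N x) = wt N \<beta> \<alpha> x"
proof -
  have "dt N (refl_coord N x) = du N x" "du N (refl_coord N x) = dt N x"
    unfolding dt_def du_def one_minus_refl unfolding herm_of_refl by simp_all
  then show ?thesis by (simp add: wt_def add.commute)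
qed

lemma norm_symmetric: "jint N \<alpha> \<beta> (\<lambda>_. 1) = jint N \<beta> \<alpha> (\<lambda>_. 1)"
proof -
  have m: "(\<lambda>x. if good N x then 1 * wt N \<alpha> \<beta> x else 0) \<in> borel_measurable (herm_lebesgue N)"
    by (rule good_measurable) measurable
  have "jint N \<alpha> \<beta> (\<lambda>_. 1) = (\<integral>x. (if good N x then 1 * wt N \<alpha> \<beta> x else 0) \<partial>distr (herm_lebesgue N) (herm_lebesgue N) (refl_coord N))"
    unfolding jint_def distr_refl_coord ..
  also have "\<dots> = (\<integral>x. (if good N (refl_coord N x) then 1 * wt N \<alpha> \<beta> (refl_coord N x) else 0) \<partial>herm_lebesgue N)"
    by (rule integral_distr[OF refl_coord_measurable m])
  also have "\<dots> = jint N \<beta> \<alpha> (\<lambda>_. 1)" unfolding good_refl wt_refl jint_def ..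
  finally show ?thesis .
qed

lemma norm_shift:
  assumes a: "-1 < Re \<alpha>" "-1 < Re \<beta>" and Z: "jint N \<alpha> \<beta> (\<lambda>_. 1) = 0"
  shows "jint N (\<alpha> + of_nat i) (\<beta> + of_nat j) (\<lambda>_. 1) = 0"
proof -
  have A: "jint N (\<alpha> + of_nat i) \<beta> (\<lambda>_. 1) = 0" if "-1 < Re \<alpha>" "-1 < Re \<beta>" "jint N \<alpha> \<beta> (\<lambda>_. 1) = 0" for \<alpha> \<beta> i
  proof (induction i)
    case 0 then show ?case using that by simp
  next
    case (Suc i)
    have "jint N (\<alpha> + of_nat i + 1) \<beta> (\<lambda>_. 1) = 0" by (rule norm_shift_alpha[OF _ _ Suc]) (use that in auto)
    then show ?case by (simp add: add_ac)
  qed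
  have "jint N (\<beta> + of_nat j) (\<alpha> + of_nat i) (\<lambda>_. 1) = 0"
    by (rule A) (use a A[OF a Z] in \<open>auto simp: norm_symmetric[of N \<beta>]\<close>)
  then show ?thesis by (simp add: norm_symmetric[of N "\<alpha> + of_nat i"])
qed

section \<open>Vanishing against all continuous functions of the determinants\<close>

lemma jintegrable_one:
  assumes "-1 < Re \<alpha>" "-1 < Re \<beta>" shows "jintegrable N \<alpha> \<beta> (\<lambda>_. 1)"
proof -
  have "tf N 0 id y = 1" for y unfolding tf_def by (simp add: permutes_id)
  then show ?thesis using loop_data.jintegrable_tf[OF loop_data_pos, of \<alpha> 0 \<beta> N id] assms by simp
qed

lemma jintegrable_bounded:
  assumes a: "-1 < Re \<alpha>" "-1 < Re \<beta>" and f: "f \<in> borel_measurable (herm_lebesgue N)" and b: "\<And>x. good N x \<Longrightarrow> norm (f x) \<le> C"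
  shows "jintegrable N \<alpha> \<beta> f"
    "norm (jint N \<alpha> \<beta> f) \<le> C * (\<integral>x. norm (if good N x then 1 * wt N \<alpha> \<beta> x else 0) \<partial>herm_lebesgue N)"
proof -
  have n: "integrable (herm_lebesgue N) (\<lambda>x. C * norm (if good N x then 1 * wt N \<alpha> \<beta> x else 0))"
    using jintegrable_one[OF a] unfolding jintegrable_def by (intro integrable_mult_right integrable_norm)
  have le: "norm (if good N x then f x * wt N \<alpha> \<beta> x else 0) \<le> C * norm (if good N x then 1 * wt N \<alpha> \<beta> x else 0)" for x
    using mult_right_mono[OF b[of x], of "norm (wt N \<alpha> \<beta> x)"] by (auto simp: norm_mult)
  show i: "jintegrable N \<alpha> \<beta> f" unfolding jintegrable_def
  proof (rule Bochner_Integration.integrable_bound[OF n])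
    show "(\<lambda>x. if good N x then f x * wt N \<alpha> \<beta> x else 0) \<in> borel_measurable (herm_lebesgue N)"
      by (intro good_measurable borel_measurable_times f wt_measurable)
    show "AE x in herm_lebesgue N. norm (if good N x then f x * wt N \<alpha> \<beta> x else 0) \<le> norm (C * norm (if good N x then 1 * wt N \<alpha> \<beta> x else 0))"
      by (rule AE_I2, rule order_trans[OF le]) simp
  qed
  have "norm (jint N \<alpha> \<beta> f) \<le> (\<integral>x. norm (if good N x then f x * wt N \<alpha> \<beta> x else 0) \<partial>herm_lebesgue N)"
    unfolding jint_def by (rule integral_norm_bound)
  also have "\<dots> \<le> (\<integral>x. C * norm (if good N x then 1 * wt N \<alpha> \<beta> x else 0) \<partial>herm_lebesgue N)"
    using i n le unfolding jintegrable_def by (intro integral_mono integrable_norm)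
  finally show "norm (jint N \<alpha> \<beta> f) \<le> C * (\<integral>x. norm (if good N x then 1 * wt N \<alpha> \<beta> x else 0) \<partial>herm_lebesgue N)" by simp
qed

text \<open>Integer shifts of the parameters are monomials in the two determinants, so the weight
  annihilates all polynomials in them. On the domain the determinants lie in a compact rectangle,
  where polynomials approximate \<open>\<phi>\<close> uniformly, and the integral of the modulus of
  the weight bounds the error.\<close>

lemma jint_continuous_zero:
  fixes \<phi> :: "real \<times> real \<Rightarrow> real"
  assumes a: "-1 < Re \<alpha>" "-1 < Re \<beta>" and Z: "jint N \<alpha> \<beta> (\<lambda>_. 1) = 0" and \<phi>: "continuous_on UNIV \<phi>"
  shows "jintegrable N \<alpha> \<beta> (\<lambda>x. of_real (\<phi> (dt N x, du N x)))" "jint N \<alpha> \<beta> (\<lambda>x. of_real (\<phi> (dt N x, du N x))) = 0"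
proof -
  \<comment> \<open>All monomials in the determinants are built into \<open>V\<close>, which makes
    it closed under multiplication by either determinant and so by any polynomial in them.\<close>
  define V where "V h \<longleftrightarrow> (\<forall>i j. jintegrable N \<alpha> \<beta> (\<lambda>x. h x * of_real (dt N x ^ i * du N x ^ j)) \<and>
     jint N \<alpha> \<beta> (\<lambda>x. h x * of_real (dt N x ^ i * du N x ^ j)) = 0)" for h
  have V1: "V (\<lambda>_. 1)" unfolding V_def
  proof (intro allI conjI)
    fix i j
    have e: "1 * of_real (dt N x ^ i * du N x ^ j) * wt N \<alpha> \<beta> x = 1 * wt N (\<alpha> + of_nat i) (\<beta> + of_nat j) x" if "good N x" for x
      using good_det[OF that] by (simp add: wt_def exp_add distrib_right exp_of_nat_mult exp_of_real)
    have e2: "(\<lambda>x. if good N x then 1 * of_real (dt N x ^ i * du N x ^ j) * wt N \<alpha> \<beta> x else 0) =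
      (\<lambda>x. if good N x then 1 * wt N (\<alpha> + of_nat i) (\<beta> + of_nat j) x else 0)"
      using e by (auto simp: fun_eq_iff)
    show "jintegrable N \<alpha> \<beta> (\<lambda>x. 1 * of_real (dt N x ^ i * du N x ^ j))"
      using jintegrable_one[of "\<alpha> + of_nat i" "\<beta> + of_nat j" N] a unfolding jintegrable_def e2 by simp
    show "jint N \<alpha> \<beta> (\<lambda>x. 1 * of_real (dt N x ^ i * du N x ^ j)) = 0"
      using norm_shift[OF a Z, of i j] unfolding jint_def e2 .
  qed
  have Vadd: "V (\<lambda>x. f x + g x)" if "V f" "V g" for f g
    using that jint_add unfolding V_def distrib_right by simp
  have Vc: "V (\<lambda>x. c * f x)" if "V f" for f c
    using that jint_cmult unfolding V_def mult.assoc by simp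
  have Vt: "V (\<lambda>x. of_real (dt N x) * f x)" if "V f" for f
  proof -
    have e: "of_real (dt N x) * f x * of_real (dt N x ^ i * du N x ^ j) = f x * of_real (dt N x ^ Suc i * du N x ^ j)" for x i j by simp
    show ?thesis using that unfolding V_def e by blast
  qed
  have Vu: "V (\<lambda>x. of_real (du N x) * f x)" if "V f" for f
  proof -
    have e: "of_real (du N x) * f x * of_real (dt N x ^ i * du N x ^ j) = f x * of_real (dt N x ^ i * du N x ^ Suc j)" for x i j by simp
    show ?thesis using that unfolding V_def e by blast
  qed
  have Q: "V (\<lambda>x. of_real (g (dt N x, du N x)) * h x)" if "real_polynomial_function g" "V h" for g :: "real \<times> real \<Rightarrow> real" and h
    using that
  proof (induction arbitrary: h rule: real_polynomial_function.induct)
    case (linear f)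
    have l: "linear f" using linear(1) by (rule bounded_linear.linear)
    have f: "f (t, u) = f (1, 0) * t + f (0, 1) * u" for t u
    proof -
      have "f (t, u) = f (t *\<^sub>R (1, 0) + u *\<^sub>R (0, 1))" by simp
      also have "\<dots> = t *\<^sub>R f (1, 0) + u *\<^sub>R f (0, 1)" by (simp only: linear_add[OF l] linear_scale[OF l])
      finally show ?thesis by (simp add: mult.commute)
    qed
    have "V (\<lambda>x. of_real (f (1, 0)) * (of_real (dt N x) * h x) + of_real (f (0, 1)) * (of_real (du N x) * h x))"
      by (intro Vadd Vc Vt Vu linear)
    moreover have "of_real (f (1, 0)) * (of_real (dt N x) * h x) + of_real (f (0, 1)) * (of_real (du N x) * h x) = of_real (f (dt N x, du N x)) * h x" for x
      unfolding f[of "dt N x" "du N x"] by (simp add: algebra_simps)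
    ultimately show ?case by simp
  next
    case (const c)
    then show ?case by (intro Vc)
  next
    case (add f g)
    have "V (\<lambda>x. of_real (f (dt N x, du N x)) * h x + of_real (g (dt N x, du N x)) * h x)" by (intro Vadd add)
    then show ?case by (simp add: distrib_right)
  next
    case (mult f g)
    have "V (\<lambda>x. of_real (f (dt N x, du N x)) * (of_real (g (dt N x, du N x)) * h x))" by (intro mult)
    then show ?case by (simp add: mult.assoc)
  qed
  have P: "jintegrable N \<alpha> \<beta> (\<lambda>x. of_real (g (dt N x, du N x)))" "jint N \<alpha> \<beta> (\<lambda>x. of_real (g (dt N x, du N x))) = 0"
    if "real_polynomial_function g" for g :: "real \<times> real \<Rightarrow> real"
    using Q[OF that V1, unfolded V_def, rule_format, of 0 0] by simp_all
  obtain C1 C2 where C: "\<And>x. good N x \<Longrightarrow> norm (complex_of_real (dt N x)) \<le> C1" "\<And>x. good N x \<Longrightarrow> norm (complex_of_real (du N x)) \<le> C2"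
    using pf_bounded_good[OF pf_dt] pf_bounded_good[OF pf_du] by metis
  define S where "S = {0..C1} \<times> {0..C2}"
  have S: "compact S" unfolding S_def by (intro compact_Times compact_Icc)
  have inS: "(dt N x, du N x) \<in> S" if "good N x" for x using C[OF that] good_det[OF that] by (simp add: S_def)
  have c\<phi>: "continuous_on S \<phi>" using \<phi> by (rule continuous_on_subset) simp
  obtain B where B: "\<And>y. y \<in> S \<Longrightarrow> norm (\<phi> y) \<le> B"
    using compact_imp_bounded[OF compact_continuous_image[OF c\<phi> S]] unfolding bounded_iff by blast
  have mc: "(\<lambda>x. complex_of_real (\<psi> (dt N x, du N x))) \<in> borel_measurable (herm_lebesgue N)" if "continuous_on UNIV \<psi>" for \<psi> :: "real \<times> real \<Rightarrow> real"
  proof -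
    have "(\<lambda>x. \<psi> (dt N x, du N x)) \<in> borel_measurable (herm_lebesgue N)"
      by (rule borel_measurable_continuous_on[OF that]) measurable
    then show ?thesis by measurable
  qed
  show J: "jintegrable N \<alpha> \<beta> (\<lambda>x. of_real (\<phi> (dt N x, du N x)))"
    by (rule jintegrable_bounded(1)[OF a mc[OF \<phi>]]) (use B inS in auto)
  define K where "K = (\<integral>x. norm (if good N x then 1 * wt N \<alpha> \<beta> x else 0) \<partial>herm_lebesgue N)"
  have K: "0 \<le> K" unfolding K_def by (rule Bochner_Integration.integral_nonneg) simp
  have "norm (jint N \<alpha> \<beta> (\<lambda>x. of_real (\<phi> (dt N x, du N x)))) \<le> e" if e: "0 < e" for e
  proof -
    define d where "d = e / (K + 1)"
    have d: "0 < d" "d * K \<le> e" using e K by (auto simp: d_def field_simps)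
    obtain g where g: "real_polynomial_function g" "\<And>y. y \<in> S \<Longrightarrow> \<bar>\<phi> y - g y\<bar> < d"
      using Stone_Weierstrass_real_polynomial_function[OF S c\<phi> d(1)] by blast
    have "continuous_on UNIV g" using g(1)
      by (intro continuous_at_imp_continuous_on ballI continuous_real_polymonial_function)
    then have cd: "continuous_on UNIV (\<lambda>y. \<phi> y - g y)" by (intro continuous_on_diff \<phi>)
    have "norm (jint N \<alpha> \<beta> (\<lambda>x. of_real (\<phi> (dt N x, du N x) - g (dt N x, du N x)))) \<le> d * K"
      unfolding K_def
    proof (rule jintegrable_bounded(2)[OF a mc[OF cd]])
      fix x assume "good N x"
      from g(2)[OF inS[OF this]] show "norm (complex_of_real (\<phi> (dt N x, du N x) - g (dt N x, du N x))) \<le> d"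
        by (simp only: norm_of_real less_imp_le)
    qed
    moreover have "jint N \<alpha> \<beta> (\<lambda>x. of_real (\<phi> (dt N x, du N x) - g (dt N x, du N x))) = jint N \<alpha> \<beta> (\<lambda>x. of_real (\<phi> (dt N x, du N x)))"
      using jint_add(2)[OF J jint_cmult(1)[OF P(1)[OF g(1)], of "-1"]] P(2)[OF g(1)] unfolding jint_cmult(2) by simp
    ultimately show ?thesis using d(2) by simp
  qed
  then have "norm (jint N \<alpha> \<beta> (\<lambda>x. of_real (\<phi> (dt N x, du N x)))) \<le> 0" by (rule field_le_epsilon[of _ 0, simplified])
  then show "jint N \<alpha> \<beta> (\<lambda>x. of_real (\<phi> (dt N x, du N x))) = 0" by simp
qed

text \<open>If the constant vanished at \<open>(\<alpha>, \<beta>)\<close>, it would vanish at all \<open>(\<alpha> + i, \<beta> + j)\<close>. By the Weierstrass theorem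
  the weight would then be orthogonal to every continuous function of the two determinants, in particular to
  a truncation of its own conjugate.\<close>

theorem norm_nonzero:
  assumes N: "0 < N" and a: "-1 < Re \<alpha>" "-1 < Re \<beta>"
  shows "jint N \<alpha> \<beta> (\<lambda>_. 1) \<noteq> 0"
proof
  assume Z: "jint N \<alpha> \<beta> (\<lambda>_. 1) = 0"
  have "AE x in herm_lebesgue N. \<not> (good N x \<and> e < min (dt N x) (du N x))" if e: "0 < e" for e
  proof -
    \<comment> \<open>The logarithms are truncated at \<open>e\<close> to make the function
      continuous on the whole plane. Where both determinants are at least \<open>e\<close> its first
      factor is the conjugate of the weight, and the last factor vanishes elsewhere, so the product
      with the weight is nonnegative on the domain.\<close>
    define \<phi> where "\<phi> y = cnj (exp (\<alpha> * of_real (ln (max (fst y) e)) + \<beta> * of_real (ln (max (snd y) e)))) * of_real (max 0 (min (fst y) (snd y) - e))" for y :: "real \<times> real"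
    have ne: "max t e \<noteq> 0" for t using e by (auto simp: max_def)
    have c: "continuous_on UNIV \<phi>" unfolding \<phi>_def
      by (intro continuous_intros) (use ne in auto)
    have cR: "continuous_on UNIV (\<lambda>y. Re (\<phi> y))" and cI: "continuous_on UNIV (\<lambda>y. Im (\<phi> y))" by (intro continuous_intros c)+
    note R = jint_continuous_zero[OF a Z cR] and I = jint_continuous_zero[OF a Z cI]
    have eq: "(\<lambda>x. \<phi> (dt N x, du N x)) = (\<lambda>x. of_real (Re (\<phi> (dt N x, du N x))) + \<i> * of_real (Im (\<phi> (dt N x, du N x))))"
      by (auto simp: fun_eq_iff complex_eq_iff)
    have J: "jintegrable N \<alpha> \<beta> (\<lambda>x. \<phi> (dt N x, du N x))" "jint N \<alpha> \<beta> (\<lambda>x. \<phi> (dt N x, du N x)) = 0"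
      unfolding eq using jint_add[OF R(1) jint_cmult(1)[OF I(1), of \<i>]] R(2) I(2) unfolding jint_cmult(2) by simp_all
    define F where "F x = (if good N x then (norm (wt N \<alpha> \<beta> x))\<^sup>2 * max 0 (min (dt N x) (du N x) - e) else 0)" for x
    have F: "(\<lambda>x. if good N x then \<phi> (dt N x, du N x) * wt N \<alpha> \<beta> x else 0) = (\<lambda>x. complex_of_real (F x))"
    proof
      fix x
      show "(if good N x then \<phi> (dt N x, du N x) * wt N \<alpha> \<beta> x else 0) = complex_of_real (F x)"
      proof (cases "e \<le> dt N x \<and> e \<le> du N x")
        case True
        then have "\<phi> (dt N x, du N x) * wt N \<alpha> \<beta> x = cnj (wt N \<alpha> \<beta> x) * wt N \<alpha> \<beta> x * of_real (max 0 (min (dt N x) (du N x) - e))"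
          unfolding \<phi>_def wt_def by (simp add: max_absorb1)
        also have "cnj (wt N \<alpha> \<beta> x) * wt N \<alpha> \<beta> x = of_real ((norm (wt N \<alpha> \<beta> x))\<^sup>2)"
          unfolding complex_norm_square by (rule mult.commute)
        finally show ?thesis unfolding F_def by (simp only: of_real_mult split: if_split) simp
      next
        case False
        then have "max 0 (min (dt N x) (du N x) - e) = 0" by auto
        then show ?thesis unfolding F_def \<phi>_def by simp
      qed
    qed
    have iF: "integrable (herm_lebesgue N) F" using J(1) unfolding jintegrable_def F complex_of_real_integrable_eq .
    have "complex_of_real (\<integral>x. F x \<partial>herm_lebesgue N) = 0" using J(2) unfolding jint_def F integral_complex_of_real .
    then have "(\<integral>x. F x \<partial>herm_lebesgue N) = 0" by simp
    moreover have "AE x in herm_lebesgue N. 0 \<le> F x" by (rule AE_I2) (simp add: F_def)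
    ultimately have "AE x in herm_lebesgue N. F x = 0" using integral_nonneg_eq_0_iff_AE[OF iF] by blast
    then show ?thesis
    proof (rule AE_mp, intro AE_I2 impI notI)
      fix x assume "F x = 0" and g: "good N x \<and> e < min (dt N x) (du N x)"
      then have "(norm (wt N \<alpha> \<beta> x))\<^sup>2 * (min (dt N x) (du N x) - e) = 0" by (auto simp: F_def max_def split: if_splits)
      then show False using g by (auto simp: wt_def)
    qed
  qed
  \<comment> \<open>Both determinants are positive on the domain, so countably many thresholds
    \<open>1 / Suc k\<close> exhaust it.\<close>
  then have "AE x in herm_lebesgue N. \<forall>k. \<not> (good N x \<and> 1 / real (Suc k) < min (dt N x) (du N x))"
    unfolding AE_all_countable by simp
  then have "AE x in herm_lebesgue N. x \<notin> herm01 N"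
  proof (rule AE_mp, intro AE_I2 impI notI)
    fix x assume k: "\<forall>k. \<not> (good N x \<and> 1 / real (Suc k) < min (dt N x) (du N x))" and x: "x \<in> herm01 N"
    then have g: "good N x" by (simp add: herm01_iff)
    then obtain k where "inverse (real (Suc k)) < min (dt N x) (du N x)"
      using good_det[OF g] reals_Archimedean[of "min (dt N x) (du N x)"] by auto
    then show False using k[rule_format, of k] g by (simp only: inverse_eq_divide) simp
  qed
  then have "herm01 N \<in> null_sets (herm_lebesgue N)" using AE_iff_null_sets[OF herm01_sets] by blast
  then show False using emeasure_herm01_pos[OF N] by (simp add: null_sets_def)
qed

section \<open>The correlators\<close>

lemma jue_weight_wt:
  assumes "good N x" shows "jue_weight N \<alpha> \<beta> (herm_of N x) = wt N \<alpha> \<beta> x"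
proof -
  have p: "complex_of_real t powr c = exp (c * of_real (ln t))" if "0 < t" for t c
    using that by (simp add: powr_def Ln_of_real)
  show ?thesis using good_det[OF assms]
    unfolding jue_weight_def det_dt det_du wt_def exp_add by (simp only: p)
qed

lemma jue_mean_jint:
  "jue_mean f N \<alpha> \<beta> = jint N \<alpha> \<beta> (\<lambda>x. f (herm_of N x)) / jint N \<alpha> \<beta> (\<lambda>_. 1)"
proof -
  have e: "(LINT x:herm01 N|herm_lebesgue N. g x * jue_weight N \<alpha> \<beta> (herm_of N x)) = jint N \<alpha> \<beta> g" for g
    unfolding set_lebesgue_integral_def jint_def
    by (intro Bochner_Integration.integral_cong refl) (auto simp: herm01_iff jue_weight_wt indicator_def)
  have "(LINT x:herm01 N|herm_lebesgue N. jue_weight N \<alpha> \<beta> (herm_of N x)) = jint N \<alpha> \<beta> (\<lambda>_. 1)"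
    using e[of "\<lambda>_. 1"] by (simp only: mult_1)
  then show ?thesis unfolding jue_mean_def e by (rule arg_cong)
qed

lemma tr_tf:
  assumes A: "A \<in> carrier_mat N N" and Y: "\<And>a b. a < N \<Longrightarrow> b < N \<Longrightarrow> A $$ (a, b) = Y a b" and \<sigma>: "\<sigma> \<in> cyc n lam"
  shows "(\<Prod>k\<in>#lam. mtrace (A ^\<^sub>m k)) = tf N n \<sigma> Y"
proof -
  have p: "\<sigma> permutes {1..n}" and t: "wtype {1..n} (\<lambda>_. 1) \<sigma> = lam"
    using \<sigma> unfolding cyc_def cycle_type_wtype by auto
  have "A ^\<^sub>m 1 = A" using A by simp
  then have "(\<Prod>k\<in>#lam. mtrace (A ^\<^sub>m k)) = tperm N {1..n} \<sigma> (\<lambda>k a b. A $$ (a, b))"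
    using tperm_power[OF A finite_atLeastAtMost p, of "\<lambda>_. 1"] t by (simp only:)
  also have "\<dots> = tperm N {1..n} \<sigma> (\<lambda>_. Y)" by (rule tperm_cong[OF p]) (rule Y)
  finally show ?thesis using p by (simp only: tf_def if_True)
qed

lemma tr_pos_tf: "\<sigma> \<in> cyc n lam \<Longrightarrow> tr_pos lam (herm_of N x) = tf N n \<sigma> (Xm N x)"
  unfolding tr_pos_def by (rule tr_tf[OF herm_of_carrier]) (simp_all add: Xm_def)

text \<open>Both products of the cofactor matrix with \<open>X\<close> are 1, which puts
  \<open>X\<close> among the units; uniqueness of the inverse then identifies the result of
  elimination.\<close>

lemma mat_inverse_Xi:
  assumes "good N x"
  shows "mat_inverse (herm_of N x) = Some (mat N N (\<lambda>(a, b). Xi N x a b))"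
proof -
  let ?X = "herm_of N x" and ?B = "mat N N (\<lambda>(a, b). Xi N x a b)"
  have d: "dt N x \<noteq> 0" using good_det[OF assms] by simp
  have X: "?X \<in> carrier_mat N N" by simp
  have B: "?B \<in> carrier_mat N N" by simp
  have XB: "?X * ?B = 1\<^sub>m N"
  proof (rule eq_matI)
    fix i j assume "i < dim_row (1\<^sub>m N :: complex mat)" "j < dim_col (1\<^sub>m N :: complex mat)"
    then have ij: "i < N" "j < N" by auto
    show "(?X * ?B) $$ (i, j) = 1\<^sub>m N $$ (i, j)"
      unfolding index_mult_mat_sum[OF X B ij] using mm_Xi(1)[OF d ij] ij by (simp add: mm_def Xm_def Im1_def)
  qed (use carrier_matD[OF X] in auto)
  have BX: "?B * ?X = 1\<^sub>m N"
  proof (rule eq_matI)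
    fix i j assume "i < dim_row (1\<^sub>m N :: complex mat)" "j < dim_col (1\<^sub>m N :: complex mat)"
    then have ij: "i < N" "j < N" by auto
    show "(?B * ?X) $$ (i, j) = 1\<^sub>m N $$ (i, j)"
      unfolding index_mult_mat_sum[OF B X ij] using mm_Xi(2)[OF d ij] ij by (simp add: mm_def Xm_def Im1_def)
  qed (use carrier_matD[OF X] in auto)
  have u: "?X \<in> Units (ring_mat TYPE(complex) N ())"
    unfolding Units_def ring_mat_def using X B XB BX by auto
  then have "mat_inverse ?X \<noteq> None" using mat_inverse(1)[OF X, where b = "()"] by blast
  then obtain C where C: "mat_inverse ?X = Some C" by blast
  note c = mat_inverse(2)[OF X C]
  have "C = (?B * ?X) * C" unfolding BX using left_mult_one_mat[of C N N] c by simp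
  also have "\<dots> = ?B" using assoc_mult_mat[OF B X, of C N] c B by simp
  finally show ?thesis using C by simp
qed

lemma tr_neg_tf: "good N x \<Longrightarrow> \<sigma> \<in> cyc n lam \<Longrightarrow> tr_neg lam (herm_of N x) = tf N n \<sigma> (Xi N x)"
  unfolding tr_neg_def by (rule tr_tf) (simp_all add: mat_inverse_Xi)

lemma loop_sol_pos:
  assumes "0 < N" "-1 < Re \<alpha>" "-1 < Re \<beta>"
  shows "loop_sol M (of_nat N) (of_nat N + \<alpha>) (2 * of_nat N + \<alpha> + \<beta>) (\<lambda>n \<sigma>. jint N \<alpha> \<beta> (\<lambda>x. tf N n \<sigma> (Xm N x)) / jint N \<alpha> \<beta> (\<lambda>_. 1))"
  by (rule loop_sol_jint[OF norm_nonzero[OF assms]]) (rule jint_loop_pos[OF _ assms(2,3)])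

lemma loop_sol_neg:
  assumes "0 < N" "-1 < Re \<alpha> - real M" "-1 < Re \<beta>"
  shows "loop_sol M (of_nat N) (- (of_nat N + \<alpha> + \<beta>)) (- \<alpha>) (\<lambda>n \<sigma>. jint N \<alpha> \<beta> (\<lambda>x. tf N n \<sigma> (Xi N x)) / jint N \<alpha> \<beta> (\<lambda>_. 1))"
proof (rule loop_sol_jint)
  show "jint N \<alpha> \<beta> (\<lambda>_. 1) \<noteq> 0" by (rule norm_nonzero) (use assms in auto)
  fix n \<sigma> assume n: "n < M" and \<sigma>: "\<sigma> permutes {1..Suc n}"
  have "-1 < Re \<alpha> - real (Suc n)" using assms(2) n by simp
  from jint_loop_neg[OF \<sigma> this assms(3)]
  show "- \<alpha> * jint N \<alpha> \<beta> (\<lambda>x. tf N (Suc n) \<sigma> (Xi N x)) + jm (Suc n) (\<lambda>\<sigma>. jint N \<alpha> \<beta> (\<lambda>x. tf N (Suc n) \<sigma> (Xi N x))) \<sigma> =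
    loop_rhs n (of_nat N) (- (of_nat N + \<alpha> + \<beta>)) (\<lambda>\<sigma>. jint N \<alpha> \<beta> (\<lambda>x. tf N n \<sigma> (Xi N x))) \<sigma>" .
qed

text \<open>\<open>loop_rational\<close> supplies one pair \<open>P\<close>, \<open>Q\<close> for
  all solutions. The integrals identify the rational extension as \<open>P / Q\<close>; the series,
  itself a solution for large \<open>c\<close>, has the same value at the given point, where no
  integral need exist.\<close>

lemma rational_ext_series:
  assumes c: "polyf3 c" and e: "polyf3 e" 
    and D: "\<And>n x y. n \<ge> 1 \<Longrightarrow> Re x > A \<Longrightarrow> Re y > B \<Longrightarrow> D n x y"
    and F: "\<And>n x y. D n x y \<Longrightarrow> \<exists>f. loop_sol k (of_nat n) (e (of_nat n) x y) (c (of_nat n) x y) f \<and> F n x y = f k \<sigma>"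
    and large: "real (k * k) < norm (c N a b)"
  shows "rational_ext D F N a b = loop_series N (e N a b) (c N a b) k \<sigma>"
proof -
  obtain Q P where Q: "polyf3 Q" and P: "polyf3 (P \<sigma>)"
    and sol: "\<And>N a b f. loop_sol k N (e N a b) (c N a b) f \<Longrightarrow> f k \<sigma> * Q N a b = P \<sigma> N a b"
    and nz: "\<And>N a b. real k < norm (c N a b) \<Longrightarrow> Q N a b \<noteq> 0"
    using loop_rational[OF c e, of k] by blast
  obtain p q where p: "\<And>N a b. P \<sigma> N a b = poly3 p N a b" and q: "\<And>N a b. Q N a b = poly3 q N a b"
    using P Q unfolding polyf3_def by blast
  have "real k \<le> real (k * k)" unfolding of_nat_le_iff by (rule le_square)
  then have n: "Q N a b \<noteq> 0" using large by (intro nz) simp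
  have "rational_ext D F N a b = poly3 p N a b / poly3 q N a b"
  proof (rule rational_ext_eq[OF _ _ D])
    show "poly3 q N a b \<noteq> 0" using n unfolding q .
    fix n x y assume "D n x y" and q0: "poly3 q (of_nat n) x y \<noteq> 0"
    then obtain f where f: "loop_sol k (of_nat n) (e (of_nat n) x y) (c (of_nat n) x y) f" "F n x y = f k \<sigma>" using F by blast
    show "F n x y = poly3 p (of_nat n) x y / poly3 q (of_nat n) x y"
      using sol[OF f(1)] q0 unfolding f(2) p q by (simp add: eq_divide_eq)
  qed
  also have "\<dots> = loop_series N (e N a b) (c N a b) k \<sigma>"
    using sol[OF loop_series_sol[OF large]] n unfolding p q by (simp add: divide_eq_eq)
  finally show ?thesis .
qed

lemma jue_pos_series:
  assumes \<sigma>: "\<sigma> \<in> cyc (sum_mset lam) lam" and large: "real (sum_mset lam * sum_mset lam) < norm (2 * N + a + b)"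
  shows "jue_pos lam N a b = loop_series N (N + a) (2 * N + a + b) (sum_mset lam) \<sigma>"
  unfolding jue_pos_def
proof (rule rational_ext_series[where c = "\<lambda>N a b. 2 * N + a + b" and e = "\<lambda>N a b. N + a"])
  show "polyf3 (\<lambda>N a b. 2 * N + a + b)" "polyf3 (\<lambda>N a b. N + a)" by (intro polyf3_intros)+
  show "1 \<le> n \<and> - 1 < Re x \<and> - 1 < Re y" if "n \<ge> 1" "-1 < Re x" "-1 < Re y" for n :: nat and x y using that by simp
  show "\<exists>f. loop_sol (sum_mset lam) (of_nat n) (of_nat n + x) (2 * of_nat n + x + y) f \<and> jue_mean (tr_pos lam) n x y = f (sum_mset lam) \<sigma>"
    if "1 \<le> n \<and> - 1 < Re x \<and> - 1 < Re y" for n x y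
  proof (intro exI conjI)
    show "loop_sol (sum_mset lam) (of_nat n) (of_nat n + x) (2 * of_nat n + x + y) (\<lambda>m \<sigma>. jint n x y (\<lambda>z. tf n m \<sigma> (Xm n z)) / jint n x y (\<lambda>_. 1))"
      by (rule loop_sol_pos) (use that in auto)
    show "jue_mean (tr_pos lam) n x y = jint n x y (\<lambda>z. tf n (sum_mset lam) \<sigma> (Xm n z)) / jint n x y (\<lambda>_. 1)"
      unfolding jue_mean_jint tr_pos_tf[OF \<sigma>] ..
  qed
qed (rule large)

lemma jue_neg_series:
  assumes \<sigma>: "\<sigma> \<in> cyc (sum_mset lam) lam" and large: "real (sum_mset lam * sum_mset lam) < norm (- a)"
  shows "jue_neg lam N a b = loop_series N (- (N + a + b)) (- a) (sum_mset lam) \<sigma>"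
  unfolding jue_neg_def
proof (rule rational_ext_series[where c = "\<lambda>N a b. - a" and e = "\<lambda>N a b. - (N + a + b)"])
  show "polyf3 (\<lambda>N a b. - a)" "polyf3 (\<lambda>N a b. - (N + a + b))" by (intro polyf3_intros)+
  show "1 \<le> n \<and> - 1 < Re x - real (sum_mset lam) \<and> - 1 < Re y" if "n \<ge> 1" "real (sum_mset lam) - 1 < Re x" "-1 < Re y" for n :: nat and x y
    using that by simp
  show "\<exists>f. loop_sol (sum_mset lam) (of_nat n) (- (of_nat n + x + y)) (- x) f \<and> jue_mean (tr_neg lam) n x y = f (sum_mset lam) \<sigma>"
    if "1 \<le> n \<and> - 1 < Re x - real (sum_mset lam) \<and> - 1 < Re y" for n x y
  proof (intro exI conjI)
    show "loop_sol (sum_mset lam) (of_nat n) (- (of_nat n + x + y)) (- x) (\<lambda>m \<sigma>. jint n x y (\<lambda>z. tf n m \<sigma> (Xi n z)) / jint n x y (\<lambda>_. 1))"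
      by (rule loop_sol_neg) (use that in auto)
    have "jint n x y (\<lambda>z. tr_neg lam (herm_of n z)) = jint n x y (\<lambda>z. tf n (sum_mset lam) \<sigma> (Xi n z))"
      by (rule jint_cong) (rule tr_neg_tf[OF _ \<sigma>])
    then show "jue_mean (tr_neg lam) n x y = jint n x y (\<lambda>z. tf n (sum_mset lam) \<sigma> (Xi n z)) / jint n x y (\<lambda>_. 1)"
      unfolding jue_mean_jint by simp
  qed
qed (rule large)

text \<open>The correlator \<open>v\<close> is the same for all \<sigma> of the class, so summing
  over the class multiplies it by the class size, \<open>fact (sum_mset lam)\<close> over
  \<open>z_part lam\<close>. This is the origin of that prefactor.\<close>

lemma hurwitz_expansion:
  fixes e kap N v :: complex
  assumes lam: "0 \<notin># lam" and N: "N \<noteq> 0" "real (sum_mset lam * sum_mset lam) < norm (kap * N)"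
    and v: "\<And>\<sigma>. \<sigma> \<in> cyc (sum_mset lam) lam \<Longrightarrow> v = loop_series N (e * N) (- (kap * N)) (sum_mset lam) \<sigma>"
  shows "((\<lambda>g. (1 / N powi (2 * g - 2)) *
            (\<Sum>\<mu>\<in>partitions_of (sum_mset lam). \<Sum>\<nu>\<in>partitions_of (sum_mset lam).
              e ^ size \<nu> / kap powi (int (size \<mu>) + int (size \<nu>) + int (size lam) + 2 * g - 2) *
              of_nat (hurwitz g lam \<mu> \<nu>)))
         has_sum ((-1) ^ sum_mset lam * N ^ size lam * (fact (sum_mset lam) / of_nat (z_part lam)) * v))
        {1 - int (size lam)..}"
proof -
  let ?n = "sum_mset lam"
  have "(\<Sum>s\<in>cyc ?n lam. loop_series N (e * N) (- (kap * N)) ?n s) = (\<Sum>s\<in>cyc ?n lam. v)"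
    by (intro sum.cong refl) (rule v[symmetric])
  also have "\<dots> = of_nat (card (cyc ?n lam)) * v" by simp
  also have "of_nat (card (cyc ?n lam)) = (fact ?n / of_nat (z_part lam) :: complex)"
  proof -
    have c: "card (cyc ?n lam) * z_part lam = fact ?n" by (rule card_cyc[OF lam])
    have "z_part lam \<noteq> 0"
    proof
      assume "z_part lam = 0"
      then have "fact ?n = (0 :: nat)" using c by simp
      then show False by simp
    qed
    moreover have "of_nat (card (cyc ?n lam)) * of_nat (z_part lam) = (fact ?n :: complex)"
      using arg_cong[OF c, of "of_nat :: nat \<Rightarrow> complex"] by simp
    ultimately show ?thesis by (simp add: eq_divide_eq)
  qed
  finally show ?thesis using loop_series_has_sum[OF refl N, of e] by (simp add: mult.assoc)
qed

lemma eventually_norm_mult_gt: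
  assumes "c \<noteq> (0 :: complex)"
  shows "eventually (\<lambda>N. N \<noteq> 0 \<and> K < norm (c * N)) at_infinity"
  unfolding eventually_at_infinity
proof (intro exI allI impI)
  fix N :: complex assume N: "\<bar>K\<bar> / norm c + 1 \<le> norm N"
  have "\<bar>K\<bar> < norm c * (\<bar>K\<bar> / norm c + 1)" using assms by (simp add: distrib_left)
  also have "\<dots> \<le> norm c * norm N" using N by (intro mult_left_mono) auto
  finally show "N \<noteq> 0 \<and> K < norm (c * N)" by (auto simp: norm_mult)
qed

theorem theorem1p3:
  fixes lam :: "nat multiset" and c\<alpha> c\<beta> :: complex
  assumes "0 \<notin># lam"
  shows
    "(c\<alpha> + c\<beta> \<noteq> 0 \<longrightarrow>
      (\<forall>\<^sub>F N in at_infinity.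
        ((\<lambda>g. (1 / N powi (2 * g - 2)) *
            (\<Sum>\<mu>\<in>partitions_of (sum_mset lam). \<Sum>\<nu>\<in>partitions_of (sum_mset lam).
              c\<alpha> ^ size \<nu> /
              (- c\<alpha> - c\<beta>) powi (int (size \<mu>) + int (size \<nu>) + int (size lam) + 2 * g - 2) *
              of_nat (hurwitz g lam \<mu> \<nu>)))
         has_sum
           ((-1) ^ sum_mset lam * N ^ size lam * (fact (sum_mset lam) / of_nat (z_part lam)) *
            jue_pos lam N ((c\<alpha> - 1) * N) ((c\<beta> - 1) * N)))
        {1 - int (size lam)..})) \<and>
     (c\<alpha> \<noteq> 1 \<longrightarrow>
      (\<forall>\<^sub>F N in at_infinity.
        ((\<lambda>g. (1 / N powi (2 * g - 2)) *
            (\<Sum>\<mu>\<in>partitions_of (sum_mset lam). \<Sum>\<nu>\<in>partitions_of (sum_mset lam).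
              (1 - c\<alpha> - c\<beta>) ^ size \<nu> /
              (c\<alpha> - 1) powi (int (size \<mu>) + int (size \<nu>) + int (size lam) + 2 * g - 2) *
              of_nat (hurwitz g lam \<mu> \<nu>)))
         has_sum
           ((-1) ^ sum_mset lam * N ^ size lam * (fact (sum_mset lam) / of_nat (z_part lam)) *
            jue_neg lam N ((c\<alpha> - 1) * N) ((c\<beta> - 1) * N)))
        {1 - int (size lam)..}))"
  (is "(_ \<longrightarrow> (\<forall>\<^sub>F N in at_infinity. ?P1 N)) \<and> (_ \<longrightarrow> (\<forall>\<^sub>F N in at_infinity. ?P2 N))")
proof (intro conjI impI)
  let ?n = "sum_mset lam"
  assume "c\<alpha> + c\<beta> \<noteq> 0"
  then have "- c\<alpha> - c\<beta> \<noteq> 0" by (simp add: eq_neg_iff_add_eq_0 neg_eq_iff_add_eq_0)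
  note ev = eventually_norm_mult_gt[OF this, of "real (?n * ?n)"]
  have v: "jue_pos lam N ((c\<alpha> - 1) * N) ((c\<beta> - 1) * N) = loop_series N (c\<alpha> * N) (- ((- c\<alpha> - c\<beta>) * N)) ?n \<sigma>"
    if N: "real (?n * ?n) < norm ((- c\<alpha> - c\<beta>) * N)" and \<sigma>: "\<sigma> \<in> cyc ?n lam" for N \<sigma>
  proof -
    have c: "2 * N + (c\<alpha> - 1) * N + (c\<beta> - 1) * N = - ((- c\<alpha> - c\<beta>) * N)"
      and e: "N + (c\<alpha> - 1) * N = c\<alpha> * N" by (simp_all add: algebra_simps)
    show ?thesis using jue_pos_series[OF \<sigma>, of N "(c\<alpha> - 1) * N" "(c\<beta> - 1) * N"] N
      unfolding c e norm_minus_cancel by blast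
  qed
  show "\<forall>\<^sub>F N in at_infinity. ?P1 N"
    using ev
  proof (rule eventually_mono)
    fix N assume N: "N \<noteq> 0 \<and> real (?n * ?n) < norm ((- c\<alpha> - c\<beta>) * N)"
    show "?P1 N"
      by (rule hurwitz_expansion[OF assms conjunct1[OF N] conjunct2[OF N]]) (rule v[OF conjunct2[OF N]])
  qed
next
  let ?n = "sum_mset lam"
  assume "c\<alpha> \<noteq> 1"
  then have "c\<alpha> - 1 \<noteq> 0" by simp
  note ev = eventually_norm_mult_gt[OF this, of "real (?n * ?n)"]
  have v: "jue_neg lam N ((c\<alpha> - 1) * N) ((c\<beta> - 1) * N) = loop_series N ((1 - c\<alpha> - c\<beta>) * N) (- ((c\<alpha> - 1) * N)) ?n \<sigma>"
    if N: "real (?n * ?n) < norm ((c\<alpha> - 1) * N)" and \<sigma>: "\<sigma> \<in> cyc ?n lam" for N \<sigma>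
  proof -
    have e: "- (N + (c\<alpha> - 1) * N + (c\<beta> - 1) * N) = (1 - c\<alpha> - c\<beta>) * N" by (simp add: algebra_simps)
    show ?thesis using jue_neg_series[OF \<sigma>, of "(c\<alpha> - 1) * N" N "(c\<beta> - 1) * N"] N
      unfolding e norm_minus_cancel by blast
  qed
  show "\<forall>\<^sub>F N in at_infinity. ?P2 N"
    using ev
  proof (rule eventually_mono)
    fix N assume N: "N \<noteq> 0 \<and> real (?n * ?n) < norm ((c\<alpha> - 1) * N)"
    show "?P2 N"
      by (rule hurwitz_expansion[OF assms conjunct1[OF N] conjunct2[OF N]]) (rule v[OF conjunct2[OF N]])
  qed
qed

end
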